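(* Let $M$ be a connected matroid and let $(\Lambda,\Gamma)$ be a Tutte constellation of type $M$, with $\Gamma\neq\emptyset$. Then every closed Tutte path in $(\Lambda,\Gamma)$ can be decomposed into elementary Tutte paths in $(\Lambda,\Gamma)$ of types 1--9.
   Context: **Lattices, modular cuts, constellations.** Matroids are on finite ground sets. For a matroid $M$ on $E$, $\Lambda=\Lambda_M$ is its lattice of flats (a geometric lattice), $\langle S\rangle$ is the closure of $S\subseteq E$, $F_1\vee F_2=\langle F_1\cup F_2\rangle$, and the corank of a flat $F$ is $\mathrm{rk}(M)-\mathrm{rk}(F)$; hyperplanes are the corank $1$ flats. Two flats form a modular pair if $\mathrm{rk}(F_1)+\mathrm{rk}(F_2)=\mathrm{rk}(F_1\cap F_2)+\mathrm{rk}(F_1\vee F_2)$. A modular cut in $\Lambda$ is a subset $\Gamma\subseteq\Lambda$ that is closed under passing to larger flats and such that $F_1\cap F_2\in\Gamma$ for every modular pair $F_1,F_2\in\Gamma$. A flat $F$ is indecomposable if $M/F$ is a connected matroid (the empty matroid being connected), and decomposable otherwise; a corank $2$ flat is indecomposable iff it is contained in at least $3$ hyperplanes. A Tutte constellation is a pair $(\Lambda,\Gamma)$ of a geometric lattice $\Lambda$ and a modular cut $\Gamma$ in $\Lambda$; its type is the isomorphism type of the simple matroid whose lattice of flats is $\Lambda$. An upper sublattice of $\Lambda=\Lambda_M$ is a subset $\Lambda'$ of the form $\{\langle S\rangle : I\subseteq S\subseteq E-J\}$ for disjoint $I,J\subseteq E$ with $I$ independent and $E-J$ spanning, ordered by inclusion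 (equivalently: a subset that is a geometric lattice under inclusion, has the same joins as $\Lambda$, and whose rank equals the corank in $\Lambda$ of its bottom element; meets in $\Lambda'$ may be smaller than in $\Lambda$). A subconstellation of $(\Lambda,\Gamma)$ is a pair $(\Lambda',\Gamma')$ with $\Lambda'$ an upper sublattice of $\Lambda$ and $\Gamma'=\Gamma\cap\Lambda'$. Hyperplanes of $\Lambda'$ are hyperplanes of $\Lambda$. **Tutte paths.** A Tutte path is a finite sequence $(H_1,\dots,H_k)$, $k\ge1$, of hyperplanes, any two consecutive ones being distinct and intersecting in an indecomposable corank $2$ flat of $\Lambda$. It is closed if $H_1=H_k$. A closed Tutte path in $(\Lambda,\Gamma)$ is a closed Tutte path none of whose terms is in $\Gamma$. If $\alpha=(H_1,\dots,H_i,\dots,H_k,H_1)$ and $\beta=(H_i,G_1,\dots,G_\ell,H_i)$ are closed Tutte paths in $(\Lambda,\Gamma)$, let $\gamma=(H_1,\dots,H_{i-1},H_i,G_1,\dots,G_\ell,H_i,H_{i+1},\dots,H_k,H_1)$. Passing from $\alpha$ to $\gamma$ or from $\gamma$ to $\alpha$ is a deformation using $\beta$. A closed Tutte path can be decomposed into elementary Tutte paths of given types if it can be derived from a one-term path by a finite sequence of deformations using elementary Tutte paths of these types. **Elementary Tutte paths.** They are the following closed paths in subconstellations $(\Lambda',\Gamma')$ of $(\Lambda,\Gamma)$, where $\Lambda'$ is identified with the lattice of flats of the given matroid $N$ via some lattice isomorphism; flats are written as strings of elements (e.g. $12=\{1,2\}$). - Type 1: $(1,2,1)$, $N=U_{2,3}$,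 $\Gamma'=\{123\}$. - Type 2: $(1,2,1)$, $N=U_{2,3}$, $\Gamma'=\{3,123\}$. - Type 3: $(1,2,3,1)$, $N=U_{2,3}$, $\Gamma'=\{123\}$. - Type 4: $(12,13,23,12)$, $N=U_{3,4}$, $\Gamma'=\{1234\}$. - Type 5: $(12,13,23,12)$, $N=U_{3,4}$, $\Gamma'=\{14,1234\}$. - Type 6: $(12,13,23,12)$, $N=U_{3,4}$, $\Gamma'=\{4,14,24,34,1234\}$. - Type 7: $(12,24,34,13,12)$, $N=U_{3,4}$, $\Gamma'=\{23,14,1234\}$. - Type 8: $(126,135,234,126)$, $N=M(K_4)$, the simple rank $3$ matroid on $\{1,\dots,6\}$ with hyperplanes $126,135,234,456,14,25,36$, and $\Gamma'=\{14,25,36,123456\}$. - Type 9: $(1245,126,1346,456,1245)$, $N=M(K_{2,3})$, the rank $4$ graphic matroid of the complete bipartite graph $K_{2,3}$ with serial pairs $\{1,4\},\{2,5\},\{3,6\}$ (its hyperplanes are $1245,1346,2356,123,126,135,156,234,246,345,456$), and $\Gamma'=\{123,156,246,345,123456\}$, such that the corank $2$ flats $14$, $25$, $36$ are decomposable in $\Lambda$. *)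

theory Defs
  imports Main
begin

section \<open>Matroids on finite ground sets\<close>

datatype 'a set_system = Set_System (ground: "'a set") (indep: "'a set set")

locale matroid =
  fixes M :: "'a set_system"
  assumes finite_ground: "finite (ground M)"
    and indep_subset_ground: "I \<in> indep M \<Longrightarrow> I \<subseteq> ground M"
    and empty_indep: "{} \<in> indep M"
    and indep_subset: "I \<in> indep M \<Longrightarrow> J \<subseteq> I \<Longrightarrow> J \<in> indep M"
    and augment: "I \<in> indep M \<Longrightarrow> J \<in> indep M \<Longrightarrow> card I < card J
      \<Longrightarrow> \<exists>x\<in>J - I. insert x I \<in> indep M"

definition rank :: "'a set_system \<Rightarrow> 'a set \<Rightarrow> nat" where
  "rank M S = Max (card ` {I \<in> indep M. I \<subseteq> S})"

definition closure :: "'a set_system \<Rightarrow> 'a set \<Rightarrow> 'a set" where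
  "closure M S = {x \<in> ground M. rank M (insert x S) = rank M S}"

definition flats :: "'a set_system \<Rightarrow> 'a set set" where
  "flats M = {F. F \<subseteq> ground M \<and> closure M F = F}"

definition corank :: "'a set_system \<Rightarrow> 'a set \<Rightarrow> nat" where
  "corank M F = rank M (ground M) - rank M F"

definition hyperplanes :: "'a set_system \<Rightarrow> 'a set set" where
  "hyperplanes M = {H \<in> flats M. corank M H = 1}"

definition join :: "'a set_system \<Rightarrow> 'a set \<Rightarrow> 'a set \<Rightarrow> 'a set" where
  "join M F G = closure M (F \<union> G)"

definition circuits :: "'a set_system \<Rightarrow> 'a set set" where
  "circuits M = {C. C \<subseteq> ground M \<and> C \<notin> indep M \<and> (\<forall>D. D \<subset> C \<longrightarrow> D \<in> indep M)}"

definition connected_matroid :: "'a set_system \<Rightarrow> bool" where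
  "connected_matroid M \<longleftrightarrow>
     matroid M \<and>
     (\<forall>x\<in>ground M. \<forall>y\<in>ground M. x \<noteq> y \<longrightarrow> (\<exists>C\<in>circuits M. x \<in> C \<and> y \<in> C))"

definition contract :: "'a set_system \<Rightarrow> 'a set \<Rightarrow> 'a set_system" where
  "contract M F = Set_System (ground M - F)
     {I. I \<subseteq> ground M - F \<and> rank M (I \<union> F) = card I + rank M F}"

definition indecomposable :: "'a set_system \<Rightarrow> 'a set \<Rightarrow> bool" where
  "indecomposable M F \<longleftrightarrow> F \<in> flats M \<and> connected_matroid (contract M F)"

definition decomposable :: "'a set_system \<Rightarrow> 'a set \<Rightarrow> bool" where
  "decomposable M F \<longleftrightarrow> F \<in> flats M \<and> \<not> connected_matroid (contract M F)"

definition uniform_matroid :: "nat \<Rightarrow> nat \<Rightarrow> nat set_system" where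
  "uniform_matroid r n = Set_System {1..n} {I. I \<subseteq> {1..n} \<and> card I \<le> r}"

text \<open>
  The matroid on \<open>E\<close> whose hyperplanes are \<open>\<H>\<close>.  The closure of a set is the intersection of
  the hyperplanes containing it (and \<open>E\<close> if there are none), and a set is independent iff none
  of its elements lies in the closure of the others.
\<close>

definition matroid_of_hyperplanes :: "'a set \<Rightarrow> 'a set set \<Rightarrow> 'a set_system" where
  "matroid_of_hyperplanes E \<H> =
     Set_System E {I. I \<subseteq> E \<and> (\<forall>x\<in>I. \<exists>H\<in>\<H>. I - {x} \<subseteq> H \<and> x \<notin> H)}"

definition MK4 :: "nat set_system" where
  "MK4 = matroid_of_hyperplanes {1..6}
     {{1,2,6}, {1,3,5}, {2,3,4}, {4,5,6}, {1,4}, {2,5}, {3,6}}"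

definition MK23 :: "nat set_system" where
  "MK23 = matroid_of_hyperplanes {1..6}
     {{1,2,4,5}, {1,3,4,6}, {2,3,5,6}, {1,2,3}, {1,2,6}, {1,3,5}, {1,5,6},
      {2,3,4}, {2,4,6}, {3,4,5}, {4,5,6}}"


section \<open>Lattices of flats and Tutte constellations\<close>

definition modular_pair :: "'a set_system \<Rightarrow> 'a set \<Rightarrow> 'a set \<Rightarrow> bool" where
  "modular_pair M F G \<longleftrightarrow>
     F \<in> flats M \<and> G \<in> flats M \<and>
     rank M F + rank M G = rank M (F \<inter> G) + rank M (join M F G)"

definition modular_cut :: "'a set_system \<Rightarrow> 'a set set \<Rightarrow> bool" where
  "modular_cut M \<Gamma> \<longleftrightarrow>
     \<Gamma> \<subseteq> flats M \<and>
     (\<forall>F\<in>\<Gamma>. \<forall>G\<in>flats M. F \<subseteq> G \<longrightarrow> G \<in> \<Gamma>) \<and>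
     (\<forall>F\<in>\<Gamma>. \<forall>G\<in>\<Gamma>. modular_pair M F G \<longrightarrow> F \<inter> G \<in> \<Gamma>)"

text \<open>Isomorphism of lattices given as families of sets ordered by inclusion.\<close>

definition lattice_iso :: "('a set \<Rightarrow> 'b set) \<Rightarrow> 'a set set \<Rightarrow> 'b set set \<Rightarrow> bool" where
  "lattice_iso \<phi> \<Lambda> \<Lambda>' \<longleftrightarrow>
     bij_betw \<phi> \<Lambda> \<Lambda>' \<and> (\<forall>F\<in>\<Lambda>. \<forall>G\<in>\<Lambda>. F \<subseteq> G \<longleftrightarrow> \<phi> F \<subseteq> \<phi> G)"

text \<open>
  Every geometric lattice is, up to isomorphism, the lattice of flats of a matroid \<open>L\<close>; the
  constellation \<open>(\<Lambda>, \<Gamma>)\<close> with \<open>\<Lambda> = flats L\<close> is represented by \<open>L\<close> and \<open>\<Gamma>\<close>.  Its type is only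
  determined by the lattice, so \<open>L\<close> and the matroid \<open>M\<close> naming the type may live on different
  ground sets.  For simple \<open>M\<close>, being of type \<open>M\<close> means that \<open>M\<close> is the simple matroid with
  lattice of flats \<open>\<Lambda>\<close>; otherwise it means this for the simplification of \<open>M\<close>.
\<close>

definition tutte_constellation :: "'a set_system \<Rightarrow> 'a set set \<Rightarrow> bool" where
  "tutte_constellation L \<Gamma> \<longleftrightarrow> matroid L \<and> modular_cut L \<Gamma>"

definition constellation_of_type ::
    "'a set_system \<Rightarrow> 'a set set \<Rightarrow> 'b set_system \<Rightarrow> bool" where
  "constellation_of_type L \<Gamma> M \<longleftrightarrow>
     tutte_constellation L \<Gamma> \<and> matroid M \<and> (\<exists>\<phi>. lattice_iso \<phi> (flats L) (flats M))"

definition upper_sublattice :: "'a set_system \<Rightarrow> 'a set set \<Rightarrow> bool" where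
  "upper_sublattice L \<Lambda>' \<longleftrightarrow>
     (\<exists>I J. I \<subseteq> ground L \<and> J \<subseteq> ground L \<and> I \<inter> J = {} \<and>
        I \<in> indep L \<and> closure L (ground L - J) = ground L \<and>
        \<Lambda>' = {closure L S |S. I \<subseteq> S \<and> S \<subseteq> ground L - J})"

definition subconstellation ::
    "'a set_system \<Rightarrow> 'a set set \<Rightarrow> 'a set set \<Rightarrow> 'a set set \<Rightarrow> bool" where
  "subconstellation L \<Gamma> \<Lambda>' \<Gamma>' \<longleftrightarrow> upper_sublattice L \<Lambda>' \<and> \<Gamma>' = \<Gamma> \<inter> \<Lambda>'"


section \<open>Tutte paths\<close>

definition tutte_path :: "'a set_system \<Rightarrow> 'a set list \<Rightarrow> bool" where
  "tutte_path L p \<longleftrightarrow>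
     p \<noteq> [] \<and> set p \<subseteq> hyperplanes L \<and>
     successively (\<lambda>G H. G \<noteq> H \<and> corank L (G \<inter> H) = 2 \<and> indecomposable L (G \<inter> H)) p"

definition closed_tutte_path :: "'a set_system \<Rightarrow> 'a set set \<Rightarrow> 'a set list \<Rightarrow> bool" where
  "closed_tutte_path L \<Gamma> p \<longleftrightarrow> tutte_path L p \<and> hd p = last p \<and> set p \<inter> \<Gamma> = {}"

text \<open>
  \<open>inserts L \<Gamma> \<beta> \<alpha> \<gamma>\<close>: the path \<open>\<gamma>\<close> arises from \<open>\<alpha> = (H\<^sub>1,\<dots>,H\<^sub>k,H\<^sub>1)\<close> by replacing a term \<open>H = H\<^sub>i\<close> by
  \<open>\<beta> = (H,G\<^sub>1,\<dots>,G\<^sub>l,H)\<close>, where \<open>1 \<le> i \<le> k\<close>; so \<open>H\<close> is not the closing term of \<open>\<alpha>\<close>, unless \<open>\<alpha>\<close> is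
  the one-term path \<open>(H)\<close>.
\<close>

definition inserts ::
    "'a set_system \<Rightarrow> 'a set set \<Rightarrow> 'a set list \<Rightarrow> 'a set list \<Rightarrow> 'a set list \<Rightarrow> bool" where
  "inserts L \<Gamma> \<beta> \<alpha> \<gamma> \<longleftrightarrow>
     closed_tutte_path L \<Gamma> \<alpha> \<and> closed_tutte_path L \<Gamma> \<beta> \<and>
     (\<exists>xs H ys Gs. (ys = [] \<longrightarrow> xs = []) \<and>
        \<alpha> = xs @ [H] @ ys \<and> \<beta> = [H] @ Gs @ [H] \<and> \<gamma> = xs @ [H] @ Gs @ [H] @ ys)"

definition deformation ::
    "'a set_system \<Rightarrow> 'a set set \<Rightarrow> 'a set list \<Rightarrow> 'a set list \<Rightarrow> 'a set list \<Rightarrow> bool" where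
  "deformation L \<Gamma> \<beta> p q \<longleftrightarrow> inserts L \<Gamma> \<beta> p q \<or> inserts L \<Gamma> \<beta> q p"


section \<open>Elementary Tutte paths\<close>

definition realizes ::
    "'a set_system \<Rightarrow> 'a set set \<Rightarrow> 'a set list \<Rightarrow> (nat set \<Rightarrow> 'a set) \<Rightarrow>
     nat set_system \<Rightarrow> nat set set \<Rightarrow> nat set list \<Rightarrow> bool" where
  "realizes L \<Gamma> \<beta> \<phi> N \<Delta> p \<longleftrightarrow>
     (\<exists>\<Lambda>' \<Gamma>'. subconstellation L \<Gamma> \<Lambda>' \<Gamma>' \<and> lattice_iso \<phi> (flats N) \<Lambda>' \<and>
        \<Gamma>' = \<phi> ` \<Delta> \<and> \<beta> = map \<phi> p)"

inductive elementary_tutte_path ::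
    "'a set_system \<Rightarrow> 'a set set \<Rightarrow> nat \<Rightarrow> 'a set list \<Rightarrow> bool"
  for L :: "'a set_system" and \<Gamma> :: "'a set set" where
  type1: "elementary_tutte_path L \<Gamma> 1 \<beta>"
    if "realizes L \<Gamma> \<beta> \<phi> (uniform_matroid 2 3) {{1,2,3}} [{1}, {2}, {1}]"
| type2: "elementary_tutte_path L \<Gamma> 2 \<beta>"
    if "realizes L \<Gamma> \<beta> \<phi> (uniform_matroid 2 3) {{3}, {1,2,3}} [{1}, {2}, {1}]"
| type3: "elementary_tutte_path L \<Gamma> 3 \<beta>"
    if "realizes L \<Gamma> \<beta> \<phi> (uniform_matroid 2 3) {{1,2,3}} [{1}, {2}, {3}, {1}]"
| type4: "elementary_tutte_path L \<Gamma> 4 \<beta>"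
    if "realizes L \<Gamma> \<beta> \<phi> (uniform_matroid 3 4) {{1,2,3,4}}
          [{1,2}, {1,3}, {2,3}, {1,2}]"
| type5: "elementary_tutte_path L \<Gamma> 5 \<beta>"
    if "realizes L \<Gamma> \<beta> \<phi> (uniform_matroid 3 4) {{1,4}, {1,2,3,4}}
          [{1,2}, {1,3}, {2,3}, {1,2}]"
| type6: "elementary_tutte_path L \<Gamma> 6 \<beta>"
    if "realizes L \<Gamma> \<beta> \<phi> (uniform_matroid 3 4) {{4}, {1,4}, {2,4}, {3,4}, {1,2,3,4}}
          [{1,2}, {1,3}, {2,3}, {1,2}]"
| type7: "elementary_tutte_path L \<Gamma> 7 \<beta>"
    if "realizes L \<Gamma> \<beta> \<phi> (uniform_matroid 3 4) {{2,3}, {1,4}, {1,2,3,4}}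
          [{1,2}, {2,4}, {3,4}, {1,3}, {1,2}]"
| type8: "elementary_tutte_path L \<Gamma> 8 \<beta>"
    if "realizes L \<Gamma> \<beta> \<phi> MK4 {{1,4}, {2,5}, {3,6}, {1,2,3,4,5,6}}
          [{1,2,6}, {1,3,5}, {2,3,4}, {1,2,6}]"
| type9: "elementary_tutte_path L \<Gamma> 9 \<beta>"
    if "realizes L \<Gamma> \<beta> \<phi> MK23
          {{1,2,3}, {1,5,6}, {2,4,6}, {3,4,5}, {1,2,3,4,5,6}}
          [{1,2,4,5}, {1,2,6}, {1,3,4,6}, {4,5,6}, {1,2,4,5}]"
      and "decomposable L (\<phi> {1,4})"
      and "decomposable L (\<phi> {2,5})"
      and "decomposable L (\<phi> {3,6})"

definition decomposes_into_elementary ::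
    "'a set_system \<Rightarrow> 'a set set \<Rightarrow> nat set \<Rightarrow> 'a set list \<Rightarrow> bool" where
  "decomposes_into_elementary L \<Gamma> T p \<longleftrightarrow>
     (\<exists>H. closed_tutte_path L \<Gamma> [H] \<and>
        (\<lambda>q r. \<exists>t\<in>T. \<exists>\<beta>. elementary_tutte_path L \<Gamma> t \<beta> \<and> deformation L \<Gamma> \<beta> q r)\<^sup>*\<^sup>* [H] p)"

end

theory Submission
  imports Defs
begin

text \<open>
  Call a hyperplane good if it is not in \<open>\<Gamma>\<close>, and call two walks through good hyperplanes with the same
  ends homotopic if they differ by inserting and deleting elementary loops.  By induction on the corank of
  a flat \<open>F\<close> with \<open>M/F\<close> connected, any two walks above \<open>F\<close> with the same ends are homotopic; for the least
  flat this is the theorem.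

  In the induction step fix a cover \<open>O\<close> of \<open>F\<close> with connected quotient below the starting point.  Every good
  hyperplane above \<open>F\<close> is reached by a walk above \<open>O\<close> followed by a walk above another such cover, the class
  of this walk depends on its end only, and every edge extends it.  The main ingredient is that for covers
  \<open>P\<close>, \<open>Q\<close> of \<open>F\<close> with connected quotients, walks above \<open>P\<close> and above \<open>Q\<close> with the same ends \<open>X\<close>, \<open>Y\<close> above
  \<open>P \<or> Q\<close> are homotopic.  This is clear if \<open>M/(P \<or> Q)\<close> is connected.  Otherwise, in corank at least 5, one
  passes to a larger flat \<open>F \<or> c\<close> such that \<open>P \<or> c\<close> and \<open>Q \<or> c\<close> still have connected quotients.  Corank 4 is
  where type 9 is needed; the other types fill the triangles and quadrangles above flats of corank 2 and 3.
\<close>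

section \<open>Flats, rank and separators\<close>

text \<open>Connectedness of \<open>M/D\<close> is treated through separators, so it becomes a
  statement about ranks and most arguments are submodularity counts. The cut acts mainly through one
  consequence: a flat outside \<Gamma> has at most one cover inside \<Gamma>, so that of two
  independent candidates for a point one is usable. The obstacle is a decomposable join of
  \<open>P\<close> and \<open>Q\<close>. If the complements of \<open>X\<close> and \<open>Y\<close>
  lie in different components of its quotient, no walk above the join leads from \<open>X\<close> to
  \<open>Y\<close>. The way out is a point \<open>c\<close> of some component that keeps both
  quotients connected; it exists in any two suitable parallel classes of a component, and in every
  component of rank 1. In corank 4 the quotient has only two components, both of rank 1, and none is
  left to put \<open>c\<close> into both \<open>X\<close> and \<open>Y\<close>. There walks
  \<open>X\<close>, \<open>A\<close>, \<open>Y\<close> above \<open>P\<close> are compared with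
  walks \<open>X\<close>, \<open>B\<close>, \<open>Y\<close> above \<open>Q\<close>. If no such pair
  is adjacent, the points of \<open>X\<close> and of \<open>Y\<close> off the join form two classes
  each, and these four together with \<open>a\<close> and \<open>b\<close> carry the configuration
  of \<open>K_{2,3}\<close> or a fillable quadrangle.\<close>

context matroid
begin

abbreviation "E \<equiv> ground M"
abbreviation "r \<equiv> rank M"
abbreviation "cl \<equiv> closure M"

lemma finite_indep: "finite (indep M)"
  using finite_ground indep_subset_ground by (meson Pow_iff finite_Pow_iff finite_subset subsetI)

lemma indep_finite: "I \<in> indep M \<Longrightarrow> finite I"
  using finite_ground indep_subset_ground finite_subset by blast

lemma rank_ex: "\<exists>I\<in>indep M. I \<subseteq> S \<and> card I = r S"
proof -
  have "Max (card ` {I \<in> indep M. I \<subseteq> S}) \<in> card ` {I \<in> indep M. I \<subseteq> S}"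
    using finite_indep empty_indep by (intro Max_in) auto
  then show ?thesis unfolding rank_def by auto
qed

lemma rank_ge: "I \<in> indep M \<Longrightarrow> I \<subseteq> S \<Longrightarrow> card I \<le> r S"
  unfolding rank_def using finite_indep by (intro Max_ge) auto

lemma rank_mono: "A \<subseteq> B \<Longrightarrow> r A \<le> r B"
  using rank_ex[of A] rank_ge by (metis subset_trans)

lemma rank_indep: "I \<in> indep M \<Longrightarrow> r I = card I"
  using rank_ex[of I] rank_ge[of I I] indep_finite[of I] by (metis card_mono le_antisym order_refl)

lemma indep_extend:
  assumes "I \<in> indep M" "I \<subseteq> S"
  shows "\<exists>J\<in>indep M. I \<subseteq> J \<and> J \<subseteq> S \<and> card J = r S"
  using assms
proof (induction "r S - card I" arbitrary: I rule: less_induct)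
  case less
  show ?case
  proof (cases "card I = r S")
    case False
    then have lt: "card I < r S" using rank_ge less.prems by (simp add: le_neq_implies_less)
    obtain K where K: "K \<in> indep M" "K \<subseteq> S" "card K = r S" using rank_ex by blast
    obtain x where x: "x \<in> K - I" "insert x I \<in> indep M"
      using augment[OF less.prems(1) K(1)] lt K(3) by auto
    have "card (insert x I) = Suc (card I)" using x indep_finite less.prems by auto
    then have "r S - card (insert x I) < r S - card I" using lt by auto
    from less.hyps[OF this x(2)] x K less.prems show ?thesis by auto
  qed (use less.prems in auto)
qed

text \<open>A basis of the intersection is extended to a basis \<open>K\<close> of the union. Then
  \<open>K\<close> meets \<open>A\<close> and \<open>B\<close> in independent sets, and counting
  \<open>K\<close> gives the inequality.\<close>

lemma rank_submod: "r (A \<union> B) + r (A \<inter> B) \<le> r A + r B"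
proof -
  obtain I where I: "I \<in> indep M" "I \<subseteq> A \<inter> B" "card I = r (A \<inter> B)" using rank_ex by blast
  then obtain K where K: "K \<in> indep M" "I \<subseteq> K" "K \<subseteq> A \<union> B" "card K = r (A \<union> B)"
    using indep_extend[of I "A \<union> B"] by auto
  have fin: "finite K" using K indep_finite by auto
  have "card K + card (K \<inter> (A \<inter> B)) = card (K \<inter> A) + card (K \<inter> B)"
    using card_Un_Int[of "K \<inter> A" "K \<inter> B"] fin K(3)
    by (metis Int_Un_distrib finite_Int inf.absorb_iff1 inf_assoc inf_left_commute inf_left_idem)
  moreover have "card I \<le> card (K \<inter> (A \<inter> B))" using I K fin by (intro card_mono) auto
  moreover have "card (K \<inter> A) \<le> r A" "card (K \<inter> B) \<le> r B"
    using K indep_subset rank_ge by (meson Int_lower1 Int_lower2)+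
  ultimately show ?thesis using I K by linarith
qed

text \<open>The form used for the later counts: the union may be shrunk and the intersection
  replaced by any common subset.\<close>

lemma rank_submod':
  assumes "U \<subseteq> A \<union> B" "I \<subseteq> A" "I \<subseteq> B"
  shows "r U + r I \<le> r A + r B"
  using rank_submod[of A B] rank_mono[OF assms(1)] rank_mono[of I "A \<inter> B"] assms by auto

lemma rank_empty: "r {} = 0"
  using rank_indep[OF empty_indep] by simp

lemma rank_card: "finite S \<Longrightarrow> r S \<le> card S"
  using rank_ex[of S] by (metis card_mono)

lemma rank_Un_le: "finite S \<Longrightarrow> r (A \<union> S) \<le> r A + card S"
  using rank_submod[of A S] rank_card[of S] by linarith

lemma rank_insert_ge: "r A \<le> r (insert x A)"
  by (rule rank_mono) auto

lemma rank_insert_le: "r (insert x A) \<le> r A + 1"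
  using rank_Un_le[of "{x}" A] by simp

text \<open>\<open>rank\<close> is applied to arbitrary sets; elements outside the ground set are
  invisible because independent sets lie in it.\<close>

lemma rank_Int_ground: "r (S \<inter> E) = r S"
proof (rule antisym)
  obtain I where "I \<in> indep M" "I \<subseteq> S" "card I = r S" using rank_ex by blast
  then show "r S \<le> r (S \<inter> E)" using rank_ge[of I "S \<inter> E"] indep_subset_ground by auto
qed (simp add: rank_mono)

lemma cl_ground: "cl S \<subseteq> E" by (auto simp: closure_def)

lemma cl_iff: "x \<in> cl S \<longleftrightarrow> x \<in> E \<and> r (insert x S) = r S" by (auto simp: closure_def)

lemma cl_superset: "x \<in> S \<Longrightarrow> x \<in> E \<Longrightarrow> x \<in> cl S" by (simp add: cl_iff insert_absorb)

lemma subset_cl: "S \<subseteq> E \<Longrightarrow> S \<subseteq> cl S" using cl_superset by blast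

lemma rank_insert: "x \<in> E \<Longrightarrow> x \<notin> cl S \<Longrightarrow> r (insert x S) = r S + 1"
  using rank_insert_le[of x S] rank_insert_ge[of S x] by (auto simp: cl_iff)

lemma rank_Un_cl: "A \<subseteq> cl S \<Longrightarrow> r (S \<union> A) = r S"
proof -
  assume A: "A \<subseteq> cl S"
  have "finite A" using A cl_ground finite_ground by (meson finite_subset)
  then show ?thesis using A
  proof (induction A)
    case (insert x A)
    have "r (S \<union> insert x A) + r S \<le> r (S \<union> A) + r (insert x S)"
      by (rule rank_submod') auto
    moreover have "r (insert x S) = r S" using insert.prems by (simp add: cl_iff)
    moreover have "r S \<le> r (S \<union> insert x A)" by (rule rank_mono) auto
    ultimately show ?case using insert by auto
  qed auto
qed

lemma rank_cl: "r (cl S) = r S"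
proof -
  have "r (S \<inter> E) \<le> r (cl S)" using cl_superset by (intro rank_mono) auto
  moreover have "r (cl S) \<le> r (S \<union> cl S)" by (rule rank_mono) auto
  ultimately show ?thesis using rank_Un_cl[of "cl S" S] rank_Int_ground by auto
qed

lemma cl_mono: "A \<subseteq> B \<Longrightarrow> cl A \<subseteq> cl B"
proof
  fix x assume "A \<subseteq> B" "x \<in> cl A"
  moreover have "r (insert x B) + r A \<le> r B + r (insert x A)" using \<open>A \<subseteq> B\<close> by (intro rank_submod') auto
  ultimately show "x \<in> cl B" using rank_insert_ge[of B x] by (auto simp: cl_iff)
qed

lemma cl_eqI: "A \<subseteq> B \<Longrightarrow> r B \<le> r A \<Longrightarrow> B \<subseteq> E \<Longrightarrow> B \<subseteq> cl A"
  unfolding cl_iff subset_iff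
  by (metis insert_subset le_antisym order_trans rank_mono subsetD subset_insertI subset_iff)

lemma cl_idem: "cl (cl S) = cl S"
proof
  show "cl S \<subseteq> cl (cl S)" using subset_cl cl_ground by auto
  show "cl (cl S) \<subseteq> cl S"
  proof
    fix x assume x: "x \<in> cl (cl S)"
    have "r (insert x S) \<le> r (insert x (S \<union> cl S))" by (rule rank_mono) auto
    also have "\<dots> + r (cl S) \<le> r (S \<union> cl S) + r (insert x (cl S))" by (rule rank_submod') auto
    finally show "x \<in> cl S"
      using x rank_Un_cl[of "cl S" S] rank_cl[of S] rank_insert_ge[of S x] by (auto simp: cl_iff)
  qed
qed

lemma cl_subset_iff: "A \<subseteq> E \<Longrightarrow> cl A \<subseteq> cl B \<longleftrightarrow> A \<subseteq> cl B"
  using subset_cl cl_mono cl_idem by (metis subset_trans)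

abbreviation "flat F \<equiv> F \<in> flats M"

lemma flat_ground: "flat F \<Longrightarrow> F \<subseteq> E" by (auto simp: flats_def)
lemma flat_cl: "flat (cl S)" using cl_idem cl_ground by (auto simp: flats_def)
lemma cl_flat: "flat F \<Longrightarrow> cl F = F" by (auto simp: flats_def)
lemma flat_E: "flat E" using subset_cl[of E] cl_ground[of E] by (auto simp: flats_def)

lemma cl_least: "flat F \<Longrightarrow> A \<subseteq> F \<Longrightarrow> cl A \<subseteq> F" using cl_mono cl_flat by metis

lemma flat_Int: "flat F \<Longrightarrow> flat G \<Longrightarrow> flat (F \<inter> G)"
proof -
  assume a: "flat F" "flat G"
  then have "cl (F \<inter> G) \<subseteq> F \<inter> G" using cl_least[of _ "F \<inter> G"] by auto
  moreover have "F \<inter> G \<subseteq> E" using flat_ground[OF a(1)] by auto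
  ultimately show ?thesis using subset_cl[of "F \<inter> G"] unfolding flats_def by auto
qed

lemma flat_rank_less: "flat F \<Longrightarrow> F \<subset> A \<Longrightarrow> A \<subseteq> E \<Longrightarrow> r F < r A"
  using cl_eqI[of F A] cl_flat[of F] by (metis leI psubsetE)

lemma flat_eq: "flat F \<Longrightarrow> F \<subseteq> A \<Longrightarrow> A \<subseteq> E \<Longrightarrow> r A \<le> r F \<Longrightarrow> A = F"
  using flat_rank_less[of F A] by (metis leD psubsetI)

lemma rank_flat_insert: "flat F \<Longrightarrow> x \<in> E - F \<Longrightarrow> r (insert x F) = r F + 1"
  using rank_insert cl_flat by auto

text \<open>The cover of a flat \<open>F\<close> generated by a point outside it. The priority is
  above that of union, intersection and difference, so \<open>E - F \<squnion> a\<close> is the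
  complement of the join.\<close>

abbreviation adj (infixl "\<squnion>" 75) where "F \<squnion> x \<equiv> cl (insert x F)"

lemma adj_rank: "flat F \<Longrightarrow> x \<in> E - F \<Longrightarrow> r (F \<squnion> x) = r F + 1"
  using rank_flat_insert rank_cl by simp

lemma adj_self: "x \<in> E \<Longrightarrow> x \<in> F \<squnion> x" by (rule cl_superset) auto
lemma adj_superset: "F \<subseteq> E \<Longrightarrow> F \<subseteq> F \<squnion> x" using cl_superset by blast
lemma adj_least: "flat G \<Longrightarrow> F \<subseteq> G \<Longrightarrow> x \<in> G \<Longrightarrow> F \<squnion> x \<subseteq> G" by (rule cl_least) auto

lemma adj_eq: "flat F \<Longrightarrow> flat G \<Longrightarrow> F \<subseteq> G \<Longrightarrow> x \<in> G - F \<Longrightarrow> r G \<le> r F + 1 \<Longrightarrow> G = F \<squnion> x"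
proof -
  assume a: "flat F" "flat G" "F \<subseteq> G" "x \<in> G - F" "r G \<le> r F + 1"
  then have x: "x \<in> E - F" "G \<subseteq> E" using flat_ground by auto
  show ?thesis using flat_eq[OF flat_cl adj_least[of G F x] x(2)] adj_rank[OF a(1) x(1)] a by auto
qed

lemma adj_exchange: "flat F \<Longrightarrow> y \<in> F \<squnion> x \<Longrightarrow> y \<notin> F \<Longrightarrow> x \<in> E \<Longrightarrow> F \<squnion> y = F \<squnion> x"
proof -
  assume a: "flat F" "y \<in> F \<squnion> x" "y \<notin> F" "x \<in> E"
  then have "x \<notin> F" using cl_flat insert_absorb by metis
  then show ?thesis using adj_eq[of F "F \<squnion> x" y] a flat_cl adj_rank[of F x] adj_superset flat_ground by auto
qed

lemma adj_adj: "F \<subseteq> E \<Longrightarrow> x \<in> E \<Longrightarrow> F \<squnion> x \<squnion> y = cl (insert x (insert y F))"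
proof
  assume a: "F \<subseteq> E" "x \<in> E"
  show "F \<squnion> x \<squnion> y \<subseteq> cl (insert x (insert y F))"
  proof -
    have "F \<squnion> x \<subseteq> cl (insert x (insert y F))" by (rule cl_mono) auto
    moreover have "y \<in> E \<Longrightarrow> y \<in> cl (insert x (insert y F))" by (rule cl_superset) auto
    ultimately have "insert y (F \<squnion> x) \<inter> E \<subseteq> cl (insert x (insert y F))" by auto
    moreover have "cl (insert y (F \<squnion> x)) = cl (insert y (F \<squnion> x) \<inter> E)"
      by (auto simp: cl_iff) (metis Int_insert_left rank_Int_ground)+
    ultimately show ?thesis using cl_subset_iff[of "insert y (F \<squnion> x) \<inter> E"] by auto
  qed
  show "cl (insert x (insert y F)) \<subseteq> F \<squnion> x \<squnion> y"
    using a cl_superset[of _ "insert x F"] by (intro cl_mono) auto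
qed

lemma adj_commute: "F \<subseteq> E \<Longrightarrow> x \<in> E \<Longrightarrow> y \<in> E \<Longrightarrow> F \<squnion> x \<squnion> y = F \<squnion> y \<squnion> x"
  by (simp add: adj_adj insert_commute)


text \<open>\<open>K\<close> is a separator of \<open>M/D\<close>.\<close>

definition sep where
  "sep D K \<longleftrightarrow> K \<subseteq> E - D \<and> r (K \<union> D) + r (E - K) = r E + r D"

text \<open>Connectedness of \<open>M/D\<close> in terms of separators instead of circuits, so that
  ranks decide it. The ground set and all hyperplanes satisfy it.\<close>

definition conn where
  "conn D \<longleftrightarrow> flat D \<and> (\<forall>K. sep D K \<longrightarrow> K = {} \<or> K = E - D)"

lemma conn_flat: "conn D \<Longrightarrow> flat D" by (simp add: conn_def)

lemma sep_ge: "K \<subseteq> E - D \<Longrightarrow> D \<subseteq> E \<Longrightarrow> r E + r D \<le> r (K \<union> D) + r (E - K)"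
  by (rule rank_submod') auto

lemma sep_compl: "D \<subseteq> E \<Longrightarrow> sep D K \<Longrightarrow> sep D (E - D - K)"
proof -
  assume a: "D \<subseteq> E" "sep D K"
  then have "(E - D - K) \<union> D = E - K" "E - (E - D - K) = K \<union> D" by (auto simp: sep_def)
  then show ?thesis using a unfolding sep_def by auto
qed

text \<open>Uncrossing: two submodular inequalities add up to the two lower bounds of
  \<open>sep_ge\<close> for union and intersection, so both bounds are attained.\<close>

lemma sep_Int: "D \<subseteq> E \<Longrightarrow> sep D K \<Longrightarrow> sep D K' \<Longrightarrow> sep D (K \<inter> K')"
proof -
  assume a: "D \<subseteq> E" "sep D K" "sep D K'"
  have "r ((K \<union> K') \<union> D) + r ((K \<inter> K') \<union> D) \<le> r (K \<union> D) + r (K' \<union> D)"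
    by (rule rank_submod') auto
  moreover have "r (E - (K \<inter> K')) + r (E - (K \<union> K')) \<le> r (E - K) + r (E - K')"
    by (rule rank_submod') auto
  moreover have "r E + r D \<le> r ((K \<union> K') \<union> D) + r (E - (K \<union> K'))"
    "r E + r D \<le> r ((K \<inter> K') \<union> D) + r (E - (K \<inter> K'))"
    using a by (auto intro!: sep_ge simp: sep_def)
  ultimately show ?thesis using a unfolding sep_def by auto
qed

text \<open>\<open>M/D\<close> is the direct sum of its parts on \<open>K\<close> and off
  \<open>K\<close>, hence rank over \<open>D\<close> splits for every \<open>Z\<close>, not only for
  the whole ground set.\<close>

lemma sep_rank:
  assumes "D \<subseteq> E" "sep D K" "Z \<subseteq> E"
  shows "r (Z \<inter> K \<union> D) + r (Z - K \<union> D) = r (Z \<union> D) + r D"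
proof -
  have "r (Z \<union> D) + r D \<le> r (Z \<inter> K \<union> D) + r (Z - K \<union> D)" by (rule rank_submod') auto
  moreover have "r (Z \<union> K \<union> D) + r (Z \<inter> K \<union> D) \<le> r (Z \<union> D) + r (K \<union> D)"
    by (rule rank_submod') auto
  moreover have "r E + r (Z - K \<union> D) \<le> r (Z \<union> K \<union> D) + r (E - K)"
    using assms by (intro rank_submod') (auto simp: sep_def)
  ultimately show ?thesis using assms(2) unfolding sep_def by linarith
qed

text \<open>A direct sum stays one after contraction of \<open>T\<close>. The three instances of
  \<open>sep_rank\<close> compute the two sides and \<open>T\<close> itself.\<close>

lemma sep_contract:
  assumes "sep D K" "D \<subseteq> T" "T \<subseteq> E"
  shows "sep T (K - T)"
proof -
  have D: "D \<subseteq> E" using assms by auto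
  have K: "K \<subseteq> E - D" "r (K \<union> D) + r (E - K) = r E + r D" using assms by (auto simp: sep_def)
  have e: "(K \<union> T) \<inter> K = K" "T \<inter> K \<union> D \<subseteq> K \<union> D" by auto
  have "r (K \<union> D) + r (T - K \<union> D) = r (K \<union> T) + r D"
  proof -
    have "(K \<union> T) - K \<union> D = T - K \<union> D" "(K \<union> T) \<union> D = K \<union> T" "K \<union> T \<subseteq> E" using K assms by auto
    then show ?thesis using sep_rank[OF D assms(1), of "K \<union> T"] by (simp add: e)
  qed
  moreover have "r (T \<inter> K \<union> D) + r (E - K) = r (E - K \<union> T) + r D"
  proof -
    have "(E - K \<union> T) \<inter> K = T \<inter> K" "(E - K \<union> T) - K \<union> D = E - K" "(E - K \<union> T) \<union> D = E - K \<union> T"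
      using K assms by auto
    then show ?thesis using sep_rank[OF D assms(1), of "E - K \<union> T"] assms by auto
  qed
  moreover have "r (T \<inter> K \<union> D) + r (T - K \<union> D) = r T + r D"
    using sep_rank[OF D assms(1), of T] assms by (simp add: Un_absorb2)
  moreover have "K - T \<union> T = K \<union> T" "E - (K - T) = E - K \<union> T" using assms by auto
  ultimately show ?thesis using K unfolding sep_def by auto
qed

text \<open>\<open>T\<close> lies on the other side of \<open>K\<close>, so contracting it does not
  change ranks inside \<open>K\<close>, and a separator found there was one before.\<close>

lemma sep_lift:
  assumes "sep D K" "Z \<subseteq> K" "D \<subseteq> T" "T \<subseteq> E" "T \<inter> K = {}" "sep T Z"
  shows "sep D Z"
proof -
  have K: "K \<subseteq> E - D" using assms by (auto simp: sep_def)
  have e: "(Z \<union> T) \<inter> K = Z" "(Z \<union> T) - K \<union> D = T" "(Z \<union> T) \<union> D = Z \<union> T" using assms by auto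
  have "r (Z \<union> D) + r T = r (Z \<union> T) + r D"
  proof -
    have "D \<subseteq> E" "Z \<union> T \<subseteq> E" using assms K by auto
    then show ?thesis using sep_rank[of D K "Z \<union> T"] assms(1) by (simp add: e)
  qed
  then show ?thesis using assms K unfolding sep_def by auto
qed

text \<open>An element of \<open>K\<close> spanned by the other summand would be a loop of
  \<open>M/D\<close>, and a flat \<open>D\<close> leaves no loops.\<close>

lemma sep_closed:
  assumes "flat D" "sep D K"
  shows "flat (E - K)"
proof -
  have D: "D \<subseteq> E" using assms flat_ground by auto
  have K: "K \<subseteq> E - D" using assms by (auto simp: sep_def)
  have "c \<notin> cl (E - K)" if "c \<in> K" for c
  proof
    assume "c \<in> cl (E - K)"
    then have c: "r (insert c (E - K)) = r (E - K)" by (simp add: cl_iff)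
    have e: "insert c (E - K) \<inter> K = {c}" "insert c (E - K) - K \<union> D = E - K"
      "insert c (E - K) \<union> D = insert c (E - K)" using that K D by auto
    have "r ({c} \<union> D) + r (E - K) = r (insert c (E - K)) + r D"
      using sep_rank[OF D assms(2), of "insert c (E - K)"] e that K by auto
    then have "r (insert c D) = r D" using c by simp
    moreover have "c \<in> E - D" using that K by auto
    ultimately show False using rank_flat_insert[of D c] assms by auto
  qed
  then have "cl (E - K) \<subseteq> E - K" using cl_ground by auto
  then show ?thesis using subset_cl[of "E - K"] by (auto simp: flats_def)
qed

section \<open>Covers with connected quotient\<close>

lemma conn_sep_ground: "conn E"
  using flat_E by (auto simp: conn_def sep_def)

text \<open>\<open>S\<close> misses \<open>d\<close>, so it is not a separator of the connected
  \<open>M/F\<close>. The resulting strict inequality lifts the rank of \<open>S \<union> F\<close>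
  to that of \<open>S \<union> F \<squnion> d\<close>.\<close>

lemma conn_spans:
  assumes "conn F" "F \<subseteq> E" "sep (F \<squnion> d) S" "S \<noteq> {}" "d \<in> E - F"
  shows "r (S \<union> F) = r (S \<union> F \<squnion> d)" "d \<in> cl (S \<union> F)"
proof -
  let ?D = "F \<squnion> d"
  have F: "flat F" using assms conn_def by auto
  have S: "S \<subseteq> E - ?D" "r (S \<union> ?D) + r (E - S) = r E + r ?D" using assms by (auto simp: sep_def)
  have FD: "F \<subseteq> ?D" "d \<in> ?D" using adj_superset adj_self assms by auto
  have "\<not> sep F S" using assms S FD unfolding conn_def by auto
  moreover have SF: "S \<subseteq> E - F" using S FD by auto
  ultimately have "r E + r F < r (S \<union> F) + r (E - S)"
    using sep_ge[OF SF] assms by (simp add: sep_def le_neq_implies_less)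
  moreover have "r ?D = r F + 1" using adj_rank F assms by auto
  ultimately have "r (S \<union> ?D) \<le> r (S \<union> F)" using S by linarith
  then show "r (S \<union> F) = r (S \<union> ?D)" using rank_mono[of "S \<union> F" "S \<union> ?D"] FD by (auto intro: antisym)
  then show "d \<in> cl (S \<union> F)"
    using cl_eqI[of "S \<union> F" "S \<union> ?D"] FD S cl_ground by (auto simp: subset_iff)
qed

text \<open>Descent on \<open>S\<close>. As \<open>S\<close> spans \<open>d\<close> over
  \<open>F\<close>, some \<open>c\<close> in \<open>S\<close> lies outside \<open>T\<close>. If
  \<open>M/(F \<squnion> c)\<close> is disconnected, a separator \<open>B\<close> of it avoiding
  \<open>d\<close> turns out to lie properly inside \<open>S\<close>, and \<open>c\<close>,
  \<open>B\<close> take the place of \<open>d\<close>, \<open>S\<close>.\<close>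

lemma sep_conn_cover:
  assumes "conn F" "flat T" "F \<subseteq> T"
  shows "d \<in> E - T \<Longrightarrow> sep (F \<squnion> d) S \<Longrightarrow> S \<noteq> {} \<Longrightarrow> \<exists>c\<in>S - T. conn (F \<squnion> c)"
proof (induction "card S" arbitrary: S d rule: less_induct)
  case less
  let ?D = "F \<squnion> d"
  have F: "flat F" "F \<subseteq> E" using assms conn_def flat_ground by auto
  have d: "d \<in> E - F" using less assms by auto
  have D: "flat ?D" "F \<subseteq> ?D" "d \<in> ?D" "?D \<subseteq> E" using flat_cl adj_superset adj_self F d cl_ground by auto
  have S: "S \<subseteq> E - ?D" "r (S \<union> ?D) + r (E - S) = r E + r ?D" using less.prems by (auto simp: sep_def)
  have "d \<in> cl (S \<union> F)" using conn_spans(2)[OF assms(1) F(2) less.prems(2,3) d] .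
  moreover have "cl (S \<union> F) \<subseteq> T" if "S \<subseteq> T" using that assms by (intro cl_least) auto
  ultimately obtain c where c: "c \<in> S" "c \<notin> T" using less.prems by auto
  let ?C = "F \<squnion> c"
  have cE: "c \<in> E" "c \<notin> F" "c \<notin> ?D" using c S D by auto
  have C: "flat ?C" "F \<subseteq> ?C" "c \<in> ?C" "?C \<subseteq> E" using flat_cl adj_superset adj_self F cE cl_ground by auto
  show ?case
  proof (cases "conn ?C")
    case True then show ?thesis using c by auto
  next
    case False
    then obtain B0 where B0: "sep ?C B0" "B0 \<noteq> {}" "B0 \<noteq> E - ?C" using C by (auto simp: conn_def)
    have "B0 \<subseteq> E - ?C" using B0 by (auto simp: sep_def)
    define B where "B = (if d \<in> B0 then E - ?C - B0 else B0)"
    have B: "sep ?C B" "B \<noteq> {}" "d \<notin> B" using B0 sep_compl[OF C(4) B0(1)] \<open>B0 \<subseteq> _\<close> by (auto simp: B_def)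
    have BC: "B \<subseteq> E - ?C" using B by (auto simp: sep_def)
    have flS: "flat (E - S)" using sep_closed D less.prems by auto
    let ?B' = "B - S" and ?A = "E - S - B"
    have FA: "F \<subseteq> ?A" "d \<in> ?A" "F \<subseteq> E - S" using D S BC C B d by auto
    \<comment> \<open>\<open>E - S\<close> is a flat without \<open>c\<close>, so joining
      \<open>F \<squnion> c\<close> raises the rank of each set between \<open>F\<close> and
      \<open>E - S\<close> by one. This turns the separator equation for \<open>B\<close> into one
      over \<open>F\<close>, and \<open>B - S\<close> becomes a separator of
      \<open>M/F\<close>.\<close>
    have up: "r (Z \<union> ?C) = r Z + 1" if "Z \<subseteq> E - S" "F \<subseteq> Z" for Z
    proof -
      have "c \<notin> cl Z" using cl_mono[OF that(1)] flS cl_flat c by auto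
      then have "r (insert c Z) = r Z + 1" using rank_insert cE by auto
      moreover have "r (insert c Z) = r (Z \<union> ?C)"
      proof (rule antisym)
        show "r (insert c Z) \<le> r (Z \<union> ?C)" using C by (intro rank_mono) auto
        have "Z \<union> ?C \<subseteq> cl (insert c Z)"
          using that cl_superset[of _ "insert c Z"] cl_mono[of "insert c F" "insert c Z"] by auto
        then show "r (Z \<union> ?C) \<le> r (insert c Z)" using rank_mono rank_cl by metis
      qed
      ultimately show ?thesis by simp
    qed
    have "r ((E - S) \<inter> B \<union> ?C) + r ((E - S) - B \<union> ?C) = r ((E - S) \<union> ?C) + r ?C"
      using sep_rank[OF C(4) B(1), of "E - S"] by auto
    moreover have "(E - S) \<inter> B \<union> ?C = ?B' \<union> F \<union> ?C" using C BC by auto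
    moreover have "r (?B' \<union> F \<union> ?C) = r (?B' \<union> F) + 1" using up[of "?B' \<union> F"] BC FA by auto
    moreover have "r (?A \<union> ?C) = r ?A + 1" using up[of ?A] FA by auto
    moreover have "r (E - S \<union> ?C) = r (E - S) + 1" using up[of "E - S"] FA by auto
    moreover have "r ?C = r F + 1" using adj_rank F cE by auto
    ultimately have eq: "r (?B' \<union> F) + r ?A = r (E - S) + r F" by simp
    have "?D \<subseteq> cl ?A" using FA by (intro cl_mono) auto
    then have "r (?A \<union> ?D) = r ?A" by (rule rank_Un_cl)
    moreover have "r (E - ?B') + r ?D \<le> r (S \<union> ?D) + r (?A \<union> ?D)" by (rule rank_submod') auto
    ultimately have "r (?B' \<union> F) + r (E - ?B') \<le> r E + r F" using eq S by linarith
    moreover have B'F: "?B' \<subseteq> E - F" using BC C by auto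
    ultimately have "sep F ?B'" using sep_ge[OF B'F F(2)] by (simp add: sep_def)
    then have "?B' = {}" using assms(1) c cE unfolding conn_def by blast
    then have BS: "B \<subset> S" using BC C c by auto
    moreover have "finite S" using S finite_ground by (auto intro: finite_subset)
    ultimately have "card B < card S" by (simp add: psubset_card_mono)
    from less.hyps[OF this _ B(1,2)] c cE BS show ?thesis by auto
  qed
qed

text \<open>If \<open>M/(F \<squnion> d)\<close> is disconnected for \<open>d\<close> in
  \<open>L\<close>, a separator of it has trivial trace on the connected \<open>M/L\<close>, so it
  or its complement lies inside \<open>L\<close>; there \<open>sep_conn_cover\<close> finds the
  point. With a hyperplane as \<open>L\<close> this supplies the covers for all inductions on
  corank.\<close>

lemma conn_cover:
  assumes "conn F" "conn L" "F \<subseteq> L" "flat T" "F \<subseteq> T" "\<not> L \<subseteq> T"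
  shows "\<exists>c\<in>L - T. conn (F \<squnion> c)"
proof -
  obtain d where d: "d \<in> L" "d \<notin> T" using assms by auto
  have L: "flat L" "L \<subseteq> E" using assms conn_def flat_ground by auto
  let ?D = "F \<squnion> d"
  have D: "?D \<subseteq> L" "flat ?D" "?D \<subseteq> E" using cl_least L d assms flat_cl cl_ground by auto
  show ?thesis
  proof (cases "conn ?D")
    case False
    then obtain S where S: "sep ?D S" "S \<noteq> {}" "S \<noteq> E - ?D" using D by (auto simp: conn_def)
    have S': "S \<subseteq> E - ?D" using S by (auto simp: sep_def)
    have "sep L (S - L)" using sep_contract[OF S(1) D(1) L(2)] .
    then have "S - L = {} \<or> S - L = E - L" using assms(2) by (auto simp: conn_def)
    then consider "S \<subseteq> L" | "E - ?D - S \<subseteq> L" by auto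
    then obtain S1 where "sep ?D S1" "S1 \<noteq> {}" "S1 \<subseteq> L"
      using S S' sep_compl[OF D(3) S(1)] by cases auto
    then show ?thesis using sep_conn_cover[OF assms(1,4,5), of d S1] d L by auto
  qed (use d in auto)
qed

text \<open>The instance of \<open>conn_spans\<close> with the largest separator: in a connected
  quotient a parallel class is spanned by the remaining elements, if there are any.\<close>

lemma conn_spans_ground: "conn F \<Longrightarrow> c \<in> E - F \<Longrightarrow> E - F \<squnion> c \<noteq> {} \<Longrightarrow> c \<in> cl ((E - F \<squnion> c) \<union> F)"
proof -
  assume a: "conn F" "c \<in> E - F" "E - F \<squnion> c \<noteq> {}"
  have e: "E - F \<squnion> c \<union> F \<squnion> c = E" "E - (E - F \<squnion> c) = F \<squnion> c" using cl_ground by auto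
  have "sep (F \<squnion> c) (E - F \<squnion> c)" unfolding sep_def e by auto
  then show ?thesis using conn_spans(2)[of F c "E - F \<squnion> c"] a conn_flat flat_ground by auto
qed

text \<open>On the summand \<open>K\<close> the quotients by \<open>D\<close> and by
  \<open>E - K\<close> have the same ranks, hence the same parallel classes.\<close>

lemma sep_adj_trace:
  assumes "flat D" "sep D K" "c \<in> K"
  shows "(E - K) \<squnion> c \<inter> K \<subseteq> D \<squnion> c"
proof
  fix e assume e: "e \<in> (E - K) \<squnion> c \<inter> K"
  have D: "D \<subseteq> E" and K: "K \<subseteq> E - D" using assms flat_ground by (auto simp: sep_def)
  have eq: "r (Z \<union> D) + r (E - K) = r (Z \<union> (E - K)) + r D" if "Z \<subseteq> K" for Z
  proof -
    have "(Z \<union> (E - K)) \<inter> K = Z" "Z \<union> (E - K) - K \<union> D = E - K" "Z \<union> (E - K) \<union> D = Z \<union> (E - K)" "Z \<union> (E - K) \<subseteq> E"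
      using that K D by auto
    then show ?thesis using sep_rank[OF D assms(2), of "Z \<union> (E - K)"] by simp
  qed
  have "r (insert e (insert c (E - K))) = r (insert c (E - K))" using e by (auto simp: cl_iff)
  then have "r (insert e (insert c D)) = r (insert c D)"
    using eq[of "{e,c}"] eq[of "{c}"] assms e by auto
  then show "e \<in> D \<squnion> c" using e K by (auto simp: cl_iff)
qed

text \<open>Let \<open>B\<close> be a separator of \<open>M/(P \<squnion> c)\<close> avoiding
  \<open>b\<close>. A part of it outside \<open>K\<close> would separate
  \<open>M/(P \<squnion> b)\<close> and so span \<open>b\<close>, against the flat
  \<open>B \<union> P \<squnion> c\<close>. Inside \<open>K\<close> it separates the connected
  quotient by \<open>(E - K) \<squnion> c\<close>, so it is the whole complement of that
  flat.\<close>

lemma not_conn_adj: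
  assumes "conn P" "b \<in> E - P" "sep (P \<squnion> b) K" "c \<in> K" "conn ((E - K) \<squnion> c)" "\<not> conn (P \<squnion> c)"
  shows "E - (E - K) \<squnion> c \<noteq> {}" "b \<notin> cl ((E - (E - K) \<squnion> c) \<union> P \<squnion> c)"
proof -
  let ?R = "P \<squnion> c" and ?D = "P \<squnion> b" and ?G1 = "(E - K) \<squnion> c"
  have P: "flat P" "P \<subseteq> E" using assms conn_flat flat_ground by auto
  have D: "flat ?D" "?D \<subseteq> E" "P \<subseteq> ?D" "b \<in> ?D" using flat_cl cl_ground adj_superset adj_self P assms by auto
  have K: "K \<subseteq> E - ?D" using assms by (auto simp: sep_def)
  have c: "c \<in> E" "c \<notin> P" "c \<notin> ?D" using assms K D by auto
  have R: "flat ?R" "?R \<subseteq> E" "P \<subseteq> ?R" "c \<in> ?R" using flat_cl cl_ground adj_superset adj_self P c by auto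
  have bR: "b \<notin> ?R" using adj_exchange[OF P(1), of b c] assms(2) c adj_self[of c P] by blast
  define T where "T = ?R \<squnion> b"
  have T: "flat T" "T \<subseteq> E" "?R \<subseteq> T" "b \<in> T"
    using flat_cl cl_ground adj_superset[OF R(2)] adj_self assms unfolding T_def by auto
  have Teq: "T = ?D \<squnion> c" using adj_commute[of P c b] P c assms unfolding T_def by auto
  have DT: "?D \<subseteq> T" using Teq adj_superset[OF D(2)] by auto
  obtain B0 where B0: "sep ?R B0" "B0 \<noteq> {}" "B0 \<noteq> E - ?R" using R assms by (auto simp: conn_def)
  have B0R: "B0 \<subseteq> E - ?R" using B0 by (auto simp: sep_def)
  define B where "B = (if b \<in> B0 then E - ?R - B0 else B0)"
  have B: "sep ?R B" "B \<noteq> {}" "b \<notin> B" using B0 B0R sep_compl[OF R(2) B0(1)] by (auto simp: B_def)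
  have BR: "B \<subseteq> E - ?R" using B by (auto simp: sep_def)
  have "E - (E - ?R - B) = B \<union> ?R" using BR R by auto
  then have flB: "flat (B \<union> ?R)" using sep_closed[OF R(1) sep_compl[OF R(2) B(1)]] by simp
  have bB: "b \<notin> B \<union> ?R" using B bR by auto
  have BT: "B \<inter> T = {}"
  proof (rule ccontr)
    assume "B \<inter> T \<noteq> {}"
    then obtain e where e: "e \<in> B" "e \<in> T" by auto
    then have "?R \<squnion> e = ?R \<squnion> b" using adj_exchange[OF R(1), of e b] BR assms T_def by auto
    moreover have "?R \<squnion> e \<subseteq> B \<union> ?R" using adj_least[OF flB] e by auto
    ultimately show False using bB T T_def by auto
  qed
  have sT: "sep T B" using sep_contract[OF B(1) T(3,2)] BT by (metis Diff_triv)
  let ?K' = "E - ?D - K"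
  have sK': "sep ?D ?K'" using sep_compl D assms by auto
  have "flat (E - ?K')" using sep_closed D sK' by auto
  moreover have "?D \<subseteq> E - ?K'" "c \<in> E - ?K'" using D assms c by auto
  ultimately have "T \<subseteq> E - ?K'" unfolding Teq by (rule adj_least)
  then have TK': "T \<inter> ?K' = {}" by auto
  have "sep T ?K'" using sep_contract[OF sK' DT T(2)] TK' by (metis Diff_triv inf_commute)
  then have "sep T (B \<inter> ?K')" using sep_Int T sT by auto
  then have sD: "sep ?D (B \<inter> ?K')" using sep_lift[OF sK' _ DT T(2) TK'] by auto
  have "B \<inter> ?K' = {}"
  proof (rule ccontr)
    assume "B \<inter> ?K' \<noteq> {}"
    then have "b \<in> cl (B \<inter> ?K' \<union> P)" using conn_spans(2)[OF assms(1) P(2) sD] assms by auto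
    also have "\<dots> \<subseteq> B \<union> ?R" using R by (intro cl_least[OF flB]) auto
    finally show False using bB by auto
  qed
  then have BK: "B \<subseteq> K" using BT DT BR by auto
  have "?D \<subseteq> E - K" using D K by auto
  then have TG: "T \<subseteq> ?G1" unfolding Teq by (intro cl_mono) auto
  have "?G1 \<inter> K \<subseteq> T" unfolding Teq using sep_adj_trace D assms by auto
  then have "B \<inter> ?G1 = {}" using BK BT by auto
  then have "sep ?G1 B" using sep_contract[OF sT TG cl_ground] by (metis Diff_triv)
  then have B_eq: "B = E - ?G1" using assms(5) B by (auto simp: conn_def)
  then show "E - ?G1 \<noteq> {}" using B by auto
  have "cl (B \<union> ?R) = B \<union> ?R" using cl_flat flB by auto
  then show "b \<notin> cl (E - ?G1 \<union> ?R)" using bB B_eq by simp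
qed

text \<open>
  The parallel classes of \<open>M/(E - K)\<close> are the sets \<open>C\<close>.  If no element of such a class keeps both quotients
  connected, then \<open>C\<close> has rank at least 2 over \<open>F\<close>, while \<open>D\<close> keeps its full rank 2 over the complement \<open>B\<close>.
  Submodularity rules this out for two different classes.
\<close>

lemma bad_class:
  assumes "flat F" "a \<in> E - F" "b \<in> E - F \<squnion> a" "conn (F \<squnion> a)" "conn (F \<squnion> b)"
    and "sep (F \<squnion> a \<squnion> b) K" "conn (E - K)" "c0 \<in> K" "conn ((E - K) \<squnion> c0)"
    and bad: "\<And>c. c \<in> K \<Longrightarrow> c \<in> (E - K) \<squnion> c0 \<Longrightarrow> conn (F \<squnion> a \<squnion> c) \<Longrightarrow> conn (F \<squnion> b \<squnion> c) \<Longrightarrow> False"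
  defines "B \<equiv> E - (E - K) \<squnion> c0" and "C \<equiv> K \<inter> (E - K) \<squnion> c0" and "D \<equiv> F \<squnion> a \<squnion> b"
  shows "r (B \<union> D) = r (B \<union> F) + 2" "r (C \<union> F) \<ge> r F + 2"
proof -
  let ?P = "F \<squnion> a" and ?Q = "F \<squnion> b" and ?G = "E - K"
  let ?N = "cl (B \<union> F)"
  have F: "F \<subseteq> E" using assms flat_ground by auto
  have ab: "a \<in> E" "b \<in> E" "a \<notin> F" "b \<notin> F" using assms adj_superset F by auto
  have aQ: "a \<notin> ?Q" using adj_exchange[of F a b] assms ab adj_self by auto
  have P: "flat ?P" "?P \<subseteq> E" "F \<subseteq> ?P" "a \<in> ?P" using flat_cl cl_ground adj_superset adj_self F ab by auto
  have Q: "flat ?Q" "?Q \<subseteq> E" "F \<subseteq> ?Q" "b \<in> ?Q" using flat_cl cl_ground adj_superset adj_self F ab by auto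
  have DQ: "D = ?Q \<squnion> a" unfolding D_def using adj_commute F ab by auto
  have D: "flat D" "D \<subseteq> E" "?P \<subseteq> D" "?Q \<subseteq> D" "b \<in> D" "a \<in> D"
    using flat_cl cl_ground adj_superset[OF P(2), of b] adj_self[of b ?P] ab P(4) adj_superset[OF Q(2), of a] DQ
    unfolding D_def by (blast, blast, blast, simp, blast, blast)
  have sD: "sep D K" using assms unfolding D_def by auto
  have K: "K \<subseteq> E - D" using sD by (auto simp: sep_def)
  have N: "flat ?N" "?N \<subseteq> E" "F \<subseteq> ?N" "B \<subseteq> ?N"
    using flat_cl cl_ground F cl_superset[of _ "B \<union> F"] by (auto simp: B_def)
  have Geq: "?G \<squnion> c = ?G \<squnion> c0" if "c \<in> C" for c
    using adj_exchange[of ?G c c0] sep_closed D sD assms(8) that K unfolding C_def by auto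
  have c0C: "c0 \<in> C" unfolding C_def using assms(8) K adj_self by auto
  have CE: "c \<in> E" "c \<in> K" if "c \<in> C" for c using that K unfolding C_def by auto
  \<comment> \<open>At each \<open>c\<close> of the class one of the two quotients is disconnected,
    and \<open>not_conn_adj\<close> turns this into a failure of \<open>B\<close> to span.\<close>
  have fails: "B \<noteq> {} \<and> (b \<notin> cl (B \<union> ?P \<squnion> c) \<or> a \<notin> cl (B \<union> ?Q \<squnion> c))" if "c \<in> C" for c
  proof (cases "conn (?P \<squnion> c)")
    case True
    then have nc: "\<not> conn (?Q \<squnion> c)" using bad that unfolding C_def by auto
    have s: "sep (?Q \<squnion> a) K" using sD DQ by simp
    have a: "a \<in> E - ?Q" using aQ ab by auto
    have cG: "conn (?G \<squnion> c)" using Geq that assms by auto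
    show ?thesis using not_conn_adj[OF assms(5) a s CE(2)[OF that] cG nc] Geq[OF that] unfolding B_def by auto
  next
    case False
    have b: "b \<in> E - ?P" using assms by auto
    have cG: "conn (?G \<squnion> c)" using Geq that assms by auto
    show ?thesis using not_conn_adj[OF assms(4) b assms(6) CE(2)[OF that] cG False] Geq[OF that] unfolding B_def by auto
  qed
  \<comment> \<open>Read in \<open>M/?N\<close>: a single \<open>c\<close> never spans
    \<open>b\<close> with the help of \<open>a\<close> and also \<open>a\<close> with the help of
    \<open>b\<close>.\<close>
  have failsN: "b \<notin> ?N \<squnion> a \<squnion> c \<or> a \<notin> ?N \<squnion> b \<squnion> c" if "c \<in> C" for c
  proof -
    have sub: "?N \<squnion> x \<squnion> c \<subseteq> cl (B \<union> F \<squnion> x \<squnion> c)" if "x \<in> E" for x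
    proof -
      have x: "F \<squnion> x \<squnion> c \<subseteq> E" using cl_ground by auto
      have F1: "F \<subseteq> F \<squnion> x \<squnion> c" "x \<in> F \<squnion> x \<squnion> c" "c \<in> F \<squnion> x \<squnion> c"
        using adj_superset[OF cl_ground[of "insert x F"], of c] adj_superset[OF F, of x] adj_self[of x] adj_self[of c]
          CE(1)[OF \<open>c \<in> C\<close>] \<open>x \<in> E\<close> by auto
      let ?U = "cl (B \<union> F \<squnion> x \<squnion> c)"
      have U: "B \<union> F \<squnion> x \<squnion> c \<subseteq> ?U" by (rule subset_cl) (use x in \<open>auto simp: B_def\<close>)
      have "?N \<subseteq> ?U" using F1 by (intro cl_mono) auto
      moreover have "x \<in> ?U" "c \<in> ?U" using U F1 by auto
      ultimately show ?thesis by (intro adj_least flat_cl) auto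
    qed
    show ?thesis using fails[OF that] sub[of a] sub[of b] ab by auto
  qed
  have f1: "c \<in> ?N \<squnion> a \<squnion> b" if "c \<in> C" for c
  proof -
    have cG: "c \<in> E - ?G" using that K unfolding C_def by auto
    have "c \<in> cl (B \<union> ?G)"
      using conn_spans_ground[OF assms(7) cG] fails[OF that] Geq[OF that] unfolding B_def by auto
    then have r1: "r (insert c (B \<union> ?G)) = r (B \<union> ?G)" by (simp add: cl_iff)
    have eq: "r (Z \<union> D) + r (E - K) = r (Z \<union> (E - K)) + r D" if "Z \<subseteq> K" for Z
    proof -
      have "(Z \<union> (E - K)) \<inter> K = Z" "Z \<union> (E - K) - K \<union> D = E - K" "Z \<union> (E - K) \<union> D = Z \<union> (E - K)" "Z \<union> (E - K) \<subseteq> E"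
        using that K D by auto
      then show ?thesis using sep_rank[OF D(2) sD, of "Z \<union> (E - K)"] by simp
    qed
    have "?G \<subseteq> ?G \<squnion> c0" by (rule adj_superset) auto
    then have BK: "B \<subseteq> K" unfolding B_def by auto
    have "r (insert c (B \<union> D)) = r (B \<union> D)"
      using eq[of "insert c B"] eq[of B] BK r1 that unfolding C_def by simp
    then have "c \<in> cl (B \<union> D)" using CE[OF that] by (simp add: cl_iff)
    also have "cl (B \<union> D) \<subseteq> ?N \<squnion> a \<squnion> b"
    proof (rule cl_least[OF flat_cl])
      let ?U = "?N \<squnion> a \<squnion> b"
      have NU: "?N \<subseteq> ?U" "a \<in> ?U" "b \<in> ?U"
        using adj_superset[OF cl_ground[of "insert a ?N"], of b] adj_superset[OF N(2), of a]
           adj_self[of a] adj_self[of b] ab by auto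
      have "?P \<subseteq> ?U" using NU N(3) by (intro adj_least flat_cl) auto
      then have "D \<subseteq> ?U" unfolding D_def using NU adj_least[OF flat_cl] by metis
      then show "B \<union> D \<subseteq> ?U" using NU N by auto
    qed
    finally show ?thesis .
  qed
  have K_eq: "K = B \<union> C"
    using K adj_superset[of ?G c0] unfolding B_def C_def by auto
  have K0: "K \<noteq> {}" using assms by auto
  \<comment> \<open>By contrast the whole class \<open>C\<close> does span \<open>b\<close> with the
    help of \<open>a\<close>, and \<open>a\<close> with the help of \<open>b\<close>, since
    \<open>K\<close> consists of \<open>B\<close> and \<open>C\<close> and spans over both
    covers.\<close>
  have f2b: "b \<in> cl (?N \<union> {a} \<union> C)"
  proof -
    have "b \<in> cl (K \<union> ?P)" using conn_spans(2)[OF assms(4) P(2) assms(6) K0] assms by auto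
    also have "\<dots> \<subseteq> cl (?N \<union> {a} \<union> C)"
    proof (rule cl_least[OF flat_cl])
      have "?P \<subseteq> cl (?N \<union> {a} \<union> C)" using N by (intro cl_mono) auto
      moreover have "K \<subseteq> cl (?N \<union> {a} \<union> C)" using K K_eq N(4) cl_superset[of _ "?N \<union> {a} \<union> C"] by auto
      ultimately show "K \<union> ?P \<subseteq> cl (?N \<union> {a} \<union> C)" by auto
    qed
    finally show ?thesis .
  qed
  have f2a: "a \<in> cl (?N \<union> {b} \<union> C)"
  proof -
    have "sep (?Q \<squnion> a) K" "a \<in> E - ?Q" using sD DQ aQ ab by auto
    then have "a \<in> cl (K \<union> ?Q)" using conn_spans(2)[OF assms(5) Q(2) _ K0] by auto
    also have "\<dots> \<subseteq> cl (?N \<union> {b} \<union> C)"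
    proof (rule cl_least[OF flat_cl])
      have "?Q \<subseteq> cl (?N \<union> {b} \<union> C)" using N by (intro cl_mono) auto
      moreover have "K \<subseteq> cl (?N \<union> {b} \<union> C)" using K K_eq N(4) cl_superset[of _ "?N \<union> {b} \<union> C"] by auto
      ultimately show "K \<union> ?Q \<subseteq> cl (?N \<union> {b} \<union> C)" by auto
    qed
    finally show ?thesis .
  qed
  have sw: "?N \<squnion> a \<squnion> b = ?N \<squnion> b \<squnion> a" using adj_commute N(2) ab by auto
  have NS: "?N \<subseteq> ?N \<squnion> x" "?N \<squnion> x \<subseteq> ?N \<squnion> x \<squnion> y" for x y
    using adj_superset[OF N(2)] adj_superset[OF cl_ground] by auto
  have in2: "x \<in> ?N \<squnion> x \<squnion> y" "y \<in> ?N \<squnion> x \<squnion> y" if "x \<in> E" "y \<in> E" for x y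
    using adj_self that NS(1)[of x] NS(2)[of x y] by auto
  \<comment> \<open>If \<open>u\<close> were a loop of \<open>M/?N\<close>, then no \<open>c\<close>
    could span \<open>v\<close>, while every \<open>c\<close> lies on the point of \<open>v\<close>;
    so all of \<open>C\<close> would be loops and could not span \<open>v\<close> either.\<close>
  have notin: "u \<notin> ?N" if "\<And>c. c \<in> C \<Longrightarrow> v \<notin> ?N \<squnion> u \<squnion> c \<or> u \<notin> ?N \<squnion> v \<squnion> c"
    "v \<in> cl (?N \<union> {u} \<union> C)" "\<And>c. c \<in> C \<Longrightarrow> c \<in> ?N \<squnion> u \<squnion> v" "u \<in> E" "v \<in> E" for u v
  proof
    assume u: "u \<in> ?N"
    then have Nu: "?N \<squnion> u = ?N" using cl_flat N insert_absorb by metis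
    have v: "v \<notin> ?N \<squnion> c" if "c \<in> C" for c
      using \<open>c \<in> C \<Longrightarrow> v \<notin> ?N \<squnion> u \<squnion> c \<or> _\<close> that Nu u NS(1)[of v] NS(2)[of v c] by auto
    have "c \<in> ?N" if "c \<in> C" for c
    proof (rule ccontr)
      assume "c \<notin> ?N"
      then have "?N \<squnion> c = ?N \<squnion> v" using adj_exchange[OF N(1), of c v] \<open>\<And>c. c \<in> C \<Longrightarrow> c \<in> ?N \<squnion> u \<squnion> v\<close>[OF that] Nu \<open>v \<in> E\<close> by auto
      then show False using v[OF that] adj_self[OF \<open>v \<in> E\<close>, of ?N] by auto
    qed
    then have "?N \<union> {u} \<union> C = ?N" using u by auto
    then have "v \<in> ?N" using \<open>v \<in> cl (?N \<union> {u} \<union> C)\<close> cl_flat N by auto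
    then show False using v[OF c0C] NS by auto
  qed
  have aN: "a \<notin> ?N" using notin[of b a] failsN f2b f1 ab by auto
  have bN: "b \<notin> ?N" using notin[of a b] failsN f2a f1 ab sw by auto
  have bNa: "b \<notin> ?N \<squnion> a"
  proof
    assume b: "b \<in> ?N \<squnion> a"
    then have "?N \<squnion> b = ?N \<squnion> a" using adj_exchange N bN ab by auto
    then have "a \<in> ?N \<squnion> b" "b \<in> ?N \<squnion> a" using adj_self[of _ ?N] ab b by auto
    then show False using failsN[OF c0C] NS by blast
  qed
  have aNb: "a \<notin> ?N \<squnion> b"
    using adj_exchange[of ?N a b] N aN ab bNa adj_self[of b ?N] by auto
  show "r (B \<union> D) = r (B \<union> F) + 2"
  proof -
    have "r (?N \<squnion> a \<squnion> b) = r ?N + 2"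
      using adj_rank[of ?N a] adj_rank[of "?N \<squnion> a" b] N flat_cl aN bNa ab by auto
    moreover have "?N \<squnion> a \<squnion> b \<subseteq> cl (B \<union> D)"
    proof -
      have "B \<union> D \<subseteq> cl (B \<union> D)" using D by (intro subset_cl) (auto simp: B_def)
      moreover have "?N \<subseteq> cl (B \<union> D)" using D P by (intro cl_mono) auto
      ultimately show ?thesis using D by (intro adj_least flat_cl) auto
    qed
    ultimately have "r ?N + 2 \<le> r (B \<union> D)" using rank_mono rank_cl by metis
    moreover have "r (B \<union> D) \<le> r (B \<union> F) + 2"
    proof -
      have "r (B \<union> D) + r F \<le> r (B \<union> F) + r D" by (rule rank_submod') (use D P in auto)
      moreover have "r D = r F + 2" unfolding D_def using adj_rank[of F a] adj_rank[of ?P b] assms P by auto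
      ultimately show ?thesis by auto
    qed
    ultimately show ?thesis using rank_cl[of "B \<union> F"] by auto
  qed
  have ex: "\<exists>c\<in>C. c \<notin> ?N \<squnion> u" if "v \<in> cl (?N \<union> {u} \<union> C)" "v \<notin> ?N \<squnion> u" "u \<in> E" for u v
  proof (rule ccontr)
    assume "\<not> ?thesis"
    then have "?N \<union> {u} \<union> C \<subseteq> ?N \<squnion> u" using NS adj_self that by auto
    then have "cl (?N \<union> {u} \<union> C) \<subseteq> ?N \<squnion> u" by (rule cl_least[OF flat_cl])
    then show False using that by auto
  qed
  \<comment> \<open>Off the point of \<open>a\<close> over \<open>?N\<close>, an element of
    \<open>C\<close> must be parallel to \<open>b\<close> there, by \<open>par\<close>. Since
    \<open>c2\<close> is off the point of \<open>b\<close>, the elements \<open>c1\<close> and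
    \<open>c2\<close> are independent already over \<open>F\<close>.\<close>
  obtain c1 where c1: "c1 \<in> C" "c1 \<notin> ?N \<squnion> a" using ex[OF f2b bNa] ab by auto
  obtain c2 where c2: "c2 \<in> C" "c2 \<notin> ?N \<squnion> b" using ex[OF f2a aNb] ab by auto
  have par: "?N \<squnion> c = ?N \<squnion> v" if "c \<in> C" "c \<notin> ?N \<squnion> u" "v \<notin> ?N \<squnion> u \<squnion> c \<or> u \<notin> ?N \<squnion> v \<squnion> c"
    "c \<in> ?N \<squnion> u \<squnion> v" "?N \<squnion> u \<squnion> v = ?N \<squnion> v \<squnion> u" "u \<in> E" "v \<in> E" for u v c
  proof -
    have cN: "c \<notin> ?N" using that NS by auto
    have "?N \<squnion> u \<squnion> c = ?N \<squnion> u \<squnion> v" using adj_exchange[OF flat_cl that(4,2,7)] .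
    then have "u \<notin> ?N \<squnion> v \<squnion> c" using that(3,7) in2(2)[of u v] that(6) by blast
    moreover have "?N \<squnion> v \<squnion> c = ?N \<squnion> v \<squnion> u" if "c \<notin> ?N \<squnion> v"
      using adj_exchange[of "?N \<squnion> v" c u, OF flat_cl] that \<open>c \<in> ?N \<squnion> u \<squnion> v\<close> \<open>u \<in> E\<close> \<open>?N \<squnion> u \<squnion> v = _\<close> by simp
    ultimately have "c \<in> ?N \<squnion> v" using in2(2)[of v u] that(6,7) by blast
    then show ?thesis using adj_exchange[OF N(1), of c v] cN that(7) by blast
  qed
  have N1: "?N \<squnion> c1 = ?N \<squnion> b" using par[OF c1 failsN[OF c1(1)] f1[OF c1(1)] sw] ab by auto
  have "c1 \<notin> F" using c1(2) NS(1)[of a] N(3) by blast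
  moreover have "F \<squnion> c1 \<subseteq> ?N \<squnion> c1" using N by (intro cl_mono) auto
  then have "c2 \<notin> F \<squnion> c1" using N1 c2 by auto
  ultimately have "r (F \<squnion> c1 \<squnion> c2) = r F + 2"
    using adj_rank[of F c1] adj_rank[of "F \<squnion> c1" c2] assms(1) flat_cl CE c1 c2 by auto
  moreover have "F \<squnion> c1 \<squnion> c2 \<subseteq> cl (C \<union> F)"
  proof -
    have "C \<union> F \<subseteq> cl (C \<union> F)" using F CE by (intro subset_cl) auto
    then show ?thesis using c1 c2 by (intro adj_least flat_cl) auto
  qed
  ultimately show "r (C \<union> F) \<ge> r F + 2" using rank_mono rank_cl by metis
qed

text \<open>If both classes were bad, the first would lie in the complement \<open>?B2\<close> of
  the second. In the final count the left side exceeds \<open>r (?B2 \<union> F) + r F\<close> by at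
  least 4, the right side by at most 3, because \<open>?C1\<close> is a single point over
  \<open>?D\<close>. The point \<open>c\<close> obtained here is the one through which walks above
  two covers are compared.\<close>

lemma common_conn_cover:
  assumes "flat F" "a \<in> E - F" "b \<in> E - F \<squnion> a" "conn (F \<squnion> a)" "conn (F \<squnion> b)"
    and "sep (F \<squnion> a \<squnion> b) K" "conn (E - K)" "c1 \<in> K" "c2 \<in> K"
    and "conn ((E - K) \<squnion> c1)" "conn ((E - K) \<squnion> c2)" "c2 \<notin> (E - K) \<squnion> c1"
  shows "\<exists>c\<in>K. (c \<in> (E - K) \<squnion> c1 \<or> c \<in> (E - K) \<squnion> c2) \<and> conn (F \<squnion> a \<squnion> c) \<and> conn (F \<squnion> b \<squnion> c)"
proof (rule ccontr)
  assume no: "\<not> ?thesis"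
  let ?D = "F \<squnion> a \<squnion> b"
  let ?C1 = "K \<inter> (E - K) \<squnion> c1" and ?B2 = "E - (E - K) \<squnion> c2"
  have 1: "r (?C1 \<union> F) \<ge> r F + 2" using bad_class(2)[OF assms(1-8,10)] no by blast
  have 2: "r (?B2 \<union> ?D) = r (?B2 \<union> F) + 2" using bad_class(1)[OF assms(1-7,9,11)] no by blast
  have F: "F \<subseteq> E" using assms flat_ground by auto
  have FD: "F \<subseteq> ?D" using adj_superset[OF F, of a] adj_superset[OF cl_ground, of "insert a F" b] by auto
  have K: "K \<subseteq> E - ?D" using assms by (auto simp: sep_def)
  have fl: "flat (E - K)" using assms conn_flat by auto
  have "?C1 \<subseteq> ?B2"
  proof
    fix c assume c: "c \<in> ?C1"
    have "c \<notin> (E - K) \<squnion> c2"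
    proof
      assume "c \<in> (E - K) \<squnion> c2"
      then have "(E - K) \<squnion> c2 = (E - K) \<squnion> c1"
        using adj_exchange[OF fl, of c c1] adj_exchange[OF fl, of c c2] c assms K by auto
      then show False using assms K adj_self[of c2 "E - K"] by auto
    qed
    then show "c \<in> ?B2" using c K by auto
  qed
  then have "r (?B2 \<union> ?D) + r (?C1 \<union> F) \<le> r (?C1 \<union> ?D) + r (?B2 \<union> F)"
    using FD by (intro rank_submod') auto
  moreover have "?C1 \<subseteq> ?D \<squnion> c1" using sep_adj_trace[OF flat_cl assms(6,8)] by auto
  then have "?C1 \<union> ?D \<subseteq> ?D \<squnion> c1" using adj_superset[OF cl_ground, of "insert b (F \<squnion> a)" c1] by auto
  then have "r (?C1 \<union> ?D) \<le> r ?D + 1"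
    using rank_mono[of "?C1 \<union> ?D" "?D \<squnion> c1"] rank_cl[of "insert c1 ?D"] rank_insert_le[of c1 ?D] by linarith
  moreover have "r ?D = r F + 2" using adj_rank[OF assms(1,2)] adj_rank[OF flat_cl assms(3)] by simp
  ultimately show False using 1 2 by linarith
qed

section \<open>Hyperplanes and Tutte paths\<close>

definition hyp where "hyp H \<longleftrightarrow> flat H \<and> r H + 1 = r E"

lemma hyp_iff: "H \<in> hyperplanes M \<longleftrightarrow> hyp H"
  using rank_mono[of H E] flat_ground[of H] by (auto simp: hyperplanes_def hyp_def corank_def)

lemma hyp_flat: "hyp H \<Longrightarrow> flat H" "hyp H \<Longrightarrow> H \<subseteq> E" "hyp H \<Longrightarrow> H \<noteq> E"
  using flat_ground by (auto simp: hyp_def)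

lemma hyp_eq: "hyp H \<Longrightarrow> hyp H' \<Longrightarrow> H \<subseteq> H' \<Longrightarrow> H = H'"
  using flat_eq[of H H'] flat_ground by (auto simp: hyp_def)

lemma hyp_Un: "hyp H \<Longrightarrow> hyp H' \<Longrightarrow> H \<noteq> H' \<Longrightarrow> r (H \<union> H') = r E"
proof -
  assume a: "hyp H" "hyp H'" "H \<noteq> H'"
  have "\<not> H' \<subseteq> H" using hyp_eq[OF a(2,1)] a(3) by auto
  moreover have "H \<union> H' \<subseteq> E" using hyp_flat(2) a by simp
  ultimately have "r H < r (H \<union> H')" "r (H \<union> H') \<le> r E"
    using flat_rank_less[OF hyp_flat(1)[OF a(1)], of "H \<union> H'"] rank_mono[of "H \<union> H'" E] by blast+
  then show ?thesis using a by (auto simp: hyp_def)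
qed

lemma hyp_adj: "flat N \<Longrightarrow> r N + 2 = r E \<Longrightarrow> x \<in> E - N \<Longrightarrow> hyp (N \<squnion> x)"
  using adj_rank[of N x] flat_cl by (auto simp: hyp_def)

lemma hyp_adj_eq: "flat N \<Longrightarrow> r N + 2 = r E \<Longrightarrow> x \<in> H - N \<Longrightarrow> hyp H \<Longrightarrow> N \<subseteq> H \<Longrightarrow> H = N \<squnion> x"
  using adj_eq[of N H x] by (auto simp: hyp_def)

lemma hyp_Int:
  assumes "flat N" "r N + 2 = r E" "hyp X" "hyp Y" "X \<noteq> Y" "N \<subseteq> X" "N \<subseteq> Y"
  shows "X \<inter> Y = N"
proof -
  have "r (X \<union> Y) + r (X \<inter> Y) \<le> r X + r Y" by (rule rank_submod)
  then have "r (X \<inter> Y) \<le> r N" using hyp_Un[OF assms(3-5)] assms by (auto simp: hyp_def)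
  moreover have "X \<inter> Y \<subseteq> E" using hyp_flat assms by auto
  ultimately show ?thesis using flat_eq[of N "X \<inter> Y"] assms by auto
qed

lemma conn_hyp: "hyp X \<Longrightarrow> conn X"
proof -
  assume X: "hyp X"
  have "K = {} \<or> K = E - X" if K: "sep X K" for K
  proof (rule ccontr)
    assume "\<not> ?thesis"
    moreover have "K \<subseteq> E - X" using K by (simp add: sep_def)
    ultimately have "X \<subset> K \<union> X" "X \<subset> E - K" "K \<union> X \<subseteq> E" using hyp_flat[OF X] by auto
    then have "r (K \<union> X) > r X" "r (E - K) > r X" using flat_rank_less hyp_flat[OF X] by auto
    then show False using K X by (auto simp: sep_def hyp_def)
  qed
  then show ?thesis using X by (auto simp: conn_def hyp_def)
qed

text \<open>Two distinct hyperplanes through \<open>N\<close> that cover \<open>E\<close> would make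
  \<open>X - N\<close> a separator.\<close>

lemma conn_third:
  assumes "conn N" "r N + 2 = r E" "hyp X" "hyp Y" "N \<subseteq> X" "N \<subseteq> Y"
  shows "\<exists>z\<in>E. z \<notin> X \<and> z \<notin> Y"
proof (cases "X = Y")
  case True then show ?thesis using hyp_flat[OF assms(3)] by auto
next
  case False
  have N: "flat N" using assms conn_flat by auto
  show ?thesis
  proof (rule ccontr)
    assume no: "\<not> ?thesis"
    have i: "X \<inter> Y = N" using hyp_Int[OF N assms(2-4) False assms(5,6)] .
    have "X \<subseteq> E" "Y \<subseteq> E" using assms hyp_flat by auto
    then have e: "X - N \<union> N = X" "E - (X - N) = Y" "X - N \<subseteq> E - N" using i no by auto
    have "sep N (X - N)" unfolding sep_def e using assms e by (auto simp: hyp_def)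
    then have "X - N = {} \<or> X - N = E - N" using assms conn_def by auto
    then have "X = N \<or> Y = N" using i no assms(5,6) \<open>Y \<subseteq> E\<close> by blast
    then show False using assms by (auto simp: hyp_def)
  qed
qed

text \<open>A circuit of the contraction through both sides of a separator has independent parts on
  the two sides, and additivity of rank would make the circuit itself independent.\<close>

lemma indecomposable_conn:
  assumes "indecomposable M F"
  shows "conn F"
proof -
  let ?C = "contract M F"
  have F: "flat F" "F \<subseteq> E" and c: "connected_matroid ?C" using assms flat_ground by (auto simp: indecomposable_def)
  have gr: "ground ?C = E - F" by (simp add: contract_def)
  have "A = {} \<or> A = E - F" if A: "sep F A" for A
  proof (rule ccontr)
    assume "\<not> ?thesis"
    then obtain x y where xy: "x \<in> A" "y \<in> E - F - A" using A by (auto simp: sep_def)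
    moreover have "A \<subseteq> E - F" using A by (simp add: sep_def)
    ultimately obtain C where C: "C \<in> circuits ?C" "x \<in> C" "y \<in> C"
      using c unfolding connected_matroid_def gr by (metis DiffD1 DiffD2 subsetD)
    have CE: "C \<subseteq> E - F" "finite C" using C gr finite_ground by (auto simp: circuits_def intro: finite_subset)
    have "C \<inter> A \<subset> C" "C - A \<subset> C" using xy C by auto
    then have "C \<inter> A \<in> indep ?C" "C - A \<in> indep ?C" using C by (auto simp: circuits_def)
    then have "r (C \<inter> A \<union> F) = card (C \<inter> A) + r F" "r (C - A \<union> F) = card (C - A) + r F"
      by (auto simp: contract_def)
    moreover have "r (C \<inter> A \<union> F) + r (C - A \<union> F) = r (C \<union> F) + r F"
      using sep_rank[OF F(2) A, of C] CE by auto
    moreover have "card C = card (C \<inter> A) + card (C - A)"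
      using CE card_Un_disjoint[of "C \<inter> A" "C - A"] by (simp add: Int_Diff_Un Int_Diff_disjoint)
    ultimately have "r (C \<union> F) = card C + r F" by simp
    then have "C \<in> indep ?C" using CE by (auto simp: contract_def)
    then show False using C by (auto simp: circuits_def)
  qed
  then show ?thesis using F by (auto simp: conn_def)
qed

text \<open>\<open>connected_matroid\<close> demands a matroid, so indecomposability can only be
  established once contractions are known to be matroids.\<close>

lemma matroid_contract:
  assumes "F \<subseteq> E"
  shows "matroid (contract M F)"
proof
  show "finite (ground (contract M F))" using finite_ground by (simp add: contract_def)
  show "I \<subseteq> ground (contract M F)" if "I \<in> indep (contract M F)" for I using that by (simp add: contract_def)
  show "{} \<in> indep (contract M F)" by (simp add: contract_def)
  show "J \<in> indep (contract M F)" if "I \<in> indep (contract M F)" "J \<subseteq> I" for I J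
  proof -
    have I: "I \<subseteq> E - F" "r (I \<union> F) = card I + r F" using that by (auto simp: contract_def)
    have fin: "finite I" using I finite_ground by (auto intro: finite_subset)
    then have finJ: "finite J" using that finite_subset by blast
    have "I \<union> F = J \<union> F \<union> (I - J)" using that by auto
    then have "r (I \<union> F) \<le> r (J \<union> F) + card (I - J)" using rank_Un_le[of "I - J" "J \<union> F"] fin by auto
    moreover have "card I = card J + card (I - J)" using that fin finJ by (simp add: card_Diff_subset card_mono)
    moreover have "r (J \<union> F) \<le> r F + card J" using rank_Un_le[OF finJ, of F] by (simp add: Un_commute)
    ultimately show ?thesis using I that by (auto simp: contract_def)
  qed
  show "\<exists>x\<in>J - I. insert x I \<in> indep (contract M F)"
    if "I \<in> indep (contract M F)" "J \<in> indep (contract M F)" "card I < card J" for I J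
  proof -
    have I: "I \<subseteq> E - F" "r (I \<union> F) = card I + r F" "J \<subseteq> E - F" "r (J \<union> F) = card J + r F"
      using that by (auto simp: contract_def)
    have fin: "finite I" using I finite_ground by (auto intro: finite_subset)
    have "\<not> J \<subseteq> cl (I \<union> F)"
    proof
      assume "J \<subseteq> cl (I \<union> F)"
      then have "r (I \<union> F \<union> J) = r (I \<union> F)" by (rule rank_Un_cl)
      moreover have "r (J \<union> F) \<le> r (I \<union> F \<union> J)" by (rule rank_mono) auto
      ultimately show False using I that by auto
    qed
    then obtain x where x: "x \<in> J" "x \<notin> cl (I \<union> F)" by auto
    then have "x \<in> E - F" "x \<notin> I" using I cl_superset[of x "I \<union> F"] by auto
    moreover have "r (insert x I \<union> F) = card (insert x I) + r F"
      using rank_insert[of x "I \<union> F"] x I fin \<open>x \<notin> I\<close> \<open>x \<in> E - F\<close> by auto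
    ultimately show ?thesis using x I by (auto simp: contract_def)
  qed
qed

text \<open>In the rank 2 quotient two elements are parallel, hence a circuit, or they span
  different hyperplanes; then one of the three given ones differs from both and contains the
  \<open>z\<close> that completes a circuit of size 3.\<close>

lemma indecomposableI:
  assumes "flat N" "r N + 2 = r E" "hyp X" "hyp Y" "hyp Z" "N \<subseteq> X" "N \<subseteq> Y" "N \<subseteq> Z" "X \<noteq> Y" "Y \<noteq> Z" "X \<noteq> Z"
  shows "indecomposable M N"
proof -
  let ?C = "contract M N"
  have N: "N \<subseteq> E" using assms flat_ground by auto
  have card_le: "I \<in> indep ?C \<longleftrightarrow> I \<subseteq> E - N \<and> r (I \<union> N) = card I + r N" for I by (auto simp: contract_def)
  have one: "{x} \<in> indep ?C" if "x \<in> E - N" for x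
    using rank_flat_insert[OF assms(1) that] that by (simp add: card_le)
  have nil: "{} \<in> indep ?C" by (simp add: card_le)
  have two: "{x, y} \<in> indep ?C" if "x \<in> E - N" "y \<in> E - N" "y \<notin> N \<squnion> x" for x y
  proof -
    have "x \<noteq> y" using that adj_self by auto
    moreover have "r (insert y (insert x N)) = r N + 2"
      using rank_insert[of y "insert x N"] rank_flat_insert[OF assms(1)] that by auto
    ultimately show ?thesis using that by (simp add: card_le insert_commute)
  qed
  have "\<exists>C\<in>circuits ?C. x \<in> C \<and> y \<in> C" if x: "x \<in> E - N" and y: "y \<in> E - N" and xy: "x \<noteq> y" for x y
  proof (cases "y \<in> N \<squnion> x")
    case True
    then have "r (insert y (insert x N)) = r N + 1" using rank_flat_insert[OF assms(1) x] by (simp add: cl_iff)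
    then have "{x, y} \<notin> indep ?C" using xy by (simp add: card_le insert_commute)
    moreover have "D \<in> indep ?C" if "D \<subset> {x, y}" for D
    proof -
      have "D = {} \<or> D = {x} \<or> D = {y}" using that by blast
      then show ?thesis using nil one x y by auto
    qed
    ultimately have "{x, y} \<in> circuits ?C" using x y by (auto simp: circuits_def contract_def)
    then show ?thesis by blast
  next
    case False
    have "\<exists>H\<in>{X, Y, Z}. H \<noteq> N \<squnion> x \<and> H \<noteq> N \<squnion> y" using assms(9-11) by auto
    then obtain H where H: "hyp H" "N \<subseteq> H" "H \<noteq> N \<squnion> x" "H \<noteq> N \<squnion> y" using assms by auto
    then have "H \<noteq> N" using assms by (auto simp: hyp_def)
    then obtain z where z: "z \<in> H" "z \<notin> N" using H by auto
    have zE: "z \<in> E - N" using z H hyp_flat by auto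
    have Hz: "H = N \<squnion> z" using hyp_adj_eq assms H z by auto
    have zx: "z \<notin> N \<squnion> x" "z \<notin> N \<squnion> y" using adj_exchange[OF assms(1), of z] z Hz H x y by auto
    have "r (insert z (insert y (insert x N))) \<le> r E" by (rule rank_mono) (use x y zE N in auto)
    moreover have "x \<noteq> z" "y \<noteq> z" using zx adj_self[of _ N] x y by auto
    then have "card {x, y, z} = 3" using xy by simp
    ultimately have "{x, y, z} \<notin> indep ?C" using assms(2)
      by (auto simp: card_le insert_commute)
    moreover have "D \<in> indep ?C" if "D \<subset> {x, y, z}" for D
    proof -
      have "D \<subseteq> {x, y} \<or> D \<subseteq> {x, z} \<or> D \<subseteq> {y, z}" using that by blast
      moreover have "{x, y} \<in> indep ?C" "{x, z} \<in> indep ?C" "{y, z} \<in> indep ?C" using two x y zE zx False by auto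
      ultimately show ?thesis using matroid.indep_subset[OF matroid_contract[OF N]] by meson
    qed
    ultimately have "{x, y, z} \<in> circuits ?C" using x y zE by (auto simp: circuits_def contract_def)
    then show ?thesis by blast
  qed
  then have "connected_matroid ?C"
    unfolding connected_matroid_def using matroid_contract[OF N] by (simp add: contract_def)
  then show ?thesis using assms by (simp add: indecomposable_def)
qed

text \<open>Adjacency in Tutte paths with \<open>conn\<close> in place of
  \<open>indecomposable\<close>; \<open>edge_iff\<close> is the translation.\<close>

definition edge where
  "edge X Y \<longleftrightarrow> hyp X \<and> hyp Y \<and> X \<noteq> Y \<and> conn (X \<inter> Y) \<and> r (X \<inter> Y) + 2 = r E"

lemma edge_sym: "edge X Y \<Longrightarrow> edge Y X" by (auto simp: edge_def Int_commute)

lemma edge_iff: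
  "edge X Y \<longleftrightarrow> hyp X \<and> hyp Y \<and> X \<noteq> Y \<and> corank M (X \<inter> Y) = 2 \<and> indecomposable M (X \<inter> Y)"
proof
  assume "edge X Y"
  then have e: "hyp X" "hyp Y" "X \<noteq> Y" "conn (X \<inter> Y)" "r (X \<inter> Y) + 2 = r E" by (auto simp: edge_def)
  let ?N = "X \<inter> Y"
  have N: "flat ?N" using e conn_flat by auto
  obtain z where z: "z \<in> E" "z \<notin> X" "z \<notin> Y" using conn_third[OF e(4,5,1,2)] by auto
  have "hyp (?N \<squnion> z)" "?N \<subseteq> ?N \<squnion> z" "z \<in> ?N \<squnion> z"
    using hyp_adj[OF N e(5)] adj_superset adj_self flat_ground[OF N] z by auto
  then have "indecomposable M ?N" using indecomposableI[OF N e(5,1,2), of "?N \<squnion> z"] e z by auto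
  then show "hyp X \<and> hyp Y \<and> X \<noteq> Y \<and> corank M (X \<inter> Y) = 2 \<and> indecomposable M (X \<inter> Y)"
    using e by (auto simp: corank_def)
qed (auto simp: edge_def corank_def indecomposable_conn)

lemma edgeI:
  assumes "flat N" "r N + 2 = r E" "hyp X" "hyp Y" "hyp Z" "N \<subseteq> X" "N \<subseteq> Y" "N \<subseteq> Z" "X \<noteq> Y" "Y \<noteq> Z" "X \<noteq> Z"
  shows "edge X Y"
  using indecomposable_conn[OF indecomposableI[OF assms]] hyp_Int[of N X Y] assms unfolding edge_def by auto

lemma edge_connI:
  assumes "conn N" "r N + 2 = r E" "hyp X" "hyp Y" "N \<subseteq> X" "N \<subseteq> Y" "X \<noteq> Y"
  shows "edge X Y"
  using hyp_Int[of N X Y] conn_flat assms unfolding edge_def by auto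

end

section \<open>Modular cuts, walks outside the cut and their homotopy\<close>

locale constellation = matroid M for M :: "'a set_system" +
  fixes \<Gamma> :: "'a set set"
  assumes cut: "modular_cut M \<Gamma>" and cut_nonempty: "\<Gamma> \<noteq> {}"
begin

definition good where "good H \<longleftrightarrow> hyp H \<and> H \<notin> \<Gamma>"

lemma good_hyp: "good H \<Longrightarrow> hyp H" by (simp add: good_def)

lemma good_flat: "good H \<Longrightarrow> flat H" "good H \<Longrightarrow> H \<subseteq> E" using good_hyp hyp_flat by auto

lemma cut_up: "F \<in> \<Gamma> \<Longrightarrow> flat G \<Longrightarrow> F \<subseteq> G \<Longrightarrow> G \<in> \<Gamma>"
  using cut by (auto simp: modular_cut_def)

lemma cut_flat: "F \<in> \<Gamma> \<Longrightarrow> flat F" using cut by (auto simp: modular_cut_def)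

lemma cut_E: "E \<in> \<Gamma>"
proof -
  obtain F where "F \<in> \<Gamma>" using cut_nonempty by auto
  then show ?thesis using cut_up[OF _ flat_E] cut_flat flat_ground by auto
qed

lemma cut_Int: "F \<in> \<Gamma> \<Longrightarrow> G \<in> \<Gamma> \<Longrightarrow> r F + r G = r (F \<inter> G) + r (F \<union> G) \<Longrightarrow> F \<inter> G \<in> \<Gamma>"
proof -
  assume a: "F \<in> \<Gamma>" "G \<in> \<Gamma>" "r F + r G = r (F \<inter> G) + r (F \<union> G)"
  then have "modular_pair M F G" using cut_flat rank_cl[of "F \<union> G"] by (simp add: modular_pair_def join_def)
  then show ?thesis using cut a unfolding modular_cut_def by blast
qed

lemma good_not_cut: "good H \<Longrightarrow> F \<subseteq> H \<Longrightarrow> F \<notin> \<Gamma>"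
  using cut_up good_flat by (auto simp: good_def)

text \<open>Distinct covers of \<open>N\<close> form a modular pair with intersection
  \<open>N\<close>. The usual application is the converse direction: if \<open>N\<close> is outside
  \<Gamma>, two covers in \<Gamma> coincide.\<close>

lemma cut_adj:
  assumes "flat N" "N \<squnion> x \<in> \<Gamma>" "N \<squnion> y \<in> \<Gamma>" "N \<squnion> x \<noteq> N \<squnion> y" "x \<in> E" "y \<in> E"
  shows "N \<in> \<Gamma>"
proof (cases "x \<in> N \<or> y \<in> N")
  case True
  then show ?thesis using assms cl_flat insert_absorb by metis
next
  case False
  have N: "N \<subseteq> E" using assms flat_ground by auto
  have yx: "y \<notin> N \<squnion> x" using adj_exchange[OF assms(1)] False assms by auto
  let ?X = "N \<squnion> x" and ?Y = "N \<squnion> y"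
  have rX: "r ?X = r N + 1" "r ?Y = r N + 1" using adj_rank[OF assms(1)] False assms by auto
  have sup: "N \<subseteq> ?X" "N \<subseteq> ?Y" "y \<in> ?Y" using adj_superset N adj_self assms by auto
  have "r N + 2 \<le> r (?X \<union> ?Y)"
  proof -
    have "r (insert y ?X) = r N + 2" using rank_flat_insert[OF flat_cl, of y "insert x N"] yx assms rX by auto
    moreover have "r (insert y ?X) \<le> r (?X \<union> ?Y)" using sup by (intro rank_mono) auto
    ultimately show ?thesis by auto
  qed
  moreover have "r (?X \<union> ?Y) + r (?X \<inter> ?Y) \<le> r ?X + r ?Y" by (rule rank_submod)
  moreover have "r N \<le> r (?X \<inter> ?Y)" using sup by (intro rank_mono) auto
  ultimately have r: "r ?X + r ?Y = r (?X \<inter> ?Y) + r (?X \<union> ?Y)" "r (?X \<inter> ?Y) \<le> r N" using rX by auto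
  have "?X \<inter> ?Y = N" using flat_eq[OF assms(1) _ _ r(2)] sup cl_ground by auto
  then show ?thesis using cut_Int[OF assms(2,3) r(1)] by simp
qed

text \<open>Climbing by covers: a flat of corank at least 2 has two distinct covers, and they are
  not both in \<Gamma>.\<close>

lemma good_above: "flat F \<Longrightarrow> F \<notin> \<Gamma> \<Longrightarrow> \<exists>H. good H \<and> F \<subseteq> H"
proof (induction "r E - r F" arbitrary: F rule: less_induct)
  case less
  have FE: "F \<subseteq> E" "F \<noteq> E" using less.prems flat_ground cut_E by auto
  then obtain x where x: "x \<in> E" "x \<notin> F" by auto
  have rF: "r F < r E" using flat_rank_less less.prems FE by auto
  show ?case
  proof (cases "r F + 1 = r E")
    case True then show ?thesis using less.prems by (auto simp: good_def hyp_def)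
  next
    case False
    have rx: "r (F \<squnion> x) = r F + 1" using adj_rank less.prems x by auto
    then have "F \<squnion> x \<noteq> E" using False by auto
    then obtain y where y: "y \<in> E" "y \<notin> F \<squnion> x" using cl_ground[of "insert x F"] by auto
    have yF: "y \<notin> F" using y adj_superset FE by auto
    have ry: "r (F \<squnion> y) = r F + 1" using adj_rank less.prems y yF by auto
    have "F \<squnion> x \<noteq> F \<squnion> y" using y adj_self by auto
    then obtain z where z: "F \<squnion> z \<notin> \<Gamma>" "r (F \<squnion> z) = r F + 1"
      using cut_adj[of F x y] less.prems x y rx ry by blast
    then have "r E - r (F \<squnion> z) < r E - r F" using rF by auto
    from less.hyps[OF this flat_cl z(1)] obtain H where "good H" "F \<squnion> z \<subseteq> H" by auto
    moreover have "F \<subseteq> F \<squnion> z" using adj_superset FE by auto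
    ultimately show ?thesis by auto
  qed
qed

text \<open>A walk is its first term together with the list of the later ones. Concatenation at a
  common hyperplane is then \<open>@\<close>, without repeating that hyperplane. The first argument
  is a flat below all terms.\<close>

primrec walk :: "'a set \<Rightarrow> 'a set \<Rightarrow> 'a set list \<Rightarrow> bool" where
  "walk D X [] \<longleftrightarrow> good X \<and> D \<subseteq> X"
| "walk D X (Y # ps) \<longleftrightarrow> good X \<and> D \<subseteq> X \<and> edge X Y \<and> walk D Y ps"

primrec fin :: "'a set \<Rightarrow> 'a set list \<Rightarrow> 'a set" where
  "fin X [] = X"
| "fin X (Y # ps) = fin Y ps"

text \<open>The list of later terms of the reversed walk, which starts at \<open>fin X ps\<close>
  and ends at \<open>X\<close>.\<close>

primrec rv :: "'a set \<Rightarrow> 'a set list \<Rightarrow> 'a set list" where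
  "rv X [] = []"
| "rv X (Y # ps) = rv Y ps @ [X]"

lemma fin_last: "fin X ps = last (X # ps)" by (induction ps arbitrary: X) auto

lemma fin_append [simp]: "fin X (ps @ qs) = fin (fin X ps) qs" by (induction ps arbitrary: X) auto

lemma walk_start: "walk D X ps \<Longrightarrow> good X \<and> D \<subseteq> X" by (cases ps) auto

lemma walk_append [simp]: "walk D X (ps @ qs) \<longleftrightarrow> walk D X ps \<and> walk D (fin X ps) qs"
  by (induction ps arbitrary: X) (auto dest: walk_start)

lemma walk_fin: "walk D X ps \<Longrightarrow> good (fin X ps) \<and> D \<subseteq> fin X ps" by (induction ps arbitrary: X) auto

lemma walk_mono: "walk D X ps \<Longrightarrow> D' \<subseteq> D \<Longrightarrow> walk D' X ps" by (induction ps arbitrary: X) auto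

lemma fin_rv [simp]: "fin (fin X ps) (rv X ps) = X" by (induction ps arbitrary: X) auto

lemma walk_rv: "walk D X ps \<Longrightarrow> walk D (fin X ps) (rv X ps)"
  by (induction ps arbitrary: X) (auto simp: edge_sym dest: walk_start)

text \<open>In corank at least 3, \<open>X\<close> and \<open>Y\<close> are joined through a good
  \<open>Z\<close> above a point \<open>p\<close> of \<open>X\<close> and a point \<open>s\<close>
  of \<open>Y\<close>, both with connected quotients, by induction above
  \<open>F \<squnion> p\<close> and \<open>F \<squnion> s\<close>. Such a \<open>Z\<close> exists
  once \<open>F \<squnion> p \<squnion> s\<close> is outside \<Gamma>.\<close>

lemma path_connected:
  "conn F \<Longrightarrow> good X \<Longrightarrow> good Y \<Longrightarrow> F \<subseteq> X \<Longrightarrow> F \<subseteq> Y \<Longrightarrow> \<exists>p. walk F X p \<and> fin X p = Y"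
proof (induction "r E - r F" arbitrary: F X Y rule: less_induct)
  case less
  have F: "flat F" "F \<subseteq> E" using less.prems conn_flat flat_ground by auto
  have X: "hyp X" "flat X" "X \<subseteq> E" and Y: "hyp Y" "flat Y" "Y \<subseteq> E"
    using less.prems good_hyp good_flat by auto
  have rX: "r X + 1 = r E" "r Y + 1 = r E" using X Y by (auto simp: hyp_def)
  have rF: "r F \<le> r X" using less.prems by (intro rank_mono)
  consider "X = Y" | "X \<noteq> Y" "r F + 2 = r E" | "r F + 2 < r E"
  proof -
    have "X = Y" if "r F = r X"
    proof -
      have "X = F" "Y = F" using flat_eq[OF F(1)] that X Y rX less.prems by auto
      then show ?thesis by simp
    qed
    then show ?thesis using that rF rX by fastforce
  qed
  then show ?case
  proof cases
    case 1
    then have "walk F X []" "fin X [] = Y" using less.prems by auto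
    then show ?thesis by blast
  next
    case 2
    then have "walk F X [Y]" using less.prems edge_connI X Y by auto
    moreover have "fin X [Y] = Y" by simp
    ultimately show ?thesis by blast
  next
    case 3
    obtain p where p: "p \<in> X - F" "conn (F \<squnion> p)"
    proof -
      have "\<not> X \<subseteq> F" using less.prems 3 rX rank_mono[of X F] by auto
      then show ?thesis using that conn_cover[OF less.prems(1) conn_hyp[OF X(1)] less.prems(4) F(1)] by auto
    qed
    obtain q where q: "q \<in> Y - F" "conn (F \<squnion> q)"
    proof -
      have "\<not> Y \<subseteq> F" using less.prems 3 rX rank_mono[of Y F] by auto
      then show ?thesis using that conn_cover[OF less.prems(1) conn_hyp[OF Y(1)] less.prems(5) F(1)] by auto
    qed
    have pE: "p \<in> E - F" "q \<in> E - F" using p q X Y by auto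
    have rp: "r (F \<squnion> p) = r F + 1" "r (F \<squnion> q) = r F + 1" using adj_rank[OF F(1)] pE by auto
    obtain q' where q': "q' \<in> Y - F \<squnion> q" "conn (F \<squnion> q')"
    proof -
      have "\<not> Y \<subseteq> F \<squnion> q" using 3 rX rp rank_mono[of Y "F \<squnion> q"] by auto
      then show ?thesis using that adj_superset[OF F(2)]
          conn_cover[OF less.prems(1) conn_hyp[OF Y(1)] less.prems(5) flat_cl, of "insert q F"] by auto
    qed
    have q'E: "q' \<in> E - F" using q' adj_superset[OF F(2), of q] Y by auto
    have less_p: "r E - r (F \<squnion> s) < r E - r F" if "s \<in> E - F" for s using adj_rank[OF F(1) that] 3 by auto
    show ?thesis
    proof (cases "p \<in> Y")
      case True
      then have "F \<squnion> p \<subseteq> X" "F \<squnion> p \<subseteq> Y" using adj_least X Y p less.prems by auto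
      then obtain w where "walk (F \<squnion> p) X w" "fin X w = Y" using less.hyps[OF less_p p(2)] pE less.prems by blast
      then show ?thesis using walk_mono adj_superset[OF F(2)] by blast
    next
      case False
      \<comment> \<open>If both independent candidates \<open>q\<close> and \<open>q'\<close> fail,
        their joins with \<open>F \<squnion> p\<close> coincide and have the rank of
        \<open>F \<squnion> q \<squnion> q'\<close>, which lies in \<open>Y\<close>; but
        \<open>p\<close> does not.\<close>
      have "\<exists>s. s \<in> Y - F \<and> conn (F \<squnion> s) \<and> F \<squnion> p \<squnion> s \<notin> \<Gamma>"
      proof (rule ccontr)
        assume "\<not> ?thesis"
        then have g: "F \<squnion> p \<squnion> q \<in> \<Gamma>" "F \<squnion> p \<squnion> q' \<in> \<Gamma>" using q q' q'E by auto
        have "F \<squnion> p \<notin> \<Gamma>" using good_not_cut[of X] adj_least[OF X(2)] less.prems p by auto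
        then have eq: "F \<squnion> p \<squnion> q = F \<squnion> p \<squnion> q'" using cut_adj[OF flat_cl g] pE q'E by auto
        let ?U = "F \<squnion> p \<squnion> q"
        have U: "p \<in> ?U" "q \<in> ?U" "q' \<in> ?U" "F \<subseteq> ?U" 
          using adj_superset[OF cl_ground, of "insert p F" q] adj_self[of p F] adj_self[of q] adj_self[of q' "F \<squnion> p"] eq
            adj_superset[OF F(2), of p] pE q'E by auto
        have "F \<squnion> q \<squnion> q' \<subseteq> ?U" using U by (intro adj_least flat_cl) auto
        moreover have "r (F \<squnion> q \<squnion> q') = r F + 2" using adj_rank[OF flat_cl, of q' "insert q F"] rp q' Y by auto
        moreover have "r ?U \<le> r F + 2" using rank_insert_le[of q "F \<squnion> p"] rank_cl rp by auto
        ultimately have "?U = F \<squnion> q \<squnion> q'" using flat_eq[OF flat_cl _ cl_ground] by auto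
        moreover have "F \<squnion> q \<squnion> q' \<subseteq> Y" using Y q q' less.prems by (intro adj_least) auto
        ultimately show False using U False by auto
      qed
      then obtain s where s: "s \<in> Y - F" "conn (F \<squnion> s)" "F \<squnion> p \<squnion> s \<notin> \<Gamma>" by auto
      have sE: "s \<in> E" "s \<in> E - F" using s Y by auto
      obtain Z where Z: "good Z" "F \<squnion> p \<squnion> s \<subseteq> Z" using good_above[OF flat_cl s(3)] by auto
      have "F \<squnion> p \<subseteq> Z" "F \<squnion> s \<subseteq> Z"
      proof -
        show "F \<squnion> p \<subseteq> Z" using Z adj_superset[OF cl_ground, of "insert p F" s] by auto
        moreover have "s \<in> Z" using Z adj_self[OF sE(1), of "F \<squnion> p"] by auto
        ultimately show "F \<squnion> s \<subseteq> Z" using adj_superset[OF F(2), of p] good_flat Z by (intro adj_least) auto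
      qed
      moreover have "F \<squnion> p \<subseteq> X" "F \<squnion> s \<subseteq> Y" using adj_least X Y p s less.prems by auto
      ultimately obtain w1 w2 where w: "walk (F \<squnion> p) X w1" "fin X w1 = Z" "walk (F \<squnion> s) Z w2" "fin Z w2 = Y"
        using less.hyps[OF less_p[OF pE(1)] p(2), of X Z] less.hyps[OF less_p[OF sE(2)] s(2), of Z Y] less.prems Z by blast
      have "walk F X w1" "walk F Z w2" using w walk_mono adj_superset[OF F(2)] by blast+
      then have "walk F X (w1 @ w2)" "fin X (w1 @ w2) = Y" using w by auto
      then show ?thesis by blast
    qed
  qed
qed

definition elem where
  "elem X ps \<longleftrightarrow> (\<exists>t\<in>{1..9}. elementary_tutte_path M \<Gamma> t (X # ps))"

text \<open>Homotopy of walks with common ends. In contrast to a deformation it concerns walks that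
  need not be closed and it permits loops at the last term, so it is compatible with concatenation
  and reversal.\<close>

inductive hm :: "'a set \<Rightarrow> 'a set list \<Rightarrow> 'a set list \<Rightarrow> bool" where
  hm_refl: "walk {} X ps \<Longrightarrow> hm X ps ps"
| hm_sym: "hm X ps qs \<Longrightarrow> hm X qs ps"
| hm_trans: "hm X ps qs \<Longrightarrow> hm X qs us \<Longrightarrow> hm X ps us"
| hm_elem: "elem H (Gs @ [H]) \<Longrightarrow> fin X ps = H \<Longrightarrow> walk {} X (ps @ qs) \<Longrightarrow> walk {} H (Gs @ [H])
    \<Longrightarrow> hm X (ps @ qs) (ps @ (Gs @ [H]) @ qs)"

lemma hm_walk: "hm X ps qs \<Longrightarrow> walk {} X ps \<and> walk {} X qs \<and> fin X ps = fin X qs"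
  by (induction rule: hm.induct) auto

lemma hm_prefix: "hm Y p q \<Longrightarrow> walk {} X a \<Longrightarrow> fin X a = Y \<Longrightarrow> hm X (a @ p) (a @ q)"
proof (induction rule: hm.induct)
  case (hm_elem H Gs Y ps qs)
  then show ?case using hm.hm_elem[of H Gs X "a @ ps" qs] by auto
qed (auto intro: hm.intros)

lemma hm_suffix: "hm X p q \<Longrightarrow> walk {} (fin X p) b \<Longrightarrow> hm X (p @ b) (q @ b)"
proof (induction rule: hm.induct)
  case (hm_trans X ps qs us)
  then show ?case using hm_walk hm.hm_trans by metis
next
  case (hm_sym X ps qs)
  then show ?case using hm_walk hm.hm_sym by metis
next
  case (hm_elem H Gs Y ps qs)
  then show ?case using hm.hm_elem[of H Gs Y ps "qs @ b"] by auto
qed (auto intro: hm.intros)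

lemma hm_append: "hm X p q \<Longrightarrow> hm (fin X p) a b \<Longrightarrow> hm X (p @ a) (q @ b)"
  using hm_walk hm_suffix[of X p q a] hm_prefix[of "fin X q" a b X q] hm_trans by metis

lemma elem_hm: "elem X (Gs @ [X]) \<Longrightarrow> walk {} X (Gs @ [X]) \<Longrightarrow> hm X (Gs @ [X]) []"
  using hm_elem[of X Gs X "[]" "[]"] hm_sym by (auto dest: walk_start)

end

section \<open>Recognising elementary paths\<close>

declare One_nat_def [simp del]

lemma Pow6: "(\<forall>S\<in>Pow {1,2,3,4,5,6::nat}. P S) \<longleftrightarrow>
  (\<forall>T\<in>Pow {4,5,6::nat}. P T \<and> P (insert 1 T) \<and> P (insert 2 T) \<and> P (insert 3 T) \<and> P (insert 1 (insert 2 T)) \<and> P (insert 1 (insert 3 T)) \<and> P (insert 2 (insert 3 T)) \<and> P (insert 1 (insert 2 (insert 3 T))))"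
  by (simp only: Pow_insert Pow_empty) (simp add: ball_Un conj_ac)

lemma interval_nat: "{1..3::nat} = {1,2,3}" "{1..4::nat} = {1,2,3,4}" "{1..6::nat} = {1,2,3,4,5,6}" by auto

lemma subsets_3:
  "\<forall>S\<in>Pow {1..3::nat}. card S = 2 \<longrightarrow> S = {1,2} \<or> S = {1,3} \<or> S = {2,3}"
  "\<forall>S\<in>Pow {1..3::nat}. S = {} \<or> S = {1} \<or> S = {2} \<or> S = {3} \<or> card S \<ge> 2"
  unfolding interval_nat by (simp_all add: Pow_insert ball_Un)

lemma subsets_4:
  "\<forall>S\<in>Pow {1..4::nat}. card S = 3 \<longrightarrow> S = {1,2,3} \<or> S = {1,2,4} \<or> S = {1,3,4} \<or> S = {2,3,4}"
  "\<forall>S\<in>Pow {1..4::nat}. S = {} \<or> S = {1} \<or> S = {2} \<or> S = {3} \<or> S = {4} \<or> S = {1,2} \<or> S = {1,3} \<or> S = {1,4}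
    \<or> S = {2,3} \<or> S = {2,4} \<or> S = {3,4} \<or> card S \<ge> 3"
  unfolding interval_nat by (simp_all add: Pow_insert ball_Un)

text \<open>Every set outside the list is independent. The sets in the list are later seen to be
  dependent by ranks in \<open>M\<close>: they are too large, or their images lie in one
  hyperplane.\<close>

lemma MK4_dep:
  "\<forall>S\<in>Pow {1..6}. S \<in> indep MK4 \<or> card S \<ge> 4 \<or> S = {1,2,6} \<or> S = {1,3,5} \<or> S = {2,3,4} \<or> S = {4,5,6}"
  unfolding interval_nat Pow6 MK4_def matroid_of_hyperplanes_def
  by (simp add: Pow_insert ball_Un insert_Diff_if)

lemma MK23_dep:
  "\<forall>S\<in>Pow {1..6}. S \<in> indep MK23 \<or> card S \<ge> 5 \<or> S = {1,2,4,5} \<or> S = {1,3,4,6} \<or> S = {2,3,5,6}"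
  unfolding interval_nat Pow6 MK23_def matroid_of_hyperplanes_def
  by (simp add: Pow_insert ball_Un insert_Diff_if)

section \<open>Upper sublattices given by labelled elements\<close>

context matroid
begin

lemma cl_Un_cl: "A \<subseteq> E \<Longrightarrow> B \<subseteq> E \<Longrightarrow> cl (cl A \<union> B) = cl (A \<union> B)"
proof
  assume a: "A \<subseteq> E" "B \<subseteq> E"
  then show "cl (A \<union> B) \<subseteq> cl (cl A \<union> B)" using subset_cl by (intro cl_mono) auto
  have "cl A \<subseteq> cl (A \<union> B)" "B \<subseteq> cl (A \<union> B)" using cl_mono[of A "A \<union> B"] subset_cl[of "A \<union> B"] a by auto
  then show "cl (cl A \<union> B) \<subseteq> cl (A \<union> B)" by (intro cl_least flat_cl) auto
qed

text \<open>Chosen greedily among indices rather than elements, because \<open>e\<close> is not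
  assumed injective; on \<open>I\<close> the number of indices counts the rank over
  \<open>F\<close>.\<close>

lemma rank_basis_image:
  "finite S \<Longrightarrow> e ` S \<subseteq> E \<Longrightarrow> \<exists>I\<subseteq>S. r (F \<union> e ` I) = r F + card I \<and> r (F \<union> e ` I) = r (F \<union> e ` S)"
proof (induction rule: finite_induct)
  case (insert x S)
  then obtain I where I: "I \<subseteq> S" "r (F \<union> e ` I) = r F + card I" "r (F \<union> e ` I) = r (F \<union> e ` S)" by auto
  show ?case
  proof (cases "e x \<in> cl (F \<union> e ` S)")
    case True
    then show ?thesis using I by (intro exI[of _ I]) (auto simp: cl_iff)
  next
    case False
    have "e x \<notin> cl (F \<union> e ` I)" using False cl_mono[of "F \<union> e ` I" "F \<union> e ` S"] I(1) by auto
    then have "r (insert (e x) (F \<union> e ` I)) = r (F \<union> e ` I) + 1" "r (insert (e x) (F \<union> e ` S)) = r (F \<union> e ` S) + 1"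
      using rank_insert False insert.prems by auto
    moreover have "x \<notin> I" "finite I" using I insert finite_subset by auto
    ultimately show ?thesis using I by (intro exI[of _ "insert x I"]) auto
  qed
qed auto

lemma rank_image_le: "finite S \<Longrightarrow> r (F \<union> e ` S) \<le> r F + card S"
  using rank_Un_le[of "e ` S" F] card_image_le[of S e] by auto

context
  fixes F :: "'a set" and e :: "nat \<Rightarrow> 'a" and n :: nat and N :: "nat set_system"
  assumes F: "flat F" and e: "e ` {1..n} \<subseteq> E - F" and span: "r (F \<union> e ` {1..n}) = r E"
    and N: "ground N = {1..n}" "\<And>S. S \<in> indep N \<longleftrightarrow> S \<subseteq> {1..n} \<and> r (F \<union> e ` S) = r F + card S"
begin

text \<open>\<open>N\<close> is the matroid that \<open>M/F\<close> induces on the labels through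
  \<open>e\<close>, so ranks of \<open>N\<close> are ranks of \<open>M\<close> over
  \<open>F\<close>, and with them closures and flats.\<close>

lemma rank_minor: "S \<subseteq> {1..n} \<Longrightarrow> rank N S + r F = r (F \<union> e ` S)"
proof -
  assume S: "S \<subseteq> {1..n}"
  have fin: "finite S" using S finite_subset by blast
  have eS: "e ` S \<subseteq> E" using image_mono[OF S, of e] e by blast
  obtain I where I: "I \<subseteq> S" "r (F \<union> e ` I) = r F + card I" "r (F \<union> e ` I) = r (F \<union> e ` S)"
    using rank_basis_image[OF fin eS, of F] by auto
  have finN: "finite {I \<in> indep N. I \<subseteq> S}" by (rule finite_subset[of _ "Pow S"]) (use fin in auto)
  have "rank N S = card I" unfolding rank_def
  proof (rule Max_eqI)
    show "card I \<in> card ` {I \<in> indep N. I \<subseteq> S}" using I S N(2) by auto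
    fix k assume "k \<in> card ` {I \<in> indep N. I \<subseteq> S}"
    then obtain J where J: "J \<in> indep N" "J \<subseteq> S" "k = card J" by auto
    have "r (F \<union> e ` J) \<le> r (F \<union> e ` S)" using J by (intro rank_mono) auto
    then show "k \<le> card I" using J N(2) I by auto
  qed (use finN in auto)
  then show ?thesis using I by simp
qed

lemma closure_minor: "S \<subseteq> {1..n} \<Longrightarrow> closure N S = {i \<in> {1..n}. e i \<in> cl (F \<union> e ` S)}"
proof -
  assume S: "S \<subseteq> {1..n}"
  have "rank N (insert i S) = rank N S \<longleftrightarrow> e i \<in> cl (F \<union> e ` S)" if "i \<in> {1..n}" for i
  proof -
    have "rank N (insert i S) + r F = r (insert (e i) (F \<union> e ` S))" using rank_minor[of "insert i S"] S that by auto
    moreover have "rank N S + r F = r (F \<union> e ` S)" using rank_minor[OF S] .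
    moreover have "e i \<in> E" using e that by blast
    ultimately show ?thesis by (auto simp: cl_iff)
  qed
  then show ?thesis unfolding closure_def[of N] N(1) by auto
qed

lemma closure_minor_idem: "S \<subseteq> {1..n} \<Longrightarrow> cl (F \<union> e ` closure N S) = cl (F \<union> e ` S)" "S \<subseteq> {1..n} \<Longrightarrow> closure N S \<in> flats N"
proof -
  assume S: "S \<subseteq> {1..n}"
  have FS: "F \<union> e ` S \<subseteq> E" using S e F flat_ground by auto
  have c: "S \<subseteq> closure N S" "closure N S \<subseteq> {1..n}" using closure_minor[OF S] subset_cl[OF FS] S by auto
  show eq: "cl (F \<union> e ` closure N S) = cl (F \<union> e ` S)"
  proof
    show "cl (F \<union> e ` S) \<subseteq> cl (F \<union> e ` closure N S)" using c by (intro cl_mono) auto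
    show "cl (F \<union> e ` closure N S) \<subseteq> cl (F \<union> e ` S)"
      using closure_minor[OF S] subset_cl[OF FS] by (intro cl_least flat_cl) auto
  qed
  show "closure N S \<in> flats N" using c closure_minor[OF S] closure_minor[OF c(2)] unfolding flats_def N(1) eq by auto
qed

text \<open>For the upper sublattice, \<open>I\<close> is a basis of \<open>F\<close> and
  \<open>J\<close> is everything except \<open>I\<close> and the labelled elements. Replacing
  \<open>F\<close> by \<open>I\<close> does not change closures, so the closures between
  \<open>I\<close> and \<open>E - J\<close> are exactly the values of \<open>\<phi>\<close>.\<close>

lemma minor_iso:
  defines "\<phi> \<equiv> \<lambda>S. cl (F \<union> e ` S)"
  shows "lattice_iso \<phi> (flats N) {\<phi> S | S. S \<subseteq> {1..n}}" "upper_sublattice M {\<phi> S | S. S \<subseteq> {1..n}}"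
proof -
  have FE: "F \<subseteq> E" using F flat_ground by auto
  have sub: "S \<subseteq> {1..n}" if "S \<in> flats N" for S using that N by (auto simp: flats_def)
  have iff: "S \<subseteq> T \<longleftrightarrow> \<phi> S \<subseteq> \<phi> T" if "S \<in> flats N" "T \<in> flats N" for S T
  proof
    show "\<phi> S \<subseteq> \<phi> T" if "S \<subseteq> T" using that unfolding \<phi>_def by (intro cl_mono) auto
    assume a: "\<phi> S \<subseteq> \<phi> T"
    have T: "T = {i \<in> {1..n}. e i \<in> cl (F \<union> e ` T)}"
      using closure_minor[OF sub[OF \<open>T \<in> _\<close>]] \<open>T \<in> flats N\<close> unfolding flats_def by auto
    have "F \<union> e ` S \<subseteq> E" using FE e sub[OF \<open>S \<in> _\<close>] by auto
    then have "e ` S \<subseteq> \<phi> T" using subset_cl[of "F \<union> e ` S"] a unfolding \<phi>_def by auto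
    then show "S \<subseteq> T" using T sub[OF \<open>S \<in> _\<close>] unfolding \<phi>_def by blast
  qed
  have "\<phi> ` flats N = {\<phi> S | S. S \<subseteq> {1..n}}"
  proof
    show "\<phi> ` flats N \<subseteq> {\<phi> S | S. S \<subseteq> {1..n}}" using sub by auto
    show "{\<phi> S | S. S \<subseteq> {1..n}} \<subseteq> \<phi> ` flats N" using closure_minor_idem unfolding \<phi>_def by blast
  qed
  moreover have "inj_on \<phi> (flats N)" using iff by (intro inj_onI) (metis subset_antisym order_refl)
  ultimately show "lattice_iso \<phi> (flats N) {\<phi> S | S. S \<subseteq> {1..n}}"
    using iff unfolding lattice_iso_def bij_betw_def by auto
  obtain I where I: "I \<in> indep M" "I \<subseteq> F" "card I = r F" using rank_ex by blast
  have IF: "cl I = F" using cl_eqI[OF I(2) _ FE] rank_indep[OF I(1)] I cl_least[OF F I(2)] by auto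
  have IE: "I \<subseteq> E" using I FE by auto
  define J where "J = E - (I \<union> e ` {1..n})"
  have EJ: "E - J = I \<union> e ` {1..n}" using IE e unfolding J_def by auto
  have eq: "cl (I \<union> A) = cl (F \<union> A)" if "A \<subseteq> E" for A using cl_Un_cl[OF IE that] IF by simp
  have "r (I \<union> e ` {1..n}) = r E"
  proof -
    have "r (I \<union> e ` {1..n}) = r (F \<union> e ` {1..n})" using eq[of "e ` {1..n}"] rank_cl e by (metis Diff_subset subset_trans)
    then show ?thesis using span by simp
  qed
  then have "E \<subseteq> cl (E - J)" unfolding EJ using IE e by (intro cl_eqI) auto
  then have cE: "cl (E - J) = E" using cl_ground by auto
  have "{\<phi> S | S. S \<subseteq> {1..n}} = {cl S | S. I \<subseteq> S \<and> S \<subseteq> E - J}"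
  proof
    show "{\<phi> S | S. S \<subseteq> {1..n}} \<subseteq> {cl S | S. I \<subseteq> S \<and> S \<subseteq> E - J}"
    proof
      fix G assume "G \<in> {\<phi> S | S. S \<subseteq> {1..n}}"
      then obtain S where S: "S \<subseteq> {1..n}" "G = \<phi> S" by auto
      have "e ` S \<subseteq> E" using S e by auto
      then have "G = cl (I \<union> e ` S)" using S eq unfolding \<phi>_def by simp
      moreover have "I \<subseteq> I \<union> e ` S" "I \<union> e ` S \<subseteq> E - J" using S unfolding EJ by auto
      ultimately show "G \<in> {cl S | S. I \<subseteq> S \<and> S \<subseteq> E - J}" by blast
    qed
    show "{cl S | S. I \<subseteq> S \<and> S \<subseteq> E - J} \<subseteq> {\<phi> S | S. S \<subseteq> {1..n}}"
    proof
      fix G assume "G \<in> {cl S | S. I \<subseteq> S \<and> S \<subseteq> E - J}"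
      then obtain S where S: "G = cl S" "I \<subseteq> S" "S \<subseteq> I \<union> e ` {1..n}" unfolding EJ by auto
      let ?T = "{i \<in> {1..n}. e i \<in> S}"
      have "S = I \<union> e ` ?T" using S by auto
      moreover have "e ` ?T \<subseteq> E" using e by blast
      ultimately have "G = \<phi> ?T" using eq[of "e ` ?T"] S unfolding \<phi>_def by metis
      then show "G \<in> {\<phi> S | S. S \<subseteq> {1..n}}" by blast
    qed
  qed
  moreover have "I \<inter> J = {}" "J \<subseteq> E" by (auto simp: J_def)
  ultimately show "upper_sublattice M {\<phi> S | S. S \<subseteq> {1..n}}"
    unfolding upper_sublattice_def using I IE cE by blast
qed

text \<open>Only images matter for \<Gamma>': a label set whose image is in \<Gamma> has to share
  its image with a member of \<open>\<Delta>\<close>. This avoids listing the flats of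
  \<open>N\<close>.\<close>

lemma realizesI:
  assumes "\<And>S. S \<in> \<Delta> \<Longrightarrow> S \<subseteq> {1..n} \<and> cl (F \<union> e ` S) \<in> \<Gamma>"
    and "\<And>S. S \<subseteq> {1..n} \<Longrightarrow> cl (F \<union> e ` S) \<in> \<Gamma> \<Longrightarrow> \<exists>S'\<in>\<Delta>. cl (F \<union> e ` S) = cl (F \<union> e ` S')"
  shows "realizes M \<Gamma> (map (\<lambda>S. cl (F \<union> e ` S)) p) (\<lambda>S. cl (F \<union> e ` S)) N \<Delta> p"
proof -
  let ?\<phi> = "\<lambda>S. cl (F \<union> e ` S)"
  have "\<Gamma> \<inter> {?\<phi> S | S. S \<subseteq> {1..n}} \<subseteq> ?\<phi> ` \<Delta>" using assms(2) by blast
  moreover have "?\<phi> ` \<Delta> \<subseteq> \<Gamma> \<inter> {?\<phi> S | S. S \<subseteq> {1..n}}" using assms(1) by blast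
  ultimately have "\<Gamma> \<inter> {?\<phi> S | S. S \<subseteq> {1..n}} = ?\<phi> ` \<Delta>" by (rule subset_antisym)
  then show ?thesis unfolding realizes_def subconstellation_def using minor_iso by blast
qed

end

text \<open>A set of at most \<open>k\<close> labels extends to a spanning one of size
  \<open>k\<close>. Each label adds at most one to the rank, so no label of the smaller set can fail
  to contribute.\<close>

lemma uniform_indep:
  assumes "r F + k = r E" "k \<le> n" "\<And>S. S \<subseteq> {1..n} \<Longrightarrow> card S = k \<Longrightarrow> r (F \<union> e ` S) = r E" "F \<subseteq> E" "e ` {1..n} \<subseteq> E"
  shows "S \<in> indep (uniform_matroid k n) \<longleftrightarrow> S \<subseteq> {1..n} \<and> r (F \<union> e ` S) = r F + card S"
proof (cases "S \<subseteq> {1..n}")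
  case True
  then have fin: "finite S" using finite_subset by blast
  have "r (F \<union> e ` S) = r F + card S" if "card S \<le> k"
  proof -
    have "\<exists>T. S \<subseteq> T \<and> T \<subseteq> {1..n} \<and> card T = k"
      by (rule exists_subset_between) (use that assms(2) True in auto)
    then obtain T where T: "S \<subseteq> T" "T \<subseteq> {1..n}" "card T = k" by blast
    have finT: "finite T" using T finite_subset by blast
    have "F \<union> e ` S \<union> e ` (T - S) = F \<union> e ` T" using T by auto
    then have "r (F \<union> e ` T) \<le> r (F \<union> e ` S) + card (T - S)"
      using rank_image_le[of "T - S" "F \<union> e ` S" e] finT by auto
    moreover have "card (T - S) = k - card S" using T fin by (simp add: card_Diff_subset)
    ultimately show ?thesis using assms(1) assms(3)[OF T(2,3)] rank_image_le[OF fin, of F e] that by auto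
  qed
  moreover have "r (F \<union> e ` S) \<noteq> r F + card S" if "card S > k"
  proof -
    have "r (F \<union> e ` S) \<le> r E" using assms(4,5) True by (intro rank_mono) blast
    then show ?thesis using assms(1) that by auto
  qed
  ultimately show ?thesis using True by (cases "card S \<le> k") (auto simp: uniform_matroid_def not_le)
qed (auto simp: uniform_matroid_def)

lemma cl_spanning: "A \<subseteq> E \<Longrightarrow> r A = r E \<Longrightarrow> cl A = E"
  using cl_eqI[of A E] cl_ground by auto

end

section \<open>Elementary paths of types 1 to 7, and a criterion for matroids given by
  hyperplanes\<close>

context constellation
begin

text \<open>One label is placed on each of \<open>X\<close>, \<open>Y\<close>, \<open>Z\<close>.
  Going to \<open>Y\<close> and back is type 1 or 2 according to whether the third hyperplane is
  outside or inside \<Gamma>; the triangle is type 3.\<close>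

lemma elem_line:
  assumes "flat F" "r F + 2 = r E" "good X" "good Y" "hyp Z" "F \<subseteq> X" "F \<subseteq> Y" "F \<subseteq> Z"
    "X \<noteq> Y" "Y \<noteq> Z" "X \<noteq> Z"
  shows "elem X [Y, X]" "good Z \<Longrightarrow> elem X [Y, Z, X]"
proof -
  have FE: "F \<subseteq> E" using assms flat_ground by auto
  have hX: "hyp X" "hyp Y" using assms good_hyp by auto
  have ne: "F \<noteq> X" "F \<noteq> Y" "F \<noteq> Z" using hX assms by (auto simp: hyp_def)
  obtain x y z where xyz: "x \<in> X - F" "y \<in> Y - F" "z \<in> Z - F" using ne assms by blast
  have E: "x \<in> E - F" "y \<in> E - F" "z \<in> E - F" using xyz hX assms(5) hyp_flat(2) by blast+
  have X: "F \<squnion> x = X" "F \<squnion> y = Y" "F \<squnion> z = Z" using hyp_adj_eq[OF assms(1,2)] xyz hX assms by auto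
  have two: "r (insert a (insert b F)) = r E" if "a \<in> E" "b \<in> E - F" "F \<squnion> a \<noteq> F \<squnion> b" "a \<notin> F" for a b
  proof -
    have "a \<notin> F \<squnion> b" using adj_exchange[OF assms(1), of a b] that by auto
    then show ?thesis using rank_insert[of a "insert b F"] rank_flat_insert[OF assms(1), of b] that assms(2) by auto
  qed
  have 2: "r (insert y (insert x F)) = r E" "r (insert z (insert x F)) = r E" "r (insert z (insert y F)) = r E"
    using two X E assms(9-11) by auto
  define e where "e = (\<lambda>i::nat. if i = 1 then x else if i = 2 then y else z)"
  have eE: "e ` {1..3} \<subseteq> E - F" using E by (auto simp: e_def)
  have sub2: "S = {1,2} \<or> S = {1,3} \<or> S = {2,3}" if "S \<subseteq> {1..3}" "card S = 2" for S :: "nat set"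
    using bspec[OF subsets_3(1), of S] that by simp
  have ind: "S \<in> indep (uniform_matroid 2 3) \<longleftrightarrow> S \<subseteq> {1..3} \<and> r (F \<union> e ` S) = r F + card S" for S
  proof (rule uniform_indep)
    show "r (F \<union> e ` S) = r E" if "S \<subseteq> {1..3}" "card S = 2" for S
      using sub2[OF that] 2 by (auto simp: e_def insert_commute)
  qed (use assms FE eE in auto)
  have full: "cl (F \<union> e ` S) = E" if "S \<subseteq> {1..3}" "card S \<ge> 2" for S
  proof (rule cl_spanning)
    show "F \<union> e ` S \<subseteq> E" using FE eE that by auto
    obtain T where T: "T \<subseteq> S" "card T = 2" using obtain_subset_with_card_n[OF \<open>card S \<ge> _\<close>] by metis
    then have "T = {1,2} \<or> T = {1,3} \<or> T = {2,3}" using sub2[of T] that by blast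
    then have "r (F \<union> e ` T) = r E" using 2 by (auto simp: e_def insert_commute)
    moreover have "F \<union> e ` T \<subseteq> F \<union> e ` S" "F \<union> e ` S \<subseteq> E" using T FE eE that by blast+
    then have "r (F \<union> e ` T) \<le> r (F \<union> e ` S)" "r (F \<union> e ` S) \<le> r E" by (blast intro: rank_mono)+
    ultimately show "r (F \<union> e ` S) = r E" by simp
  qed
  have span: "r (F \<union> e ` {1..3}) = r E" using full[of "{1..3}"] rank_cl[of "F \<union> e ` {1..3}"] by simp
  have gr: "ground (uniform_matroid 2 3) = {1..3}" by (simp add: uniform_matroid_def)
  have phi: "cl (F \<union> e ` {1}) = X" "cl (F \<union> e ` {2}) = Y" "cl (F \<union> e ` {3}) = Z" "cl (F \<union> e ` {1,2,3}) = E"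
    using X full[of "{1,2,3}"] interval_nat by (auto simp: e_def)
  have FG: "F \<notin> \<Gamma>" using good_not_cut assms by auto
  have sub: "S = {} \<or> S = {1} \<or> S = {2} \<or> S = {3} \<or> card S \<ge> 2" if "S \<subseteq> {1..3}" for S :: "nat set"
    using bspec[OF subsets_3(2), of S] that by simp
  have D: "\<exists>S'\<in>\<Delta>. cl (F \<union> e ` S) = cl (F \<union> e ` S')"
    if "S \<subseteq> {1..3}" "cl (F \<union> e ` S) \<in> \<Gamma>" "{1,2,3} \<in> \<Delta>" "Z \<in> \<Gamma> \<Longrightarrow> {3} \<in> \<Delta>" for S \<Delta>
    using sub[OF that(1)]
  proof (elim disjE)
    assume "S = {}" then show ?thesis using FG that cl_flat[OF assms(1)] by auto
  next
    assume "S = {1}" then show ?thesis using that assms phi by (auto simp: good_def)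
  next
    assume "S = {2}" then show ?thesis using that assms phi by (auto simp: good_def)
  next
    assume "S = {3}"
    moreover then have "{3} \<in> \<Delta>" using that phi by simp
    ultimately show ?thesis by blast
  next
    assume "card S \<ge> 2" then show ?thesis using that full phi by metis
  qed
  have real: "realizes M \<Gamma> (map (\<lambda>S. cl (F \<union> e ` S)) p) (\<lambda>S. cl (F \<union> e ` S)) (uniform_matroid 2 3) \<Delta> p"
    if "{1,2,3} \<in> \<Delta>" "Z \<in> \<Gamma> \<Longrightarrow> {3} \<in> \<Delta>" "\<And>S. S \<in> \<Delta> \<Longrightarrow> S \<subseteq> {1..3} \<and> cl (F \<union> e ` S) \<in> \<Gamma>" for p \<Delta>
    by (rule realizesI[OF assms(1) eE span gr ind that(3) D]) (use that in auto)
  show "elem X [Y, X]"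
  proof (cases "Z \<in> \<Gamma>")
    case True
    have "realizes M \<Gamma> (map (\<lambda>S. cl (F \<union> e ` S)) [{1},{2},{1}]) (\<lambda>S. cl (F \<union> e ` S)) (uniform_matroid 2 3) {{3},{1,2,3}} [{1},{2},{1}]"
      by (rule real) (use True phi cut_E interval_nat in auto)
    then have "elementary_tutte_path M \<Gamma> 2 [X, Y, X]" using type2 phi by simp
    then show ?thesis unfolding elem_def by (intro bexI[of _ 2]) auto
  next
    case False
    have "realizes M \<Gamma> (map (\<lambda>S. cl (F \<union> e ` S)) [{1},{2},{1}]) (\<lambda>S. cl (F \<union> e ` S)) (uniform_matroid 2 3) {{1,2,3}} [{1},{2},{1}]"
      by (rule real) (use False phi cut_E interval_nat in auto)
    then have "elementary_tutte_path M \<Gamma> 1 [X, Y, X]" using type1 phi by simp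
    then show ?thesis unfolding elem_def by (intro bexI[of _ 1]) auto
  qed
  assume "good Z"
  have "realizes M \<Gamma> (map (\<lambda>S. cl (F \<union> e ` S)) [{1},{2},{3},{1}]) (\<lambda>S. cl (F \<union> e ` S)) (uniform_matroid 2 3) {{1,2,3}} [{1},{2},{3},{1}]"
    by (rule real) (use \<open>good Z\<close> phi cut_E interval_nat in \<open>auto simp: good_def\<close>)
  then have "elementary_tutte_path M \<Gamma> 3 [X, Y, Z, X]" using type3 phi by simp
  then show "elem X [Y, Z, X]" unfolding elem_def by (intro bexI[of _ 3]) auto
qed

lemma elem_U34:
  assumes "flat F" "r F + 3 = r E" "{x1,x2,x3,x4} \<subseteq> E"
    and "r (F \<union> {x1,x2,x3}) = r E" "r (F \<union> {x1,x2,x4}) = r E" "r (F \<union> {x1,x3,x4}) = r E" "r (F \<union> {x2,x3,x4}) = r E"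
    and "cl (F \<union> {x1,x2}) \<notin> \<Gamma>" "cl (F \<union> {x1,x3}) \<notin> \<Gamma>"
  shows "cl (F \<union> {x2,x3}) \<notin> \<Gamma> \<Longrightarrow> cl (F \<union> {x1,x4}) \<notin> \<Gamma> \<Longrightarrow> cl (F \<union> {x2,x4}) \<notin> \<Gamma> \<Longrightarrow> cl (F \<union> {x3,x4}) \<notin> \<Gamma> \<Longrightarrow>
      elem (cl (F \<union> {x1,x2})) [cl (F \<union> {x1,x3}), cl (F \<union> {x2,x3}), cl (F \<union> {x1,x2})]"
    and "cl (F \<union> {x2,x3}) \<notin> \<Gamma> \<Longrightarrow> cl (F \<union> {x1,x4}) \<in> \<Gamma> \<Longrightarrow> cl (F \<union> {x2,x4}) \<notin> \<Gamma> \<Longrightarrow> cl (F \<union> {x3,x4}) \<notin> \<Gamma> \<Longrightarrow>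
      elem (cl (F \<union> {x1,x2})) [cl (F \<union> {x1,x3}), cl (F \<union> {x2,x3}), cl (F \<union> {x1,x2})]"
    and "cl (F \<union> {x2,x3}) \<notin> \<Gamma> \<Longrightarrow> cl (F \<union> {x4}) \<in> \<Gamma> \<Longrightarrow>
      elem (cl (F \<union> {x1,x2})) [cl (F \<union> {x1,x3}), cl (F \<union> {x2,x3}), cl (F \<union> {x1,x2})]"
    and "cl (F \<union> {x2,x4}) \<notin> \<Gamma> \<Longrightarrow> cl (F \<union> {x3,x4}) \<notin> \<Gamma> \<Longrightarrow> cl (F \<union> {x2,x3}) \<in> \<Gamma> \<Longrightarrow> cl (F \<union> {x1,x4}) \<in> \<Gamma> \<Longrightarrow>
      elem (cl (F \<union> {x1,x2})) [cl (F \<union> {x2,x4}), cl (F \<union> {x3,x4}), cl (F \<union> {x1,x3}), cl (F \<union> {x1,x2})]"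
proof -
  have FE: "F \<subseteq> E" using assms flat_ground by auto
  define e where "e = (\<lambda>i::nat. if i = 1 then x1 else if i = 2 then x2 else if i = 3 then x3 else x4)"
  let ?\<phi> = "\<lambda>S. cl (F \<union> e ` S)"
  have sub3: "S = {1,2,3} \<or> S = {1,2,4} \<or> S = {1,3,4} \<or> S = {2,3,4}" if "S \<subseteq> {1..4}" "card S = 3" for S :: "nat set"
    using bspec[OF subsets_4(1), of S] that by simp
  have eE: "e ` {1..4} \<subseteq> E" using assms(3) by (auto simp: e_def)
  have tri: "r (F \<union> e ` S) = r E" if "S \<subseteq> {1..4}" "card S = 3" for S
    using sub3[OF that] assms(4-7) by (auto simp: e_def insert_commute)
  have ind: "S \<in> indep (uniform_matroid 3 4) \<longleftrightarrow> S \<subseteq> {1..4} \<and> r (F \<union> e ` S) = r F + card S" for S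
    by (rule uniform_indep) (use assms FE eE tri in auto)
  have eF: "e i \<notin> F" if "i \<in> {1..4}" for i
  proof -
    have "{i} \<in> indep (uniform_matroid 3 4)" using that by (simp add: uniform_matroid_def)
    then have "r (F \<union> e ` {i}) = r F + 1" using ind[of "{i}"] by simp
    then show ?thesis by (auto simp: insert_absorb)
  qed
  have eEF: "e ` {1..4} \<subseteq> E - F" using eE eF by auto
  have full: "?\<phi> S = E" if "S \<subseteq> {1..4}" "card S \<ge> 3" for S
  proof (rule cl_spanning)
    show "F \<union> e ` S \<subseteq> E" using FE eE that by blast
    obtain T where T: "T \<subseteq> S" "card T = 3" using obtain_subset_with_card_n[OF \<open>card S \<ge> _\<close>] by metis
    then have "r (F \<union> e ` T) = r E" using tri[of T] that by auto
    moreover have "F \<union> e ` T \<subseteq> F \<union> e ` S" "F \<union> e ` S \<subseteq> E" using T FE eE that by blast+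
    then have "r (F \<union> e ` T) \<le> r (F \<union> e ` S)" "r (F \<union> e ` S) \<le> r E" by (blast intro: rank_mono)+
    ultimately show "r (F \<union> e ` S) = r E" by simp
  qed
  have span: "r (F \<union> e ` {1..4}) = r E" using full[of "{1..4}"] rank_cl[of "F \<union> e ` {1..4}"] by simp
  have gr: "ground (uniform_matroid 3 4) = {1..4}" by (simp add: uniform_matroid_def)
  have phi: "?\<phi> {1,2} = cl (F \<union> {x1,x2})" "?\<phi> {1,3} = cl (F \<union> {x1,x3})" "?\<phi> {2,3} = cl (F \<union> {x2,x3})"
    "?\<phi> {1,4} = cl (F \<union> {x1,x4})" "?\<phi> {2,4} = cl (F \<union> {x2,x4})" "?\<phi> {3,4} = cl (F \<union> {x3,x4})" "?\<phi> {4} = cl (F \<union> {x4})"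
    "?\<phi> {1,2,3,4} = E"
    using full[of "{1,2,3,4}"] interval_nat by (simp_all add: e_def insert_commute)
  have mono: "?\<phi> S \<in> \<Gamma> \<Longrightarrow> S \<subseteq> T \<Longrightarrow> ?\<phi> T \<in> \<Gamma>" for S T using cut_up[OF _ flat_cl] cl_mono by (metis Un_mono image_mono order_refl)
  have sub: "S = {} \<or> S = {1} \<or> S = {2} \<or> S = {3} \<or> S = {4} \<or> S = {1,2} \<or> S = {1,3} \<or> S = {1,4} \<or> S = {2,3} \<or> S = {2,4} \<or> S = {3,4} \<or> card S \<ge> 3"
    if "S \<subseteq> {1..4}" for S :: "nat set"
    using bspec[OF subsets_4(2), of S] that by simp
  have g: "?\<phi> {1,2} \<notin> \<Gamma>" "?\<phi> {1,3} \<notin> \<Gamma>" using assms phi by auto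
  have small: "?\<phi> {} \<notin> \<Gamma>" "?\<phi> {1} \<notin> \<Gamma>" "?\<phi> {2} \<notin> \<Gamma>" "?\<phi> {3} \<notin> \<Gamma>"
    using g mono[of "{}" "{1,2}"] mono[of "{1}" "{1,2}"] mono[of "{2}" "{1,2}"] mono[of "{3}" "{1,3}"] by auto
  have real: "realizes M \<Gamma> (map ?\<phi> p) ?\<phi> (uniform_matroid 3 4) \<Delta> p"
    if "{1,2,3,4} \<in> \<Delta>" "?\<phi> {4} \<in> \<Gamma> \<Longrightarrow> {4} \<in> \<Delta>" "?\<phi> {1,4} \<in> \<Gamma> \<Longrightarrow> {1,4} \<in> \<Delta>" "?\<phi> {2,4} \<in> \<Gamma> \<Longrightarrow> {2,4} \<in> \<Delta>"
      "?\<phi> {3,4} \<in> \<Gamma> \<Longrightarrow> {3,4} \<in> \<Delta>" "?\<phi> {2,3} \<in> \<Gamma> \<Longrightarrow> {2,3} \<in> \<Delta>"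
      "\<And>S. S \<in> \<Delta> \<Longrightarrow> S \<subseteq> {1..4} \<and> ?\<phi> S \<in> \<Gamma>" for p \<Delta>
  proof (rule realizesI[OF assms(1) eEF span gr ind that(7)])
    fix S assume S: "S \<subseteq> {1..4}" "?\<phi> S \<in> \<Gamma>"
    show "\<exists>S'\<in>\<Delta>. ?\<phi> S = ?\<phi> S'"
    proof (cases "S \<in> \<Delta>")
      case False
      then have "card S \<ge> 3" using sub[OF S(1)] S(2) small g that(2-6) by blast
      then show ?thesis using full S that(1) phi by metis
    qed auto
  qed auto
  have n: "{1,2,3,4} \<subseteq> {1..4::nat}" by auto
  let ?p = "[{1,2},{1,3},{2,3},{1,2}] :: nat set list"
  {
    assume a: "cl (F \<union> {x2,x3}) \<notin> \<Gamma>" "cl (F \<union> {x1,x4}) \<notin> \<Gamma>" "cl (F \<union> {x2,x4}) \<notin> \<Gamma>" "cl (F \<union> {x3,x4}) \<notin> \<Gamma>"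
    have "realizes M \<Gamma> (map ?\<phi> ?p) ?\<phi> (uniform_matroid 3 4) {{1,2,3,4}} ?p"
      by (rule real) (use a phi cut_E n mono[of "{4}" "{1,4}"] in auto)
    then show "elem (cl (F \<union> {x1,x2})) [cl (F \<union> {x1,x3}), cl (F \<union> {x2,x3}), cl (F \<union> {x1,x2})]"
      unfolding elem_def using type4[of M \<Gamma>] phi by (intro bexI[of _ 4]) auto
  }
  {
    assume a: "cl (F \<union> {x2,x3}) \<notin> \<Gamma>" "cl (F \<union> {x1,x4}) \<in> \<Gamma>" "cl (F \<union> {x2,x4}) \<notin> \<Gamma>" "cl (F \<union> {x3,x4}) \<notin> \<Gamma>"
    have "realizes M \<Gamma> (map ?\<phi> ?p) ?\<phi> (uniform_matroid 3 4) {{1,4},{1,2,3,4}} ?p"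
      by (rule real) (use a phi cut_E n mono[of "{4}" "{2,4}"] in auto)
    then show "elem (cl (F \<union> {x1,x2})) [cl (F \<union> {x1,x3}), cl (F \<union> {x2,x3}), cl (F \<union> {x1,x2})]"
      unfolding elem_def using type5[of M \<Gamma>] phi by (intro bexI[of _ 5]) auto
  }
  {
    assume a: "cl (F \<union> {x2,x3}) \<notin> \<Gamma>" "cl (F \<union> {x4}) \<in> \<Gamma>"
    then have "?\<phi> {1,4} \<in> \<Gamma>" "?\<phi> {2,4} \<in> \<Gamma>" "?\<phi> {3,4} \<in> \<Gamma>"
      using mono[of "{4}" "{1,4}"] mono[of "{4}" "{2,4}"] mono[of "{4}" "{3,4}"] phi by auto
    then have "realizes M \<Gamma> (map ?\<phi> ?p) ?\<phi> (uniform_matroid 3 4) {{4},{1,4},{2,4},{3,4},{1,2,3,4}} ?p"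
      by (intro real) (use a phi cut_E n in auto)
    then show "elem (cl (F \<union> {x1,x2})) [cl (F \<union> {x1,x3}), cl (F \<union> {x2,x3}), cl (F \<union> {x1,x2})]"
      unfolding elem_def using type6[of M \<Gamma>] phi by (intro bexI[of _ 6]) auto
  }
  {
    assume a: "cl (F \<union> {x2,x4}) \<notin> \<Gamma>" "cl (F \<union> {x3,x4}) \<notin> \<Gamma>" "cl (F \<union> {x2,x3}) \<in> \<Gamma>" "cl (F \<union> {x1,x4}) \<in> \<Gamma>"
    let ?p = "[{1,2},{2,4},{3,4},{1,3},{1,2}] :: nat set list"
    have "realizes M \<Gamma> (map ?\<phi> ?p) ?\<phi> (uniform_matroid 3 4) {{2,3},{1,4},{1,2,3,4}} ?p"
      by (rule real) (use a phi cut_E n mono[of "{4}" "{2,4}"] in auto)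
    then show "elem (cl (F \<union> {x1,x2})) [cl (F \<union> {x2,x4}), cl (F \<union> {x3,x4}), cl (F \<union> {x1,x3}), cl (F \<union> {x1,x2})]"
      unfolding elem_def using type7[of M \<Gamma>] phi by (intro bexI[of _ 7]) auto
  }
qed

text \<open>Incidences with the \<open>h H\<close> certify independence in \<open>M\<close>, since a
  hyperplane witnessing independence in \<open>N\<close> separates the image of an element from the
  others; \<open>dep\<close> gives the converse. By \<open>small\<close>, a proper part of a member
  of \<open>\<D>\<close> lies in a hyperplane outside \<Gamma>, so the cut has no further members
  below the top.\<close>

lemma realizes_hyperplanes:
  fixes h :: "nat set \<Rightarrow> 'a set"
  assumes "flat F" "e ` {1..n} \<subseteq> E - F" and N: "N = matroid_of_hyperplanes {1..n} \<H>"
    and h: "\<And>H. H \<in> \<H> \<Longrightarrow> hyp (h H) \<and> F \<subseteq> h H"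
    and tr: "\<And>H i. H \<in> \<H> \<Longrightarrow> i \<in> {1..n} \<Longrightarrow> e i \<in> h H \<longleftrightarrow> i \<in> H"
    and dep: "\<And>S. S \<subseteq> {1..n} \<Longrightarrow> S \<notin> indep N \<Longrightarrow> r (F \<union> e ` S) \<noteq> r F + card S"
    and sub: "\<And>H. H \<in> \<H> \<Longrightarrow> H \<subseteq> {1..n}"
    and basis: "\<And>H. H \<in> \<H> \<Longrightarrow> \<exists>I\<in>indep N. I \<subseteq> H \<and> r F + card I + 1 = r E"
    and full: "\<exists>I\<in>indep N. r F + card I = r E"
    and D: "\<D> \<subseteq> \<H>" "\<And>H. H \<in> \<D> \<Longrightarrow> h H \<in> \<Gamma>" "\<And>H. H \<in> \<H> - \<D> \<Longrightarrow> h H \<notin> \<Gamma>"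
    and small: "\<And>H S. H \<in> \<D> \<Longrightarrow> S \<subset> H \<Longrightarrow> \<exists>H'\<in>\<H> - \<D>. S \<subseteq> H'"
  shows "realizes M \<Gamma> (map (\<lambda>S. cl (F \<union> e ` S)) p) (\<lambda>S. cl (F \<union> e ` S)) N (insert {1..n} \<D>) p
    \<and> (\<forall>H\<in>\<H>. cl (F \<union> e ` H) = h H)"
proof -
  have FE: "F \<subseteq> E" using assms flat_ground by auto
  have gr: "ground N = {1..n}" by (simp add: N matroid_of_hyperplanes_def)
  have indN: "S \<in> indep N \<longleftrightarrow> S \<subseteq> {1..n} \<and> (\<forall>x\<in>S. \<exists>H\<in>\<H>. S - {x} \<subseteq> H \<and> x \<notin> H)" for S
    by (simp add: N matroid_of_hyperplanes_def)
  have inh: "cl (F \<union> e ` S) \<subseteq> h H" if "H \<in> \<H>" "S \<subseteq> H" for S H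
  proof (rule cl_least)
    have "e i \<in> h H" if "i \<in> S" for i using tr[OF \<open>H \<in> \<H>\<close>] sub[OF \<open>H \<in> \<H>\<close>] \<open>S \<subseteq> H\<close> that by blast
    then show "F \<union> e ` S \<subseteq> h H" using h[OF that(1)] by auto
  qed (use h[OF that(1)] hyp_flat in auto)
  have ind1: "r (F \<union> e ` S) = r F + card S" if "S \<in> indep N" for S
  proof -
    have S: "S \<subseteq> {1..n}" and SH: "\<And>x. x \<in> S \<Longrightarrow> \<exists>H\<in>\<H>. S - {x} \<subseteq> H \<and> x \<notin> H" using that indN by auto
    have finS: "finite S" using S finite_subset by blast
    have "T \<subseteq> S \<Longrightarrow> r (F \<union> e ` T) = r F + card T" if "finite T" for T
      using that
    proof (induction T rule: finite_induct)
      case (insert x T)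
      obtain H where H: "H \<in> \<H>" "S - {x} \<subseteq> H" "x \<notin> H" using SH[of x] insert by blast
      have "T \<subseteq> H" using insert H by auto
      have xn: "x \<in> {1..n}" using insert S by blast
      then have "e x \<notin> cl (F \<union> e ` T)" using inh[OF H(1) \<open>T \<subseteq> H\<close>] tr[OF H(1) xn] H(3) by blast
      then have "r (insert (e x) (F \<union> e ` T)) = r (F \<union> e ` T) + 1"
        using rank_insert assms(2) xn by blast
      then show ?case using insert by simp
    qed simp
    then show ?thesis using finS by auto
  qed
  have ind: "S \<in> indep N \<longleftrightarrow> S \<subseteq> {1..n} \<and> r (F \<union> e ` S) = r F + card S" for S
    using ind1 dep indN by blast
  have fe: "F \<union> e ` S \<subseteq> E" if "S \<subseteq> {1..n}" for S using FE assms(2) that by auto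
  have span: "r (F \<union> e ` {1..n}) = r E"
  proof -
    obtain I where "I \<in> indep N" "r F + card I = r E" using full by auto
    then have "I \<subseteq> {1..n}" "r (F \<union> e ` I) = r E" using ind by auto
    moreover then have "F \<union> e ` I \<subseteq> F \<union> e ` {1..n}" by blast
    moreover have "F \<union> e ` {1..n} \<subseteq> E" using fe by blast
    ultimately show ?thesis using rank_mono by (metis le_antisym)
  qed
  have hH: "cl (F \<union> e ` H) = h H" if "H \<in> \<H>" for H
  proof -
    obtain I where I: "I \<in> indep N" "I \<subseteq> H" "r F + card I + 1 = r E" using basis[OF \<open>H \<in> \<H>\<close>] by blast
    have "r (F \<union> e ` I) \<le> r (F \<union> e ` H)" using I by (intro rank_mono) auto
    then have "r (h H) \<le> r (cl (F \<union> e ` H))" using ind1 I h[OF that] rank_cl by (auto simp: hyp_def)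
    then show ?thesis using flat_eq[OF flat_cl inh[OF that order_refl]] hyp_flat h[OF that] by auto
  qed
  \<comment> \<open>A basis \<open>I\<close> of a set that does not span can be enlarged by some
    \<open>x\<close>. The hyperplane of \<open>N\<close> that witnesses \<open>x\<close> contains
    \<open>I\<close>, hence the whole set, against the assumption.\<close>
  have spanning: "cl (F \<union> e ` S) = E" if S: "S \<subseteq> {1..n}" and no: "\<And>H. H \<in> \<H> \<Longrightarrow> \<not> S \<subseteq> H" for S
  proof (rule ccontr)
    assume ne: "cl (F \<union> e ` S) \<noteq> E"
    have fin: "finite S" using S finite_subset by blast
    have eS: "e ` S \<subseteq> E" using S assms(2) by auto
    obtain I where I: "I \<subseteq> S" "r (F \<union> e ` I) = r F + card I" "r (F \<union> e ` I) = r (F \<union> e ` S)"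
      using rank_basis_image[OF fin eS, of F] by auto
    have clI: "F \<union> e ` S \<subseteq> cl (F \<union> e ` I)" using I fe[OF S] by (intro cl_eqI) auto
    have "\<not> e ` {1..n} \<subseteq> cl (F \<union> e ` S)"
    proof
      assume "e ` {1..n} \<subseteq> cl (F \<union> e ` S)"
      then have "F \<union> e ` {1..n} \<subseteq> cl (F \<union> e ` S)" using subset_cl[OF fe[OF S]] by auto
      then have "cl (F \<union> e ` {1..n}) \<subseteq> cl (F \<union> e ` S)" by (intro cl_least flat_cl)
      then show False using cl_spanning[OF fe span] ne cl_ground by auto
    qed
    then obtain x where x: "x \<in> {1..n}" "e x \<notin> cl (F \<union> e ` S)" by blast
    have "e x \<notin> cl (F \<union> e ` I)" using x cl_mono[of "F \<union> e ` I" "F \<union> e ` S"] I by auto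
    moreover have "x \<notin> I" using x I subset_cl[OF fe[OF S]] by auto
    moreover have "finite I" using fin I finite_subset by auto
    ultimately have "insert x I \<in> indep N"
    proof -
      have "e x \<in> E" "insert x I \<subseteq> {1..n}" using x(1) assms(2) I(1) S by blast+
      then show ?thesis
        using rank_insert[of "e x" "F \<union> e ` I"] \<open>e x \<notin> cl (F \<union> e ` I)\<close> \<open>x \<notin> I\<close> \<open>finite I\<close> I(2) by (simp add: ind)
    qed
    then obtain H where H: "H \<in> \<H>" "insert x I - {x} \<subseteq> H" using indN by blast
    then have "I \<subseteq> H" using \<open>x \<notin> I\<close> by auto
    then have "e ` S \<subseteq> h H" using clI inh[OF H(1)] by blast
    then have "S \<subseteq> H" using tr[OF H(1)] S by blast
    then show False using no H by blast
  qed
  have "realizes M \<Gamma> (map (\<lambda>S. cl (F \<union> e ` S)) p) (\<lambda>S. cl (F \<union> e ` S)) N (insert {1..n} \<D>) p"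
  proof (rule realizesI[OF assms(1,2) span gr ind])
    show "S \<subseteq> {1..n} \<and> cl (F \<union> e ` S) \<in> \<Gamma>" if "S \<in> insert {1..n} \<D>" for S
    proof (cases "S = {1..n}")
      case True then show ?thesis using cl_spanning[OF fe span] cut_E by simp
    next
      case False
      then have "S \<in> \<D>" "S \<in> \<H>" using that D(1) by blast+
      then show ?thesis using sub D(2) hH by metis
    qed
    fix S assume S: "S \<subseteq> {1..n}" "cl (F \<union> e ` S) \<in> \<Gamma>"
    have no: "\<not> S \<subseteq> H" if "H \<in> \<H> - \<D>" for H
    proof
      assume "S \<subseteq> H"
      then show False using cut_up[OF S(2), of "h H"] inh[of H S] D(3)[OF that] h[of H] that hyp_flat by blast
    qed
    show "\<exists>S'\<in>insert {1..n} \<D>. cl (F \<union> e ` S) = cl (F \<union> e ` S')"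
    proof (cases "\<exists>H\<in>\<D>. S \<subseteq> H")
      case True
      then obtain H where "H \<in> \<D>" "S \<subseteq> H" by auto
      then have "S = H" using small[of H S] no by blast
      then show ?thesis using \<open>H \<in> \<D>\<close> by auto
    next
      case False
      then have "cl (F \<union> e ` S) = E" using spanning[OF S(1)] no by blast
      then show ?thesis using cl_spanning[OF fe span] by auto
    qed
  qed
  then show ?thesis using hH by blast
qed

end

section \<open>Types 8 and 9: incidences in the cycle matroids of \<open>K_4\<close> and
  \<open>K_{2,3}\<close>\<close>

declare One_nat_def [simp]

text \<open>The hyperplanes are divided according to the cut of type 8: the four lines with three
  points are outside \<Gamma>, the three pairs are inside.\<close>

definition MK4_lines :: "nat set set" where "MK4_lines = {{1,2,6},{1,3,5},{2,3,4},{4,5,6}}"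
definition MK4_pairs :: "nat set set" where "MK4_pairs = {{1,4},{2,5},{3,6}}"

lemma MK4_eq: "MK4 = matroid_of_hyperplanes {1..6} (MK4_lines \<union> MK4_pairs)"
  unfolding MK4_def MK4_lines_def MK4_pairs_def Un_insert_left Un_empty_left by (rule refl)

lemma MK4_card: "\<forall>H\<in>MK4_lines. card H = 3" "\<forall>H\<in>MK4_pairs. card H = 2"
  unfolding MK4_lines_def MK4_pairs_def by simp_all

lemma MK4_sub: "\<forall>H\<in>MK4_lines \<union> MK4_pairs. H \<subseteq> {1..6}"
  unfolding MK4_lines_def MK4_pairs_def by simp

lemma MK4_dependent: "S \<subseteq> {1..6} \<Longrightarrow> S \<notin> indep MK4 \<Longrightarrow> card S \<ge> 4 \<or> S \<in> MK4_lines"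
  using bspec[OF MK4_dep, of S] unfolding MK4_lines_def by simp

lemma MK4_basis: "\<forall>H\<in>MK4_lines \<union> MK4_pairs. \<exists>I\<in>indep MK4. I \<subseteq> H \<and> card I = 2" "\<exists>I\<in>indep MK4. card I = 3"
proof -
  have "\<forall>H\<in>MK4_lines \<union> MK4_pairs. \<exists>I\<in>{{1,2},{1,3},{2,3},{4,5},{1,4},{2,5},{3,6}}. I \<subseteq> H"
    unfolding MK4_lines_def MK4_pairs_def by simp
  moreover have "\<forall>I\<in>{{1,2},{1,3},{2,3},{4,5},{1,4},{2,5},{3,6}}. I \<in> indep MK4 \<and> card I = 2"
    unfolding MK4_def matroid_of_hyperplanes_def by (simp add: insert_Diff_if)
  ultimately show "\<forall>H\<in>MK4_lines \<union> MK4_pairs. \<exists>I\<in>indep MK4. I \<subseteq> H \<and> card I = 2" by meson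
  have "{1,2,3} \<in> indep MK4" unfolding MK4_def matroid_of_hyperplanes_def by (simp add: insert_Diff_if)
  then show "\<exists>I\<in>indep MK4. card I = 3" by (rule bexI[rotated]) simp
qed

lemma MK4_small: "H \<in> MK4_pairs \<Longrightarrow> S \<subset> H \<Longrightarrow> \<exists>H'\<in>MK4_lines. S \<subseteq> H'"
proof -
  assume "H \<in> MK4_pairs" "S \<subset> H"
  then have "\<exists>i\<in>{1,2,3,4,5,6}. S \<subseteq> {i}" unfolding MK4_pairs_def by (elim insertE emptyE) blast+
  moreover have "\<forall>i\<in>{1,2,3,4,5,6}. \<exists>H'\<in>MK4_lines. i \<in> H'" unfolding MK4_lines_def by simp
  ultimately show ?thesis by (meson empty_subsetI insert_subset subset_trans)
qed

text \<open>The planes are unions of two serial pairs. The triples are the transversals of the three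
  pairs: those with an odd number of elements among 4, 5, 6 are outside \<Gamma> in type 9, those
  with an even number are inside.\<close>

definition MK23_planes :: "nat set set" where "MK23_planes = {{1,2,4,5},{1,3,4,6},{2,3,5,6}}"
definition MK23_good :: "nat set set" where "MK23_good = {{1,2,6},{1,3,5},{2,3,4},{4,5,6}}"
definition MK23_bad :: "nat set set" where "MK23_bad = {{1,2,3},{1,5,6},{2,4,6},{3,4,5}}"

lemma MK23_eq: "MK23 = matroid_of_hyperplanes {1..6} (MK23_planes \<union> MK23_good \<union> MK23_bad)"
proof -
  have "{{1,2,4,5},{1,3,4,6},{2,3,5,6},{1,2,3},{1,2,6},{1,3,5},{1,5,6},{2,3,4},{2,4,6},{3,4,5},{4,5,6}} = MK23_planes \<union> MK23_good \<union> MK23_bad"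
    unfolding MK23_planes_def MK23_good_def MK23_bad_def
    by (rule set_eqI) (simp only: Un_iff insert_iff empty_iff disj_ac simp_thms)
  then show ?thesis unfolding MK23_def by simp
qed

lemma MK23_card: "\<forall>H\<in>MK23_planes. card H = 4" "\<forall>H\<in>MK23_good \<union> MK23_bad. card H = 3"
  unfolding MK23_planes_def MK23_good_def MK23_bad_def by simp_all

lemma MK23_sub: "\<forall>H\<in>MK23_planes \<union> MK23_good \<union> MK23_bad. H \<subseteq> {1..6}"
  unfolding MK23_planes_def MK23_good_def MK23_bad_def by simp

lemma MK23_dependent: "S \<subseteq> {1..6} \<Longrightarrow> S \<notin> indep MK23 \<Longrightarrow> card S \<ge> 5 \<or> S \<in> MK23_planes"
  using bspec[OF MK23_dep, of S] unfolding MK23_planes_def by simp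

lemma MK23_basis: "\<forall>H\<in>MK23_planes \<union> MK23_good \<union> MK23_bad. \<exists>I\<in>indep MK23. I \<subseteq> H \<and> card I = 3" "\<exists>I\<in>indep MK23. card I = 4"
proof -
  have "\<forall>H\<in>MK23_planes. \<exists>I\<in>{{1,2,4},{1,3,4},{2,3,5}}. I \<subseteq> H" unfolding MK23_planes_def by simp
  moreover have "\<forall>I\<in>{{1,2,4},{1,3,4},{2,3,5}}. I \<in> indep MK23 \<and> card I = 3"
    unfolding MK23_def matroid_of_hyperplanes_def by (simp add: insert_Diff_if)
  moreover have "\<forall>H\<in>MK23_good \<union> MK23_bad. H \<in> indep MK23"
    unfolding MK23_good_def MK23_bad_def MK23_def matroid_of_hyperplanes_def by (simp add: insert_Diff_if)
  ultimately show "\<forall>H\<in>MK23_planes \<union> MK23_good \<union> MK23_bad. \<exists>I\<in>indep MK23. I \<subseteq> H \<and> card I = 3"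
    using MK23_card(2) by (metis Un_iff order_refl)
  have "{1,2,3,4} \<in> indep MK23" unfolding MK23_def matroid_of_hyperplanes_def by (simp add: insert_Diff_if)
  then show "\<exists>I\<in>indep MK23. card I = 4" by (rule bexI[rotated]) simp
qed

lemma MK23_small: "H \<in> MK23_bad \<Longrightarrow> S \<subset> H \<Longrightarrow> \<exists>H'\<in>MK23_planes. S \<subseteq> H'"
proof -
  assume "H \<in> MK23_bad" "S \<subset> H"
  then obtain x where x: "x \<in> H" "S \<subseteq> H - {x}" by blast
  have "\<forall>H\<in>MK23_bad. \<forall>x\<in>H. \<exists>H'\<in>MK23_planes. H - {x} \<subseteq> H'"
    unfolding MK23_bad_def MK23_planes_def by (simp add: insert_Diff_if)
  then show ?thesis using \<open>H \<in> MK23_bad\<close> x by (meson subset_trans)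
qed

context constellation
begin

lemma rank_less_hyp: "flat F \<Longrightarrow> F \<subseteq> h \<Longrightarrow> (\<And>i. i \<in> S \<Longrightarrow> e i \<in> h) \<Longrightarrow> hyp h \<Longrightarrow> r (F \<union> e ` S) < r E"
proof -
  assume a: "F \<subseteq> h" "\<And>i. i \<in> S \<Longrightarrow> e i \<in> h" "hyp h"
  then have "F \<union> e ` S \<subseteq> h" by blast
  then have "r (F \<union> e ` S) \<le> r h" by (rule rank_mono)
  then show ?thesis using a(3) by (auto simp: hyp_def)
qed

lemma elem_MK4:
  fixes h :: "nat set \<Rightarrow> 'a set"
  assumes F: "flat F" "r F + 3 = r E" "e ` {1..6} \<subseteq> E - F"
    and h: "\<And>H. H \<in> MK4_lines \<union> MK4_pairs \<Longrightarrow> hyp (h H) \<and> F \<subseteq> h H"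
    and tr: "\<And>H i. H \<in> MK4_lines \<union> MK4_pairs \<Longrightarrow> i \<in> {1..6} \<Longrightarrow> e i \<in> h H \<longleftrightarrow> i \<in> H"
    and good: "\<And>H. H \<in> MK4_lines \<Longrightarrow> h H \<notin> \<Gamma>"
    and bad: "\<And>H. H \<in> MK4_pairs \<Longrightarrow> h H \<in> \<Gamma>"
  shows "elem (h {1,2,6}) [h {1,3,5}, h {2,3,4}, h {1,2,6}]"
proof -
  let ?p = "[{1,2,6},{1,3,5},{2,3,4},{1,2,6}] :: nat set list"
  let ?\<phi> = "\<lambda>S. cl (F \<union> e ` S)"
  have FE: "F \<subseteq> E" using F flat_ground by auto
  have dep: "r (F \<union> e ` S) \<noteq> r F + card S" if S: "S \<subseteq> {1..6}" "S \<notin> indep MK4" for S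
  proof (cases "card S \<ge> 4")
    case True
    have "F \<union> e ` S \<subseteq> E" using FE F(3) S by blast
    then have "r (F \<union> e ` S) \<le> r E" by (rule rank_mono)
    then show ?thesis using True F(2) by linarith
  next
    case False
    then have SH: "S \<in> MK4_lines" using MK4_dependent S by blast
    then have "r (F \<union> e ` S) < r E" using rank_less_hyp[OF F(1), of "h S" S e] h[of S] tr[of S] S(1) by blast
    moreover have "card S = 3" using SH MK4_card by blast
    ultimately show ?thesis using F(2) by linarith
  qed
  have R: "realizes M \<Gamma> (map ?\<phi> ?p) ?\<phi> MK4 (insert {1..6} MK4_pairs) ?p \<and> (\<forall>H\<in>MK4_lines \<union> MK4_pairs. ?\<phi> H = h H)"
  proof (rule realizes_hyperplanes[OF F(1,3) MK4_eq h tr dep])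
    show "H \<subseteq> {1..6}" if "H \<in> MK4_lines \<union> MK4_pairs" for H using MK4_sub that by blast
    show "\<exists>I\<in>indep MK4. I \<subseteq> H \<and> r F + card I + 1 = r E" if "H \<in> MK4_lines \<union> MK4_pairs" for H
    proof -
      obtain I where "I \<in> indep MK4" "I \<subseteq> H" "card I = 2" using MK4_basis(1) \<open>H \<in> _\<close> by blast
      then show ?thesis using F(2) by (intro bexI[of _ I]) simp_all
    qed
    obtain I where "I \<in> indep MK4" "card I = 3" using MK4_basis(2) by blast
    then show "\<exists>I\<in>indep MK4. r F + card I = r E" using F(2) by (intro bexI[of _ I]) simp_all
    show "MK4_pairs \<subseteq> MK4_lines \<union> MK4_pairs" by blast
    show "h H \<in> \<Gamma>" if "H \<in> MK4_pairs" for H using that bad by blast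
    show "h H \<notin> \<Gamma>" if "H \<in> MK4_lines \<union> MK4_pairs - MK4_pairs" for H using that good by blast
    show "\<exists>H'\<in>MK4_lines \<union> MK4_pairs - MK4_pairs. S \<subseteq> H'" if H: "H \<in> MK4_pairs" "S \<subset> H" for H S
    proof -
      obtain H' where H': "H' \<in> MK4_lines" "S \<subseteq> H'" using MK4_small H by blast
      have "card H' = 3" using MK4_card H' by blast
      then have "H' \<notin> MK4_pairs" using MK4_card(2) by force
      then show ?thesis using H' by blast
    qed
  qed
  have "set ?p \<subseteq> MK4_lines \<union> MK4_pairs" unfolding MK4_lines_def by simp
  then have "map ?\<phi> ?p = map h ?p" using R by (intro map_cong refl) blast
  moreover have "insert {1..6} MK4_pairs = {{1,4},{2,5},{3,6},{1,2,3,4,5,6}}"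
    unfolding interval_nat MK4_pairs_def
    by (rule set_eqI) (simp only: Un_iff insert_iff empty_iff disj_ac simp_thms)
  ultimately have "realizes M \<Gamma> (map h ?p) ?\<phi> MK4 {{1,4},{2,5},{3,6},{1,2,3,4,5,6}} ?p" using R by metis
  then have "elementary_tutte_path M \<Gamma> 8 (map h ?p)" by (rule type8)
  then show ?thesis unfolding elem_def by (intro bexI[of _ 8]) simp_all
qed

lemma elem_MK23:
  fixes h :: "nat set \<Rightarrow> 'a set"
  assumes F: "flat F" "r F + 4 = r E" "e ` {1..6} \<subseteq> E - F"
    and h: "\<And>H. H \<in> MK23_planes \<union> MK23_good \<union> MK23_bad \<Longrightarrow> hyp (h H) \<and> F \<subseteq> h H"
    and tr: "\<And>H i. H \<in> MK23_planes \<union> MK23_good \<union> MK23_bad \<Longrightarrow> i \<in> {1..6} \<Longrightarrow> e i \<in> h H \<longleftrightarrow> i \<in> H"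
    and good: "\<And>H. H \<in> MK23_planes \<union> MK23_good \<Longrightarrow> h H \<notin> \<Gamma>"
    and bad: "\<And>H. H \<in> MK23_bad \<Longrightarrow> h H \<in> \<Gamma>"
    and decomp: "decomposable M (cl (F \<union> {e 1, e 4}))" "decomposable M (cl (F \<union> {e 2, e 5}))" "decomposable M (cl (F \<union> {e 3, e 6}))"
  shows "elem (h {1,2,4,5}) [h {1,2,6}, h {1,3,4,6}, h {4,5,6}, h {1,2,4,5}]"
proof -
  let ?p = "[{1,2,4,5},{1,2,6},{1,3,4,6},{4,5,6},{1,2,4,5}] :: nat set list"
  let ?\<phi> = "\<lambda>S. cl (F \<union> e ` S)"
  let ?H = "MK23_planes \<union> MK23_good \<union> MK23_bad"
  have FE: "F \<subseteq> E" using F flat_ground by auto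
  have dep: "r (F \<union> e ` S) \<noteq> r F + card S" if S: "S \<subseteq> {1..6}" "S \<notin> indep MK23" for S
  proof (cases "card S \<ge> 5")
    case True
    have "F \<union> e ` S \<subseteq> E" using FE F(3) S by blast
    then have "r (F \<union> e ` S) \<le> r E" by (rule rank_mono)
    then show ?thesis using True F(2) by linarith
  next
    case False
    then have SH: "S \<in> MK23_planes" using MK23_dependent S by blast
    then have "r (F \<union> e ` S) < r E" using rank_less_hyp[OF F(1), of "h S" S e] h[of S] tr[of S] S(1) by blast
    moreover have "card S = 4" using SH MK23_card by blast
    ultimately show ?thesis using F(2) by linarith
  qed
  have R: "realizes M \<Gamma> (map ?\<phi> ?p) ?\<phi> MK23 (insert {1..6} MK23_bad) ?p \<and> (\<forall>H\<in>?H. ?\<phi> H = h H)"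
  proof (rule realizes_hyperplanes[OF F(1,3) MK23_eq h tr dep])
    show "H \<subseteq> {1..6}" if "H \<in> ?H" for H using MK23_sub that by blast
    show "\<exists>I\<in>indep MK23. I \<subseteq> H \<and> r F + card I + 1 = r E" if "H \<in> ?H" for H
    proof -
      obtain I where "I \<in> indep MK23" "I \<subseteq> H" "card I = 3" using MK23_basis(1) \<open>H \<in> _\<close> by blast
      then show ?thesis using F(2) by (intro bexI[of _ I]) simp_all
    qed
    obtain I where "I \<in> indep MK23" "card I = 4" using MK23_basis(2) by blast
    then show "\<exists>I\<in>indep MK23. r F + card I = r E" using F(2) by (intro bexI[of _ I]) simp_all
    show "MK23_bad \<subseteq> ?H" by blast
    show "h H \<in> \<Gamma>" if "H \<in> MK23_bad" for H using that bad by blast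
    show "h H \<notin> \<Gamma>" if "H \<in> ?H - MK23_bad" for H using that good by blast
    show "\<exists>H'\<in>?H - MK23_bad. S \<subseteq> H'" if H: "H \<in> MK23_bad" "S \<subset> H" for H S
    proof -
      obtain H' where H': "H' \<in> MK23_planes" "S \<subseteq> H'" using MK23_small H by blast
      have "card H' = 4" using MK23_card H' by blast
      then have "H' \<notin> MK23_bad" using MK23_card(2) by force
      then show ?thesis using H' by blast
    qed
  qed
  have "set ?p \<subseteq> ?H" unfolding MK23_good_def MK23_planes_def by simp
  then have "map ?\<phi> ?p = map h ?p" using R by (intro map_cong refl) blast
  moreover have "insert {1..6} MK23_bad = {{1,2,3},{1,5,6},{2,4,6},{3,4,5},{1,2,3,4,5,6}}"
    unfolding interval_nat MK23_bad_def
    by (rule set_eqI) (simp only: Un_iff insert_iff empty_iff disj_ac simp_thms)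
  ultimately have "realizes M \<Gamma> (map h ?p) ?\<phi> MK23 {{1,2,3},{1,5,6},{2,4,6},{3,4,5},{1,2,3,4,5,6}} ?p" using R by metis
  then have "elementary_tutte_path M \<Gamma> 9 (map h ?p)"
  proof (rule type9)
    show "decomposable M (?\<phi> {1,4})" "decomposable M (?\<phi> {2,5})" "decomposable M (?\<phi> {3,6})"
      using decomp by simp_all
  qed
  then show ?thesis unfolding elem_def by (intro bexI[of _ 9]) simp_all
qed

section \<open>Triangles and quadrangles\<close>

declare hm_trans [trans]

text \<open>Connectedness of the quotient by \<open>X \<inter> Y\<close> supplies the third
  hyperplane that types 1 and 2 require.\<close>

lemma hm_back: "good X \<Longrightarrow> good Y \<Longrightarrow> edge X Y \<Longrightarrow> hm X [Y, X] []"
proof -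
  assume a: "good X" "good Y" "edge X Y"
  then have e: "hyp X" "hyp Y" "X \<noteq> Y" "conn (X \<inter> Y)" "r (X \<inter> Y) + 2 = r E" by (auto simp: edge_def)
  let ?N = "X \<inter> Y"
  have N: "flat ?N" using e conn_flat by auto
  obtain z where z: "z \<in> E" "z \<notin> X" "z \<notin> Y" using conn_third[OF e(4,5,1,2)] by auto
  have Z: "hyp (?N \<squnion> z)" "?N \<subseteq> ?N \<squnion> z" "z \<in> ?N \<squnion> z"
    using hyp_adj[OF N e(5)] adj_superset adj_self flat_ground[OF N] z by auto
  have "elem X [Y, X]" by (rule elem_line(1)[OF N e(5) a(1,2) Z(1)]) (use Z z e in auto)
  then show ?thesis using elem_hm[of X "[Y]"] a by (simp add: edge_sym)
qed

lemma hm_rv: "walk {} X ps \<Longrightarrow> hm X (ps @ rv X ps) []"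
proof (induction ps arbitrary: X)
  case (Cons Y ps)
  then have w: "good X" "edge X Y" "walk {} Y ps" "good Y" by (auto dest: walk_start)
  have "hm Y (ps @ rv Y ps) []" using Cons.IH w by auto
  then have "hm Y ((ps @ rv Y ps) @ [X]) ([] @ [X])" by (rule hm_suffix) (use w edge_sym in auto)
  then have "hm X ([Y] @ (ps @ rv Y ps) @ [X]) ([Y] @ [] @ [X])" by (intro hm_prefix[of Y]) (use w in auto)
  also have "hm X \<dots> []" using hm_back w by auto
  finally (hm_trans) show ?case by simp
qed (auto intro: hm_refl)

lemma hm_rv': "walk {} X ps \<Longrightarrow> hm (fin X ps) (rv X ps @ ps) []"
proof (induction ps arbitrary: X)
  case (Cons Y ps)
  then have w: "good X" "edge X Y" "walk {} Y ps" "good Y" by (auto dest: walk_start)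
  have "hm Y ([X, Y] @ ps) ([] @ ps)" by (rule hm_suffix[OF hm_back]) (use w edge_sym in auto)
  then have "hm (fin Y ps) (rv Y ps @ [X, Y] @ ps) (rv Y ps @ [] @ ps)"
    by (intro hm_prefix[of Y]) (use w walk_rv in auto)
  also have "hm (fin Y ps) \<dots> []" using Cons.IH w by auto
  finally (hm_trans) show ?case by simp
qed (auto intro: hm_refl)

text \<open>After \<open>q\<close> is appended to the contractible loop, the middle part
  \<open>rv X q @ q\<close> cancels and leaves \<open>p\<close>.\<close>

lemma hm_loopI:
  assumes "hm X (p @ rv X q) []" "walk {} X q" "fin X p = fin X q"
  shows "hm X p q"
proof -
  have p: "walk {} X p" using hm_walk[OF assms(1)] by auto
  have "hm X (p @ rv X q @ q) (p @ [])"
    by (rule hm_prefix[of "fin X p"]) (use hm_rv' assms p in auto)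
  moreover have "hm X ((p @ rv X q) @ q) ([] @ q)" by (rule hm_suffix[OF assms(1)]) (use assms p in auto)
  ultimately show ?thesis using hm_sym hm_trans by (metis append.assoc append_Nil append_Nil2)
qed

lemma hm_reverse: "hm X p q \<Longrightarrow> hm (fin X p) (rv X p) (rv X q)"
proof -
  assume h: "hm X p q"
  then have w: "walk {} X p" "walk {} X q" "fin X p = fin X q" using hm_walk by auto
  let ?Y = "fin X p"
  have rp: "walk {} ?Y (rv X p)" "fin ?Y (rv X p) = X" using walk_rv[OF w(1)] fin_rv[of X p] .
  have rq: "walk {} ?Y (rv X q)" "fin ?Y (rv X q) = X" using walk_rv[OF w(2)] fin_rv[of X q] w(3) by simp_all
  have "hm ?Y (rv X p @ q @ rv X q) (rv X p @ [])"
    by (rule hm_prefix[OF hm_rv[OF w(2)] rp])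
  moreover have "hm X (q @ rv X q) (p @ rv X q)" by (rule hm_suffix[OF hm_sym[OF h]]) (use w rq in simp)
  then have "hm ?Y (rv X p @ q @ rv X q) (rv X p @ p @ rv X q)" by (rule hm_prefix[OF _ rp])
  moreover have "hm ?Y ((rv X p @ p) @ rv X q) ([] @ rv X q)"
    by (rule hm_suffix[OF hm_rv'[OF w(1)]]) (use rp rq in simp)
  ultimately show ?thesis using hm_sym hm_trans by (metis append.assoc append_Nil append_Nil2)
qed

section \<open>Contractible triangles and quadrangles above flats of corank 2 and 3\<close>

definition tri where "tri X Y Z \<longleftrightarrow> hm X [Y, Z] [Z]"

lemma tri_walk: "tri X Y Z \<Longrightarrow> good X \<and> good Y \<and> good Z \<and> edge X Y \<and> edge Y Z \<and> edge X Z"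
  using hm_walk[of X "[Y, Z]" "[Z]"] by (auto simp: tri_def)

lemma tri_loopI: "hm X [Y, Z, X] [] \<Longrightarrow> tri X Y Z"
  unfolding tri_def using hm_loopI[of X "[Y, Z]" "[Z]"] hm_walk[of X "[Y, Z, X]" "[]"] edge_sym[of Z X] by simp

lemma tri_del:
  assumes "tri A B C" "walk {} X ps" "fin X ps = A" "walk {} C qs"
  shows "hm X (ps @ B # C # qs) (ps @ C # qs)"
proof -
  have "hm A ([B, C] @ qs) ([C] @ qs)" by (rule hm_suffix) (use assms tri_def in auto)
  then show ?thesis using hm_prefix[of A] assms by auto
qed

lemma tri_ins:
  assumes "tri A B C" "walk {} X ps" "fin X ps = A" "walk {} C qs"
  shows "hm X (ps @ C # qs) (ps @ B # C # qs)"
  using tri_del[OF assms] hm_sym by auto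

text \<open>Conjugation by the edge from \<open>Y\<close> to \<open>X\<close> moves the base point
  of the contractible loop.\<close>

lemma tri_rot: "tri X Y Z \<Longrightarrow> tri Y Z X"
proof -
  assume t: "tri X Y Z"
  then have w: "good X" "good Y" "good Z" "edge X Y" "edge Y Z" "edge X Z" "edge Y X" "edge Z X" "edge Z Y"
    using tri_walk edge_sym by blast+
  have "hm X ([Z, X] @ []) ([Y, Z, X] @ [])"
    using tri_ins[OF t, of X "[]" "[X]"] w by auto
  then have "hm X [Z, X] [Y, Z, X]" by simp
  then have "hm X [Y, Z, X] []" using hm_trans[OF hm_sym hm_back[of X Z]] w by blast
  then have "hm Y ([X] @ [Y, Z, X]) ([X] @ [])" by (intro hm_prefix[of X]) (use w in auto)
  moreover have "hm Y ([X, Y] @ [Z, X]) ([] @ [Z, X])" by (rule hm_suffix[OF hm_back]) (use w in auto)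
  ultimately show ?thesis unfolding tri_def using hm_sym hm_trans by (metis append_Cons append_Nil append_Nil2)
qed

lemma tri_rev: "tri X Y Z \<Longrightarrow> tri Z Y X"
  using hm_reverse[of X "[Y, Z]" "[Z]"] by (simp add: tri_def)

lemma tri_swap: "tri X Y Z \<Longrightarrow> tri Y X Z" "tri X Y Z \<Longrightarrow> tri X Z Y"
  using tri_rot[OF tri_rev] tri_rev[OF tri_rot] by blast+

lemma tri_line:
  assumes "flat N" "r N + 2 = r E" "good X" "good Y" "good Z" "N \<subseteq> X" "N \<subseteq> Y" "N \<subseteq> Z" "X \<noteq> Y" "Y \<noteq> Z" "X \<noteq> Z"
  shows "tri X Y Z"
proof (rule tri_loopI)
  have h: "hyp X" "hyp Y" "hyp Z" using good_hyp assms by auto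
  have "elem X ([Y, Z] @ [X])"
    using elem_line(2)[OF assms(1-4) h(3) assms(6-11,5)] by simp
  moreover have "edge X Y" "edge Y Z" "edge Z X"
    using edgeI[OF assms(1,2) h(1,2,3) assms(6-8)] edgeI[OF assms(1,2) h(2,3,1) assms(7,8,6)]
      edgeI[OF assms(1,2) h(3,1,2) assms(8,6,7)] assms(9-11) by simp_all
  ultimately show "hm X [Y, Z, X] []" using elem_hm[of X "[Y, Z]"] assms by auto
qed

lemma plane_span:
  assumes "flat F" "r F + 3 = r E" "hyp X" "F \<subseteq> X" "a \<in> X - F" "b \<in> X - F \<squnion> a"
  shows "cl (F \<union> {a, b}) = X" "c \<in> E - X \<Longrightarrow> r (F \<union> {a, b, c}) = r E" "F \<squnion> a \<squnion> b = X"
proof -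
  have F: "F \<subseteq> E" and X: "X \<subseteq> E" "flat X" using assms flat_ground hyp_flat by auto
  have ab: "a \<in> E - F" "b \<in> E" "b \<notin> F \<squnion> a" using assms X by auto
  have rab: "r (insert b (insert a F)) = r F + 2"
    using rank_insert[OF ab(2,3)] rank_flat_insert[OF assms(1) ab(1)] by simp
  have sub: "cl (F \<union> {a, b}) \<subseteq> X" using assms X by (intro cl_least) auto
  show c: "cl (F \<union> {a, b}) = X"
  proof (rule sym, rule flat_eq[OF flat_cl sub X(1)])
    show "r X \<le> r (cl (F \<union> {a, b}))" using rab rank_cl assms by (auto simp: hyp_def insert_commute)
  qed
  show "F \<squnion> a \<squnion> b = X" using adj_adj[OF F, of a b] ab c by (simp add: insert_commute)
  show "r (F \<union> {a, b, c}) = r E" if "c \<in> E - X"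
    using rank_insert[of c "F \<union> {a, b}"] that rab assms(2) unfolding c by (simp add: insert_commute)
qed

text \<open>In the plane \<open>M/F\<close> the three lines meet in three different points, which
  together with \<open>p\<close> are in general position. If two of the lines from \<open>p\<close>
  to these points are in \<Gamma>, so is \<open>p\<close>, and type 6 applies. Otherwise none or one
  of them is, which is type 4 or, after relabelling, type 5.\<close>

lemma tri_off:
  assumes F: "flat F" "r F + 3 = r E" "F \<subseteq> X" "F \<subseteq> Y" "F \<subseteq> Z"
    and g: "good X" "good Y" "good Z" and e: "edge X Y" "edge X Z" "edge Y Z"
    and ne: "X \<inter> Y \<noteq> X \<inter> Z" and p: "p \<in> E" "p \<notin> X" "p \<notin> Y" "p \<notin> Z"
  shows "tri X Y Z"
proof -
  have h: "hyp X" "hyp Y" "hyp Z" using good_hyp g by auto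
  have sub: "X \<subseteq> E" "Y \<subseteq> E" "Z \<subseteq> E" using hyp_flat h by auto
  have rk: "r (X \<inter> Y) = r F + 1" "r (X \<inter> Z) = r F + 1" "r (Y \<inter> Z) = r F + 1" using e F by (auto simp: edge_def)
  have fl: "flat (X \<inter> Y)" "flat (X \<inter> Z)" "flat (Y \<inter> Z)" using flat_Int hyp_flat h by auto
  have "F \<noteq> X \<inter> Y" "F \<noteq> X \<inter> Z" "F \<noteq> Y \<inter> Z" using rk by auto
  then obtain x1 x2 x3 where x: "x1 \<in> X \<inter> Y - F" "x2 \<in> X \<inter> Z - F" "x3 \<in> Y \<inter> Z - F" using F by blast
  have N: "F \<squnion> x1 = X \<inter> Y" "F \<squnion> x2 = X \<inter> Z" "F \<squnion> x3 = Y \<inter> Z"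
    using adj_eq[OF F(1) fl(1) _ x(1)] adj_eq[OF F(1) fl(2) _ x(2)] adj_eq[OF F(1) fl(3) _ x(3)] rk F by auto
  have all3: False if "s \<in> X" "s \<in> Y" "s \<in> Z" "s \<notin> F" for s
  proof -
    have "X \<inter> Y = F \<squnion> s" "X \<inter> Z = F \<squnion> s"
      using adj_eq[OF F(1) fl(1), of s] adj_eq[OF F(1) fl(2), of s] rk F that by auto
    then show False using ne by simp
  qed
  have nx: "x1 \<notin> Z" "x2 \<notin> Y" "x3 \<notin> X" using all3 x by auto
  have X: "cl (F \<union> {x1, x2}) = X" "\<And>c. c \<in> E - X \<Longrightarrow> r (F \<union> {x1, x2, c}) = r E"
    using plane_span(1,2)[OF F(1,2) h(1) F(3), of x1 x2] x N nx by auto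
  have Y: "cl (F \<union> {x1, x3}) = Y" "\<And>c. c \<in> E - Y \<Longrightarrow> r (F \<union> {x1, x3, c}) = r E"
    using plane_span(1,2)[OF F(1,2) h(2) F(4), of x1 x3] x N nx by auto
  have Z: "cl (F \<union> {x2, x3}) = Z" "\<And>c. c \<in> E - Z \<Longrightarrow> r (F \<union> {x2, x3, c}) = r E"
    using plane_span(1,2)[OF F(1,2) h(3) F(5), of x2 x3] x N nx by auto
  have xE: "x1 \<in> E" "x2 \<in> E" "x3 \<in> E" using x sub by auto
  have spans: "r (F \<union> {x1,x2,x3}) = r E" "r (F \<union> {x1,x2,p}) = r E" "r (F \<union> {x1,x3,p}) = r E" "r (F \<union> {x2,x3,p}) = r E"
    using X(2)[of x3] X(2)[of p] Y(2)[of p] Z(2)[of p] xE nx p by auto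
  have gn: "cl (F \<union> {x1, x2}) \<notin> \<Gamma>" "cl (F \<union> {x1, x3}) \<notin> \<Gamma>" "cl (F \<union> {x2, x3}) \<notin> \<Gamma>"
    using X Y Z g by (auto simp: good_def)
  have loop: "tri A B C" if el: "elem A [B, C, A]" and "(A, B, C) \<in> {(X, Y, Z), (X, Z, Y), (Y, Z, X)}" for A B C
  proof (rule tri_loopI)
    have "edge A B \<and> edge B C \<and> edge C A \<and> good A \<and> good B \<and> good C"
      using that(2) e g edge_sym[OF e(1)] edge_sym[OF e(2)] edge_sym[OF e(3)] by blast
    then show "hm A [B, C, A] []" using elem_hm[of A "[B, C]"] el by simp
  qed
  note U = elem_U34[OF F(1,2)]
  consider "cl (F \<union> {p}) \<in> \<Gamma>" | "cl (F \<union> {x1, p}) \<notin> \<Gamma>" "cl (F \<union> {x2, p}) \<notin> \<Gamma>" "cl (F \<union> {x3, p}) \<notin> \<Gamma>"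
    | "cl (F \<union> {x1, p}) \<in> \<Gamma>" "cl (F \<union> {x2, p}) \<notin> \<Gamma>" "cl (F \<union> {x3, p}) \<notin> \<Gamma>"
    | "cl (F \<union> {x1, p}) \<notin> \<Gamma>" "cl (F \<union> {x2, p}) \<in> \<Gamma>" "cl (F \<union> {x3, p}) \<notin> \<Gamma>"
    | "cl (F \<union> {x1, p}) \<notin> \<Gamma>" "cl (F \<union> {x2, p}) \<notin> \<Gamma>" "cl (F \<union> {x3, p}) \<in> \<Gamma>"
  proof -
    have "cl (F \<union> {p}) \<in> \<Gamma>" if "cl (F \<union> {s, p}) \<in> \<Gamma>" "cl (F \<union> {t, p}) \<in> \<Gamma>" "r (F \<union> {s, t, p}) = r E" "s \<in> E" "t \<in> E" for s t
    proof -
      have eq: "F \<squnion> p \<squnion> u = cl (F \<union> {u, p})" for u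
        using adj_adj[OF flat_ground[OF F(1)] p(1), of u] by (simp add: insert_commute)
      have "F \<squnion> p \<squnion> s \<noteq> F \<squnion> p \<squnion> t"
      proof
        assume "F \<squnion> p \<squnion> s = F \<squnion> p \<squnion> t"
        then have "t \<in> cl (F \<union> {s, p})" using adj_self[OF that(5), of "F \<squnion> p"] eq by auto
        then have "r (F \<union> {s, t, p}) = r (F \<union> {s, p})" by (simp add: cl_iff insert_commute)
        moreover have "r (F \<union> {s, p}) \<le> r F + 2" using rank_Un_le[of "{s, p}" F] card_insert_le_m1[of 2 "{p}" s] by (simp add: card_insert_if split: if_splits)
        ultimately show False using that F by auto
      qed
      then show ?thesis using cut_adj[of "F \<squnion> p" s t, OF flat_cl] that eq by simp
    qed
    from this[of x1 x2] this[of x1 x3] this[of x2 x3] show ?thesis using that spans xE by metis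
  qed
  then show ?thesis
  proof cases
    case 1
    show ?thesis using U(3)[of x1 x2 x3 p] spans gn xE p 1 loop[of X Y Z] X Y Z by auto
  next
    case 2
    show ?thesis using U(1)[of x1 x2 x3 p] spans gn xE p 2 loop[of X Y Z] X Y Z by auto
  next
    case 3
    show ?thesis using U(2)[of x1 x2 x3 p] spans gn xE p 3 loop[of X Y Z] X Y Z by auto
  next
    case 4
    have "elem X [Z, Y, X]" using U(2)[of x2 x1 x3 p] spans gn xE p 4 X Y Z by (simp add: insert_commute)
    then have "tri X Z Y" using loop[of X Z Y] by auto
    then show ?thesis using tri_rot tri_rev by blast
  next
    case 5
    have "elem Y [Z, X, Y]" using U(2)[of x3 x1 x2 p] spans gn xE p 5 X Y Z by (simp add: insert_commute)
    then have "tri Y Z X" using loop[of Y Z X] by auto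
    then show ?thesis using tri_rot tri_rev by blast
  qed
qed


text \<open>The line \<open>?H\<close> from the vertex \<open>X \<inter> Y\<close> to the point
  \<open>p4\<close> of \<open>Z\<close> cuts the triangle into two. Each of them leaves out a point:
  \<open>p5\<close> is off \<open>X\<close>, \<open>?H\<close>, \<open>Z\<close>, and
  \<open>p6\<close> is off \<open>Y\<close>, \<open>?H\<close>, \<open>Z\<close>. The lines
  \<open>X\<close>, \<open>?H\<close>, \<open>Y\<close> are concurrent.\<close>

lemma tri_through:
  assumes F: "flat F" "r F + 3 = r E" "F \<subseteq> X" "F \<subseteq> Y" "F \<subseteq> Z"
    and g: "good X" "good Y" "good Z" and e: "edge X Y" "edge X Z" "edge Y Z"
    and ne: "X \<inter> Y \<noteq> X \<inter> Z" "X \<inter> Y \<noteq> Y \<inter> Z"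
    and p: "p4 \<in> Z - X - Y" "p5 \<in> Y - X - Z" "p6 \<in> X - Y - Z"
    and gH: "(X \<inter> Y) \<squnion> p4 \<notin> \<Gamma>"
  shows "tri X Y Z"
proof -
  let ?N = "X \<inter> Y" and ?H = "(X \<inter> Y) \<squnion> p4"
  have h: "hyp X" "hyp Y" "hyp Z" using good_hyp g by auto
  have sub: "X \<subseteq> E" "Y \<subseteq> E" "Z \<subseteq> E" "flat Z" using hyp_flat h by auto
  have pE: "p4 \<in> E" "p5 \<in> E" "p6 \<in> E" using p sub by auto
  have N: "flat ?N" "r ?N + 2 = r E" using flat_Int hyp_flat h e by (auto simp: edge_def)
  have H: "hyp ?H" using hyp_adj[OF N] p pE by auto
  have gH': "good ?H" using H gH by (simp add: good_def)
  have NH: "?N \<subseteq> ?H" "p4 \<in> ?H" using adj_superset[of ?N p4] adj_self[OF pE(1), of ?N] sub(1) by blast+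
  have p5H: "p5 \<notin> ?H"
  proof
    assume "p5 \<in> ?H"
    then have "?H = ?N \<squnion> p5" using hyp_adj_eq[OF N _ H NH(1), of p5] p by auto
    also have "\<dots> = Y" using hyp_adj_eq[OF N _ h(2), of p5] p by auto
    finally show False using NH p by auto
  qed
  have p6H: "p6 \<notin> ?H"
  proof
    assume "p6 \<in> ?H"
    then have "?H = ?N \<squnion> p6" using hyp_adj_eq[OF N _ H NH(1), of p6] p by auto
    also have "\<dots> = X" using hyp_adj_eq[OF N _ h(1), of p6] p by auto
    finally show False using NH p by auto
  qed
  have HX: "?H \<noteq> X" "?H \<noteq> Y" "X \<noteq> Y" using NH p e by (auto simp: edge_def)
  have t0: "tri X ?H Y" using tri_line[OF N g(1) gH' g(2)] NH HX by auto
  have FH: "F \<subseteq> ?H" using F sub NH by auto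
  have p4F: "p4 \<in> E - F" using p pE F by auto
  let ?L = "F \<squnion> p4"
  have L: "flat ?L" "r ?L + 2 = r E" "?L \<subseteq> E" using flat_cl adj_rank[OF F(1) p4F] F cl_ground by auto
  have LH: "?L \<subseteq> ?H" "?L \<subseteq> Z" using adj_least hyp_flat h H FH NH F p by auto
  have p5L: "p5 \<in> E - ?L" using pE p LH by auto
  have W: "hyp (?L \<squnion> p5)" "?L \<subseteq> ?L \<squnion> p5" "p5 \<in> ?L \<squnion> p5" using hyp_adj[OF L(1,2) p5L] adj_superset[OF L(3)] adj_self pE by auto
  have HZ: "?H \<noteq> Z"
  proof
    assume "?H = Z"
    then have "?N \<subseteq> X \<inter> Z" using NH by auto
    moreover have "r (X \<inter> Z) = r ?N" using e by (auto simp: edge_def)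
    ultimately have "X \<inter> Z = ?N" using flat_eq[OF N(1)] sub by (metis inf.coboundedI1 order_refl)
    then show False using ne by simp
  qed
  \<comment> \<open>The third line through \<open>p4\<close> that makes \<open>?H\<close> and
    \<open>Z\<close> adjacent is the one through \<open>p5\<close>.\<close>
  have eHZ: "edge ?H Z"
    by (rule edgeI[OF L(1,2) H h(3) W(1) LH W(2) HZ]) (use W p5H p in auto)
  have eXH: "edge X ?H" "edge ?H Y" using tri_walk[OF t0] by auto
  have XH: "X \<inter> ?H = ?N" "Y \<inter> ?H = ?N" using hyp_Int[OF N h(1) H] hyp_Int[OF N h(2) H] HX NH by auto
  have t1: "tri X ?H Z"
    by (rule tri_off[OF F(1,2,3) FH F(5) g(1) gH' g(3) eXH(1) e(2) eHZ]) (use XH ne p5H p pE in auto)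
  have t2: "tri Y ?H Z"
    by (rule tri_off[OF F(1,2,4) FH F(5) g(2) gH' g(3) edge_sym[OF eXH(2)] e(3) eHZ]) (use XH ne p6H p pE in auto)
  have "hm X [Y, Z] [?H, Y, Z]" using tri_ins[OF t0, of X "[]" "[Z]"] g e by auto
  also have "hm X [?H, Y, Z] [?H, Z]"
    using tri_del[OF tri_swap(1)[OF t2], of X "[?H]" "[]"] g gH' eXH by (auto simp: Int_commute)
  also have "hm X [?H, Z] [Z]" using t1 by (simp add: tri_def)
  finally (hm_trans) show ?thesis by (simp add: tri_def)
qed

text \<open>The hard case is a triangle whose lines cover the plane. By \<open>conn_third\<close>
  each line has a point off the other two; points are numbered as in \<open>K_4\<close>. A good line
  from a vertex to the point opposite reduces to \<open>tri_through\<close>. If all three such lines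
  are in \<Gamma>, collinearity of \<open>p4\<close>, \<open>p5\<close>, \<open>p6\<close> gives
  type 8, and otherwise the lines joining them complete the triangle to an octahedron.\<close>

lemma tri_plane:
  assumes F: "flat F" "r F + 3 = r E" "F \<subseteq> X" "F \<subseteq> Y" "F \<subseteq> Z"
    and g: "good X" "good Y" "good Z" and e: "edge X Y" "edge X Z" "edge Y Z"
  shows "tri X Y Z"
proof (cases "X \<inter> Y = X \<inter> Z \<or> (\<exists>p\<in>E. p \<notin> X \<and> p \<notin> Y \<and> p \<notin> Z)")
  case True
  show ?thesis
  proof (cases "X \<inter> Y = X \<inter> Z")
    case True
    have "flat (X \<inter> Y)" using flat_Int good_flat g by auto
    moreover have "X \<noteq> Y" "Y \<noteq> Z" "X \<noteq> Z" "r (X \<inter> Y) + 2 = r E" using e unfolding edge_def by blast+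
    ultimately show ?thesis using tri_line[of "X \<inter> Y" X Y Z] True g by blast
  next
    case False
    then obtain p where "p \<in> E" "p \<notin> X" "p \<notin> Y" "p \<notin> Z" using True by blast
    then show ?thesis by (rule tri_off[OF assms(1-11) False])
  qed
next
  case False
  then have ne: "X \<inter> Y \<noteq> X \<inter> Z" and cover: "\<And>p. p \<in> E \<Longrightarrow> p \<in> X \<or> p \<in> Y \<or> p \<in> Z" by auto
  have h: "hyp X" "hyp Y" "hyp Z" using good_hyp g by auto
  have sub: "X \<subseteq> E" "Y \<subseteq> E" "Z \<subseteq> E" using hyp_flat h by auto
  have FE: "F \<subseteq> E" using F sub by auto
  have rk: "r (X \<inter> Y) = r F + 1" "r (X \<inter> Z) = r F + 1" "r (Y \<inter> Z) = r F + 1" using e F by (auto simp: edge_def)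
  have fl: "flat (X \<inter> Y)" "flat (X \<inter> Z)" "flat (Y \<inter> Z)" using flat_Int hyp_flat h by auto
  have "F \<noteq> X \<inter> Y" "F \<noteq> X \<inter> Z" "F \<noteq> Y \<inter> Z" using rk by auto
  then obtain x1 x2 x3 where x: "x1 \<in> X \<inter> Y - F" "x2 \<in> X \<inter> Z - F" "x3 \<in> Y \<inter> Z - F" using F by blast
  have N: "F \<squnion> x1 = X \<inter> Y" "F \<squnion> x2 = X \<inter> Z" "F \<squnion> x3 = Y \<inter> Z"
    using adj_eq[OF F(1) fl(1) _ x(1)] adj_eq[OF F(1) fl(2) _ x(2)] adj_eq[OF F(1) fl(3) _ x(3)] rk F by auto
  have all3: False if "s \<in> X" "s \<in> Y" "s \<in> Z" "s \<notin> F" for s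
  proof -
    have "X \<inter> Y = F \<squnion> s" "X \<inter> Z = F \<squnion> s"
      using adj_eq[OF F(1) fl(1), of s] adj_eq[OF F(1) fl(2), of s] rk F that by auto
    then show False using ne by simp
  qed
  have nx: "x1 \<notin> Z" "x2 \<notin> Y" "x3 \<notin> X" using all3 x by auto
  have ne': "X \<inter> Y \<noteq> Y \<inter> Z" "X \<inter> Z \<noteq> Y \<inter> Z" using x nx by auto
  have c: "conn (X \<inter> Y)" "conn (X \<inter> Z)" "conn (Y \<inter> Z)" "r (X \<inter> Y) + 2 = r E" "r (X \<inter> Z) + 2 = r E" "r (Y \<inter> Z) + 2 = r E"
    using e by (auto simp: edge_def)
  obtain p4 where p4: "p4 \<in> Z - X - Y" using conn_third[OF c(1,4) h(1,2)] cover by auto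
  obtain p5 where p5: "p5 \<in> Y - X - Z" using conn_third[OF c(2,5) h(1,3)] cover by auto
  obtain p6 where p6: "p6 \<in> X - Y - Z" using conn_third[OF c(3,6) h(2,3)] cover by auto
  have pE: "p4 \<in> E" "p5 \<in> E" "p6 \<in> E" "x1 \<in> E" "x2 \<in> E" "x3 \<in> E" using p4 p5 p6 x sub by auto
  let ?H14 = "(X \<inter> Y) \<squnion> p4" and ?H25 = "(X \<inter> Z) \<squnion> p5" and ?H36 = "(Y \<inter> Z) \<squnion> p6"
  consider "?H14 \<notin> \<Gamma>" | "?H25 \<notin> \<Gamma>" | "?H36 \<notin> \<Gamma>" | "?H14 \<in> \<Gamma>" "?H25 \<in> \<Gamma>" "?H36 \<in> \<Gamma>" by blast
  then show ?thesis
  proof cases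
    case 1
    show ?thesis by (rule tri_through[OF assms ne ne'(1) p4 p5 p6 1])
  next
    case 2
    have "tri X Z Y"
    proof (rule tri_through[OF F(1-3,5,4) g(1,3,2) e(2,1) edge_sym[OF e(3)] ne[symmetric] _ p5 p4 _ 2])
      show "X \<inter> Z \<noteq> Z \<inter> Y" using ne'(2) by (simp add: Int_commute)
      show "p6 \<in> X - Z - Y" using p6 by blast
    qed
    then show ?thesis using tri_rot tri_rev by blast
  next
    case 3
    have "tri Y Z X"
    proof (rule tri_through[OF F(1,2,4,5,3) g(2,3,1) e(3) edge_sym[OF e(1)] edge_sym[OF e(2)] _ _ p6 _ _ 3])
      show "Y \<inter> Z \<noteq> Y \<inter> X" "Y \<inter> Z \<noteq> Z \<inter> X" using ne' by (simp_all add: Int_commute)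
      show "p4 \<in> Z - Y - X" "p5 \<in> Y - Z - X" using p4 p5 by blast+
    qed
    then show ?thesis using tri_rot by blast
  next
    case 4
    have nF: "p4 \<in> E - F" "p5 \<in> E - F" "p6 \<in> E - F" using p4 p5 p6 pE F by auto
    have X: "F \<squnion> a \<squnion> b = X" if "a \<in> X - F" "b \<in> X - F \<squnion> a" for a b using plane_span(3)[OF F(1,2) h(1) F(3) that] .
    have Y: "F \<squnion> a \<squnion> b = Y" if "a \<in> Y - F" "b \<in> Y - F \<squnion> a" for a b using plane_span(3)[OF F(1,2) h(2) F(4) that] .
    have Z: "F \<squnion> a \<squnion> b = Z" if "a \<in> Z - F" "b \<in> Z - F \<squnion> a" for a b using plane_span(3)[OF F(1,2) h(3) F(5) that] .
    have L: "F \<squnion> p4 \<subseteq> Z" "F \<squnion> p5 \<subseteq> Y" "F \<squnion> p6 \<subseteq> X" using adj_least hyp_flat h F p4 p5 p6 by auto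
    have Ls: "flat (F \<squnion> s)" "r (F \<squnion> s) + 2 = r E" "F \<squnion> s \<subseteq> E" "s \<in> F \<squnion> s" "F \<subseteq> F \<squnion> s" if "s \<in> E - F" for s
      using flat_cl adj_rank[OF F(1) that] F cl_ground adj_self that adj_superset[OF FE] by auto
    have H14eq: "?H14 = F \<squnion> p4 \<squnion> x1" using N adj_commute FE pE by auto
    have H25eq: "?H25 = F \<squnion> p5 \<squnion> x2" using N adj_commute FE pE by auto
    let ?H45 = "F \<squnion> p4 \<squnion> p5" and ?H46 = "F \<squnion> p4 \<squnion> p6" and ?H56 = "F \<squnion> p5 \<squnion> p6"
    have pd: "p5 \<in> E - F \<squnion> p4" "p6 \<in> E - F \<squnion> p4" "p6 \<in> E - F \<squnion> p5" "p4 \<in> E - X \<inter> Y" "p5 \<in> E - X \<inter> Z" "p6 \<in> E - Y \<inter> Z"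
      using p4 p5 p6 pE L by blast+
    have hyps: "hyp ?H14" "hyp ?H25" "hyp ?H36" "hyp ?H45" "hyp ?H46" "hyp ?H56"
      using hyp_adj[OF fl(1) c(4) pd(4)] hyp_adj[OF fl(2) c(5) pd(5)] hyp_adj[OF fl(3) c(6) pd(6)]
        hyp_adj[OF Ls(1,2)[OF nF(1)] pd(1)] hyp_adj[OF Ls(1,2)[OF nF(1)] pd(2)] hyp_adj[OF Ls(1,2)[OF nF(2)] pd(3)]
      by blast+
    have sup: "X \<inter> Y \<subseteq> ?H14" "X \<inter> Z \<subseteq> ?H25" "Y \<inter> Z \<subseteq> ?H36" "F \<squnion> p4 \<subseteq> ?H45" "F \<squnion> p4 \<subseteq> ?H46" "F \<squnion> p5 \<subseteq> ?H56"
      "p4 \<in> ?H14" "p5 \<in> ?H25" "p6 \<in> ?H36" "p5 \<in> ?H45" "p6 \<in> ?H46" "p6 \<in> ?H56"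
      using adj_superset[OF cl_ground] adj_superset[OF flat_ground[OF fl(1)]] adj_superset[OF flat_ground[OF fl(2)]]
        adj_superset[OF flat_ground[OF fl(3)]] adj_self pE by simp_all
    have F1: "F \<squnion> p4 \<subseteq> ?H14" "F \<squnion> p5 \<subseteq> ?H25" "F \<squnion> p6 \<subseteq> ?H36" "F \<squnion> p5 \<subseteq> ?H45" "F \<squnion> p6 \<subseteq> ?H46" "F \<squnion> p6 \<subseteq> ?H56"
    proof -
      have f: "F \<subseteq> ?H14" "F \<subseteq> ?H25" "F \<subseteq> ?H36" "F \<subseteq> ?H45" "F \<subseteq> ?H46" "F \<subseteq> ?H56"
        using subset_trans[OF _ sup(1), of F] subset_trans[OF _ sup(2), of F] subset_trans[OF _ sup(3), of F] F
          subset_trans[OF Ls(5)[OF nF(1)] sup(4)] subset_trans[OF Ls(5)[OF nF(1)] sup(5)] subset_trans[OF Ls(5)[OF nF(2)] sup(6)]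
        by simp_all
      show "F \<squnion> p4 \<subseteq> ?H14" "F \<squnion> p5 \<subseteq> ?H25" "F \<squnion> p6 \<subseteq> ?H36" "F \<squnion> p5 \<subseteq> ?H45" "F \<squnion> p6 \<subseteq> ?H46" "F \<squnion> p6 \<subseteq> ?H56"
        using f sup by (simp_all add: adj_least flat_cl)
    qed
    have in45: "p4 \<in> ?H45" "p4 \<in> ?H46" "p5 \<in> ?H56" "x1 \<in> ?H14" "x2 \<in> ?H25" "x3 \<in> ?H36"
      using sup x Ls(4)[OF nF(1)] Ls(4)[OF nF(2)] by auto
    have FH: "F \<subseteq> ?H14" "F \<subseteq> ?H25" "F \<subseteq> ?H36" "F \<subseteq> ?H45" "F \<subseteq> ?H46" "F \<subseteq> ?H56"
      using subset_trans[OF Ls(5)[OF nF(1)] F1(1)] subset_trans[OF Ls(5)[OF nF(2)] F1(2)] subset_trans[OF Ls(5)[OF nF(3)] F1(3)]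
        subset_trans[OF Ls(5)[OF nF(2)] F1(4)] subset_trans[OF Ls(5)[OF nF(3)] F1(5)] subset_trans[OF Ls(5)[OF nF(3)] F1(6)]
      by simp_all
    have eqX: "H = X" if "hyp H" "F \<subseteq> H" "a \<in> H" "b \<in> H" "a \<in> X - F" "b \<in> X - F \<squnion> a" for H a b
      using X[OF that(5,6)] plane_span(3)[OF F(1,2) that(1,2), of a b] that by auto
    have eqY: "H = Y" if "hyp H" "F \<subseteq> H" "a \<in> H" "b \<in> H" "a \<in> Y - F" "b \<in> Y - F \<squnion> a" for H a b
      using Y[OF that(5,6)] plane_span(3)[OF F(1,2) that(1,2), of a b] that by auto
    have eqZ: "H = Z" if "hyp H" "F \<subseteq> H" "a \<in> H" "b \<in> H" "a \<in> Z - F" "b \<in> Z - F \<squnion> a" for H a b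
      using Z[OF that(5,6)] plane_span(3)[OF F(1,2) that(1,2), of a b] that by auto
    have lineX: "\<not> (x1 \<in> H \<and> x2 \<in> H)" "\<not> (x1 \<in> H \<and> p6 \<in> H)" "\<not> (x2 \<in> H \<and> p6 \<in> H)"
      if "hyp H" "F \<subseteq> H" "H \<noteq> X" for H
      using eqX[OF that(1,2), of x1 x2] eqX[OF that(1,2), of x1 p6] eqX[OF that(1,2), of x2 p6] that(3) N x nx p6 by auto
    have lineY: "\<not> (x1 \<in> H \<and> x3 \<in> H)" "\<not> (x1 \<in> H \<and> p5 \<in> H)" "\<not> (x3 \<in> H \<and> p5 \<in> H)"
      if "hyp H" "F \<subseteq> H" "H \<noteq> Y" for H
      using eqY[OF that(1,2), of x1 x3] eqY[OF that(1,2), of x1 p5] eqY[OF that(1,2), of x3 p5] that(3) N x nx p5 by auto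
    have lineZ: "\<not> (x2 \<in> H \<and> x3 \<in> H)" "\<not> (x2 \<in> H \<and> p4 \<in> H)" "\<not> (x3 \<in> H \<and> p4 \<in> H)"
      if "hyp H" "F \<subseteq> H" "H \<noteq> Z" for H
      using eqZ[OF that(1,2), of x2 x3] eqZ[OF that(1,2), of x2 p4] eqZ[OF that(1,2), of x3 p4] that(3) N x nx p4 by auto
    have n14: "x2 \<notin> ?H14" "x3 \<notin> ?H14" "p5 \<notin> ?H14" "p6 \<notin> ?H14"
      using lineX[OF hyps(1) FH(1)] lineY[OF hyps(1) FH(1)] lineZ[OF hyps(1) FH(1)] in45 sup p4 nx by blast+
    have n25: "x1 \<notin> ?H25" "x3 \<notin> ?H25" "p4 \<notin> ?H25" "p6 \<notin> ?H25"
      using lineX[OF hyps(2) FH(2)] lineY[OF hyps(2) FH(2)] lineZ[OF hyps(2) FH(2)] in45 sup p5 nx by blast+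
    have n36: "x1 \<notin> ?H36" "x2 \<notin> ?H36" "p4 \<notin> ?H36" "p5 \<notin> ?H36"
      using lineX[OF hyps(3) FH(3)] lineY[OF hyps(3) FH(3)] lineZ[OF hyps(3) FH(3)] in45 sup p6 nx by blast+
    have nXYZ: "?H45 \<noteq> X" "?H45 \<noteq> Y" "?H45 \<noteq> Z" "?H46 \<noteq> X" "?H46 \<noteq> Y" "?H46 \<noteq> Z" "?H56 \<noteq> X" "?H56 \<noteq> Y" "?H56 \<noteq> Z"
      using sup in45 p4 p5 p6 by blast+
    have n45: "x1 \<notin> ?H45" "x2 \<notin> ?H45" "x3 \<notin> ?H45"
      using lineY[OF hyps(4) FH(4) nXYZ(2)] lineZ[OF hyps(4) FH(4) nXYZ(3)] in45 sup by blast+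
    have n46: "x1 \<notin> ?H46" "x2 \<notin> ?H46" "x3 \<notin> ?H46"
      using lineX[OF hyps(5) FH(5) nXYZ(4)] lineZ[OF hyps(5) FH(5) nXYZ(6)] in45 sup by blast+
    have n56: "x1 \<notin> ?H56" "x2 \<notin> ?H56" "x3 \<notin> ?H56"
      using lineX[OF hyps(6) FH(6) nXYZ(7)] lineY[OF hyps(6) FH(6) nXYZ(8)] in45 sup by blast+
    have nL: "F \<squnion> p4 \<notin> \<Gamma>" "F \<squnion> p5 \<notin> \<Gamma>" using good_not_cut L g by auto
    \<comment> \<open>Through \<open>p4\<close> there is already the line \<open>?H14\<close> in
      \<Gamma>. A second one would put the point \<open>p4\<close> into \<Gamma>, although it lies
      on the good line \<open>Z\<close>.\<close>
    have g45: "good ?H45"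
      using cut_adj[of "F \<squnion> p4" p5 x1, OF flat_cl] nL H14eq 4(1) n45 in45 pE hyps(4) by (auto simp: good_def)
    have g46: "good ?H46"
      using cut_adj[of "F \<squnion> p4" p6 x1, OF flat_cl] nL H14eq 4(1) n46 in45 pE hyps(5) by (auto simp: good_def)
    have g56: "good ?H56"
      using cut_adj[of "F \<squnion> p5" p6 x2, OF flat_cl] nL H25eq 4(2) n56 in45 pE hyps(6) by (auto simp: good_def)
    show ?thesis
    proof (cases "p6 \<in> ?H45")
      case True
      define ee where "ee = (\<lambda>i::nat. if i = 1 then x1 else if i = 2 then x2 else if i = 3 then x3 else if i = 4 then p4 else if i = 5 then p5 else p6)"
      \<comment> \<open>The default value \<open>X\<close> is the intended value at
        \<open>{1,2,6}\<close>.\<close>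
      define hh where "hh = (\<lambda>_::nat set. X)({1,3,5} := Y, {2,3,4} := Z, {4,5,6} := ?H45, {1,4} := ?H14, {2,5} := ?H25, {3,6} := ?H36)"
      have ne6: "{1,3,5} \<noteq> {2,3,4::nat}" "{1,3,5} \<noteq> {4,5,6::nat}" "{1,3,5} \<noteq> {1,4::nat}" "{1,3,5} \<noteq> {2,5::nat}" "{1,3,5} \<noteq> {3,6::nat}"
        "{2,3,4} \<noteq> {4,5,6::nat}" "{2,3,4} \<noteq> {1,4::nat}" "{2,3,4} \<noteq> {2,5::nat}" "{2,3,4} \<noteq> {3,6::nat}"
        "{4,5,6} \<noteq> {1,4::nat}" "{4,5,6} \<noteq> {2,5::nat}" "{4,5,6} \<noteq> {3,6::nat}"
        "{1,4} \<noteq> {2,5::nat}" "{1,4} \<noteq> {3,6::nat}" "{2,5} \<noteq> {3,6::nat}"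
        "{1,2,6} \<noteq> {1,3,5::nat}" "{1,2,6} \<noteq> {2,3,4::nat}" "{1,2,6} \<noteq> {4,5,6::nat}" "{1,2,6} \<noteq> {1,4::nat}" "{1,2,6} \<noteq> {2,5::nat}" "{1,2,6} \<noteq> {3,6::nat}"
        by (simp_all add: set_eq_subset)
      have hv: "hh {1,2,6} = X" "hh {1,3,5} = Y" "hh {2,3,4} = Z" "hh {4,5,6} = ?H45" "hh {1,4} = ?H14" "hh {2,5} = ?H25" "hh {3,6} = ?H36"
        unfolding hh_def fun_upd_apply by (simp_all only: ne6 ne6[symmetric] if_False if_True refl not_False_eq_True)
      have ev: "ee 1 = x1" "ee 2 = x2" "ee 3 = x3" "ee 4 = p4" "ee 5 = p5" "ee 6 = p6" by (simp_all add: ee_def)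
      have "elem (hh {1,2,6}) [hh {1,3,5}, hh {2,3,4}, hh {1,2,6}]"
      proof (rule elem_MK4[OF F(1,2)])
        show "ee ` {1..6} \<subseteq> E - F" unfolding interval_nat using pE nF x ev by simp
        show "hyp (hh H) \<and> F \<subseteq> hh H" if "H \<in> MK4_lines \<union> MK4_pairs" for H
          using that unfolding MK4_lines_def MK4_pairs_def
          by (elim UnE insertE emptyE) (simp_all only: hv hyps h FH F simp_thms)
        show "hh H \<notin> \<Gamma>" if "H \<in> MK4_lines" for H
          using that g g45 unfolding MK4_lines_def good_def by (elim insertE emptyE) (simp_all only: hv simp_thms)
        show "hh H \<in> \<Gamma>" if "H \<in> MK4_pairs" for H
          using that 4 unfolding MK4_pairs_def by (elim insertE emptyE) (simp_all only: hv simp_thms)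
        show "ee i \<in> hh H \<longleftrightarrow> i \<in> H" if "H \<in> MK4_lines \<union> MK4_pairs" "i \<in> {1..6}" for H i
        proof -
          have "H = {1,2,6} \<or> H = {1,3,5} \<or> H = {2,3,4} \<or> H = {4,5,6} \<or> H = {1,4} \<or> H = {2,5} \<or> H = {3,6}"
            using that(1) unfolding MK4_lines_def MK4_pairs_def by (simp only: Un_iff insert_iff empty_iff simp_thms disj_ac)
          moreover have "i = 1 \<or> i = 2 \<or> i = 3 \<or> i = 4 \<or> i = 5 \<or> i = 6" using that(2) unfolding interval_nat by simp
          ultimately show ?thesis
            apply (elim disjE)
            apply (simp_all only: hv ev)
            using x nx p4 p5 p6 n14 n25 n36 n45 in45 sup True
            apply simp_all
            done
        qed
      qed
      then have "elem X [Y, Z, X]" unfolding hv .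
      then show ?thesis using tri_loopI elem_hm[of X "[Y, Z]"] g e edge_sym[OF e(2)] by simp
    next
      case False
      have p5_46: "p5 \<notin> ?H46"
      proof
        assume a: "p5 \<in> ?H46"
        have "?H46 = ?H45"
          using hyp_adj_eq[OF Ls(1,2)[OF nF(1)] _ hyps(5) sup(5), of p5] a p5 L(1) by auto
        then show False using False sup by auto
      qed
      have p4_56: "p4 \<notin> ?H56"
      proof
        assume a: "p4 \<in> ?H56"
        have "?H56 = F \<squnion> p5 \<squnion> p4"
          using hyp_adj_eq[OF Ls(1,2)[OF nF(2)] _ hyps(6) sup(6), of p4] a p4 L(2) by auto
        also have "\<dots> = ?H45" using adj_commute FE pE by auto
        finally show False using False sup by auto
      qed
      have neH: "?H45 \<noteq> ?H46" "?H45 \<noteq> ?H56" "?H46 \<noteq> ?H56" using False sup(9-12) p5_46 in45(3) by metis+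
      have neq: "?H45 \<noteq> ?H25" "Y \<noteq> ?H25" "?H45 \<noteq> ?H14" "Z \<noteq> ?H14" "?H46 \<noteq> ?H14" "?H46 \<noteq> ?H36" "X \<noteq> ?H36"
        "?H56 \<noteq> ?H36" "?H56 \<noteq> ?H25"
        using n45 n46 n56 n14(1) n25(1) n36(1) in45(4-6) x by (metis DiffD1 IntD1 IntD2)+
      have e1: "edge Y ?H45" by (rule edgeI[OF Ls(1,2)[OF nF(2)] h(2) hyps(4,2) L(2) F1(4,2)]) (use nXYZ neq in simp_all)
      have e2: "edge Z ?H45" by (rule edgeI[OF Ls(1,2)[OF nF(1)] h(3) hyps(4,1) L(1) sup(4) F1(1)]) (use nXYZ neq in simp_all)
      have e3: "edge Z ?H46" by (rule edgeI[OF Ls(1,2)[OF nF(1)] h(3) hyps(5,1) L(1) sup(5) F1(1)]) (use nXYZ neq in simp_all)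
      have e4: "edge X ?H46" by (rule edgeI[OF Ls(1,2)[OF nF(3)] h(1) hyps(5,3) L(3) F1(5,3)]) (use nXYZ neq in simp_all)
      have e5: "edge X ?H56" by (rule edgeI[OF Ls(1,2)[OF nF(3)] h(1) hyps(6,3) L(3) F1(6,3)]) (use nXYZ neq in simp_all)
      have e6: "edge Y ?H56" by (rule edgeI[OF Ls(1,2)[OF nF(2)] h(2) hyps(6,2) L(2) sup(6) F1(2)]) (use nXYZ neq in simp_all)
      \<comment> \<open>Octahedron with opposite vertices \<open>X\<close> and \<open>?H45\<close>,
        \<open>Y\<close> and \<open>?H46\<close>, \<open>Z\<close> and \<open>?H56\<close>. Four
        faces contract because a point lies off their three lines, three because the lines are
        concurrent at \<open>p4\<close>, \<open>p5\<close> or \<open>p6\<close>; the walk along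
        these seven faces contracts the eighth, \<open>X\<close>, \<open>Y\<close>,
        \<open>Z\<close>.\<close>
      have t1: "tri Y Z ?H45"
        by (rule tri_off[OF F(1,2,4,5) FH(4) g(2,3) g45 e(3) e1 e2 _ pE(3)]) (use x n45 p6 False in auto)
      have t2: "tri X Z ?H46"
        by (rule tri_off[OF F(1,2,3,5) FH(5) g(1,3) g46 e(2) e4 e3 _ pE(2)]) (use x n46 p5 p5_46 in auto)
      have t3: "tri X Y ?H56"
        by (rule tri_off[OF F(1,2,3,4) FH(6) g(1,2) g56 e(1) e5 e6 _ pE(1)]) (use x n56 p4 p4_56 in auto)
      have l1: "tri ?H56 Y ?H45" by (rule tri_line[OF Ls(1,2)[OF nF(2)] g56 g(2) g45 sup(6) L(2) F1(4)]) (use nXYZ neH in simp_all)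
      have l2: "tri ?H46 ?H45 Z" by (rule tri_line[OF Ls(1,2)[OF nF(1)] g46 g45 g(3) sup(5,4) L(1)]) (use nXYZ neH in simp_all)
      have l3: "tri X ?H56 ?H46" by (rule tri_line[OF Ls(1,2)[OF nF(3)] g(1) g56 g46 L(3) F1(6,5)]) (use nXYZ neH in simp_all)
      have t4: "tri ?H56 ?H46 ?H45"
      proof (rule tri_off[OF F(1,2) FH(6,5,4) g56 g46 g45 _ _ _ _ pE(4)])
        show "edge ?H56 ?H46" "edge ?H56 ?H45" "edge ?H46 ?H45" using tri_walk l1 l2 l3 by blast+
        show "?H56 \<inter> ?H46 \<noteq> ?H56 \<inter> ?H45" using in45 sup p5_46 by auto
      qed (use n45 n46 n56 in auto)
      have es: "edge ?H56 Y" "edge ?H45 Z" "edge ?H56 ?H46" "edge ?H46 ?H45" "edge ?H56 ?H45" "edge ?H46 Z" "edge Y ?H45"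
        using e1 e2 e3 e4 e5 e6 edge_sym tri_walk[OF l1] tri_walk[OF l2] tri_walk[OF l3] by blast+
      have "hm X [Y, Z] [?H56, Y, Z]"
        using tri_ins[OF tri_swap(2)[OF t3], of X "[]" "[Z]"] g e by auto
      also have "hm X \<dots> [?H56, Y, ?H45, Z]"
        using tri_ins[OF tri_swap(2)[OF t1], of X "[?H56, Y]" "[]"] g g56 e5 es by auto
      also have "hm X \<dots> [?H56, ?H45, Z]"
        using tri_del[OF l1, of X "[?H56]" "[Z]"] g g56 g45 e5 es by auto
      also have "hm X \<dots> [?H56, ?H46, ?H45, Z]"
        using tri_ins[OF t4, of X "[?H56]" "[Z]"] g g56 g45 e5 es by auto
      also have "hm X \<dots> [?H56, ?H46, Z]"
        using tri_del[OF l2, of X "[?H56, ?H46]" "[]"] g g56 g46 e5 es by auto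
      also have "hm X \<dots> [?H46, Z]"
        using tri_del[OF l3, of X "[]" "[Z]"] g g46 es by auto
      also have "hm X \<dots> [Z]"
        using tri_swap(2)[OF t2] by (simp add: tri_def)
      finally (hm_trans) show ?thesis by (simp add: tri_def)
    qed
  qed
qed


text \<open>If one of the diagonals \<open>x1\<close>, \<open>x4\<close> or \<open>x2\<close>,
  \<open>x3\<close> spans a good line, that line is adjacent to all four sides and cuts the
  quadrangle into four triangles. If both diagonals are in \<Gamma>, the quadrangle is of type
  7.\<close>

lemma U34_square:
  assumes F: "flat F" "r F + 3 = r E" "{x1,x2,x3,x4} \<subseteq> E"
    and sp: "r (F \<union> {x1,x2,x3}) = r E" "r (F \<union> {x1,x2,x4}) = r E" "r (F \<union> {x1,x3,x4}) = r E" "r (F \<union> {x2,x3,x4}) = r E"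
    and g: "good (cl (F \<union> {x1,x2}))" "good (cl (F \<union> {x2,x4}))" "good (cl (F \<union> {x3,x4}))" "good (cl (F \<union> {x1,x3}))"
    and e: "edge (cl (F \<union> {x1,x2})) (cl (F \<union> {x2,x4}))" "edge (cl (F \<union> {x2,x4})) (cl (F \<union> {x3,x4}))"
      "edge (cl (F \<union> {x3,x4})) (cl (F \<union> {x1,x3}))" "edge (cl (F \<union> {x1,x3})) (cl (F \<union> {x1,x2}))"
  shows "hm (cl (F \<union> {x1,x2})) [cl (F \<union> {x2,x4}), cl (F \<union> {x3,x4})] [cl (F \<union> {x1,x3}), cl (F \<union> {x3,x4})]"
proof -
  have diag: "hm (cl (F \<union> {y1,y2})) [cl (F \<union> {y2,y4}), cl (F \<union> {y3,y4})] [cl (F \<union> {y1,y3}), cl (F \<union> {y3,y4})]"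
    if yE: "{y1,y2,y3,y4} \<subseteq> E"
    and sp: "r (F \<union> {y1,y2,y3}) = r E" "r (F \<union> {y1,y2,y4}) = r E" "r (F \<union> {y1,y3,y4}) = r E" "r (F \<union> {y2,y3,y4}) = r E"
    and g: "good (cl (F \<union> {y1,y2}))" "good (cl (F \<union> {y2,y4}))" "good (cl (F \<union> {y3,y4}))" "good (cl (F \<union> {y1,y3}))"
    and e: "edge (cl (F \<union> {y1,y2})) (cl (F \<union> {y2,y4}))" "edge (cl (F \<union> {y2,y4})) (cl (F \<union> {y3,y4}))"
      "edge (cl (F \<union> {y3,y4})) (cl (F \<union> {y1,y3}))" "edge (cl (F \<union> {y1,y3})) (cl (F \<union> {y1,y2}))"
    and g14: "cl (F \<union> {y1,y4}) \<notin> \<Gamma>" for y1 y2 y3 y4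
  proof -
    let ?A = "cl (F \<union> {y1,y2})" and ?B = "cl (F \<union> {y2,y4})" and ?C = "cl (F \<union> {y3,y4})" and ?D = "cl (F \<union> {y1,y3})"
      and ?H = "cl (F \<union> {y1,y4})"
    have FE: "F \<subseteq> E" using F flat_ground by auto
    have ge2: "r (F \<union> {s, t}) = r F + 2 \<and> s \<notin> F" if "r (F \<union> {s, t, u}) = r E" for s t u
    proof -
      have "r (insert u (F \<union> {s, t})) \<le> r (F \<union> {s, t}) + 1" "r (insert t (F \<union> {s})) \<le> r (F \<union> {s}) + 1" "r (insert s F) \<le> r F + 1"
        by (rule rank_insert_le)+
      then show ?thesis using that F(2) by (auto simp: insert_commute insert_absorb)
    qed
    have sp': "r (F \<union> {y1,y4,y2}) = r E" "r (F \<union> {y1,y4,y3}) = r E" "r (F \<union> {y4,y1,y2}) = r E" using sp by (simp_all add: insert_commute)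
    have yF: "y1 \<in> E - F" "y4 \<in> E - F" using ge2[OF sp(1)] ge2[OF sp'(3)] yE by auto
    have H: "hyp ?H" using ge2[OF sp'(1)] rank_cl[of "F \<union> {y1, y4}"] F flat_cl by (auto simp: hyp_def)
    have gH: "good ?H" using H g14 by (simp add: good_def)
    have inH: "F \<subseteq> ?H" "y1 \<in> ?H" "y4 \<in> ?H" using cl_superset FE yE by auto
    have inA: "F \<subseteq> ?A" "y1 \<in> ?A" "y2 \<in> ?A" "F \<subseteq> ?B" "y2 \<in> ?B" "y4 \<in> ?B" "F \<subseteq> ?C" "y3 \<in> ?C" "y4 \<in> ?C" "F \<subseteq> ?D" "y1 \<in> ?D" "y3 \<in> ?D"
      using cl_superset FE yE by auto
    have notin: "u \<notin> cl (F \<union> {s, t})" if "r (F \<union> {s, t, u}) = r E" for s t u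
    proof
      assume "u \<in> cl (F \<union> {s, t})"
      then have "r (F \<union> {s, t, u}) = r (F \<union> {s, t})" by (simp add: cl_iff insert_commute)
      then show False using ge2[OF that] that F by simp
    qed
    have nH: "y2 \<notin> ?H" "y3 \<notin> ?H" using notin sp' by auto
    let ?L1 = "F \<squnion> y1" and ?L4 = "F \<squnion> y4"
    have L: "flat ?L1" "r ?L1 + 2 = r E" "flat ?L4" "r ?L4 + 2 = r E"
      using flat_cl adj_rank[OF F(1) yF(1)] adj_rank[OF F(1) yF(2)] F by auto
    have sub: "?L1 \<subseteq> ?A" "?L1 \<subseteq> ?D" "?L1 \<subseteq> ?H" "?L4 \<subseteq> ?B" "?L4 \<subseteq> ?C" "?L4 \<subseteq> ?H"
      by (rule cl_mono, blast)+
    have ne: "?A \<noteq> ?D" "?B \<noteq> ?C" using e by (auto simp: edge_def)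
    have ne': "?A \<noteq> ?H" "?D \<noteq> ?H" "?B \<noteq> ?H" "?C \<noteq> ?H" using nH inA by auto
    have t1: "tri ?A ?H ?D" by (rule tri_line[OF L(1,2) g(1) gH g(4) sub(1,3,2)]) (use ne ne' in auto)
    have t2: "tri ?B ?H ?C" by (rule tri_line[OF L(3,4) g(2) gH g(3) sub(4,6,5)]) (use ne ne' in auto)
    have es: "edge ?A ?H" "edge ?H ?D" "edge ?B ?H" "edge ?H ?C" using tri_walk t1 t2 by blast+
    have t3: "tri ?A ?H ?B" by (rule tri_plane[OF F(1,2) inA(1) inH(1) inA(4) g(1) gH g(2) es(1) e(1) edge_sym[OF es(3)]])
    have t4: "tri ?H ?D ?C" by (rule tri_plane[OF F(1,2) inH(1) inA(10,7) gH g(4,3) es(2,4) edge_sym[OF e(3)]])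
    have "hm ?A [?B, ?C] [?H, ?B, ?C]" using tri_ins[OF t3, of ?A "[]" "[?C]"] g e by simp
    also have "hm ?A \<dots> [?H, ?C]" using tri_del[OF tri_swap(1)[OF t2], of ?A "[?H]" "[]"] g gH es by simp
    also have "hm ?A \<dots> [?H, ?D, ?C]" using tri_ins[OF t4, of ?A "[?H]" "[]"] g gH es by simp
    also have "hm ?A \<dots> [?D, ?C]" using tri_del[OF t1, of ?A "[]" "[?C]"] g edge_sym[OF e(3)] by simp
    finally show ?thesis .
  qed
  show ?thesis
  proof (cases "cl (F \<union> {x1,x4}) \<notin> \<Gamma>")
    case True
    then show ?thesis using diag[of x1 x2 x3 x4] F sp g e by blast
  next
    case b14: False
    show ?thesis
    proof (cases "cl (F \<union> {x2,x3}) \<notin> \<Gamma>")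
      case True
      \<comment> \<open>The second diagonal becomes the first by exchanging \<open>x1\<close> with
        \<open>x2\<close> and \<open>x3\<close> with \<open>x4\<close>.\<close>
      have c: "{x2,x1} = {x1,x2}" "{x4,x3} = {x3,x4}" "{x1,x4,x3} = {x1,x3,x4}" "{x2,x4,x3} = {x2,x3,x4}" "{x2,x1,x4} = {x1,x2,x4}"
        "{x2,x1,x3} = {x1,x2,x3}" by auto
      have "{x2,x1,x4,x3} \<subseteq> E" using F(3) by blast
      note diag[of x2 x1 x4 x3, unfolded c, OF this[unfolded c] sp(2,1,4,3) g(1,4,3,2) edge_sym[OF e(4)] edge_sym[OF e(3)]
          edge_sym[OF e(2)] edge_sym[OF e(1)] True]
      then show ?thesis by (rule hm_sym)
    next
      case False
      let ?A = "cl (F \<union> {x1,x2})" and ?B = "cl (F \<union> {x2,x4})" and ?C = "cl (F \<union> {x3,x4})" and ?D = "cl (F \<union> {x1,x3})"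
      have "elem ?A ([?B, ?C, ?D] @ [?A])"
        using elem_U34(4)[OF F sp] g b14 False by (simp add: good_def)
      then have "hm ?A [?B, ?C, ?D, ?A] []" using elem_hm[of ?A "[?B, ?C, ?D]"] g e by simp
      then show ?thesis using hm_loopI[of ?A "[?B, ?C]" "[?D, ?C]"] g e edge_sym by simp
    qed
  qed
qed

section \<open>Homotopy and decomposition\<close>

definition deforms where
  "deforms p q \<longleftrightarrow> (\<exists>t\<in>{1..9}. \<exists>\<beta>. elementary_tutte_path M \<Gamma> t \<beta> \<and> deformation M \<Gamma> \<beta> p q)"

lemma tutte_path_walk: "closed_tutte_path M \<Gamma> (X # ps) \<longleftrightarrow> walk {} X ps \<and> fin X ps = X"
proof -
  have "tutte_path M (X # ps) \<and> set (X # ps) \<inter> \<Gamma> = {} \<longleftrightarrow> walk {} X ps"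
  proof (induction ps arbitrary: X)
    case Nil
    show ?case by (auto simp: tutte_path_def good_def hyp_iff)
  next
    case (Cons Y ps)
    have "tutte_path M (X # Y # ps) \<and> set (X # Y # ps) \<inter> \<Gamma> = {} \<longleftrightarrow>
      good X \<and> edge X Y \<and> (tutte_path M (Y # ps) \<and> set (Y # ps) \<inter> \<Gamma> = {})"
      unfolding tutte_path_def edge_iff good_def by (auto simp: hyp_iff)
    then show ?case using Cons.IH[of Y] by simp
  qed
  then show ?thesis unfolding closed_tutte_path_def fin_last by auto
qed

lemma deforms_insert:
  assumes "walk {} X (ps @ qs)" "fin X (ps @ qs) = X" "fin X ps = H" "elem H (Gs @ [H])" "walk {} H (Gs @ [H])"
    and "qs = [] \<longrightarrow> ps = []"
  shows "deforms (X # ps @ qs) (X # ps @ (Gs @ [H]) @ qs)"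
proof -
  obtain t where t: "t \<in> {1..9}" "elementary_tutte_path M \<Gamma> t (H # Gs @ [H])" using assms by (auto simp: elem_def)
  let ?xs = "butlast (X # ps)"
  have eq: "X # ps = ?xs @ [H]" using assms(3) append_butlast_last_id[of "X # ps"] by (simp add: fin_last)
  have "inserts M \<Gamma> (H # Gs @ [H]) (X # ps @ qs) (X # ps @ (Gs @ [H]) @ qs)"
    unfolding inserts_def
  proof (intro conjI exI)
    show "closed_tutte_path M \<Gamma> (X # ps @ qs)" "closed_tutte_path M \<Gamma> (H # Gs @ [H])"
      using assms by (auto simp: tutte_path_walk)
    show "qs = [] \<longrightarrow> ?xs = []" using assms by auto
    show "X # ps @ qs = ?xs @ [H] @ qs" using eq by (metis append.assoc append_Cons)
    show "H # Gs @ [H] = [H] @ Gs @ [H]" by simp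
    show "X # ps @ (Gs @ [H]) @ qs = ?xs @ [H] @ Gs @ [H] @ qs" using eq by (metis append.assoc append_Cons)
  qed
  then show ?thesis using t unfolding deforms_def deformation_def by blast
qed

lemma deforms_sym: "deforms\<^sup>*\<^sup>* p q \<Longrightarrow> deforms\<^sup>*\<^sup>* q p"
proof (induction rule: rtranclp_induct)
  case (step q s)
  then have "deforms s q" by (auto simp: deforms_def deformation_def)
  then show ?case using step by (meson converse_rtranclp_into_rtranclp)
qed auto

text \<open>The nonempty continuation \<open>zs\<close> keeps every inserted loop away from the closing term.\<close>

lemma hm_deforms:
  "hm X p q \<Longrightarrow> zs \<noteq> [] \<Longrightarrow> walk {} (fin X p) zs \<Longrightarrow> fin (fin X p) zs = X \<Longrightarrow>
    deforms\<^sup>*\<^sup>* (X # p @ zs) (X # q @ zs)"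
proof (induction rule: hm.induct)
  case (hm_sym X ps qs)
  then show ?case using hm_walk deforms_sym by metis
next
  case (hm_trans X ps qs us)
  then have "fin X ps = fin X qs" using hm_walk by blast
  then show ?case using hm_trans by (metis rtranclp_trans)
next
  case (hm_elem H Gs X ps qs)
  then have "deforms (X # ps @ qs @ zs) (X # ps @ (Gs @ [H]) @ qs @ zs)"
    by (intro deforms_insert) auto
  then show ?case by auto
qed auto

text \<open>A homotopy may insert loops at the closing term, which deformations do not allow, so it
  is carried out in front of a detour \<open>[J, X]\<close> through the last term \<open>J\<close>
  before the closing one. The detour enters as the loop \<open>X\<close>, \<open>J\<close>,
  \<open>X\<close> on the one-term path and leaves as the loop \<open>J\<close>, \<open>X\<close>,
  \<open>J\<close> at \<open>J\<close>.\<close>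

lemma hm_decomposes:
  assumes "hm X p []"
  shows "decomposes_into_elementary M \<Gamma> {1..9} (X # p)"
proof -
  have w: "walk {} X p" "fin X p = X" "good X" using hm_walk[OF assms] by auto
  have "deforms\<^sup>*\<^sup>* [X] (X # p)"
  proof (cases p rule: rev_cases)
    case (snoc p' X')
    then have p: "p = p' @ [X]" using w by simp
    define J where "J = fin X p'"
    have J: "good J" "edge J X" "edge X J" using w p edge_sym walk_start[of "{}" J "[X]"] by (auto simp: J_def)
    have el: "elem X [J, X]" "elem J [X, J]"
    proof -
      have *: "elem A [B, A]" if "good A" "good B" "edge A B" for A B
      proof -
        have e: "hyp A" "hyp B" "A \<noteq> B" "conn (A \<inter> B)" "r (A \<inter> B) + 2 = r E" using that by (auto simp: edge_def)
        let ?N = "A \<inter> B"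
        have N: "flat ?N" using e conn_flat by auto
        obtain z where z: "z \<in> E" "z \<notin> A" "z \<notin> B" using conn_third[OF e(4,5,1,2)] by auto
        have Z: "hyp (?N \<squnion> z)" "?N \<subseteq> ?N \<squnion> z" "z \<in> ?N \<squnion> z"
          using hyp_adj[OF N e(5)] adj_superset adj_self flat_ground[OF N] z by auto
        show ?thesis by (rule elem_line(1)[OF N e(5) that(1,2) Z(1)]) (use Z z e in auto)
      qed
      show "elem X [J, X]" "elem J [X, J]" using * J w by auto
    qed
    have "deforms (X # [] @ []) (X # [] @ ([J] @ [X]) @ [])"
      by (rule deforms_insert) (use w J el in auto)
    then have "deforms\<^sup>*\<^sup>* [X] [X, J, X]" by simp
    also have "deforms\<^sup>*\<^sup>* (X # [] @ [J, X]) (X # p @ [J, X])"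
      using deforms_sym[OF hm_deforms[OF assms, of "[J, X]"]] deforms_sym w J by simp
    then have "deforms\<^sup>*\<^sup>* [X, J, X] (X # p @ [J, X])" by simp
    also have "deforms (X # p' @ [X]) (X # p' @ ([X] @ [J]) @ [X])"
      by (rule deforms_insert) (use w p J el in \<open>auto simp: J_def\<close>)
    then have "deforms (X # p) (X # p @ [J, X])" using p by simp
    then have "deforms\<^sup>*\<^sup>* (X # p @ [J, X]) (X # p)" using deforms_sym by blast
    finally show ?thesis .
  qed auto
  moreover have "deforms = (\<lambda>p q. \<exists>t\<in>{1..9}. \<exists>\<beta>. elementary_tutte_path M \<Gamma> t \<beta> \<and> deformation M \<Gamma> \<beta> p q)"
    by (intro ext) (simp add: deforms_def)
  moreover have "closed_tutte_path M \<Gamma> [X]" using w by (simp add: tutte_path_walk)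
  ultimately show ?thesis unfolding decomposes_into_elementary_def by auto
qed

end

section \<open>Decomposable joins of two covers\<close>

text \<open>
  The combinatorial core of the corank 4 case.  There \<open>sa\<close> and \<open>sb\<close> are parallelism over \<open>P\<close> and \<open>Q\<close>, and
  \<open>\<alpha> p q\<close>, \<open>\<beta> p q\<close> say that the hyperplane spanned by \<open>p\<close>, \<open>q\<close> over \<open>P\<close>, respectively \<open>Q\<close>, is in \<open>\<Gamma>\<close>.
  The conclusion is the configuration of type 9.
\<close>

lemma two_matchings:
  fixes sa sb :: "'a \<Rightarrow> 'a \<Rightarrow> bool"
  assumes eq: "\<And>x. sa x x" "\<And>x y. sa x y \<Longrightarrow> sa y x" "\<And>x y z. sa x y \<Longrightarrow> sa y z \<Longrightarrow> sa x z"
      "\<And>x. sb x x" "\<And>x y. sb x y \<Longrightarrow> sb y x" "\<And>x y z. sb x y \<Longrightarrow> sb y z \<Longrightarrow> sb x z"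
    and ne: "U \<noteq> {}" "V \<noteq> {}"
    and many: "\<And>x. x \<in> U \<Longrightarrow> \<exists>y\<in>U. \<not> sa x y" "\<And>x. x \<in> U \<Longrightarrow> \<exists>y\<in>U. \<not> sb x y"
      "\<And>x. x \<in> V \<Longrightarrow> \<exists>y\<in>V. \<not> sa x y" "\<And>x. x \<in> V \<Longrightarrow> \<exists>y\<in>V. \<not> sb x y"
    and cong: "\<And>p p' q. p \<in> U \<Longrightarrow> p' \<in> U \<Longrightarrow> q \<in> V \<Longrightarrow> sa p p' \<Longrightarrow> \<alpha> p q = \<alpha> p' q"
      "\<And>p q q'. p \<in> U \<Longrightarrow> q \<in> V \<Longrightarrow> q' \<in> V \<Longrightarrow> sa q q' \<Longrightarrow> \<alpha> p q = \<alpha> p q'"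
      "\<And>p p' q. p \<in> U \<Longrightarrow> p' \<in> U \<Longrightarrow> q \<in> V \<Longrightarrow> sb p p' \<Longrightarrow> \<beta> p q = \<beta> p' q"
      "\<And>p q q'. p \<in> U \<Longrightarrow> q \<in> V \<Longrightarrow> q' \<in> V \<Longrightarrow> sb q q' \<Longrightarrow> \<beta> p q = \<beta> p q'"
    and match: "\<And>p q q'. p \<in> U \<Longrightarrow> q \<in> V \<Longrightarrow> q' \<in> V \<Longrightarrow> \<alpha> p q \<Longrightarrow> \<alpha> p q' \<Longrightarrow> sa q q'"
      "\<And>p p' q. p \<in> U \<Longrightarrow> p' \<in> U \<Longrightarrow> q \<in> V \<Longrightarrow> \<alpha> p q \<Longrightarrow> \<alpha> p' q \<Longrightarrow> sa p p'"
      "\<And>p q q'. p \<in> U \<Longrightarrow> q \<in> V \<Longrightarrow> q' \<in> V \<Longrightarrow> \<beta> p q \<Longrightarrow> \<beta> p q' \<Longrightarrow> sb q q'"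
      "\<And>p p' q. p \<in> U \<Longrightarrow> p' \<in> U \<Longrightarrow> q \<in> V \<Longrightarrow> \<beta> p q \<Longrightarrow> \<beta> p' q \<Longrightarrow> sb p p'"
    and C: "\<And>p q x. p \<in> U \<Longrightarrow> q \<in> V \<Longrightarrow> \<not> C p q \<Longrightarrow> x \<in> U \<Longrightarrow> sa x p \<or> sb x p"
      "\<And>p q x. p \<in> U \<Longrightarrow> q \<in> V \<Longrightarrow> \<not> C p q \<Longrightarrow> x \<in> V \<Longrightarrow> sa x q \<or> sb x q"
    and no: "\<And>p q. p \<in> U \<Longrightarrow> q \<in> V \<Longrightarrow> C p q \<Longrightarrow> \<alpha> p q \<or> \<beta> p q"
  shows "\<exists>u\<in>U. \<exists>v\<in>U. \<exists>s\<in>V. \<exists>t\<in>V. \<alpha> u s \<and> \<alpha> v t \<and> \<beta> u t \<and> \<beta> v s \<and>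
    \<not> sa u v \<and> \<not> sb u v \<and> \<not> sa s t \<and> \<not> sb s t \<and>
    (\<forall>x\<in>U. sa x u \<and> sb x u \<or> sa x v \<and> sb x v) \<and> (\<forall>y\<in>V. sa y s \<and> sb y s \<or> sa y t \<and> sb y t)"
proof -
  have C_all: "C p q" if pq: "p \<in> U" "q \<in> V" for p q
  proof (rule ccontr)
    assume nC: "\<not> C p q"
    note c1 = C(1)[OF pq nC] and c2 = C(2)[OF pq nC]
    \<comment> \<open>The two classes of \<open>p\<close> cover \<open>U\<close> but neither does so
      alone. Hence some element is parallel to \<open>p\<close> only in the sense of
      \<open>sb\<close> and another only in the sense of \<open>sa\<close>; the same holds for
      \<open>q\<close> in \<open>V\<close>.\<close>
    obtain pb where pb: "pb \<in> U" "\<not> sa p pb" "sb pb p" using many(1)[OF pq(1)] c1 eq by blast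
    obtain pa where pa: "pa \<in> U" "\<not> sb p pa" "sa pa p" using many(2)[OF pq(1)] c1 eq by blast
    obtain qb where qb: "qb \<in> V" "\<not> sa q qb" "sb qb q" using many(3)[OF pq(2)] c2 eq by blast
    obtain qa where qa: "qa \<in> V" "\<not> sb q qa" "sa qa q" using many(4)[OF pq(2)] c2 eq by blast
    have npab: "\<not> sa pa pb" "\<not> sb pa pb" "\<not> sa qa qb" "\<not> sb qa qb" using pa pb qa qb eq by blast+
    have C1: "C pa y" "C pb y" if "y \<in> V" for y
    proof -
      show "C pa y" using C(1)[OF pa(1) that, of pb] npab eq pb(1) by blast
      show "C pb y" using C(1)[OF pb(1) that, of pa] npab eq pa(1) by blast
    qed
    have 1: "\<alpha> p q"
    proof (rule ccontr)
      assume n: "\<not> \<alpha> p q"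
      have "\<beta> pa q" using no[OF pa(1) pq(2) C1(1)[OF pq(2)]] cong(1)[OF pa(1) pq(1) pq(2) pa(3)] n by blast
      moreover have "\<beta> pa qa" using no[OF pa(1) qa(1) C1(1)[OF qa(1)]] cong(1)[OF pa(1) pq(1) qa(1) pa(3)] cong(2)[OF pq(1) qa(1) pq(2) qa(3)] n by blast
      ultimately have "sb q qa" using match(3)[OF pa(1) pq(2) qa(1)] by blast
      then show False using qa by blast
    qed
    have 2: "\<beta> p q"
    proof (rule ccontr)
      assume n: "\<not> \<beta> p q"
      have "\<alpha> pb q" using no[OF pb(1) pq(2) C1(2)[OF pq(2)]] cong(3)[OF pb(1) pq(1) pq(2) pb(3)] n by blast
      moreover have "\<alpha> pb qb" using no[OF pb(1) qb(1) C1(2)[OF qb(1)]] cong(3)[OF pb(1) pq(1) qb(1) pb(3)] cong(4)[OF pq(1) qb(1) pq(2) qb(3)] n by blast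
      ultimately have "sa q qb" using match(1)[OF pb(1) pq(2) qb(1)] by blast
      then show False using qb by blast
    qed
    \<comment> \<open>With both relations holding at \<open>p\<close>, \<open>q\<close>, the
      matching property excludes both at \<open>pa\<close>, \<open>qb\<close>, although
      \<open>C pa qb\<close> requires one of them.\<close>
    have "\<not> \<alpha> pa qb" using cong(1)[OF pa(1) pq(1) qb(1) pa(3)] match(1)[OF pq(1,2) qb(1) 1] qb by blast
    moreover have "\<not> \<beta> pa qb" using cong(4)[OF pa(1) qb(1) pq(2) qb(3)] match(4)[OF pq(1) pa(1) pq(2) 2] pa by blast
    ultimately show False using no[OF pa(1) qb(1) C1(1)[OF qb(1)]] by blast
  qed
  have ab: "\<alpha> p q \<or> \<beta> p q" if "p \<in> U" "q \<in> V" for p q using no C_all that by blast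
  obtain u where u: "u \<in> U" using ne by blast
  obtain q0 where q0: "q0 \<in> V" using ne by blast
  \<comment> \<open>\<open>u\<close> is matched to a single class by \<open>\<alpha>\<close> and to
    a single class by \<open>\<beta>\<close>, while every element of \<open>V\<close> must be
    matched to it by one of the two.\<close>
  have "\<exists>t\<in>V. \<not> \<alpha> u t" using match(1)[OF u] many(3)[OF q0] q0 by blast
  then obtain t where t: "t \<in> V" "\<not> \<alpha> u t" "\<beta> u t" using ab u by blast
  have "\<exists>s\<in>V. \<not> \<beta> u s" using match(3)[OF u] many(4)[OF q0] q0 by blast
  then obtain s where s: "s \<in> V" "\<not> \<beta> u s" "\<alpha> u s" using ab u by blast
  have st: "\<not> sa s t" "\<not> sb s t" using cong(2)[OF u s(1) t(1)] cong(4)[OF u s(1) t(1)] s t by blast+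
  obtain v where v: "v \<in> U" "\<not> sa u v" using many(1)[OF u] by blast
  have "\<not> \<alpha> v s" using match(2)[OF u v(1) s(1)] s v by blast
  then have bvs: "\<beta> v s" using ab v s by blast
  then have "\<not> \<beta> v t" using match(3)[OF v(1) s(1) t(1)] st by blast
  then have avt: "\<alpha> v t" using ab v t by blast
  have nb: "\<not> sb u v" using cong(3)[OF u v(1) s(1)] bvs s by blast
  \<comment> \<open>The matches of \<open>u\<close> and those of \<open>v\<close> give one
    alternative each. Mixed combinations would make \<open>s\<close> and \<open>t\<close> parallel,
    so \<open>y\<close> agrees with \<open>s\<close> or with \<open>t\<close> in both
    senses.\<close>
  have "sa y s \<and> sb y s \<or> sa y t \<and> sb y t" if y: "y \<in> V" for y
  proof -
    have "sa y s \<or> sb y t" using ab[OF u y] match(1)[OF u y s(1)] match(3)[OF u y t(1)] s t by blast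
    moreover have "sa y t \<or> sb y s" using ab[OF v(1) y] match(1)[OF v(1) y t(1)] match(3)[OF v(1) y s(1)] avt bvs by blast
    ultimately show ?thesis using eq st by blast
  qed
  moreover have "sa x u \<and> sb x u \<or> sa x v \<and> sb x v" if x: "x \<in> U" for x
  proof -
    have "sa x u \<or> sb x v" using ab[OF x s(1)] match(2)[OF x u s(1)] match(4)[OF x v(1) s(1)] s bvs by blast
    moreover have "sa x v \<or> sb x u" using ab[OF x t(1)] match(2)[OF x v(1) t(1)] match(4)[OF x u t(1)] t avt by blast
    ultimately show ?thesis using eq v nb by blast
  qed
  ultimately show ?thesis using u v s t avt bvs nb st by blast
qed

section \<open>Components of a quotient, and planes covered by two lines\<close>

context matroid
begin

lemma hyp_sep: "hyp X \<Longrightarrow> D \<subseteq> X \<Longrightarrow> sep D K \<Longrightarrow> E - X \<subseteq> K \<or> (E - X) \<inter> K = {}"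
proof -
  assume a: "hyp X" "D \<subseteq> X" "sep D K"
  then have "sep X (K - X)" using sep_contract hyp_flat by auto
  then have "K - X = {} \<or> K - X = E - X" using conn_hyp[OF a(1)] by (auto simp: conn_def)
  then show ?thesis by blast
qed

lemma sep_Diff: "D \<subseteq> E \<Longrightarrow> sep D K \<Longrightarrow> sep D K' \<Longrightarrow> sep D (K - K')"
proof -
  assume a: "D \<subseteq> E" "sep D K" "sep D K'"
  have "K \<subseteq> E - D" using a by (simp add: sep_def)
  then have "K - K' = K \<inter> (E - D - K')" by blast
  then show ?thesis using sep_Int[OF a(1,2) sep_compl[OF a(1,3)]] by simp
qed

lemma sep_full: "D \<subseteq> E \<Longrightarrow> sep D (E - D)"
  by (simp add: sep_def double_diff Un_absorb2)

text \<open>A separator of the quotient by \<open>E - K\<close> lies in \<open>K\<close> and is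
  already a separator of \<open>M/D\<close>, by \<open>sep_lift\<close>; minimality makes it
  trivial.\<close>

lemma component_conn:
  assumes "flat D" "sep D K" and min: "\<And>Z. sep D Z \<Longrightarrow> Z \<subseteq> K \<Longrightarrow> Z = {} \<or> Z = K"
  shows "conn (E - K)"
  unfolding conn_def
proof (intro conjI allI impI)
  have D: "D \<subseteq> E" and K: "K \<subseteq> E - D" using assms flat_ground by (auto simp: sep_def)
  show "flat (E - K)" using sep_closed assms by auto
  fix Z assume Z: "sep (E - K) Z"
  have "E - (E - K) = K" using K by auto
  moreover then have "Z \<subseteq> K" using Z by (auto simp: sep_def)
  moreover have "sep D Z" by (rule sep_lift[OF assms(2) \<open>Z \<subseteq> K\<close> _ _ _ Z]) (use D K in auto)
  ultimately show "Z = {} \<or> Z = E - (E - K)" using min by auto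
qed

text \<open>The complement of a hyperplane lies in a single component of \<open>M/D\<close>, as
  \<open>M/X\<close> is connected. That component is a separator of least size around the
  complement; intersections show that it is contained in all others.\<close>

lemma hyp_component:
  assumes "flat D" "hyp X" "D \<subseteq> X"
  shows "\<exists>K. sep D K \<and> E - X \<subseteq> K \<and> conn (E - K) \<and> (\<forall>K'. sep D K' \<longrightarrow> E - X \<subseteq> K' \<longrightarrow> K \<subseteq> K')"
proof -
  have D: "D \<subseteq> E" using assms flat_ground by auto
  define P where "P K \<longleftrightarrow> sep D K \<and> E - X \<subseteq> K" for K
  have "P (E - D)" using sep_full D assms by (auto simp: P_def)
  then obtain K where K: "P K" "\<And>K'. P K' \<Longrightarrow> card K \<le> card K'" using arg_min_nat_lemma[of P _ card] by blast
  have "K \<subseteq> E - D" using K by (auto simp: P_def sep_def)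
  then have finK: "finite K" using finite_ground finite_subset by blast
  have least: "K \<subseteq> K'" if "sep D K'" "E - X \<subseteq> K'" for K'
  proof -
    have "P (K \<inter> K')" using sep_Int[OF D] K(1) that by (auto simp: P_def)
    then have "card K \<le> card (K \<inter> K')" using K by auto
    then have "K \<inter> K' = K" using finK by (simp add: card_seteq)
    then show ?thesis by blast
  qed
  have "conn (E - K)"
  proof (rule component_conn[OF assms(1)])
    show "sep D K" using K by (simp add: P_def)
    fix Z assume Z: "sep D Z" "Z \<subseteq> K"
    have "E - X \<subseteq> Z \<or> E - X \<subseteq> K - Z" using hyp_sep[OF assms(2,3) Z(1)] K(1) by (auto simp: P_def)
    then show "Z = {} \<or> Z = K" using least[of Z] least[of "K - Z"] Z sep_Diff[OF D \<open>sep D K\<close> Z(1)] by blast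
  qed
  then show ?thesis using K least by (auto simp: P_def)
qed

lemma not_conn_two_hyps:
  assumes "flat D" "r D + 2 = r E" "\<not> conn D" "hyp X" "hyp Y" "X \<noteq> Y" "D \<subseteq> X" "D \<subseteq> Y" "z \<in> E"
  shows "z \<in> X \<or> z \<in> Y"
proof (rule ccontr)
  assume z: "\<not> ?thesis"
  have D: "D \<subseteq> E" using assms flat_ground by auto
  have "hyp (D \<squnion> z)" "D \<subseteq> D \<squnion> z" "z \<in> D \<squnion> z" using hyp_adj assms z adj_superset D adj_self by auto
  then have "conn D" using indecomposable_conn[OF indecomposableI[OF assms(1,2,4,5), of "D \<squnion> z"]] assms z by auto
  then show False using assms by simp
qed

text \<open>The plane \<open>M/P\<close> is the union of two lines \<open>X\<close>, \<open>Y\<close> meeting in the point \<open>D\<close>.\<close>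

lemma two_lines_many:
  assumes "conn P" "r P + 3 = r E" "hyp X" "hyp Y" "X \<noteq> Y" "flat D" "r D + 2 = r E" "D \<subseteq> X" "D \<subseteq> Y" "P \<subseteq> D"
    and cover: "X \<union> Y = E" and q: "q \<in> Y - D"
  shows "\<exists>q'\<in>Y - D. q' \<notin> P \<squnion> q"
proof (rule ccontr)
  assume no: "\<not> ?thesis"
  have P: "flat P" "P \<subseteq> E" and Y: "Y \<subseteq> E" "X \<subseteq> E" using assms conn_flat flat_ground hyp_flat by auto
  have XY: "X \<inter> Y = D" using hyp_Int[OF assms(6,7,3-5,8,9)] .
  have qE: "q \<in> E - P" using q Y assms by auto
  have "(Y - D) \<union> P \<subseteq> P \<squnion> q" using no adj_superset[OF P(2)] by auto
  then have 1: "r ((Y - D) \<union> P) \<le> r P + 1" using rank_mono[of "(Y - D) \<union> P" "P \<squnion> q"] adj_rank[OF P(1) qE] by simp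
  have "E - (Y - D) = X" using XY cover Y by auto
  then have "r ((Y - D) \<union> P) + r (E - (Y - D)) \<le> r E + r P" using 1 assms by (auto simp: hyp_def)
  moreover have YP: "Y - D \<subseteq> E - P" using Y assms by auto
  ultimately have "sep P (Y - D)" using sep_ge[OF YP P(2)] by (simp add: sep_def)
  then have "Y - D = {} \<or> Y - D = E - P" using assms(1) unfolding conn_def by blast
  then have "X \<subseteq> P" using q XY cover Y assms by blast
  then have "r X \<le> r P" by (rule rank_mono)
  then show False using assms by (auto simp: hyp_def)
qed

lemma two_lines:
  assumes "flat P" "r P + 3 = r E" "hyp X" "hyp Y" "X \<noteq> Y" "flat D" "r D + 2 = r E" "D \<subseteq> X" "D \<subseteq> Y" "P \<subseteq> D"
    and p: "p \<in> X - D" and q: "q \<in> Y - D"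
  shows "hyp (P \<squnion> p \<squnion> q)" "P \<squnion> p \<squnion> q \<inter> X = P \<squnion> p" "P \<squnion> p \<squnion> q \<inter> Y = P \<squnion> q" "P \<squnion> p \<squnion> q = P \<squnion> q \<squnion> p"
    "P \<squnion> p \<squnion> q \<noteq> X" "P \<squnion> p \<squnion> q \<noteq> Y"
    "flat (P \<squnion> p)" "r (P \<squnion> p) + 2 = r E" "P \<squnion> p \<subseteq> X" "P \<squnion> p \<subseteq> P \<squnion> p \<squnion> q" "P \<subseteq> P \<squnion> p \<squnion> q"
    "p \<in> P \<squnion> p \<squnion> q" "q \<in> P \<squnion> p \<squnion> q"
proof -
  have P: "P \<subseteq> E" and XY: "X \<subseteq> E" "Y \<subseteq> E" "flat X" "flat Y" using assms flat_ground hyp_flat by auto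
  have pq: "p \<in> E - P" "q \<in> E - P" using p q XY assms by auto
  have i: "X \<inter> Y = D" using hyp_Int[OF assms(6,7,3-5,8,9)] .
  show Lp: "flat (P \<squnion> p)" "r (P \<squnion> p) + 2 = r E" using flat_cl adj_rank[OF assms(1) pq(1)] assms by auto
  have Lq: "flat (P \<squnion> q)" "r (P \<squnion> q) + 2 = r E" using flat_cl adj_rank[OF assms(1) pq(2)] assms by auto
  show sX: "P \<squnion> p \<subseteq> X" using adj_least XY p assms by auto
  have sY: "P \<squnion> q \<subseteq> Y" using adj_least XY q assms by auto
  have nX: "q \<notin> X" "p \<notin> Y" using p q i by auto
  have qn: "q \<in> E - P \<squnion> p" using pq sX nX by auto
  show H: "hyp (P \<squnion> p \<squnion> q)" using hyp_adj[OF Lp qn] .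
  show c: "P \<squnion> p \<squnion> q = P \<squnion> q \<squnion> p" using adj_commute P pq by auto
  show in1: "P \<squnion> p \<subseteq> P \<squnion> p \<squnion> q" using adj_superset cl_ground by auto
  show in2: "p \<in> P \<squnion> p \<squnion> q" "q \<in> P \<squnion> p \<squnion> q" using adj_self[of q] adj_self[of p P] in1 pq by auto
  show "P \<subseteq> P \<squnion> p \<squnion> q" using adj_superset[OF P, of p] in1 by auto
  have in3: "P \<squnion> q \<subseteq> P \<squnion> p \<squnion> q" unfolding c using adj_superset cl_ground by auto
  show nXY: "P \<squnion> p \<squnion> q \<noteq> X" "P \<squnion> p \<squnion> q \<noteq> Y" using in2 nX by auto
  show "P \<squnion> p \<squnion> q \<inter> X = P \<squnion> p" using hyp_Int[OF Lp H assms(3) nXY(1) in1 sX] .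
  show "P \<squnion> p \<squnion> q \<inter> Y = P \<squnion> q" using hyp_Int[OF Lq H assms(4) nXY(2) in3 sY] .
qed

text \<open>Through the point \<open>p\<close> pass \<open>X\<close>, the line to \<open>q\<close>
  and the different line to \<open>q'\<close>; three hyperplanes make the point
  indecomposable.\<close>

lemma two_lines_edge:
  assumes "flat P" "r P + 3 = r E" "hyp X" "hyp Y" "X \<noteq> Y" "flat D" "r D + 2 = r E" "D \<subseteq> X" "D \<subseteq> Y" "P \<subseteq> D"
    and p: "p \<in> X - D" and q: "q \<in> Y - D" and q': "q' \<in> Y - D" "q' \<notin> P \<squnion> q"
  shows "edge X (P \<squnion> p \<squnion> q)"
proof -
  note T = two_lines[OF assms(1-12)] and T' = two_lines[OF assms(1-11) q'(1)]
  have "q' \<in> P \<squnion> p \<squnion> q'" "q' \<in> Y" using T'(13) q' by auto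
  then have ne: "P \<squnion> p \<squnion> q \<noteq> P \<squnion> p \<squnion> q'" using T(3) q'(2) by blast
  show ?thesis
    by (rule edgeI[OF T(7,8) assms(3) T(1) T'(1) T(9,10) T'(10)]) (use T(5) T'(5) ne in metis)+
qed

end

section \<open>Walks above two different covers\<close>

context constellation
begin

text \<open>The point \<open>p\<close> is outside \<Gamma> because it lies on the good
  \<open>X\<close>, so at most one line through it is in \<Gamma>. The lines in \<Gamma> therefore
  match points of \<open>X\<close> with points of \<open>Y\<close>.\<close>

lemma two_lines_match:
  assumes "flat P" "r P + 3 = r E" "good X" "hyp Y" "X \<noteq> Y" "flat D" "r D + 2 = r E" "D \<subseteq> X" "D \<subseteq> Y" "P \<subseteq> D"
    and p: "p \<in> X - D" and q: "q \<in> Y - D" "q' \<in> Y - D" and bad: "P \<squnion> p \<squnion> q \<in> \<Gamma>" "P \<squnion> p \<squnion> q' \<in> \<Gamma>"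
  shows "P \<squnion> q = P \<squnion> q'"
proof -
  have X: "hyp X" using assms good_hyp by auto
  note T = two_lines[OF assms(1,2) X assms(4-11) q(1)] and T' = two_lines[OF assms(1,2) X assms(4-11) q(2)]
  have "P \<squnion> p \<notin> \<Gamma>" using good_not_cut[OF assms(3) T(9)] .
  moreover have "q \<in> E" "q' \<in> E" using q hyp_flat assms by auto
  ultimately have "P \<squnion> p \<squnion> q = P \<squnion> p \<squnion> q'" using cut_adj[OF flat_cl bad] by auto
  then show ?thesis using T(3) T'(3) by simp
qed

text \<open>Simple connectivity of the part of the constellation above \<open>D\<close>.\<close>

definition sc where
  "sc D \<longleftrightarrow> (\<forall>X p q. walk D X p \<longrightarrow> walk D X q \<longrightarrow> fin X p = fin X q \<longrightarrow> hm X p q)"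

text \<open>All walks above \<open>P\<close> are compared with all walks above \<open>Q\<close>; if
  both parts are simply connected, one homotopic pair decides, by \<open>simI\<close>.\<close>

definition sim where
  "sim P Q X Y \<longleftrightarrow> (\<forall>p q. walk P X p \<longrightarrow> fin X p = Y \<longrightarrow> walk Q X q \<longrightarrow> fin X q = Y \<longrightarrow> hm X p q)"

lemma scD: "sc D \<Longrightarrow> walk D X p \<Longrightarrow> walk D X q \<Longrightarrow> fin X p = fin X q \<Longrightarrow> hm X p q"
  by (simp add: sc_def)

lemma simD: "sim P Q X Y \<Longrightarrow> walk P X p \<Longrightarrow> fin X p = Y \<Longrightarrow> walk Q X q \<Longrightarrow> fin X q = Y \<Longrightarrow> hm X p q"
  by (simp add: sim_def)

lemma simI:
  assumes "sc P" "sc Q" "walk P X p" "walk Q X q" "fin X p = Y" "fin X q = Y" "hm X p q"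
  shows "sim P Q X Y"
  unfolding sim_def
proof (intro allI impI)
  fix p' q' assume "walk P X p'" "fin X p' = Y" "walk Q X q'" "fin X q' = Y"
  then have "hm X p' p" "hm X q q'" using scD assms by auto
  then show "hm X p' q'" using assms(7) hm_trans by blast
qed

lemma sim_trans:
  assumes "sim P Q X W" "sim P Q W Y" "conn P" "conn Q" "sc P" "sc Q" "good X" "good W" "good Y"
    "P \<subseteq> X" "P \<subseteq> W" "P \<subseteq> Y" "Q \<subseteq> X" "Q \<subseteq> W" "Q \<subseteq> Y"
  shows "sim P Q X Y"
proof -
  obtain p1 where p1: "walk P X p1" "fin X p1 = W" using path_connected[OF assms(3,7,8,10,11)] by auto
  obtain p2 where p2: "walk P W p2" "fin W p2 = Y" using path_connected[OF assms(3,8,9,11,12)] by auto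
  obtain q1 where q1: "walk Q X q1" "fin X q1 = W" using path_connected[OF assms(4,7,8,13,14)] by auto
  obtain q2 where q2: "walk Q W q2" "fin W q2 = Y" using path_connected[OF assms(4,8,9,14,15)] by auto
  have "hm X p1 q1" "hm W p2 q2" using simD assms(1,2) p1 p2 q1 q2 by auto
  then have "hm X (p1 @ p2) (q1 @ q2)" using hm_append p1 by auto
  then show ?thesis using simI[OF assms(5,6), of X "p1 @ p2" "q1 @ q2"] p1 p2 q1 q2 by auto
qed

text \<open>A single walk above \<open>R\<close> is a walk above \<open>P\<close> and above
  \<open>Q\<close> at once.\<close>

lemma sim_conn:
  assumes "conn R" "P \<subseteq> R" "Q \<subseteq> R" "R \<subseteq> X" "R \<subseteq> Y" "good X" "good Y" "sc P" "sc Q"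
  shows "sim P Q X Y"
proof -
  obtain p where p: "walk R X p" "fin X p = Y" using path_connected[OF assms(1,6,7,4,5)] by auto
  then have w: "walk P X p" "walk Q X p" using walk_mono assms by blast+
  then have "walk {} X p" using walk_mono by blast
  then show ?thesis using simI[OF assms(8,9) w p(2,2)] hm_refl by auto
qed

lemma sim_mono:
  assumes "sim P' Q' X Y" "conn P'" "conn Q'" "P \<subseteq> P'" "Q \<subseteq> Q'" "sc P" "sc Q" "good X" "good Y"
    "P' \<subseteq> X" "P' \<subseteq> Y" "Q' \<subseteq> X" "Q' \<subseteq> Y"
  shows "sim P Q X Y"
proof -
  obtain p where p: "walk P' X p" "fin X p = Y" using path_connected[OF assms(2,8,9,10,11)] by auto
  obtain q where q: "walk Q' X q" "fin X q = Y" using path_connected[OF assms(3,8,9,12,13)] by auto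
  have "walk P X p" "walk Q X q" using walk_mono p q assms by blast+
  then show ?thesis using simI[OF assms(6,7)] simD[OF assms(1)] p q by auto
qed

lemma sim_rev: "sim P Q Y X \<Longrightarrow> sim P Q X Y"
proof -
  assume s: "sim P Q Y X"
  have "hm X p q" if p: "walk P X p" "fin X p = Y" and q: "walk Q X q" "fin X q = Y" for p q
  proof -
    have w: "walk P Y (rv X p)" "fin Y (rv X p) = X" "walk Q Y (rv X q)" "fin Y (rv X q) = X"
      using walk_rv[OF p(1)] walk_rv[OF q(1)] fin_rv[of X p] fin_rv[of X q] p q by auto
    then have "hm Y (rv X p) (rv X q)" using simD[OF s] by auto
    then have "hm X (rv Y (rv X p)) (rv Y (rv X q))" using hm_reverse[of Y "rv X p"] w by auto
    moreover have rr: "rv (fin X ps) (rv X ps) = ps" for ps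
    proof (induction ps arbitrary: X)
      case (Cons Z ps)
      have app: "rv A (as @ bs) = rv (fin A as) bs @ rv A as" for A as bs by (induction as arbitrary: A) auto
      show ?case using Cons.IH[of Z] by (simp add: app)
    qed auto
    ultimately show ?thesis using rr[of p] rr[of q] p q by simp
  qed
  then show ?thesis by (auto simp: sim_def)
qed

text \<open>\<open>a\<close>, \<open>b\<close>, \<open>x\<close> are independent over
  \<open>F\<close>. The consequence needed is that an element parallel to \<open>x\<close> over both
  covers lies in \<open>F \<squnion> x\<close>.\<close>

lemma adj_Int:
  assumes "flat F" "a \<in> E - F" "b \<in> E - F \<squnion> a" "x \<in> E - F \<squnion> a \<squnion> b"
  shows "F \<squnion> a \<squnion> x \<inter> F \<squnion> b \<squnion> x = F \<squnion> x"
proof -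
  have F: "F \<subseteq> E" using assms flat_ground by auto
  have xF: "x \<in> E - F" "a \<in> E" "b \<in> E" "x \<in> E"
    using assms adj_superset[OF F, of a] adj_superset[OF cl_ground, of "insert a F" b] by auto
  have ax: "F \<squnion> a \<squnion> x = F \<squnion> x \<squnion> a" "F \<squnion> b \<squnion> x = F \<squnion> x \<squnion> b" using adj_commute F xF by auto
  have bn: "b \<notin> F \<squnion> a \<squnion> x" using adj_exchange[of "F \<squnion> a" b x, OF flat_cl] adj_self[of x "F \<squnion> a"] assms xF
    by (metis DiffE)
  have "flat (F \<squnion> x \<squnion> a \<inter> F \<squnion> x \<squnion> b)" by (intro flat_Int flat_cl)
  moreover have sub: "F \<squnion> x \<subseteq> F \<squnion> x \<squnion> a \<inter> F \<squnion> x \<squnion> b" using adj_superset[OF cl_ground] by blast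
  moreover have "r (F \<squnion> x \<squnion> a \<inter> F \<squnion> x \<squnion> b) \<le> r (F \<squnion> x)"
  proof -
    have "b \<in> F \<squnion> x \<squnion> b" using adj_self xF by auto
    then have "r (F \<squnion> x \<squnion> a \<inter> F \<squnion> x \<squnion> b) < r (F \<squnion> x \<squnion> b)"
      using flat_rank_less[OF \<open>flat (F \<squnion> x \<squnion> a \<inter> F \<squnion> x \<squnion> b)\<close>, of "F \<squnion> x \<squnion> b"] bn ax cl_ground by blast
    moreover have "r (F \<squnion> x \<squnion> b) \<le> r (F \<squnion> x) + 1" using rank_cl rank_insert_le by metis
    ultimately show ?thesis by simp
  qed
  ultimately have "F \<squnion> x \<squnion> a \<inter> F \<squnion> x \<squnion> b = F \<squnion> x" using flat_eq[OF flat_cl sub] cl_ground by blast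
  then show ?thesis using ax by simp
qed

text \<open>No third hyperplane lies above the join, so \<open>X\<close> and \<open>Y\<close> cover
  \<open>E\<close>. For \<open>p\<close> in \<open>X\<close> and \<open>q\<close> in
  \<open>Y\<close> off the join, \<open>?P \<squnion> p \<squnion> q\<close> is adjacent to
  \<open>X\<close> and \<open>Y\<close>, and likewise above \<open>?Q\<close>; by
  \<open>reduce\<close> it suffices to compare one good detour above \<open>?P\<close> with one
  above \<open>?Q\<close>.\<close>

lemma sim_corank4:
  assumes F: "flat F" "r F + 4 = r E" and a: "a \<in> E - F" and b: "b \<in> E - F \<squnion> a"
    and c: "conn (F \<squnion> a)" "conn (F \<squnion> b)" and s: "sc (F \<squnion> a)" "sc (F \<squnion> b)"
    and g: "good X" "good Y" and XY: "X \<noteq> Y" and D: "F \<squnion> a \<squnion> b \<subseteq> X" "F \<squnion> a \<squnion> b \<subseteq> Y" "\<not> conn (F \<squnion> a \<squnion> b)"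
  shows "sim (F \<squnion> a) (F \<squnion> b) X Y"
proof -
  let ?P = "F \<squnion> a" and ?Q = "F \<squnion> b"
  define D' where "D' = ?P \<squnion> b"
  have FE: "F \<subseteq> E" using F flat_ground by auto
  have ab: "a \<in> E" "b \<in> E" using a b by auto
  have DQ: "D' = ?Q \<squnion> a" using adj_commute FE ab unfolding D'_def by auto
  have h: "hyp X" "hyp Y" using g good_hyp by auto
  have sub: "X \<subseteq> E" "Y \<subseteq> E" using hyp_flat h by auto
  have P: "flat ?P" "r ?P + 3 = r E" using flat_cl adj_rank[OF F(1) a] F by auto
  have bF: "b \<in> E - F" using b adj_superset[OF FE] by auto
  have Q: "flat ?Q" "r ?Q + 3 = r E" using flat_cl adj_rank[OF F(1) bF] F by auto
  have D': "flat D'" "r D' + 2 = r E" "D' \<subseteq> X" "D' \<subseteq> Y" "?P \<subseteq> D'" "?Q \<subseteq> D'"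
    using flat_cl adj_rank[OF P(1) b] P D adj_superset[OF cl_ground, of "insert a F" b] adj_superset[OF cl_ground, of "insert b F" a] DQ
    unfolding D'_def by auto
  have FD: "F \<subseteq> D'" "a \<in> D'" "b \<in> D'" using D' adj_superset[OF FE, of a] adj_self[of a F] adj_self[of b F] ab by auto
  have cover: "X \<union> Y = E" using not_conn_two_hyps[OF D'(1,2) _ h XY D'(3,4)] D(3) sub unfolding D'_def by auto
  then have cover': "Y \<union> X = E" by auto
  have iXY: "X \<inter> Y = D'" using hyp_Int[OF D'(1,2) h XY D'(3,4)] .
  note XY' = XY[symmetric]
  note TP = two_lines[OF P h XY D'(1-5)] and TQ = two_lines[OF Q h XY D'(1-4,6)]
  note TP' = two_lines[OF P h(2,1) XY' D'(1,2,4,3,5)] and TQ' = two_lines[OF Q h(2,1) XY' D'(1,2,4,3,6)]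
  have bn: "b \<notin> ?P \<squnion> x" "a \<notin> ?Q \<squnion> x" if "x \<in> E - D'" for x
  proof -
    show "b \<notin> ?P \<squnion> x" using adj_exchange[OF P(1), of b x] b adj_self[of x ?P] that D'_def by blast
    have "a \<notin> ?Q" using adj_exchange[OF F(1), of a b] a b adj_self[of b F] by blast
    then show "a \<notin> ?Q \<squnion> x" using adj_exchange[OF Q(1), of a x] adj_self[of x ?Q] that DQ by blast
  qed
  define \<alpha> where "\<alpha> p q \<longleftrightarrow> ?P \<squnion> p \<squnion> q \<in> \<Gamma>" for p q
  define \<beta> where "\<beta> p q \<longleftrightarrow> ?Q \<squnion> p \<squnion> q \<in> \<Gamma>" for p q
  define C where "C p q \<longleftrightarrow> conn (F \<squnion> p \<squnion> q)" for p q
  let ?U = "X - D'" and ?V = "Y - D'"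
  have UV: "?U \<subseteq> E - D'" "?V \<subseteq> E - D'" using sub by auto
  have Fx: "x \<in> E - F" if "x \<in> E - D'" for x using that FD by auto
  have UVne: "?U \<noteq> {}" "?V \<noteq> {}" using D' h by (auto simp: hyp_def dest: rank_mono)
  have many: "\<exists>y\<in>?U. ?P \<squnion> x \<noteq> ?P \<squnion> y" "\<exists>y\<in>?U. ?Q \<squnion> x \<noteq> ?Q \<squnion> y" if "x \<in> ?U" for x
    using two_lines_many[OF c(1) P(2) h(2,1) XY' D'(1,2,4,3,5) cover' that]
      two_lines_many[OF c(2) Q(2) h(2,1) XY' D'(1,2,4,3,6) cover' that] adj_self UV by (metis DiffD1 subsetD)+
  have many': "\<exists>y\<in>?V. ?P \<squnion> x \<noteq> ?P \<squnion> y" "\<exists>y\<in>?V. ?Q \<squnion> x \<noteq> ?Q \<squnion> y" if "x \<in> ?V" for x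
    using two_lines_many[OF c(1) P(2) h XY D'(1-5) cover that]
      two_lines_many[OF c(2) Q(2) h XY D'(1-4,6) cover that] adj_self UV by (metis DiffD1 subsetD)+
  have edges: "edge X (?P \<squnion> p \<squnion> q)" "edge (?P \<squnion> p \<squnion> q) Y" "edge X (?Q \<squnion> p \<squnion> q)" "edge (?Q \<squnion> p \<squnion> q) Y"
    if pq: "p \<in> ?U" "q \<in> ?V" for p q
  proof -
    obtain q1 where q1: "q1 \<in> ?V" "q1 \<notin> ?P \<squnion> q" using two_lines_many[OF c(1) P(2) h XY D'(1-5) cover pq(2)] by auto
    obtain q2 where q2: "q2 \<in> ?V" "q2 \<notin> ?Q \<squnion> q" using two_lines_many[OF c(2) Q(2) h XY D'(1-4,6) cover pq(2)] by auto
    obtain p1 where p1: "p1 \<in> ?U" "p1 \<notin> ?P \<squnion> p" using two_lines_many[OF c(1) P(2) h(2,1) XY' D'(1,2,4,3,5) cover' pq(1)] by auto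
    obtain p2 where p2: "p2 \<in> ?U" "p2 \<notin> ?Q \<squnion> p" using two_lines_many[OF c(2) Q(2) h(2,1) XY' D'(1,2,4,3,6) cover' pq(1)] by auto
    show "edge X (?P \<squnion> p \<squnion> q)" using two_lines_edge[OF P h XY D'(1-5) pq q1] .
    show "edge X (?Q \<squnion> p \<squnion> q)" using two_lines_edge[OF Q h XY D'(1-4,6) pq q2] .
    have "edge Y (?P \<squnion> q \<squnion> p)" using two_lines_edge[OF P h(2,1) XY' D'(1,2,4,3,5) pq(2,1) p1] .
    then show "edge (?P \<squnion> p \<squnion> q) Y" using TP(4)[OF pq] edge_sym by simp
    have "edge Y (?Q \<squnion> q \<squnion> p)" using two_lines_edge[OF Q h(2,1) XY' D'(1,2,4,3,6) pq(2,1) p2] .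
    then show "edge (?Q \<squnion> p \<squnion> q) Y" using TQ(4)[OF pq] edge_sym by simp
  qed
  have goodA: "good (?P \<squnion> p \<squnion> q)" if "p \<in> ?U" "q \<in> ?V" "\<not> \<alpha> p q" for p q
    using TP(1)[OF that(1,2)] that(3) by (simp add: good_def \<alpha>_def)
  have goodB: "good (?Q \<squnion> p \<squnion> q)" if "p \<in> ?U" "q \<in> ?V" "\<not> \<beta> p q" for p q
    using TQ(1)[OF that(1,2)] that(3) by (simp add: good_def \<beta>_def)
  have reduce: "sim ?P ?Q X Y"
    if "hm X [?P \<squnion> p \<squnion> q, Y] [?Q \<squnion> p' \<squnion> q', Y]" "p \<in> ?U" "q \<in> ?V" "p' \<in> ?U" "q' \<in> ?V" "\<not> \<alpha> p q" "\<not> \<beta> p' q'" for p q p' q'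
  proof (rule simI[OF s _ _ _ _ that(1)])
    show "walk ?P X [?P \<squnion> p \<squnion> q, Y]"
      using g goodA that edges TP(11)[OF that(2,3)] D' by auto
    show "walk ?Q X [?Q \<squnion> p' \<squnion> q', Y]"
      using g goodB that edges TQ(11)[OF that(4,5)] D' by auto
  qed auto
  have distinctAB: "?P \<squnion> p \<squnion> q \<noteq> ?Q \<squnion> p' \<squnion> q'" if "p \<in> ?U" "q \<in> ?V" "p' \<in> ?U" "q' \<in> ?V" for p q p' q'
  proof
    assume eq: "?P \<squnion> p \<squnion> q = ?Q \<squnion> p' \<squnion> q'"
    have "b \<in> ?Q" using adj_self ab by auto
    then have "b \<in> ?P \<squnion> p \<squnion> q \<inter> X" using eq TQ(11)[OF that(3,4)] FD D' by auto
    then show False using TP(2)[OF that(1,2)] bn(1)[of p] UV that by auto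
  qed
  have F3: "flat (F \<squnion> x)" "r (F \<squnion> x) + 3 = r E" if "x \<in> E - D'" for x
    using flat_cl adj_rank[OF F(1) Fx[OF that]] F by auto
  have Fsub: "F \<squnion> x \<subseteq> G" if "flat G" "F \<subseteq> G" "x \<in> G" for x G using adj_least that by auto
  have FX: "F \<subseteq> X" "F \<subseteq> Y" using FD D' by auto
  have FP: "F \<subseteq> ?P" "F \<subseteq> ?Q" using adj_superset FE by auto
  have FA: "F \<subseteq> ?P \<squnion> p \<squnion> q" "F \<subseteq> ?Q \<squnion> p \<squnion> q" if "p \<in> ?U" "q \<in> ?V" for p q
    using TP(11)[OF that] TQ(11)[OF that] FP by auto
  have F2: "flat (F \<squnion> p \<squnion> q)" "r (F \<squnion> p \<squnion> q) + 2 = r E" "F \<squnion> p \<squnion> q \<subseteq> ?P \<squnion> p \<squnion> q" "F \<squnion> p \<squnion> q \<subseteq> ?Q \<squnion> p \<squnion> q"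
    if pq: "p \<in> ?U" "q \<in> ?V" for p q
  proof -
    have "F \<squnion> p \<subseteq> X" using Fsub pq hyp_flat h FX by auto
    then have q: "q \<in> E - F \<squnion> p" using pq iXY sub by auto
    show "flat (F \<squnion> p \<squnion> q)" "r (F \<squnion> p \<squnion> q) + 2 = r E"
      using flat_cl adj_rank[OF flat_cl q] F3(2)[of p] UV pq by auto
    show "F \<squnion> p \<squnion> q \<subseteq> ?P \<squnion> p \<squnion> q" "F \<squnion> p \<squnion> q \<subseteq> ?Q \<squnion> p \<squnion> q"
      using cl_mono FP by (metis insert_mono)+
  qed
  show ?thesis
  proof (cases "\<exists>p\<in>?U. \<exists>q\<in>?V. C p q \<and> \<not> \<alpha> p q \<and> \<not> \<beta> p q")
    case True
    \<comment> \<open>Both detours with the same \<open>p\<close>, \<open>q\<close> are good and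
      share the connected flat \<open>F \<squnion> p \<squnion> q\<close>. They are adjacent, and
      the two triangles lie above \<open>F \<squnion> p\<close> and
      \<open>F \<squnion> q\<close>.\<close>
    then obtain p q where pq: "p \<in> ?U" "q \<in> ?V" "conn (F \<squnion> p \<squnion> q)" "\<not> \<alpha> p q" "\<not> \<beta> p q" by (auto simp: C_def)
    let ?A = "?P \<squnion> p \<squnion> q" and ?B = "?Q \<squnion> p \<squnion> q"
    note e = edges[OF pq(1,2)]
    have gA: "good ?A" "good ?B" using goodA goodB pq by auto
    have eAB: "edge ?A ?B" by (rule edge_connI[OF pq(3) F2(2)[OF pq(1,2)] TP(1)[OF pq(1,2)] TQ(1)[OF pq(1,2)] F2(3,4)[OF pq(1,2)] distinctAB[OF pq(1,2,1,2)]])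
    have pD: "p \<in> E - D'" "q \<in> E - D'" using pq UV by auto
    have subs: "F \<squnion> p \<subseteq> X" "F \<squnion> p \<subseteq> ?A" "F \<squnion> p \<subseteq> ?B" "F \<squnion> q \<subseteq> ?A" "F \<squnion> q \<subseteq> ?B" "F \<squnion> q \<subseteq> Y"
      using Fsub hyp_flat h TP(12,13)[OF pq(1,2)] TQ(12,13)[OF pq(1,2)] FX FA[OF pq(1,2)] flat_cl pq by auto
    have t1: "tri X ?A ?B" by (rule tri_plane[OF F3[OF pD(1)] subs(1-3) g(1) gA e(1,3) eAB])
    have t2: "tri ?A ?B Y" by (rule tri_plane[OF F3[OF pD(2)] subs(4-6) gA g(2) eAB e(2,4)])
    have "hm X [?A, Y] [?A, ?B, Y]" using tri_ins[OF t2, of X "[?A]" "[]"] g gA e by simp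
    also have "hm X \<dots> [?B, Y]" using tri_del[OF t1, of X "[]" "[Y]"] g gA e by simp
    finally show ?thesis using reduce pq by blast
  next
    case False
    \<comment> \<open>If \<open>F \<squnion> p \<squnion> q\<close> is decomposable, the two detour
      hyperplanes are the only ones above it and cover \<open>E\<close>. Their traces on
      \<open>X\<close> and on \<open>Y\<close> are parallel classes over \<open>?P\<close> and over
      \<open>?Q\<close>.\<close>
    have Cfail: "(x \<in> ?U \<longrightarrow> ?P \<squnion> x = ?P \<squnion> p \<or> ?Q \<squnion> x = ?Q \<squnion> p) \<and> (x \<in> ?V \<longrightarrow> ?P \<squnion> x = ?P \<squnion> q \<or> ?Q \<squnion> x = ?Q \<squnion> q)"
      if pq: "p \<in> ?U" "q \<in> ?V" "\<not> C p q" for p q x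
    proof -
      have two: "x \<in> ?P \<squnion> p \<squnion> q \<or> x \<in> ?Q \<squnion> p \<squnion> q" if "x \<in> E"
        using not_conn_two_hyps[OF F2(1,2)[OF pq(1,2)] _ TP(1)[OF pq(1,2)] TQ(1)[OF pq(1,2)] distinctAB[OF pq(1,2,1,2)] F2(3,4)[OF pq(1,2)] that]
          pq(3) by (auto simp: C_def)
      have ex: "?P \<squnion> x = ?P \<squnion> y" if "x \<in> ?P \<squnion> y" "x \<in> E - D'" "y \<in> E" for y
        using adj_exchange[OF P(1) that(1)] that D' by auto
      have ex': "?Q \<squnion> x = ?Q \<squnion> y" if "x \<in> ?Q \<squnion> y" "x \<in> E - D'" "y \<in> E" for y
        using adj_exchange[OF Q(1) that(1)] that D' by auto
      have pqE: "p \<in> E" "q \<in> E" using pq sub by auto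
      show ?thesis
      proof (intro conjI impI)
        assume x: "x \<in> ?U"
        then have "x \<in> ?P \<squnion> p \<or> x \<in> ?Q \<squnion> p" using two TP(2)[OF pq(1,2)] TQ(2)[OF pq(1,2)] sub by auto
        then show "?P \<squnion> x = ?P \<squnion> p \<or> ?Q \<squnion> x = ?Q \<squnion> p" using ex ex' x UV pqE by blast
      next
        assume x: "x \<in> ?V"
        then have "x \<in> ?P \<squnion> q \<or> x \<in> ?Q \<squnion> q" using two TP(3)[OF pq(1,2)] TQ(3)[OF pq(1,2)] sub by auto
        then show "?P \<squnion> x = ?P \<squnion> q \<or> ?Q \<squnion> x = ?Q \<squnion> q" using ex ex' x UV pqE by blast
      qed
    qed
    have comm: "?P \<squnion> p \<squnion> q = ?P \<squnion> q \<squnion> p" "?Q \<squnion> p \<squnion> q = ?Q \<squnion> q \<squnion> p" if "p \<in> ?U" "q \<in> ?V" for p q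
      using TP(4)[OF that] TQ(4)[OF that] .
    define R where "R u v s t \<longleftrightarrow> \<alpha> u s \<and> \<alpha> v t \<and> \<beta> u t \<and> \<beta> v s \<and>
      \<not> ?P \<squnion> u = ?P \<squnion> v \<and> \<not> ?Q \<squnion> u = ?Q \<squnion> v \<and> \<not> ?P \<squnion> s = ?P \<squnion> t \<and> \<not> ?Q \<squnion> s = ?Q \<squnion> t \<and>
      (\<forall>x\<in>?U. ?P \<squnion> x = ?P \<squnion> u \<and> ?Q \<squnion> x = ?Q \<squnion> u \<or> ?P \<squnion> x = ?P \<squnion> v \<and> ?Q \<squnion> x = ?Q \<squnion> v) \<and>
      (\<forall>y\<in>?V. ?P \<squnion> y = ?P \<squnion> s \<and> ?Q \<squnion> y = ?Q \<squnion> s \<or> ?P \<squnion> y = ?P \<squnion> t \<and> ?Q \<squnion> y = ?Q \<squnion> t)" for u v s t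
    have "\<exists>u\<in>?U. \<exists>v\<in>?U. \<exists>s\<in>?V. \<exists>t\<in>?V. R u v s t" unfolding R_def
    proof (rule two_matchings[where C = C and sa = "\<lambda>x y. ?P \<squnion> x = ?P \<squnion> y" and sb = "\<lambda>x y. ?Q \<squnion> x = ?Q \<squnion> y", OF _ _ _ _ _ _ UVne many many'])
      fix p q q' assume pq: "p \<in> ?U" "q \<in> ?V" "q' \<in> ?V"
      show "?P \<squnion> q = ?P \<squnion> q' \<Longrightarrow> \<alpha> p q = \<alpha> p q'" "?Q \<squnion> q = ?Q \<squnion> q' \<Longrightarrow> \<beta> p q = \<beta> p q'"
        unfolding \<alpha>_def \<beta>_def using comm pq by metis+
      show "\<alpha> p q \<Longrightarrow> \<alpha> p q' \<Longrightarrow> ?P \<squnion> q = ?P \<squnion> q'"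
        unfolding \<alpha>_def by (rule two_lines_match[OF P g(1) h(2) XY D'(1-5) pq])
      show "\<beta> p q \<Longrightarrow> \<beta> p q' \<Longrightarrow> ?Q \<squnion> q = ?Q \<squnion> q'"
        unfolding \<beta>_def by (rule two_lines_match[OF Q g(1) h(2) XY D'(1-4,6) pq])
    next
      fix p p' q assume pq: "p \<in> ?U" "p' \<in> ?U" "q \<in> ?V"
      show "\<alpha> p q \<Longrightarrow> \<alpha> p' q \<Longrightarrow> ?P \<squnion> p = ?P \<squnion> p'"
        unfolding \<alpha>_def comm[OF pq(1,3)] comm[OF pq(2,3)]
        by (rule two_lines_match[OF P g(2) h(1) XY' D'(1,2,4,3,5) pq(3,1,2)])
      show "\<beta> p q \<Longrightarrow> \<beta> p' q \<Longrightarrow> ?Q \<squnion> p = ?Q \<squnion> p'"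
        unfolding \<beta>_def comm[OF pq(1,3)] comm[OF pq(2,3)]
        by (rule two_lines_match[OF Q g(2) h(1) XY' D'(1,2,4,3,6) pq(3,1,2)])
    next
      fix p q x assume pq: "p \<in> ?U" "q \<in> ?V" "\<not> C p q"
      show "x \<in> ?U \<Longrightarrow> ?P \<squnion> x = ?P \<squnion> p \<or> ?Q \<squnion> x = ?Q \<squnion> p" "x \<in> ?V \<Longrightarrow> ?P \<squnion> x = ?P \<squnion> q \<or> ?Q \<squnion> x = ?Q \<squnion> q"
        using Cfail[OF pq, of x] by blast+
    next
      show "\<alpha> p q \<or> \<beta> p q" if "p \<in> ?U" "q \<in> ?V" "C p q" for p q using False that by blast
    qed (auto simp: \<alpha>_def \<beta>_def)
    then obtain u v s t where uv: "u \<in> ?U" "v \<in> ?U" and st: "s \<in> ?V" "t \<in> ?V" and R: "R u v s t" by blast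
    have bad: "\<alpha> u s" "\<alpha> v t" "\<beta> u t" "\<beta> v s"
      and ne: "?P \<squnion> u \<noteq> ?P \<squnion> v" "?Q \<squnion> u \<noteq> ?Q \<squnion> v" "?P \<squnion> s \<noteq> ?P \<squnion> t" "?Q \<squnion> s \<noteq> ?Q \<squnion> t"
      using R unfolding R_def by simp_all
    have allU: "?P \<squnion> x = ?P \<squnion> u \<and> ?Q \<squnion> x = ?Q \<squnion> u \<or> ?P \<squnion> x = ?P \<squnion> v \<and> ?Q \<squnion> x = ?Q \<squnion> v" if "x \<in> ?U" for x
      using R[unfolded R_def] that by simp
    have allV: "?P \<squnion> x = ?P \<squnion> s \<and> ?Q \<squnion> x = ?Q \<squnion> s \<or> ?P \<squnion> x = ?P \<squnion> t \<and> ?Q \<squnion> x = ?Q \<squnion> t" if "x \<in> ?V" for x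
      using R[unfolded R_def] that by simp
    have D: "u \<in> E - D'" "v \<in> E - D'" "s \<in> E - D'" "t \<in> E - D'" using uv st UV by auto
    have Em: "u \<in> E" "v \<in> E" "s \<in> E" "t \<in> E" using D by auto
    have mem: "x \<notin> ?P \<squnion> y" if "?P \<squnion> x \<noteq> ?P \<squnion> y" "x \<in> E - D'" "y \<in> E" for x y
      using adj_exchange[OF P(1), of x y] that D' by auto
    have mem': "x \<notin> ?Q \<squnion> y" if "?Q \<squnion> x \<noteq> ?Q \<squnion> y" "x \<in> E - D'" "y \<in> E" for x y
      using adj_exchange[OF Q(1), of x y] that D' by auto
    have nP: "u \<notin> ?P \<squnion> v" "v \<notin> ?P \<squnion> u" "s \<notin> ?P \<squnion> t" "t \<notin> ?P \<squnion> s"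
      using mem ne D Em by metis+
    have nQ: "u \<notin> ?Q \<squnion> v" "v \<notin> ?Q \<squnion> u" "s \<notin> ?Q \<squnion> t" "t \<notin> ?Q \<squnion> s"
      using mem' ne D Em by metis+
    have inF: "x \<in> F \<squnion> y" if "?P \<squnion> x = ?P \<squnion> y" "?Q \<squnion> x = ?Q \<squnion> y" "x \<in> E" "y \<in> E - D'" for x y
    proof -
      have "x \<in> ?P \<squnion> y \<inter> ?Q \<squnion> y" using adj_self[OF that(3), of ?P] adj_self[OF that(3), of ?Q] that by auto
      then show ?thesis using adj_Int[OF F(1) a b, of y] that(4) D'_def by blast
    qed
    have coverU: "x \<in> F \<squnion> u \<or> x \<in> F \<squnion> v" if "x \<in> ?U" for x
    proof -
      have "x \<in> E" using that sub by blast
      then show ?thesis using allU[OF that] inF[OF _ _ _ D(1), of x] inF[OF _ _ _ D(2), of x] by blast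
    qed
    have coverV: "x \<in> F \<squnion> s \<or> x \<in> F \<squnion> t" if "x \<in> ?V" for x
    proof -
      have "x \<in> E" using that sub by blast
      then show ?thesis using allV[OF that] inF[OF _ _ _ D(3), of x] inF[OF _ _ _ D(4), of x] by blast
    qed
    have good4: "\<not> \<alpha> u t" "\<not> \<alpha> v s" "\<not> \<beta> u s" "\<not> \<beta> v t"
    proof -
      have P1: "\<alpha> p q \<Longrightarrow> \<alpha> p q' \<Longrightarrow> ?P \<squnion> q = ?P \<squnion> q'" if "p \<in> ?U" "q \<in> ?V" "q' \<in> ?V" for p q q'
        unfolding \<alpha>_def by (rule two_lines_match[OF P g(1) h(2) XY D'(1-5) that])
      have Q1: "\<beta> p q \<Longrightarrow> \<beta> p q' \<Longrightarrow> ?Q \<squnion> q = ?Q \<squnion> q'" if "p \<in> ?U" "q \<in> ?V" "q' \<in> ?V" for p q q'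
        unfolding \<beta>_def by (rule two_lines_match[OF Q g(1) h(2) XY D'(1-4,6) that])
      show "\<not> \<alpha> u t" "\<not> \<alpha> v s" "\<not> \<beta> u s" "\<not> \<beta> v t"
        using P1[OF uv(1) st] P1[OF uv(2) st] Q1[OF uv(1) st] Q1[OF uv(2) st] bad ne by blast+
    qed
    let ?W = "F \<squnion> u \<squnion> s \<squnion> t"
    have Fs: "F \<squnion> s \<subseteq> Y" "F \<squnion> t \<subseteq> Y" "F \<squnion> u \<subseteq> X" "F \<squnion> v \<subseteq> X" using Fsub hyp_flat h FX uv st by auto
    have FPt: "F \<squnion> s \<subseteq> ?P \<squnion> s" "F \<squnion> u \<subseteq> ?P \<squnion> u" using cl_mono FP by (metis insert_mono)+
    have tFs: "t \<in> E - F \<squnion> s" "v \<in> E - F \<squnion> u" using nP FPt Em by auto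
    have Fst: "flat (F \<squnion> s \<squnion> t)" "r (F \<squnion> s \<squnion> t) + 2 = r E" "F \<squnion> s \<squnion> t \<subseteq> Y"
      using flat_cl adj_rank[OF flat_cl tFs(1)] F3(2)[OF D(3)] adj_least[OF hyp_flat(1)[OF h(2)] Fs(1)] st by auto
    have Fuv: "flat (F \<squnion> u \<squnion> v)" "r (F \<squnion> u \<squnion> v) + 2 = r E" "F \<squnion> u \<squnion> v \<subseteq> X"
      using flat_cl adj_rank[OF flat_cl tFs(2)] F3(2)[OF D(1)] adj_least[OF hyp_flat(1)[OF h(1)] Fs(3)] uv by auto
    have uY: "u \<notin> Y" "v \<notin> Y" "s \<notin> X" "t \<notin> X" using uv st iXY by auto
    have Weq: "?W = F \<squnion> s \<squnion> t \<squnion> u" using adj_commute[of "F \<squnion> u" s t] adj_commute[of "F" u s] adj_commute[of "F \<squnion> s" u t] cl_ground FE Em by auto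
    have uFst: "u \<in> E - F \<squnion> s \<squnion> t" using Fst uY Em by auto
    have W: "hyp ?W" "F \<squnion> s \<squnion> t \<subseteq> ?W" "u \<in> ?W"
      unfolding Weq using hyp_adj[OF Fst(1,2) uFst] adj_superset[OF cl_ground] adj_self Em by auto
    have Fus: "F \<squnion> u \<squnion> s \<subseteq> ?W" "t \<in> ?W" using adj_superset[OF cl_ground] adj_self Em by auto
    have WF: "F \<subseteq> ?W" "s \<in> ?W" "F \<squnion> u \<subseteq> ?W" "F \<squnion> s \<subseteq> ?W" "F \<squnion> t \<subseteq> ?W"
    proof -
      show w: "F \<squnion> u \<subseteq> ?W" using Fus adj_superset[OF cl_ground, of "insert u F" s] by auto
      then show f: "F \<subseteq> ?W" using adj_superset[OF FE, of u] by auto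
      show ss: "s \<in> ?W" using Fus adj_self[OF Em(3), of "F \<squnion> u"] by auto
      show "F \<squnion> s \<subseteq> ?W" "F \<squnion> t \<subseteq> ?W" using Fsub[OF flat_cl f] ss Fus by auto
    qed
    have WY: "?W \<noteq> Y" "?W \<noteq> X" using W uY Fus by auto
    have Ys: "?P \<squnion> s \<squnion> t = Y" "?Q \<squnion> s \<squnion> t = Y"
      using hyp_adj_eq[OF TP'(7,8)[OF st(1) uv(1)] _ h(2) TP'(9)[OF st(1) uv(1)], of t]
        hyp_adj_eq[OF TQ'(7,8)[OF st(1) uv(1)] _ h(2) TQ'(9)[OF st(1) uv(1)], of t] nP nQ st by auto
    have abW: "a \<notin> ?W" "b \<notin> ?W"
    proof -
      have *: "Y \<subseteq> ?W" if "z \<in> ?W" "F \<squnion> z \<squnion> s \<squnion> t = Y" for z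
      proof -
        have "F \<squnion> z \<subseteq> ?W" using Fsub[OF flat_cl WF(1)] that by auto
        then have "F \<squnion> z \<squnion> s \<subseteq> ?W" using adj_least[OF flat_cl] WF by auto
        then show ?thesis using adj_least[OF flat_cl, of "F \<squnion> z \<squnion> s" _ t] Fus that by auto
      qed
      show "a \<notin> ?W" "b \<notin> ?W" using *[of a] *[of b] Ys hyp_eq[OF h(2) W(1)] WY by auto
    qed
    \<comment> \<open>\<open>F \<squnion> u \<squnion> s\<close> lies in the good
      \<open>?Q \<squnion> u \<squnion> s\<close>, and its join with \<open>a\<close> is in
      \<Gamma>. As \<open>a\<close> is not in \<open>?W\<close>, the join with \<open>t\<close> is a
      different cover and stays outside \<Gamma>.\<close>
    have gW: "good ?W"
    proof -
      have "?P \<squnion> u \<squnion> s = F \<squnion> u \<squnion> s \<squnion> a"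
        using adj_commute[of F a u] adj_commute[of "F \<squnion> u" a s] FE cl_ground ab Em by auto
      then have "F \<squnion> u \<squnion> s \<squnion> a \<in> \<Gamma>" "F \<squnion> u \<squnion> s \<squnion> a \<noteq> ?W" using bad(1) abW adj_self[OF ab(1)] by (auto simp: \<alpha>_def)
      then have "?W \<in> \<Gamma> \<Longrightarrow> F \<squnion> u \<squnion> s \<in> \<Gamma>" using cut_adj[of "F \<squnion> u \<squnion> s" a t, OF flat_cl] ab Em by auto
      moreover have "F \<squnion> u \<squnion> s \<notin> \<Gamma>" using good_not_cut[OF goodB[OF uv(1) st(1) good4(3)] F2(4)[OF uv(1) st(1)]] .
      ultimately show ?thesis using W by (auto simp: good_def)
    qed
    let ?Za = "?P \<squnion> u \<squnion> t" and ?Zb = "?Q \<squnion> u \<squnion> s"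
    have gZ: "good ?Za" "good ?Zb" using goodA goodB uv st good4 by auto
    show ?thesis
    proof (cases "v \<in> ?W")
      case False
      have aZ: "a \<in> ?P \<squnion> x \<squnion> y" "b \<in> ?Q \<squnion> x \<squnion> y" if "x \<in> ?U" "y \<in> ?V" for x y
        using TP(11)[OF that] TQ(11)[OF that] adj_self[OF ab(1), of F] adj_self[OF ab(2), of F] by auto
      have FutW: "F \<squnion> u \<squnion> t \<subseteq> ?W" using adj_least[OF flat_cl WF(3) Fus(2)] .
      have eZa: "edge ?Za ?W"
      proof (rule edgeI[OF F2(1,2)[OF uv(1) st(2)] TP(1)[OF uv(1) st(2)] W(1) TQ(1)[OF uv(1) st(2)] F2(3)[OF uv(1) st(2)] FutW F2(4)[OF uv(1) st(2)]])
        show "?Za \<noteq> ?W" "?W \<noteq> ?Q \<squnion> u \<squnion> t" using aZ[OF uv(1) st(2)] abW by metis+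
      qed (rule distinctAB[OF uv(1) st(2) uv(1) st(2)])
      have eZb: "edge ?Zb ?W"
      proof (rule edgeI[OF F2(1,2)[OF uv(1) st(1)] TQ(1)[OF uv(1) st(1)] W(1) TP(1)[OF uv(1) st(1)] F2(4)[OF uv(1) st(1)] Fus(1) F2(3)[OF uv(1) st(1)]])
        show "?Zb \<noteq> ?W" "?W \<noteq> ?P \<squnion> u \<squnion> s" using aZ[OF uv(1) st(1)] abW by metis+
      qed (rule distinctAB[OF uv(1) st(1) uv(1) st(1), symmetric])
      have vFst: "v \<in> E - F \<squnion> s \<squnion> t" using Fst uY Em by auto
      have V3: "hyp (F \<squnion> s \<squnion> t \<squnion> v)" "F \<squnion> s \<squnion> t \<subseteq> F \<squnion> s \<squnion> t \<squnion> v" "v \<in> F \<squnion> s \<squnion> t \<squnion> v"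
        using hyp_adj[OF Fst(1,2) vFst] adj_superset[OF cl_ground] adj_self Em by auto
      have eYW: "edge Y ?W"
        by (rule edgeI[OF Fst(1,2) h(2) W(1) V3(1) Fst(3) W(2) V3(2)]) (use WY V3(3) False uY in metis)+
      have eX: "edge X ?Za" "edge ?Za Y" "edge X ?Zb" "edge ?Zb Y" using edges uv st by auto
      have t1: "tri ?Za ?W Y"
        by (rule tri_plane[OF F3[OF D(4)] Fsub[OF flat_cl FA(1)[OF uv(1) st(2)] TP(13)[OF uv(1) st(2)]] WF(5) Fs(2) gZ(1) gW g(2) eZa eX(2) edge_sym[OF eYW]])
      have t2: "tri ?Zb ?W Y"
        by (rule tri_plane[OF F3[OF D(3)] Fsub[OF flat_cl FA(2)[OF uv(1) st(1)] TQ(13)[OF uv(1) st(1)]] WF(4) Fs(1) gZ(2) gW g(2) eZb eX(4) edge_sym[OF eYW]])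
      \<comment> \<open>The quadrangle \<open>X\<close>, \<open>?Za\<close>, \<open>?W\<close>,
        \<open>?Zb\<close> lies in the plane of \<open>M/(F \<squnion> u)\<close>, with corners
        \<open>a\<close>, \<open>t\<close>, \<open>s\<close>, \<open>b\<close>. The rest of the
        comparison consists of the triangles joining \<open>?W\<close> with \<open>Y\<close> and one
        detour.\<close>
      let ?G = "F \<squnion> u"
      have G: "?G \<subseteq> E" using cl_ground .
      have cle: "cl (?G \<union> {x, y}) = ?G \<squnion> x \<squnion> y" if "x \<in> E" for x y using adj_adj[OF G that, of y] by simp
      have H12: "cl (?G \<union> {b, a}) = X"
      proof -
        have "?G \<squnion> b \<squnion> a = ?P \<squnion> u \<squnion> b"
          using adj_commute[OF G ab(2,1)] adj_commute[OF FE ab(1) Em(1)] by simp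
        also have "\<dots> = X"
          using hyp_adj_eq[OF TP(7,8)[OF uv(1) st(1)] _ h(1) TP(9)[OF uv(1) st(1)], of b] bn(1)[OF D(1)] FD D' by auto
        finally show ?thesis using cle ab by simp
      qed
      have H24: "cl (?G \<union> {a, t}) = ?Za" using cle[OF ab(1)] adj_commute[OF FE ab(1) Em(1)] by simp
      have H34: "cl (?G \<union> {s, t}) = ?W" using cle[OF Em(3)] by simp
      have H13: "cl (?G \<union> {b, s}) = ?Zb" using cle[OF ab(2)] adj_commute[OF FE ab(2) Em(1)] by simp
      have spn: "r (?G \<union> {x, y, z}) = r E" if "cl (?G \<union> {x, y}) = H" "hyp H" "z \<in> E - H" for x y z H
      proof -
        have "r (insert z (?G \<union> {x, y})) = r (?G \<union> {x, y}) + 1" using rank_insert[of z "?G \<union> {x, y}"] that by auto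
        moreover have "r (?G \<union> {x, y}) + 1 = r E" using that rank_cl[of "?G \<union> {x, y}"] by (simp add: hyp_def)
        ultimately show ?thesis by (simp add: insert_commute)
      qed
      have perm: "{b,s,t} = {s,t,b}" "{a,s,t} = {s,t,a}" by auto
      have sps: "r (?G \<union> {b,a,s}) = r E" "r (?G \<union> {b,a,t}) = r E" "r (?G \<union> {b,s,t}) = r E" "r (?G \<union> {a,s,t}) = r E"
        unfolding perm using spn[OF H12 h(1)] spn[OF H34 W(1)] uY abW Em ab by simp_all
      have "hm (cl (?G \<union> {b,a})) [cl (?G \<union> {a,t}), cl (?G \<union> {s,t})] [cl (?G \<union> {b,s}), cl (?G \<union> {s,t})]"
        by (rule U34_square[OF F3[OF D(1)] _ sps])
          (use ab Em g gZ gW eX eZa edge_sym[OF eZb] edge_sym[OF eX(3)] in \<open>simp_all only: H12 H24 H34 H13, simp_all\<close>)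
      then have sq: "hm X [?Za, ?W] [?Zb, ?W]" unfolding H12 H24 H34 H13 .
      have "hm X [?Za, Y] [?Za, ?W, Y]" using tri_ins[OF t1, of X "[?Za]" "[]"] g gZ eX by simp
      also have "hm X \<dots> [?Zb, ?W, Y]" using hm_suffix[OF sq, of "[Y]"] g gW edge_sym[OF eYW] by simp
      also have "hm X \<dots> [?Zb, Y]" using tri_del[OF t2, of X "[?Zb]" "[]"] g gZ eX by simp
      finally show ?thesis using reduce[OF _ uv(1) st(2) uv(1) st(1) good4(1,3)] by blast
    next
      case True
      define ee where "ee = (\<lambda>i::nat. if i = 1 then a else if i = 2 then u else if i = 3 then s else if i = 4 then b else if i = 5 then v else t)"
      \<comment> \<open>The serial pairs are \<open>a\<close>, \<open>b\<close>, then
        \<open>u\<close>, \<open>v\<close>, then \<open>s\<close>, \<open>t\<close>. A hyperplane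
        containing a whole pair is one of \<open>X\<close>, \<open>Y\<close>, \<open>?W\<close>; any
        other is a transversal and selects a cover, a point of \<open>X\<close> and a point of
        \<open>Y\<close>.\<close>
      define hh where "hh = (\<lambda>H::nat set. if 1 \<in> H \<and> 4 \<in> H then (if 2 \<in> H then X else Y) else if 2 \<in> H \<and> 5 \<in> H then ?W
        else (if 1 \<in> H then ?P else ?Q) \<squnion> (if 2 \<in> H then u else v) \<squnion> (if 3 \<in> H then s else t))"
      have ev: "ee 1 = a" "ee 2 = u" "ee 3 = s" "ee 4 = b" "ee 5 = v" "ee 6 = t" by (simp_all add: ee_def)
      have hv: "hh {1,2,4,5} = X" "hh {1,3,4,6} = Y" "hh {2,3,5,6} = ?W"
        "hh {1,2,6} = ?P \<squnion> u \<squnion> t" "hh {1,3,5} = ?P \<squnion> v \<squnion> s" "hh {2,3,4} = ?Q \<squnion> u \<squnion> s" "hh {4,5,6} = ?Q \<squnion> v \<squnion> t"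
        "hh {1,2,3} = ?P \<squnion> u \<squnion> s" "hh {1,5,6} = ?P \<squnion> v \<squnion> t" "hh {2,4,6} = ?Q \<squnion> u \<squnion> t" "hh {3,4,5} = ?Q \<squnion> v \<squnion> s"
        by (simp_all add: hh_def del: One_nat_def)
      have mA: "a \<in> ?P \<squnion> p \<squnion> q \<and> b \<notin> ?P \<squnion> p \<squnion> q \<and> (\<forall>x\<in>?U. x \<in> ?P \<squnion> p \<squnion> q \<longleftrightarrow> x \<in> ?P \<squnion> p) \<and> (\<forall>x\<in>?V. x \<in> ?P \<squnion> p \<squnion> q \<longleftrightarrow> x \<in> ?P \<squnion> q)"
        if pq: "p \<in> ?U" "q \<in> ?V" for p q
      proof (intro conjI)
        show "a \<in> ?P \<squnion> p \<squnion> q" using TP(11)[OF pq] adj_self[OF ab(1), of F] by auto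
        have "p \<in> E - D'" using pq UV by blast
        then show "b \<notin> ?P \<squnion> p \<squnion> q" using TP(2)[OF pq] bn(1)[of p] FD D' by blast
      qed (use TP(2,3)[OF pq] in blast)+
      have mB: "b \<in> ?Q \<squnion> p \<squnion> q \<and> a \<notin> ?Q \<squnion> p \<squnion> q \<and> (\<forall>x\<in>?U. x \<in> ?Q \<squnion> p \<squnion> q \<longleftrightarrow> x \<in> ?Q \<squnion> p) \<and> (\<forall>x\<in>?V. x \<in> ?Q \<squnion> p \<squnion> q \<longleftrightarrow> x \<in> ?Q \<squnion> q)"
        if pq: "p \<in> ?U" "q \<in> ?V" for p q
      proof (intro conjI)
        show "b \<in> ?Q \<squnion> p \<squnion> q" using TQ(11)[OF pq] adj_self[OF ab(2), of F] by auto
        have "p \<in> E - D'" using pq UV by blast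
        then show "a \<notin> ?Q \<squnion> p \<squnion> q" using TQ(2)[OF pq] bn(2)[of p] FD D' by blast
      qed (use TQ(2,3)[OF pq] in blast)+
      have selfs: "x \<in> G \<squnion> x" if "x \<in> E" for x G using adj_self that .
      note mems = mA[OF uv(1) st(1)] mA[OF uv(1) st(2)] mA[OF uv(2) st(1)] mA[OF uv(2) st(2)]
        mB[OF uv(1) st(1)] mB[OF uv(1) st(2)] mB[OF uv(2) st(1)] mB[OF uv(2) st(2)]
      have mXY: "a \<in> X" "b \<in> X" "a \<in> Y" "b \<in> Y" "u \<in> X" "v \<in> X" "s \<in> Y" "t \<in> Y" using FD D' uv st by auto
      have dec: "decomposable M (cl (F \<union> {x, y}))" if "F \<squnion> x \<squnion> y = N" "\<not> conn N" "x \<in> E" for x y N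
      proof -
        have "cl (F \<union> {x, y}) = N" using adj_adj[OF FE that(3), of y] that(1) by simp
        then show ?thesis using flat_cl[of "F \<union> {x, y}"] that(2) indecomposable_conn unfolding decomposable_def indecomposable_def by auto
      qed
      \<comment> \<open>A connected quotient would require a point off \<open>X\<close> and
        \<open>?W\<close>. Off \<open>X\<close> there are only points of \<open>Y\<close>, and those
        lie in \<open>F \<squnion> s\<close> or \<open>F \<squnion> t\<close>, both inside
        \<open>?W\<close>.\<close>
      have nuv: "\<not> conn (F \<squnion> u \<squnion> v)"
      proof
        assume "conn (F \<squnion> u \<squnion> v)"
        moreover have "F \<squnion> u \<squnion> v \<subseteq> ?W" using adj_least[OF flat_cl WF(3) True] .
        ultimately obtain z where z: "z \<in> E" "z \<notin> X" "z \<notin> ?W" using conn_third[OF _ Fuv(2) h(1) W(1) Fuv(3)] by auto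
        then have "z \<in> ?V" using cover D' by auto
        then show False using coverV WF z by blast
      qed
      have nst: "\<not> conn (F \<squnion> s \<squnion> t)"
      proof
        assume "conn (F \<squnion> s \<squnion> t)"
        then obtain z where z: "z \<in> E" "z \<notin> Y" "z \<notin> ?W" using conn_third[OF _ Fst(2) h(2) W(1) Fst(3) W(2)] by auto
        then have "z \<in> ?U" using cover D' by auto
        moreover have "F \<squnion> v \<subseteq> ?W" using Fsub[OF flat_cl WF(1) True] .
        ultimately show False using coverU WF z by blast
      qed
      have "elem (hh {1,2,4,5}) [hh {1,2,6}, hh {1,3,4,6}, hh {4,5,6}, hh {1,2,4,5}]"
      proof (rule elem_MK23[OF F])
        show "ee ` {1..6} \<subseteq> E - F" unfolding interval_nat using ab a bF Fx D ev by simp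
        show "hyp (hh H) \<and> F \<subseteq> hh H" if "H \<in> MK23_planes \<union> MK23_good \<union> MK23_bad" for H
          using that uv st unfolding MK23_planes_def MK23_good_def MK23_bad_def
          by (elim UnE insertE emptyE) (simp_all only: hv h FX W WF TP(1) TQ(1) FA simp_thms)
        show "hh H \<notin> \<Gamma>" if "H \<in> MK23_planes \<union> MK23_good" for H
          using that g gW good4 unfolding MK23_planes_def MK23_good_def good_def \<alpha>_def \<beta>_def
          by (elim UnE insertE emptyE) (simp_all only: hv simp_thms)
        show "hh H \<in> \<Gamma>" if "H \<in> MK23_bad" for H
          using that bad unfolding MK23_bad_def \<alpha>_def \<beta>_def by (elim UnE insertE emptyE) (simp_all only: hv simp_thms)
        show "decomposable M (cl (F \<union> {ee 1, ee 4}))" unfolding ev by (rule dec[OF refl assms(14) ab(1)])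
        show "decomposable M (cl (F \<union> {ee 2, ee 5}))" unfolding ev by (rule dec[OF refl nuv Em(1)])
        show "decomposable M (cl (F \<union> {ee 3, ee 6}))" unfolding ev by (rule dec[OF refl nst Em(3)])
        show "ee i \<in> hh H \<longleftrightarrow> i \<in> H" if "H \<in> MK23_planes \<union> MK23_good \<union> MK23_bad" "i \<in> {1..6}" for H i
        proof -
          have i: "i = 1 \<or> i = 2 \<or> i = 3 \<or> i = 4 \<or> i = 5 \<or> i = 6" using that(2) unfolding interval_nat by simp
          have *: "ee j \<in> hh K \<longleftrightarrow> j \<in> K" if "(a \<in> hh K \<longleftrightarrow> 1 \<in> K) \<and> (u \<in> hh K \<longleftrightarrow> 2 \<in> K) \<and> (s \<in> hh K \<longleftrightarrow> 3 \<in> K) \<and> (b \<in> hh K \<longleftrightarrow> 4 \<in> K) \<and> (v \<in> hh K \<longleftrightarrow> 5 \<in> K) \<and> (t \<in> hh K \<longleftrightarrow> 6 \<in> K)"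
            "j = 1 \<or> j = 2 \<or> j = 3 \<or> j = 4 \<or> j = 5 \<or> j = 6" for j K
            using that(2) by (elim disjE) (simp_all only: ev that(1))
          show ?thesis
          proof (rule *[OF _ i])
            have pl: "(a \<in> hh K \<longleftrightarrow> 1 \<in> K) \<and> (u \<in> hh K \<longleftrightarrow> 2 \<in> K) \<and> (s \<in> hh K \<longleftrightarrow> 3 \<in> K) \<and> (b \<in> hh K \<longleftrightarrow> 4 \<in> K) \<and> (v \<in> hh K \<longleftrightarrow> 5 \<in> K) \<and> (t \<in> hh K \<longleftrightarrow> 6 \<in> K)"
              if "K \<in> MK23_planes" for K
              using that unfolding MK23_planes_def
              by (elim insertE emptyE) (simp_all add: hv mXY uY W WF Fus abW True del: One_nat_def)
            have th: "(a \<in> hh K \<longleftrightarrow> 1 \<in> K) \<and> (u \<in> hh K \<longleftrightarrow> 2 \<in> K) \<and> (s \<in> hh K \<longleftrightarrow> 3 \<in> K) \<and> (b \<in> hh K \<longleftrightarrow> 4 \<in> K) \<and> (v \<in> hh K \<longleftrightarrow> 5 \<in> K) \<and> (t \<in> hh K \<longleftrightarrow> 6 \<in> K)"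
              if "K \<in> MK23_good \<union> MK23_bad" for K
              using that mems nP nQ selfs[OF Em(1)] selfs[OF Em(2)] selfs[OF Em(3)] selfs[OF Em(4)] uv st
              unfolding MK23_good_def MK23_bad_def
              by (elim UnE insertE emptyE) (simp_all add: hv del: One_nat_def)
            show "(a \<in> hh H \<longleftrightarrow> 1 \<in> H) \<and> (u \<in> hh H \<longleftrightarrow> 2 \<in> H) \<and> (s \<in> hh H \<longleftrightarrow> 3 \<in> H) \<and> (b \<in> hh H \<longleftrightarrow> 4 \<in> H) \<and> (v \<in> hh H \<longleftrightarrow> 5 \<in> H) \<and> (t \<in> hh H \<longleftrightarrow> 6 \<in> H)"
              using pl th \<open>H \<in> _\<close> by blast
          qed
        qed
      qed
      then have el: "elem X ([?Za, Y, ?Q \<squnion> v \<squnion> t] @ [X])" unfolding hv by simp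
      have gB: "good (?Q \<squnion> v \<squnion> t)" using goodB uv st good4 by auto
      note e1 = edges[OF uv(1) st(2)] and e2 = edges[OF uv(2) st(2)]
      have "hm X ([?Za, Y, ?Q \<squnion> v \<squnion> t] @ [X]) []"
        by (rule elem_hm[OF el]) (use g gZ gB e1 e2 edge_sym[OF e2(3)] edge_sym[OF e2(4)] in simp)
      then have "hm X [?Za, Y] [?Q \<squnion> v \<squnion> t, Y]"
        using hm_loopI[of X "[?Za, Y]" "[?Q \<squnion> v \<squnion> t, Y]"] g gB e2 by simp
      then show ?thesis using reduce[OF _ uv(1) st(2) uv(2) st(2) good4(1,4)] by blast
    qed
  qed
qed

text \<open>In general both covers are found below \<open>X\<close>. If \<open>X\<close> itself
  covers \<open>G\<close>, the corank is 2, and of two further hyperplanes above \<open>G\<close> at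
  least one is outside \<Gamma>. Good hyperplanes above the covers are needed as intermediate terms
  of a walk.\<close>

lemma two_good_covers:
  assumes "conn G" "r G + 2 \<le> r E" "good X" "G \<subseteq> X"
  shows "\<exists>c1 c2. c1 \<in> E - G \<and> c2 \<in> E - G \<squnion> c1 \<and> conn (G \<squnion> c1) \<and> conn (G \<squnion> c2) \<and>
    (\<exists>W. good W \<and> G \<squnion> c1 \<subseteq> W) \<and> (\<exists>W. good W \<and> G \<squnion> c2 \<subseteq> W)"
proof -
  have h: "hyp X" "X \<subseteq> E" "flat X" using assms good_hyp good_flat by auto
  have G: "flat G" "G \<subseteq> E" "G \<notin> \<Gamma>" using assms conn_flat flat_ground good_not_cut by auto
  have "\<not> X \<subseteq> G" using assms h rank_mono[of X G] by (auto simp: hyp_def)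
  then obtain c1 where c1: "c1 \<in> X - G" "conn (G \<squnion> c1)"
    using conn_cover[OF assms(1) conn_hyp[OF h(1)] assms(4) G(1)] by auto
  have c1E: "c1 \<in> E - G" and s1: "G \<squnion> c1 \<subseteq> X" using c1 h adj_least assms by auto
  have r1: "r (G \<squnion> c1) = r G + 1" using adj_rank G c1E by auto
  show ?thesis
  proof (cases "X \<subseteq> G \<squnion> c1")
    case False
    then obtain c2 where c2: "c2 \<in> X - G \<squnion> c1" "conn (G \<squnion> c2)"
      using conn_cover[OF assms(1) conn_hyp[OF h(1)] assms(4) flat_cl, of "insert c1 G"] adj_superset G by auto
    have "G \<squnion> c2 \<subseteq> X" using c2 h adj_least assms by auto
    then show ?thesis using c1 c2 c1E s1 h assms(3) by blast
  next
    case True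
    then have X: "X = G \<squnion> c1" using s1 by auto
    then have rG: "r G + 2 = r E" using h r1 by (auto simp: hyp_def)
    obtain z1 where z1: "z1 \<in> E" "z1 \<notin> X" using h hyp_flat(3)[OF h(1)] by auto
    have z1G: "z1 \<in> E - G" using z1 assms by auto
    have H1: "hyp (G \<squnion> z1)" "G \<subseteq> G \<squnion> z1" using hyp_adj[OF G(1) rG z1G] adj_superset G by auto
    obtain z2 where z2: "z2 \<in> E" "z2 \<notin> X" "z2 \<notin> G \<squnion> z1" using conn_third[OF assms(1) rG h(1) H1(1) assms(4) H1(2)] by auto
    have z2G: "z2 \<in> E - G" using z2 assms by auto
    have "G \<squnion> z1 \<noteq> G \<squnion> z2" using adj_self[OF z2(1), of G] z2 by auto
    then have "\<exists>z\<in>{z1, z2}. G \<squnion> z \<notin> \<Gamma>" using cut_adj[OF G(1), of z1 z2] z1 z2 G by auto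
    then obtain z where z: "z \<in> E - G" "z \<notin> X" "G \<squnion> z \<notin> \<Gamma>" using z1 z2 z1G z2G by auto
    have "hyp (G \<squnion> z)" using hyp_adj[OF G(1) rG z(1)] .
    then have "good (G \<squnion> z)" "conn (G \<squnion> z)" using z conn_hyp by (auto simp: good_def)
    then show ?thesis using c1 c1E z X assms(3) by blast
  qed
qed

text \<open>\<open>F\<close> is only a flat here, because the induction passes to
  \<open>F \<squnion> c\<close>, whose quotient may be disconnected. For a decomposable join in
  corank at least 5, the components \<open>K1\<close> and \<open>K2\<close> containing the
  complements of \<open>X\<close> and \<open>Y\<close> are considered. A suitable \<open>c\<close>
  comes from one of them if its rank is at least 2, and from a third component otherwise.\<close>

lemma sim_all:
  assumes sc: "\<And>D. conn D \<Longrightarrow> r E - r D < n \<Longrightarrow> sc D"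
  shows "flat F \<Longrightarrow> r E - r F \<le> n \<Longrightarrow> a \<in> E - F \<Longrightarrow> b \<in> E - F \<squnion> a \<Longrightarrow> conn (F \<squnion> a) \<Longrightarrow> conn (F \<squnion> b)
    \<Longrightarrow> good X \<Longrightarrow> good Y \<Longrightarrow> F \<squnion> a \<squnion> b \<subseteq> X \<Longrightarrow> F \<squnion> a \<squnion> b \<subseteq> Y \<Longrightarrow> sim (F \<squnion> a) (F \<squnion> b) X Y"
proof (induction "r E - r F" arbitrary: F a b X Y rule: less_induct)
  case less
  let ?P = "F \<squnion> a" and ?Q = "F \<squnion> b" and ?D = "F \<squnion> a \<squnion> b"
  note F = less.prems(1) and a = less.prems(3) and b = less.prems(4) and cP = less.prems(5) and cQ = less.prems(6)
    and g = less.prems(7,8) and DX = less.prems(9,10)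
  have FE: "F \<subseteq> E" using F flat_ground by auto
  have ab: "a \<in> E" "b \<in> E" using a b by auto
  have bF: "b \<in> E - F" using b adj_superset[OF FE] by auto
  have h: "hyp X" "hyp Y" using g good_hyp by auto
  have sub: "X \<subseteq> E" "Y \<subseteq> E" using hyp_flat h by auto
  have DQ: "?D = ?Q \<squnion> a" using adj_commute FE ab by auto
  have D: "flat ?D" "?D \<subseteq> E" "?P \<subseteq> ?D" "?Q \<subseteq> ?D"
  proof -
    show "flat ?D" "?D \<subseteq> E" using flat_cl cl_ground by auto
    show "?P \<subseteq> ?D" using adj_superset cl_ground by auto
    show "?Q \<subseteq> ?D" unfolding DQ using adj_superset cl_ground by auto
  qed
  have rk: "r ?P = r F + 1" "r ?Q = r F + 1" "r ?D = r F + 2" using adj_rank[OF F a] adj_rank[OF F bF] adj_rank[OF flat_cl b] by auto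
  have "r ?D \<le> r X" using DX by (intro rank_mono)
  then have n3: "r F + 3 \<le> r E" using rk h by (auto simp: hyp_def)
  have sP: "sc ?P" "sc ?Q" using sc cP cQ rk n3 less.prems(2) by auto
  have PX: "?P \<subseteq> X" "?Q \<subseteq> X" "?P \<subseteq> Y" "?Q \<subseteq> Y" using D DX by auto
  \<comment> \<open>The walks are moved above \<open>?P \<squnion> c\<close> and
    \<open>?Q \<squnion> c\<close>, which are covers of \<open>F \<squnion> c\<close>; this needs
    \<open>c\<close> in both end hyperplanes.\<close>
  have step: "sim ?P ?Q W Z"
    if c: "c \<in> E - ?D" "conn (?P \<squnion> c)" "conn (?Q \<squnion> c)" and WZ: "good W" "good Z" "?D \<subseteq> W" "?D \<subseteq> Z" "c \<in> W" "c \<in> Z" for c W Z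
  proof -
    have cE: "c \<in> E - F" "c \<in> E" "c \<notin> ?P" "c \<notin> ?Q" using c D adj_superset[OF FE, of a] by auto
    have a': "a \<in> E - F \<squnion> c" using adj_exchange[OF F, of a c] a cE adj_self[of c F] by blast
    have com: "F \<squnion> c \<squnion> a = ?P \<squnion> c" "F \<squnion> c \<squnion> b = ?Q \<squnion> c" using adj_commute FE cE ab by auto
    have b': "b \<in> E - F \<squnion> c \<squnion> a" unfolding com using adj_exchange[of ?P b c, OF flat_cl] b cE(2) adj_self[of c ?P] c(1) by blast
    have lt: "r E - r (F \<squnion> c) < r E - r F" using adj_rank[OF F cE(1)] n3 by auto
    have fl: "flat W" "flat Z" using WZ good_flat by auto
    have sW: "F \<squnion> c \<squnion> a \<subseteq> W" "F \<squnion> c \<squnion> a \<subseteq> Z" "F \<squnion> c \<squnion> b \<subseteq> W" "F \<squnion> c \<squnion> b \<subseteq> Z"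
      unfolding com
      using adj_least[OF fl(1) subset_trans[OF D(3) WZ(3)] WZ(5)] adj_least[OF fl(2) subset_trans[OF D(3) WZ(4)] WZ(6)]
        adj_least[OF fl(1) subset_trans[OF D(4) WZ(3)] WZ(5)] adj_least[OF fl(2) subset_trans[OF D(4) WZ(4)] WZ(6)]
      by blast+
    have inb: "b \<in> W" "b \<in> Z" using WZ(3,4) adj_self[OF ab(2), of ?P] by blast+
    have "sim (F \<squnion> c \<squnion> a) (F \<squnion> c \<squnion> b) W Z"
      by (rule less.hyps[OF lt flat_cl _ a' b' _ _ WZ(1,2)])
        (use lt less.prems(2) com c adj_least[OF fl(1) sW(1) inb(1)] adj_least[OF fl(2) sW(2) inb(2)] in simp_all)
    moreover have "?P \<subseteq> ?P \<squnion> c" "?Q \<subseteq> ?Q \<squnion> c" using adj_superset cl_ground by auto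
    ultimately show ?thesis using sim_mono[of "?P \<squnion> c" "?Q \<squnion> c"] com c sP WZ sW by auto
  qed
  \<comment> \<open>\<open>c\<close> lies in \<open>K\<close>, hence in \<open>Z\<close>, but in
    general not in \<open>U\<close>. So the comparison first goes from \<open>U\<close> to some
    \<open>W\<close> through \<open>c\<close> above the connected flat \<open>E - K\<close>, which
    contains both covers, and then from \<open>W\<close> to \<open>Z\<close> by
    \<open>step\<close>.\<close>
  have big: "sim ?P ?Q U Z"
    if U: "good U" "good Z" "?D \<subseteq> U" "?D \<subseteq> Z" and K: "sep ?D K" "E - U \<subseteq> K" "conn (E - K)" "K \<subseteq> Z" "r (E - K) + 2 \<le> r E" for U Z K
  proof -
    let ?G = "E - K"
    have KE: "K \<subseteq> E - ?D" using K by (simp add: sep_def)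
    have GU: "?G \<subseteq> U" using K good_flat U by auto
    obtain c1 c2 where c12: "c1 \<in> E - ?G" "c2 \<in> E - ?G \<squnion> c1" "conn (?G \<squnion> c1)" "conn (?G \<squnion> c2)"
      "\<exists>W. good W \<and> ?G \<squnion> c1 \<subseteq> W" "\<exists>W. good W \<and> ?G \<squnion> c2 \<subseteq> W"
      using two_good_covers[OF K(3,5) U(1) GU] by blast
    have "?G \<subseteq> ?G \<squnion> c1" by (rule adj_superset) auto
    then have cK: "c1 \<in> K" "c2 \<in> K" "c2 \<notin> ?G \<squnion> c1" using c12 by auto
    obtain c where c: "c \<in> K" "c \<in> ?G \<squnion> c1 \<or> c \<in> ?G \<squnion> c2" "conn (?P \<squnion> c)" "conn (?Q \<squnion> c)"
      using common_conn_cover[OF F a b cP cQ K(1,3) cK(1,2) c12(3,4) cK(3)] by blast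
    obtain W where W: "good W" "?G \<subseteq> W" "c \<in> W"
    proof -
      have "?G \<subseteq> ?G \<squnion> c1" "?G \<subseteq> ?G \<squnion> c2" using adj_superset[of ?G c1] adj_superset[of ?G c2] by blast+
      then show ?thesis using that c(2) c12(5,6) by blast
    qed
    have DG: "?D \<subseteq> ?G" using KE D by auto
    have "sim ?P ?Q U W" by (rule sim_conn[OF K(3) _ _ GU W(2) U(1) W(1) sP]) (use DG D in auto)
    moreover have "sim ?P ?Q W Z" by (rule step[of c]) (use c W U K KE DG in auto)
    ultimately show ?thesis
      using sim_trans[of ?P ?Q U W Z] cP cQ sP U W DG D by (meson subset_trans)
  qed
  show ?case
  proof (cases "X = Y \<or> conn ?D")
    case True
    then show ?thesis
    proof
      assume "X = Y"
      then show ?thesis using sim_conn[OF conn_hyp[OF h(1)], of ?P ?Q X Y] PX g sP by auto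
    next
      assume "conn ?D"
      then show ?thesis using sim_conn[of ?D ?P ?Q X Y] D DX g sP by auto
    qed
  next
    case False
    then have XY: "X \<noteq> Y" and nD: "\<not> conn ?D" by auto
    have n4: "r F + 4 \<le> r E"
    proof (rule ccontr)
      assume "\<not> ?thesis"
      then have "hyp ?D" using n3 rk D by (auto simp: hyp_def)
      then show False using hyp_eq h DX XY by metis
    qed
    show ?thesis
    proof (cases "r F + 4 = r E")
      case True
      show ?thesis by (rule sim_corank4[OF F True a b cP cQ sP g XY DX nD])
    next
      case False
      then have n5: "r F + 5 \<le> r E" using n4 by auto
      obtain K1 where K1: "sep ?D K1" "E - X \<subseteq> K1" "conn (E - K1)" "\<And>K. sep ?D K \<Longrightarrow> E - X \<subseteq> K \<Longrightarrow> K1 \<subseteq> K"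
        using hyp_component[OF D(1) h(1) DX(1)] by auto
      obtain K2 where K2: "sep ?D K2" "E - Y \<subseteq> K2" "conn (E - K2)" "\<And>K. sep ?D K \<Longrightarrow> E - Y \<subseteq> K \<Longrightarrow> K2 \<subseteq> K"
        using hyp_component[OF D(1) h(2) DX(2)] by auto
      have KE: "K1 \<subseteq> E - ?D" "K2 \<subseteq> E - ?D" using K1 K2 by (auto simp: sep_def)
      show ?thesis
      proof (cases "K1 = K2")
        case True
        show ?thesis by (rule sim_conn[OF K1(3) _ _ _ _ g sP]) (use True K1 K2 KE D sub in auto)
      next
        case neK: False
        have dis: "K1 \<inter> K2 = {}"
        proof (cases "E - X \<subseteq> K2")
          case True
          then have s: "K1 \<subseteq> K2" using K1(4) K2(1) by auto
          have "\<not> E - Y \<subseteq> K1" using K2(4)[OF K1(1)] s neK by auto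
          then have "(E - Y) \<inter> K1 = {}" using hyp_sep[OF h(2) DX(2) K1(1)] by auto
          then have "E - Y \<subseteq> K2 - K1" using K2 by auto
          then have "K2 \<subseteq> K2 - K1" using K2(4)[OF sep_Diff[OF D(2) K2(1) K1(1)]] by auto
          then show ?thesis by auto
        next
          case False
          then have "(E - X) \<inter> K2 = {}" using hyp_sep[OF h(1) DX(1) K2(1)] by auto
          then have "E - X \<subseteq> K1 - K2" using K1 by auto
          then have "K1 \<subseteq> K1 - K2" using K1(4)[OF sep_Diff[OF D(2) K1(1) K2(1)]] by auto
          then show ?thesis by auto
        qed
        have K12: "K1 \<subseteq> Y" "K2 \<subseteq> X" using dis K1 K2 KE by auto
        consider "r (E - K1) + 2 \<le> r E" | "r (E - K2) + 2 \<le> r E" | "r E \<le> r (E - K1) + 1" "r E \<le> r (E - K2) + 1" by linarith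
        then show ?thesis
        proof cases
          case 1
          show ?thesis by (rule big[OF g DX K1(1,2,3) K12(1) 1])
        next
          case 2
          show ?thesis by (rule sim_rev, rule big[OF g(2,1) DX(2,1) K2(1,2,3) K12(2) 2])
        next
          case 3
          \<comment> \<open>\<open>K1\<close> and \<open>K2\<close> have rank at most 1 each, while
            the quotient by \<open>?D\<close> has rank at least 3. So there is a further component
            \<open>K\<close>, and it lies in both \<open>X\<close> and \<open>Y\<close>.\<close>
          have s1: "r (K1 \<union> ?D) \<le> r ?D + 1" "r (K2 \<union> ?D) \<le> r ?D + 1" using 3 K1(1) K2(1) by (auto simp: sep_def)
          have "r (K1 \<union> K2 \<union> ?D) + r ?D \<le> r (K1 \<union> ?D) + r (K2 \<union> ?D)" by (rule rank_submod') auto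
          then have "r (K1 \<union> K2 \<union> ?D) < r E" using s1 rk n5 by linarith
          then have "E - ?D - K1 - K2 \<noteq> {}"
            using D KE by (metis Diff_eq_empty_iff Un_Diff_cancel Un_commute le_sup_iff not_less rank_mono subset_trans sup.cobounded1 sup_ge1 Diff_subset_conv)
          moreover have "sep ?D (E - ?D - K1 - K2)" using sep_Diff[OF D(2) sep_Diff[OF D(2) sep_full[OF D(2)] K1(1)] K2(1)] .
          ultimately have ex: "sep ?D (E - ?D - K1 - K2) \<and> E - ?D - K1 - K2 \<noteq> {} \<and> E - ?D - K1 - K2 \<subseteq> E - ?D - K1 - K2" by simp
          define K where "K = arg_min card (\<lambda>K. sep ?D K \<and> K \<noteq> {} \<and> K \<subseteq> E - ?D - K1 - K2)"
          have K: "sep ?D K \<and> K \<noteq> {} \<and> K \<subseteq> E - ?D - K1 - K2"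
            using arg_min_natI[of "\<lambda>K. sep ?D K \<and> K \<noteq> {} \<and> K \<subseteq> E - ?D - K1 - K2", OF ex] unfolding K_def .
          have Kmin: "card K \<le> card Z" if "sep ?D Z \<and> Z \<noteq> {} \<and> Z \<subseteq> E - ?D - K1 - K2" for Z
            using arg_min_nat_le[of "\<lambda>K. sep ?D K \<and> K \<noteq> {} \<and> K \<subseteq> E - ?D - K1 - K2", OF that] unfolding K_def .
          have finK: "finite K" using finite_subset[of K E] K finite_ground by blast
          have cG: "conn (E - K)"
          proof (rule component_conn[OF D(1)])
            show "sep ?D K" using K by simp
            fix Z assume Z: "sep ?D Z" "Z \<subseteq> K"
            show "Z = {} \<or> Z = K"
            proof (rule ccontr)
              assume n: "\<not> ?thesis"
              then have "card K \<le> card Z" using K Kmin[of Z] Z by blast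
              then show False using n card_seteq[OF finK Z(2)] by auto
            qed
          qed
          let ?G = "E - K"
          have KXY: "K \<subseteq> X" "K \<subseteq> Y" using K K1 K2 by blast+
          have KED: "K \<subseteq> E - ?D" using K by blast
          have "\<exists>c\<in>K. conn (?P \<squnion> c) \<and> conn (?Q \<squnion> c)"
          proof (cases "r ?G + 2 \<le> r E")
            case True
            have Gfl: "flat ?G" "?G \<subseteq> E" using cG conn_flat by auto
            have GE: "\<not> E \<subseteq> ?G" using K KED by auto
            obtain c1 where c1: "c1 \<in> E - ?G" "conn (?G \<squnion> c1)" using conn_cover[OF cG conn_sep_ground Gfl(2,1) order_refl GE] by auto
            have "r (?G \<squnion> c1) = r ?G + 1" using adj_rank[OF Gfl(1) c1(1)] .
            then have "\<not> E \<subseteq> ?G \<squnion> c1" using True rank_mono[of E "?G \<squnion> c1"] by auto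
            then obtain c2 where c2: "c2 \<in> E - ?G \<squnion> c1" "conn (?G \<squnion> c2)"
              using conn_cover[OF cG conn_sep_ground Gfl(2) flat_cl adj_superset[OF Gfl(2)], of c1] by auto
            have "c2 \<in> K" "c1 \<in> K" using c1 c2 adj_superset[OF Gfl(2), of c1] by auto
            then show ?thesis
              using common_conn_cover[OF F a b cP cQ conjunct1[OF K] cG _ _ c1(2) c2(2)] c2(1) by blast
          next
            \<comment> \<open>\<open>K\<close> has rank 1, so \<open>c\<close> and \<open>?G\<close>
              together span \<open>E\<close>. A disconnected quotient would leave something outside
              that span, by the first conclusion of \<open>not_conn_adj\<close>.\<close>
            case False
            obtain c where c: "c \<in> K" using K by auto
            have cE: "c \<in> E - ?G" using c KED by auto
            have "r (?G \<squnion> c) = r ?G + 1" using adj_rank[OF conn_flat[OF cG] cE] .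
            then have "E = ?G \<squnion> c" using flat_eq[OF flat_cl cl_ground order_refl] False by auto
            then have GE: "?G \<squnion> c = E" by simp
            have "conn (?P \<squnion> c)" using not_conn_adj(1)[OF cP b _ c] K GE conn_sep_ground by auto
            moreover have "a \<in> E - ?Q" using adj_exchange[OF F, of a b] a b ab adj_self[of b F] by blast
            then have "conn (?Q \<squnion> c)" using not_conn_adj(1)[OF cQ _ _ c, of a] K GE conn_sep_ground DQ by auto
            ultimately show ?thesis using c by auto
          qed
          then obtain c where "c \<in> K" "conn (?P \<squnion> c)" "conn (?Q \<squnion> c)" by auto
          then show ?thesis using step[of c X Y] KXY KED g DX by auto
        qed
      qed
    qed
  qed
qed

text \<open>Hyperplanes above \<open>F\<close> are pairwise adjacent and all triangles among them
  contract, so every walk shrinks to a single edge or to nothing.\<close>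

lemma sc_line:
  assumes "conn F" "r F + 2 = r E"
  shows "sc F"
proof -
  have F: "flat F" using assms conn_flat by auto
  have "hm X p (if fin X p = X then [] else [fin X p])" if "walk F X p" for X p
    using that
  proof (induction p arbitrary: X)
    case Nil
    then show ?case by (auto intro!: hm_refl)
  next
    case (Cons Y p)
    define Z where "Z = fin Y p"
    have ZX: "fin X (Y # p) = Z" by (simp add: Z_def)
    have w: "good X" "F \<subseteq> X" "edge X Y" "walk F Y p" using Cons.prems by auto
    then have Y: "good Y" "F \<subseteq> Y" "X \<noteq> Y" using walk_start by (auto simp: edge_def)
    have Z: "good Z" "F \<subseteq> Z" using walk_fin[OF w(4)] by (auto simp: Z_def)
    have "hm Y p (if Z = Y then [] else [Z])" unfolding Z_def by (rule Cons.IH[OF w(4)])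
    then have "hm X ([Y] @ p) ([Y] @ (if Z = Y then [] else [Z]))" by (rule hm_prefix) (use w Y in auto)
    also have "hm X \<dots> (if Z = X then [] else [Z])"
    proof -
      consider "Z = Y" | "Z = X" | "Z \<noteq> X" "Z \<noteq> Y" by blast
      then show ?thesis
      proof cases
        case 1 then show ?thesis using Y w by (auto intro!: hm_refl)
      next
        case 2 then show ?thesis using Y w hm_back by auto
      next
        case 3
        then have "tri X Y Z" using tri_line[OF F assms(2)] w Y Z by auto
        then show ?thesis using 3 by (simp add: tri_def)
      qed
    qed
    finally show ?case unfolding ZX by simp
  qed
  then show ?thesis unfolding sc_def by (metis hm_sym hm_trans)
qed

section \<open>Simple connectivity\<close>

definition reach where
  "reach F e H0 X w \<longleftrightarrow> (\<exists>x W w1 w2. x \<in> E - F \<and> conn (F \<squnion> x) \<and> walk (F \<squnion> e) H0 w1 \<and> fin H0 w1 = W \<and>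
     walk (F \<squnion> x) W w2 \<and> fin W w2 = X \<and> w = w1 @ w2)"

context
  fixes F e H0
  assumes F: "conn F" and corank: "r F + 3 \<le> r E" and e: "e \<in> E - F" "conn (F \<squnion> e)" and H0: "good H0" "F \<squnion> e \<subseteq> H0"
    and sc: "\<And>D. conn D \<Longrightarrow> r F < r D \<Longrightarrow> sc D"
begin

lemma Fflat: "flat F" "F \<subseteq> E" using F conn_flat flat_ground by auto

lemma sc_cover: "x \<in> E - F \<Longrightarrow> conn (F \<squnion> x) \<Longrightarrow> sc (F \<squnion> x)"
  using sc adj_rank[OF Fflat(1)] by auto

lemma sim_cover:
  assumes "x \<in> E - F" "y \<in> E - F" "conn (F \<squnion> x)" "conn (F \<squnion> y)" "good X" "good Y"
    "F \<squnion> x \<subseteq> X" "F \<squnion> x \<subseteq> Y" "F \<squnion> y \<subseteq> X" "F \<squnion> y \<subseteq> Y"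
  shows "sim (F \<squnion> x) (F \<squnion> y) X Y"
proof (cases "y \<in> F \<squnion> x")
  case True
  then have "F \<squnion> y = F \<squnion> x" using adj_exchange[OF Fflat(1) True] assms by auto
  then show ?thesis using sc_cover[OF assms(1,3)] by (auto simp: sim_def sc_def)
next
  case False
  have y: "y \<in> X" "y \<in> Y" using adj_self[of y F] assms by auto
  show ?thesis
    by (rule sim_all[of "r E - r F", OF _ Fflat(1) order_refl])
      (use sc assms False adj_least[OF good_flat(1)[OF assms(5)] assms(7) y(1)] adj_least[OF good_flat(1)[OF assms(6)] assms(8) y(2)] in auto)
qed

lemma path_cover: "x \<in> E - F \<Longrightarrow> conn (F \<squnion> x) \<Longrightarrow> good X \<Longrightarrow> good Y \<Longrightarrow> F \<squnion> x \<subseteq> X \<Longrightarrow> F \<squnion> x \<subseteq> Y \<Longrightarrow>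
    \<exists>p. walk (F \<squnion> x) X p \<and> walk {} X p \<and> fin X p = Y"
  using path_connected[of "F \<squnion> x" X Y] walk_mono by blast

text \<open>The turning point \<open>W\<close> can be replaced by any \<open>Z\<close> above
  \<open>F \<squnion> e\<close> and \<open>F \<squnion> x\<close>, because walks from
  \<open>W\<close> to \<open>Z\<close> above these two covers are homotopic.\<close>

lemma reach_move:
  assumes x: "x \<in> E - F" "conn (F \<squnion> x)" and w: "walk (F \<squnion> e) H0 w1" "fin H0 w1 = W" "walk (F \<squnion> x) W w2" "fin W w2 = X"
    and z: "walk (F \<squnion> e) H0 z1" "fin H0 z1 = Z" "walk (F \<squnion> x) Z z2" "fin Z z2 = X"
  shows "hm H0 (w1 @ w2) (z1 @ z2)"
proof -
  have W: "good W" "F \<squnion> e \<subseteq> W" "F \<squnion> x \<subseteq> W" using walk_fin[OF w(1)] walk_start[OF w(3)] w by auto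
  have Z: "good Z" "F \<squnion> e \<subseteq> Z" "F \<squnion> x \<subseteq> Z" using walk_fin[OF z(1)] walk_start[OF z(3)] z by auto
  obtain m where m: "walk (F \<squnion> e) W m" "fin W m = Z" using path_cover[OF e W(1) Z(1) W(2) Z(2)] by auto
  obtain k where k: "walk (F \<squnion> x) W k" "fin W k = Z" using path_cover[OF x W(1) Z(1) W(3) Z(3)] by auto
  have mk: "hm W k m" using hm_sym[OF simD[OF sim_cover[OF e(1) x(1) e(2) x(2) W(1) Z(1) W(2) Z(2) W(3) Z(3)] m k]] .
  have 0: "walk {} H0 w1" "walk {} Z z2" using w z walk_mono by blast+
  have "hm W w2 (k @ z2)" using scD[OF sc_cover[OF x]] w k z by auto
  then have "hm H0 (w1 @ w2) (w1 @ (k @ z2))" using hm_prefix[of W] 0 w by auto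
  also have "hm W (k @ z2) (m @ z2)" using hm_suffix[OF mk, of z2] 0 k by auto
  then have "hm H0 (w1 @ (k @ z2)) (w1 @ (m @ z2))" using hm_prefix[of W] 0 w by auto
  also have "hm H0 (w1 @ m) z1" using scD[OF sc_cover[OF e]] w m z by auto
  then have "hm H0 ((w1 @ m) @ z2) (z1 @ z2)" using hm_suffix[of H0 "w1 @ m" z1 z2] 0 w m by auto
  then have "hm H0 (w1 @ (m @ z2)) (z1 @ z2)" by simp
  finally show ?thesis .
qed

text \<open>The join \<open>T\<close> of the three covers decides. Outside \<Gamma> it lies below a
  good hyperplane that serves both walks as turning point. If it is in \<Gamma> and equals
  \<open>E\<close>, the corank is 3 and \<open>W\<close>, \<open>W'\<close>, \<open>X\<close> form a
  triangle. If it is in \<Gamma> and proper, a point \<open>d\<close> outside it is needed.\<close>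

lemma reach_unique:
  assumes "reach F e H0 X w" "reach F e H0 X w'"
  shows "hm H0 w w'"
proof -
  obtain x W w1 w2 where x: "x \<in> E - F" "conn (F \<squnion> x)" and w: "walk (F \<squnion> e) H0 w1" "fin H0 w1 = W" "walk (F \<squnion> x) W w2" "fin W w2 = X" "w = w1 @ w2"
    using assms(1) unfolding reach_def by blast
  obtain x' W' w1' w2' where x': "x' \<in> E - F" "conn (F \<squnion> x')" and w': "walk (F \<squnion> e) H0 w1'" "fin H0 w1' = W'" "walk (F \<squnion> x') W' w2'" "fin W' w2' = X" "w' = w1' @ w2'"
    using assms(2) unfolding reach_def by blast
  have W: "good W" "F \<squnion> e \<subseteq> W" "F \<squnion> x \<subseteq> W" using walk_fin[OF w(1)] walk_start[OF w(3)] w by auto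
  have W': "good W'" "F \<squnion> e \<subseteq> W'" "F \<squnion> x' \<subseteq> W'" using walk_fin[OF w'(1)] walk_start[OF w'(3)] w' by auto
  have X: "good X" "F \<squnion> x \<subseteq> X" "F \<squnion> x' \<subseteq> X" using walk_fin[OF w(3)] walk_fin[OF w'(3)] w w' by auto
  have el: "e \<in> E" "x \<in> E" "x' \<in> E" using e x x' by auto
  have ins: "e \<in> W" "x \<in> W" "e \<in> W'" "x' \<in> W'" "x \<in> X" "x' \<in> X" 
    using W W' X adj_self[OF el(1), of F] adj_self[OF el(2), of F] adj_self[OF el(3), of F] by (meson subsetD)+
  define T where "T = F \<squnion> e \<squnion> x \<squnion> x'"
  have T: "flat T" "T \<subseteq> E" "F \<subseteq> T" "e \<in> T" "x \<in> T" "x' \<in> T"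
  proof -
    show "flat T" "T \<subseteq> E" "x' \<in> T" unfolding T_def using flat_cl cl_ground adj_self el by auto
    have 1: "F \<squnion> e \<squnion> x \<subseteq> T" "F \<squnion> e \<subseteq> F \<squnion> e \<squnion> x" "F \<subseteq> F \<squnion> e" unfolding T_def using adj_superset cl_ground Fflat by auto
    then show "F \<subseteq> T" "e \<in> T" "x \<in> T" using adj_self[OF el(2), of "F \<squnion> e"] adj_self[OF el(1), of F] by auto
  qed
  have T1: "T = F \<squnion> x \<squnion> x' \<squnion> e" unfolding T_def using adj_commute[OF Fflat(2) el(1,2)] adj_commute[OF cl_ground el(1,3)] by simp
  have T2: "T = F \<squnion> e \<squnion> x' \<squnion> x" unfolding T_def using adj_commute[OF cl_ground el(2,3)] by simp
  have 0: "walk {} H0 w1" "walk {} H0 w1'" "walk {} W w2" "walk {} W' w2'" using w w' walk_mono by blast+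
  consider "T \<notin> \<Gamma>" | "T \<in> \<Gamma>" "T = E" | "T \<in> \<Gamma>" "T \<noteq> E" by blast
  then show ?thesis
  proof cases
    case 1
    obtain Z where Z: "good Z" "T \<subseteq> Z" using good_above[OF T(1) 1] by auto
    have sZ: "F \<squnion> e \<subseteq> Z" "F \<squnion> x \<subseteq> Z" "F \<squnion> x' \<subseteq> Z" 
      using adj_least[OF good_flat(1)[OF Z(1)], of F] Z T by (meson subset_trans subsetD)+
    obtain z1 where z1: "walk (F \<squnion> e) H0 z1" "walk {} H0 z1" "fin H0 z1 = Z" using path_cover[OF e H0(1) Z(1) H0(2) sZ(1)] by auto
    obtain z2 where z2: "walk (F \<squnion> x) Z z2" "fin Z z2 = X" using path_cover[OF x Z(1) X(1) sZ(2) X(2)] by auto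
    obtain z3 where z3: "walk (F \<squnion> x') Z z3" "fin Z z3 = X" using path_cover[OF x' Z(1) X(1) sZ(3) X(3)] by auto
    have "hm H0 w (z1 @ z2)" unfolding w(5) by (rule reach_move[OF x w(1-4) z1(1,3) z2])
    also have "hm Z z2 z3" by (rule simD[OF sim_cover[OF x(1) x'(1) x(2) x'(2) Z(1) X(1) sZ(2) X(2) sZ(3) X(3)] z2 z3])
    then have "hm H0 (z1 @ z2) (z1 @ z3)" using hm_prefix z1 by auto
    also have "hm H0 \<dots> w'" unfolding w'(5) by (rule hm_sym[OF reach_move[OF x' w'(1-4) z1(1,3) z3]])
    finally show ?thesis .
  next
    case 2
    have Tin: False if "good H" "e \<in> H" "x \<in> H" "x' \<in> H" "F \<subseteq> H" for H
    proof -
      have "F \<squnion> e \<subseteq> H" by (rule adj_least[OF good_flat(1)[OF that(1)] that(5,2)])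
      then have "T \<subseteq> H" unfolding T_def
        by (intro adj_least[OF good_flat(1)[OF that(1)] adj_least[OF good_flat(1)[OF that(1)] _ that(3)] that(4)])
      then show False using 2(2) rank_mono[of T H] good_hyp[OF that(1)] by (auto simp: hyp_def)
    qed
    have FX: "F \<subseteq> X" "F \<subseteq> W" "F \<subseteq> W'"
      using X(2) W(2) W'(2) adj_superset[OF Fflat(2), of x] adj_superset[OF Fflat(2), of e] by (meson subset_trans)+
    have ne: "W \<noteq> X" "W' \<noteq> X" "W \<noteq> W'"
      using Tin[OF X(1) _ ins(5,6) FX(1)] Tin[OF W(1) ins(1,2) _ FX(2)] ins(1,3,4) by metis+
    have rT: "r E = r F + 3"
    proof -
      have "r T \<le> r F + 3"
        unfolding T_def rank_cl using rank_insert_le[of x' "F \<squnion> e \<squnion> x"] rank_insert_le[of x "F \<squnion> e"] rank_insert_le[of e F]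
          rank_cl[of "insert x (F \<squnion> e)"] rank_cl[of "insert e F"] by linarith
      then show ?thesis using corank 2 by auto
    qed
    have rL: "r (F \<squnion> y) + 2 = r E" if "y \<in> E - F" for y using adj_rank[OF Fflat(1) that] rT by auto
    have hs: "hyp X" "hyp W" "hyp W'" using X W W' good_hyp by auto
    have e1: "edge W X" by (rule edge_connI[OF x(2) rL[OF x(1)] hs(2,1) W(3) X(2) ne(1)])
    have e2: "edge W' X" by (rule edge_connI[OF x'(2) rL[OF x'(1)] hs(3,1) W'(3) X(3) ne(2)])
    have e3: "edge W W'" by (rule edge_connI[OF e(2) rL[OF e(1)] hs(2,3) W(2) W'(2) ne(3)])
    have t: "tri W W' X" by (rule tri_plane[OF Fflat(1) _ FX(2,3,1) W(1) W'(1) X(1) e3 e1 e2]) (use rT in simp)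
    have "hm W w2 [X]" using scD[OF sc_cover[OF x] w(3), of "[X]"] w W X e1 by auto
    then have "hm H0 w (w1 @ [X])" unfolding w(5) using hm_prefix[of W] 0 w by auto
    also have "hm H0 \<dots> (w1 @ [W', X])" using tri_ins[OF t 0(1) w(2), of "[]"] X by simp
    also have "hm H0 (w1 @ [W']) w1'" using scD[OF sc_cover[OF e], of H0 "w1 @ [W']" w1'] w w' W W' e3 by auto
    then have "hm H0 ((w1 @ [W']) @ [X]) (w1' @ [X])" by (rule hm_suffix) (use w W' X e2 in auto)
    then have "hm H0 (w1 @ [W', X]) (w1' @ [X])" by simp
    also have "hm W' [X] w2'" using hm_sym[OF scD[OF sc_cover[OF x'] w'(3), of "[X]"]] w' W' X e2 by auto
    then have "hm H0 (w1' @ [X]) w'" unfolding w'(5) using hm_prefix[of W'] 0 w' by auto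
    finally show ?thesis .
  next
    case 3
    have "\<not> E \<subseteq> T" using 3 T by auto
    \<comment> \<open>The join \<open>N\<close> of two of the three covers lies in a good
      hyperplane, and joining the remaining point gives \<open>T\<close>, which is in \<Gamma>.
      Since \<open>d\<close> is not in \<open>T\<close>, the join of \<open>N\<close> with
      \<open>d\<close> is outside \<Gamma>.\<close>
    then obtain d where d: "d \<in> E - T" "conn (F \<squnion> d)"
      using conn_cover[OF F conn_sep_ground Fflat(2) T(1,3)] by auto
    have dF: "d \<in> E - F" "d \<in> E" using d T by auto
    have nd: "N \<squnion> d \<notin> \<Gamma>" if "T = N \<squnion> y" "flat N" "N \<subseteq> H" "good H" "y \<in> E" for N y H
    proof
      assume a: "N \<squnion> d \<in> \<Gamma>"
      have "N \<squnion> d \<noteq> T" using d adj_self[OF dF(2), of N] by auto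
      then have "N \<in> \<Gamma>" using cut_adj[OF that(2) a, of y] 3 that dF by auto
      then show False using good_not_cut that by auto
    qed
    have fl: "flat W" "flat W'" "flat X" using good_flat W W' X by auto
    have n1: "F \<squnion> e \<squnion> x \<squnion> d \<notin> \<Gamma>" by (rule nd[OF T_def flat_cl adj_least[OF fl(1) W(2) ins(2)] W(1) el(3)])
    have n2: "F \<squnion> x \<squnion> x' \<squnion> d \<notin> \<Gamma>" by (rule nd[OF T1 flat_cl adj_least[OF fl(3) X(2) ins(6)] X(1) el(1)])
    have n3: "F \<squnion> e \<squnion> x' \<squnion> d \<notin> \<Gamma>" by (rule nd[OF T2 flat_cl adj_least[OF fl(2) W'(2) ins(4)] W'(1) el(2)])
    have up: "\<exists>Z. good Z \<and> F \<squnion> y \<subseteq> Z \<and> F \<squnion> z \<subseteq> Z \<and> F \<squnion> d \<subseteq> Z" if yz: "F \<squnion> y \<squnion> z \<squnion> d \<notin> \<Gamma>" "y \<in> E" "z \<in> E" for y z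
    proof -
      obtain Z where Z: "good Z" "F \<squnion> y \<squnion> z \<squnion> d \<subseteq> Z" using good_above[OF flat_cl yz(1)] by auto
      have "F \<squnion> y \<squnion> z \<subseteq> Z" "F \<squnion> y \<subseteq> Z"
        using Z adj_superset[OF cl_ground, of "insert z (F \<squnion> y)" d] adj_superset[OF cl_ground, of "insert y F" z] by auto
      moreover have "d \<in> Z" "z \<in> Z" using Z calculation adj_self[OF dF(2), of "F \<squnion> y \<squnion> z"] adj_self[OF yz(3), of "F \<squnion> y"] by auto
      moreover have "F \<subseteq> Z" using calculation adj_superset[OF Fflat(2), of y] by auto
      ultimately show ?thesis using Z adj_least[OF good_flat(1)[OF Z(1)]] by blast
    qed
    obtain Z1 where Z1: "good Z1" "F \<squnion> e \<subseteq> Z1" "F \<squnion> x \<subseteq> Z1" "F \<squnion> d \<subseteq> Z1" using up[OF n1 el(1,2)] by blast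
    obtain Z2 where Z2: "good Z2" "F \<squnion> x \<subseteq> Z2" "F \<squnion> x' \<subseteq> Z2" "F \<squnion> d \<subseteq> Z2" using up[OF n2 el(2,3)] by blast
    obtain Z3 where Z3: "good Z3" "F \<squnion> e \<subseteq> Z3" "F \<squnion> x' \<subseteq> Z3" "F \<squnion> d \<subseteq> Z3" using up[OF n3 el(1,3)] by blast
    obtain p1 where p1: "walk (F \<squnion> e) H0 p1" "walk {} H0 p1" "fin H0 p1 = Z1" using path_cover[OF e H0(1) Z1(1) H0(2) Z1(2)] by auto
    obtain p3 where p3: "walk (F \<squnion> e) H0 p3" "walk {} H0 p3" "fin H0 p3 = Z3" using path_cover[OF e H0(1) Z3(1) H0(2) Z3(2)] by auto
    obtain n12 where n12: "walk (F \<squnion> x) Z1 n12" "walk {} Z1 n12" "fin Z1 n12 = Z2" using path_cover[OF x Z1(1) Z2(1) Z1(3) Z2(2)] by auto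
    obtain n32 where n32: "walk (F \<squnion> x') Z3 n32" "walk {} Z3 n32" "fin Z3 n32 = Z2" using path_cover[OF x' Z3(1) Z2(1) Z3(3) Z2(3)] by auto
    obtain a2 where a2: "walk (F \<squnion> x) Z2 a2" "walk {} Z2 a2" "fin Z2 a2 = X" using path_cover[OF x Z2(1) X(1) Z2(2) X(2)] by auto
    obtain b2 where b2: "walk (F \<squnion> x') Z2 b2" "walk {} Z2 b2" "fin Z2 b2 = X" using path_cover[OF x' Z2(1) X(1) Z2(3) X(3)] by auto
    obtain m13 where m13: "walk (F \<squnion> e) Z1 m13" "walk {} Z1 m13" "fin Z1 m13 = Z3" using path_cover[OF e Z1(1) Z3(1) Z1(2) Z3(2)] by auto
    obtain d12 where d12: "walk (F \<squnion> d) Z1 d12" "walk {} Z1 d12" "fin Z1 d12 = Z2" using path_cover[OF dF(1) d(2) Z1(1) Z2(1) Z1(4) Z2(4)] by auto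
    obtain d13 where d13: "walk (F \<squnion> d) Z1 d13" "walk {} Z1 d13" "fin Z1 d13 = Z3" using path_cover[OF dF(1) d(2) Z1(1) Z3(1) Z1(4) Z3(4)] by auto
    obtain d32 where d32: "walk (F \<squnion> d) Z3 d32" "walk {} Z3 d32" "fin Z3 d32 = Z2" using path_cover[OF dF(1) d(2) Z3(1) Z2(1) Z3(4) Z2(4)] by auto
    \<comment> \<open>The sides of the triangle \<open>Z1\<close>, \<open>Z2\<close>,
      \<open>Z3\<close> run above \<open>F \<squnion> x\<close>, \<open>F \<squnion> x'\<close> and
      \<open>F \<squnion> e\<close>. Each is exchanged for a walk above
      \<open>F \<squnion> d\<close>, where the triangle contracts.\<close>
    have h1: "hm Z1 n12 d12" by (rule simD[OF sim_cover[OF x(1) dF(1) x(2) d(2) Z1(1) Z2(1) Z1(3) Z2(2) Z1(4) Z2(4)] n12(1,3) d12(1,3)])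
    have h2: "hm Z1 d12 (d13 @ d32)" using scD[OF sc_cover[OF dF(1) d(2)] d12(1), of "d13 @ d32"] d12 d13 d32 by auto
    have h3: "hm Z1 d13 m13" by (rule hm_sym[OF simD[OF sim_cover[OF e(1) dF(1) e(2) d(2) Z1(1) Z3(1) Z1(2) Z3(2) Z1(4) Z3(4)] m13(1,3) d13(1,3)]])
    have h4: "hm Z3 d32 n32" by (rule hm_sym[OF simD[OF sim_cover[OF x'(1) dF(1) x'(2) d(2) Z3(1) Z2(1) Z3(3) Z2(3) Z3(4) Z2(4)] n32(1,3) d32(1,3)]])
    have h5: "hm Z2 a2 b2" by (rule simD[OF sim_cover[OF x(1) x'(1) x(2) x'(2) Z2(1) X(1) Z2(2) X(2) Z2(3) X(3)] a2(1,3) b2(1,3)])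
    have h34: "hm Z1 (d13 @ d32) (m13 @ n32)" using hm_append[OF h3] h4 d13 by auto
    have h14: "hm Z1 n12 (m13 @ n32)" using hm_trans[OF h1 hm_trans[OF h2 h34]] .
    have h6: "hm Z1 (n12 @ a2) ((m13 @ n32) @ b2)" by (rule hm_append[OF h14]) (use h5 n12 in simp)
    have h7: "hm H0 (p1 @ m13) p3" using scD[OF sc_cover[OF e]] p1 p3 m13 by auto
    have "hm H0 w (p1 @ (n12 @ a2))" unfolding w(5) by (rule reach_move[OF x w(1-4) p1(1,3)]) (use n12 a2 in auto)
    also have "hm H0 \<dots> (p1 @ ((m13 @ n32) @ b2))" using hm_prefix[OF h6] p1 by auto
    also have "hm H0 ((p1 @ m13) @ (n32 @ b2)) (p3 @ (n32 @ b2))" by (rule hm_suffix[OF h7]) (use p1 m13 n32 b2 in auto)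
    then have "hm H0 (p1 @ ((m13 @ n32) @ b2)) (p3 @ (n32 @ b2))" by simp
    also have "hm H0 \<dots> w'" unfolding w'(5) by (rule hm_sym[OF reach_move[OF x' w'(1-4) p3(1,3)]]) (use n32 b2 in auto)
    finally show ?thesis .
  qed
qed

lemma reachI:
  "x \<in> E - F \<Longrightarrow> conn (F \<squnion> x) \<Longrightarrow> walk (F \<squnion> e) H0 w1 \<Longrightarrow> fin H0 w1 = W \<Longrightarrow> walk (F \<squnion> x) W w2 \<Longrightarrow> fin W w2 = X
    \<Longrightarrow> reach F e H0 X (w1 @ w2)"
  unfolding reach_def by blast

text \<open>If both joins were in \<Gamma>, they would coincide, contain
  \<open>F \<squnion> x \<squnion> y\<close> and have its rank; but that flat lies in the good
  \<open>X\<close>.\<close>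

lemma reach_pair:
  assumes "good X" "F \<subseteq> X" "x \<in> X - F" "y \<in> X - F \<squnion> x"
  shows "F \<squnion> e \<squnion> x \<notin> \<Gamma> \<or> F \<squnion> e \<squnion> y \<notin> \<Gamma>"
proof (rule ccontr)
  assume "\<not> ?thesis"
  then have b: "F \<squnion> e \<squnion> x \<in> \<Gamma>" "F \<squnion> e \<squnion> y \<in> \<Gamma>" by auto
  have fX: "flat X" "X \<subseteq> E" using good_flat assms by auto
  have xy: "x \<in> E - F" "y \<in> E - F \<squnion> x" using assms fX by auto
  have "F \<squnion> e \<notin> \<Gamma>" using good_not_cut H0 by auto
  then have eq: "F \<squnion> e \<squnion> x = F \<squnion> e \<squnion> y" using cut_adj[OF flat_cl b] xy by auto
  have U: "F \<squnion> e \<subseteq> F \<squnion> e \<squnion> x" "x \<in> F \<squnion> e \<squnion> x" "y \<in> F \<squnion> e \<squnion> x" "F \<subseteq> F \<squnion> e"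
    using adj_superset[OF cl_ground] adj_self xy eq adj_superset[OF Fflat(2)] by auto
  have "F \<squnion> x \<subseteq> F \<squnion> e \<squnion> x" using U by (intro adj_least[OF flat_cl]) auto
  then have s: "F \<squnion> x \<squnion> y \<subseteq> F \<squnion> e \<squnion> x" using U by (intro adj_least[OF flat_cl]) auto
  have "r (F \<squnion> x \<squnion> y) = r F + 2" using adj_rank[OF Fflat(1) xy(1)] adj_rank[OF flat_cl xy(2)] by auto
  moreover have "r (F \<squnion> e \<squnion> x) \<le> r (F \<squnion> e) + 1" using rank_cl[of "insert x (F \<squnion> e)"] rank_insert_le[of x "F \<squnion> e"] by simp
  moreover have "r (F \<squnion> e) = r F + 1" using adj_rank[OF Fflat(1) e(1)] .
  ultimately have "F \<squnion> e \<squnion> x = F \<squnion> x \<squnion> y" using flat_eq[OF flat_cl s cl_ground] by auto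
  moreover have "F \<squnion> x \<subseteq> X" using adj_least fX assms by auto
  then have "F \<squnion> x \<squnion> y \<subseteq> X" using adj_least fX assms by auto
  ultimately show False using good_not_cut[OF assms(1)] b by auto
qed

text \<open>If a point \<open>x\<close> of \<open>X \<inter> Y\<close> with connected quotient has
  \<open>F \<squnion> e \<squnion> x\<close> outside \<Gamma>, then \<open>X\<close> is reached by
  turning above \<open>e\<close> and \<open>x\<close>, and the edge to \<open>Y\<close> continues
  above \<open>F \<squnion> x\<close>. Otherwise the corank is 3; separate turning points
  \<open>?W1\<close> for \<open>X\<close> and \<open>?W2\<close> for \<open>Y\<close> are used, and
  a triangle or quadrangle closes the gap.\<close>

lemma reach_step:
  assumes "reach F e H0 X w" "edge X Y" "good Y" "F \<subseteq> Y"
  shows "\<exists>w'. reach F e H0 Y w' \<and> hm H0 (w @ [Y]) w'"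
proof -
  have hw: "walk {} H0 w" "fin H0 w = X" "good X" "F \<subseteq> X"
  proof -
    obtain x W w1 w2 where x: "walk (F \<squnion> e) H0 w1" "fin H0 w1 = W" "walk (F \<squnion> x) W w2" "fin W w2 = X" "w = w1 @ w2"
      using assms(1) unfolding reach_def by blast
    then show "walk {} H0 w" "fin H0 w = X" using walk_mono[of _ _ _ "{}"] by auto
    show "good X" "F \<subseteq> X" using walk_fin[OF x(3)] x adj_superset[OF Fflat(2), of x] by auto
  qed
  let ?N = "X \<inter> Y"
  have N: "conn ?N" "r ?N + 2 = r E" "F \<subseteq> ?N" "flat ?N" using assms hw conn_flat by (auto simp: edge_def)
  have h: "hyp X" "hyp Y" "X \<subseteq> E" "Y \<subseteq> E" "flat X" "flat Y" using hw assms good_hyp good_flat by auto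
  have eE: "e \<in> E" "F \<squnion> e \<notin> \<Gamma>" using e good_not_cut H0 by auto
  show ?thesis
  proof (cases "\<exists>x\<in>?N - F. conn (F \<squnion> x) \<and> F \<squnion> e \<squnion> x \<notin> \<Gamma>")
    case True
    then obtain x where x: "x \<in> ?N - F" "conn (F \<squnion> x)" "F \<squnion> e \<squnion> x \<notin> \<Gamma>" by auto
    have xE: "x \<in> E - F" using x h by auto
    have xX: "F \<squnion> x \<subseteq> X" "F \<squnion> x \<subseteq> Y" using adj_least[OF h(5) hw(4)] adj_least[OF h(6) assms(4)] x(1) by auto
    obtain W where W: "good W" "F \<squnion> e \<squnion> x \<subseteq> W" using good_above[OF flat_cl x(3)] by auto
    have W1: "F \<squnion> e \<subseteq> W" "F \<squnion> x \<subseteq> W"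
    proof -
      show a: "F \<squnion> e \<subseteq> W" using W adj_superset[OF cl_ground, of "insert e F" x] by auto
      have "x \<in> W" using W adj_self[of x "F \<squnion> e"] xE by auto
      then show "F \<squnion> x \<subseteq> W" using a adj_superset[OF Fflat(2), of e] good_flat[OF W(1)] by (intro adj_least) auto
    qed
    obtain w1 where w1: "walk (F \<squnion> e) H0 w1" "fin H0 w1 = W" using path_cover[OF e H0(1) W(1) H0(2) W1(1)] by auto
    obtain v where v: "walk (F \<squnion> x) W v" "fin W v = X" using path_cover[OF xE x(2) W(1) hw(3) W1(2) xX(1)] by auto
    have "hm H0 w (w1 @ v)" by (rule reach_unique[OF assms(1) reachI[OF xE x(2) w1 v]])
    then have "hm H0 (w @ [Y]) ((w1 @ v) @ [Y])" by (rule hm_suffix) (use hw assms in auto)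
    moreover have "reach F e H0 Y (w1 @ (v @ [Y]))" by (rule reachI[OF xE x(2) w1]) (use v xX hw assms in auto)
    ultimately show ?thesis by auto
  next
    case False
    \<comment> \<open>In larger corank \<open>X \<inter> Y\<close> contains two independent points
      with connected quotients, and by \<open>reach_pair\<close> one of them would have served in
      the first case.\<close>
    have rN: "r F + 3 = r E"
    proof (rule ccontr)
      assume "r F + 3 \<noteq> r E"
      then have big: "r F + 2 \<le> r ?N" using corank N by auto
      then have "\<not> ?N \<subseteq> F" using rank_mono[of ?N F] by auto
      then obtain x1 where x1: "x1 \<in> ?N - F" "conn (F \<squnion> x1)" using conn_cover[OF F N(1,3) Fflat(1)] by auto
      have x1E: "x1 \<in> E - F" using x1 h by auto
      have "\<not> ?N \<subseteq> F \<squnion> x1" using big rank_mono[of ?N "F \<squnion> x1"] adj_rank[OF Fflat(1) x1E] by auto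
      then obtain x2 where x2: "x2 \<in> ?N - F \<squnion> x1" "conn (F \<squnion> x2)"
        using conn_cover[OF F N(1,3) flat_cl adj_superset[OF Fflat(2)], of x1] by auto
      have "x2 \<in> ?N - F" using x2 adj_superset[OF Fflat(2), of x1] by auto
      then show False using reach_pair[OF hw(3,4), of x1 x2] x1 x2 False by auto
    qed
    have "F \<noteq> ?N" using rN N by auto
    then obtain x where x: "x \<in> ?N - F" using N by auto
    have Nx: "?N = F \<squnion> x" using adj_eq[OF Fflat(1) N(4,3) x] N rN by auto
    have bx: "F \<squnion> e \<squnion> x \<in> \<Gamma>" using False x Nx N by auto
    have xE: "x \<in> E" "x \<in> X" "x \<in> Y" using x h by auto
    have nXN: "\<not> X \<subseteq> ?N" "\<not> Y \<subseteq> ?N" using N h rank_mono[of X ?N] rank_mono[of Y ?N] by (auto simp: hyp_def)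
    obtain y1 where y1: "y1 \<in> X - ?N" "conn (F \<squnion> y1)" using conn_cover[OF F conn_hyp[OF h(1)] hw(4) N(4,3) nXN(1)] by auto
    obtain y2 where y2: "y2 \<in> Y - ?N" "conn (F \<squnion> y2)" using conn_cover[OF F conn_hyp[OF h(2)] assms(4) N(4,3) nXN(2)] by auto
    have yE: "y1 \<in> E - F" "y2 \<in> E - F" "y1 \<notin> Y" "y2 \<notin> X" using y1 y2 N h by auto
    have g1: "F \<squnion> e \<squnion> y1 \<notin> \<Gamma>" using reach_pair[OF hw(3,4), of x y1] x y1 Nx bx by auto
    have g2: "F \<squnion> e \<squnion> y2 \<notin> \<Gamma>" using reach_pair[OF assms(3,4), of x y2] x y2 Nx bx by auto
    have eXY: "e \<notin> H" if "good H" "F \<subseteq> H" "x \<in> H" for H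
    proof
      assume "e \<in> H"
      then have "F \<squnion> e \<subseteq> H" by (rule adj_least[OF good_flat(1)[OF that(1)] that(2)])
      then have "F \<squnion> e \<squnion> x \<subseteq> H" by (rule adj_least[OF good_flat(1)[OF that(1)] _ that(3)])
      then show False using good_not_cut[OF that(1)] bx by auto
    qed
    have eX: "e \<notin> X" "e \<notin> Y" using eXY hw assms xE by auto
    let ?W1 = "F \<squnion> e \<squnion> y1" and ?W2 = "F \<squnion> e \<squnion> y2"
    have rL: "r (F \<squnion> y) + 2 = r E" if "y \<in> E - F" for y using adj_rank[OF Fflat(1) that] rN by auto
    have yX: "F \<squnion> y1 \<subseteq> X" "F \<squnion> y2 \<subseteq> Y" using adj_least[OF h(5) hw(4)] adj_least[OF h(6) assms(4)] y1(1) y2(1) by auto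
    have nye: "y1 \<in> E - F \<squnion> e" "y2 \<in> E - F \<squnion> e"
      using adj_exchange[OF Fflat(1), of y1 e] adj_exchange[OF Fflat(1), of y2 e] adj_self[OF eE(1), of F] yE yX eX eE by blast+
    have Wh: "hyp ?W1" "hyp ?W2" using hyp_adj[OF flat_cl rL[OF e(1)]] nye by auto
    have Wg: "good ?W1" "good ?W2" using Wh g1 g2 by (auto simp: good_def)
    have We: "F \<squnion> e \<subseteq> ?W1" "F \<squnion> e \<subseteq> ?W2" "y1 \<in> ?W1" "y2 \<in> ?W2" using adj_superset[OF cl_ground] adj_self yE by auto
    have FW: "F \<subseteq> ?W1" "F \<subseteq> ?W2" "e \<in> ?W1" "e \<in> ?W2" using We adj_superset[OF Fflat(2), of e] adj_self[OF eE(1), of F] by auto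
    have Wy: "F \<squnion> y1 \<subseteq> ?W1" "F \<squnion> y2 \<subseteq> ?W2" using adj_least[OF flat_cl] FW We by auto
    have neW: "?W1 \<noteq> X" "?W2 \<noteq> Y" using FW eX by auto
    have e1: "edge ?W1 X" by (rule edge_connI[OF y1(2) rL[OF yE(1)] Wh(1) h(1) Wy(1) yX(1) neW(1)])
    have e2: "edge ?W2 Y" by (rule edge_connI[OF y2(2) rL[OF yE(2)] Wh(2) h(2) Wy(2) yX(2) neW(2)])
    obtain w1 where w1: "walk (F \<squnion> e) H0 w1" "walk {} H0 w1" "fin H0 w1 = ?W1" using path_cover[OF e H0(1) Wg(1) H0(2) We(1)] by auto
    have p1: "hm H0 w (w1 @ [X])"
      by (rule reach_unique[OF assms(1) reachI[OF yE(1) y1(2) w1(1,3)]]) (use Wg Wy hw yX e1 in auto)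
    then have p2: "hm H0 (w @ [Y]) (w1 @ [X, Y])" using hm_suffix[OF p1, of "[Y]"] hw assms by auto
    show ?thesis
    proof (cases "?W1 = ?W2")
      case True
      have t: "tri ?W1 X Y"
        by (rule tri_plane[OF Fflat(1) rN FW(1) hw(4) assms(4) Wg(1) hw(3) assms(3) e1 _ assms(2)]) (use True e2 in simp)
      have "hm H0 (w1 @ [X, Y]) (w1 @ [Y])" using tri_del[OF t w1(2,3), of "[]"] assms by simp
      then have "hm H0 (w @ [Y]) (w1 @ [Y])" using hm_trans[OF p2] by simp
      moreover have "reach F e H0 Y (w1 @ [Y])"
        by (rule reachI[OF yE(2) y2(2) w1(1,3)]) (use Wg Wy assms yX e2 True in auto)
      ultimately show ?thesis by blast
    next
      case False
      have eW: "edge ?W1 ?W2" by (rule edge_connI[OF e(2) rL[OF e(1)] Wh We(1,2) False])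
      have cle: "cl (F \<union> {p, q}) = F \<squnion> p \<squnion> q" if "p \<in> E" for p q using adj_adj[OF Fflat(2) that, of q] by simp
      have pl: "F \<squnion> p \<squnion> q = H" if "hyp H" "F \<subseteq> H" "p \<in> H - F" "q \<in> H - F \<squnion> p" for p q H
        by (rule plane_span(3)[OF Fflat(1) rN that])
      have xn: "x \<in> X - F \<squnion> y1" "x \<in> Y - F \<squnion> y2"
        using adj_exchange[OF Fflat(1), of x y1] adj_exchange[OF Fflat(1), of x y2] x xE yE Nx y1 y2 adj_self[of y1 F] adj_self[of y2 F] by blast+
      have H24: "F \<squnion> y1 \<squnion> x = X" using pl[OF h(1) hw(4) _ xn(1)] y1 yE by auto
      have H34: "F \<squnion> y2 \<squnion> x = Y" using pl[OF h(2) assms(4) _ xn(2)] y2 yE by auto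
      have cl1: "cl (F \<union> {e, y1}) = ?W1" "cl (F \<union> {y1, x}) = X" "cl (F \<union> {y2, x}) = Y" "cl (F \<union> {e, y2}) = ?W2"
        using cle eE yE H24 H34 by auto
      have spn: "r (F \<union> {p, q, z}) = r E" if "cl (F \<union> {p, q}) = H" "hyp H" "z \<in> E - H" for p q z H
      proof -
        have "r (insert z (F \<union> {p, q})) = r (F \<union> {p, q}) + 1" using rank_insert[of z "F \<union> {p, q}"] that by auto
        moreover have "r (F \<union> {p, q}) + 1 = r E" using that rank_cl[of "F \<union> {p, q}"] by (simp add: hyp_def)
        ultimately show ?thesis by (simp add: insert_commute)
      qed
      have y2W: "y2 \<notin> ?W1"
      proof
        assume "y2 \<in> ?W1"
        then have "?W2 \<subseteq> ?W1" by (rule adj_least[OF flat_cl We(1)])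
        then show False using hyp_eq Wh False by metis
      qed
      have perm: "{e,y1,x} = {y1,x,e}" "{e,y2,x} = {y2,x,e}" "{y1,y2,x} = {y1,x,y2}" by auto
      have sps: "r (F \<union> {e,y1,y2}) = r E" "r (F \<union> {e,y1,x}) = r E" "r (F \<union> {e,y2,x}) = r E" "r (F \<union> {y1,y2,x}) = r E"
        unfolding perm using spn[OF cl1(1) Wh(1)] spn[OF cl1(2) h(1)] spn[OF cl1(3) h(2)] y2W yE eX eE by auto
      have "hm (cl (F \<union> {e,y1})) [cl (F \<union> {y1,x}), cl (F \<union> {y2,x})] [cl (F \<union> {e,y2}), cl (F \<union> {y2,x})]"
      proof (rule U34_square[OF Fflat(1) rN _ sps])
        show "{e, y1, y2, x} \<subseteq> E" using eE yE xE by auto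
      qed (simp_all only: cl1 Wg hw assms e1 edge_sym[OF e2] edge_sym[OF eW])
      then have sq: "hm ?W1 [X, Y] [?W2, Y]" unfolding cl1 .
      have "hm H0 (w1 @ [X, Y]) (w1 @ [?W2, Y])" using hm_prefix[OF sq w1(2,3)] .
      then have "hm H0 (w @ [Y]) ((w1 @ [?W2]) @ [Y])" using hm_trans[OF p2] by simp
      moreover have "reach F e H0 Y ((w1 @ [?W2]) @ [Y])"
      proof (rule reachI[OF yE(2) y2(2)])
        show "walk (F \<squnion> e) H0 (w1 @ [?W2])" using w1 Wg We eW by auto
      qed (use Wg Wy assms yX e2 in auto)
      ultimately show ?thesis by blast
    qed
  qed
qed

lemma reach_walk:
  assumes "walk F H0 p" shows "\<exists>w. reach F e H0 (fin H0 p) w \<and> hm H0 p w"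
  using assms
proof (induction p rule: rev_induct)
  case Nil
  have "reach F e H0 H0 ([] @ [])" by (rule reachI[OF e, where W = H0]) (use H0 in auto)
  moreover have "hm H0 [] []" using H0 by (auto intro: hm_refl)
  ultimately show ?case by auto
next
  case (snoc Y p)
  let ?X = "fin H0 p"
  have w: "walk F H0 p" "edge ?X Y" "good Y" "F \<subseteq> Y" "good ?X" using snoc.prems by auto
  obtain v where v: "reach F e H0 ?X v" "hm H0 p v" using snoc.IH w by auto
  obtain v' where v': "reach F e H0 Y v'" "hm H0 (v @ [Y]) v'" using reach_step[OF v(1) w(2-4)] by auto
  have "hm H0 (p @ [Y]) (v @ [Y])" by (rule hm_suffix[OF v(2)]) (use w in auto)
  then have "hm H0 (p @ [Y]) v'" using hm_trans v' by blast
  then show ?case using v' by auto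
qed

end

lemma simply_connected: "conn F \<Longrightarrow> sc F"
proof (induction "r E - r F" arbitrary: F rule: less_induct)
  case less
  have F: "flat F" "F \<subseteq> E" using less.prems conn_flat flat_ground by auto
  have rF: "r F \<le> r E" using F rank_mono by auto
  consider "r E \<le> r F + 1" | "r F + 2 = r E" | "r F + 3 \<le> r E" using rF by linarith
  then show ?case
  proof cases
    case 1
    have "p = []" if "walk F X p" for X p
    proof (cases p)
      case (Cons Y ps)
      then have XY: "edge X Y" "F \<subseteq> X" "F \<subseteq> Y" using that walk_start by auto
      then have h: "hyp X" "hyp Y" "X \<noteq> Y" by (auto simp: edge_def)
      then have "X = F" "Y = F" using flat_eq[OF F(1) XY(2)] flat_eq[OF F(1) XY(3)] 1 hyp_flat by (auto simp: hyp_def)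
      then show ?thesis using h by simp
    qed
    then show ?thesis using hm_refl walk_mono unfolding sc_def by (metis empty_subsetI)
  next
    case 2
    then show ?thesis using sc_line less.prems by auto
  next
    case 3
    have sc': "sc D" if "conn D" "r F < r D" for D
      using less.hyps[OF _ that(1)] that 3 by auto
    show ?thesis unfolding sc_def
    proof (intro allI impI)
      fix X p q assume pq: "walk F X p" "walk F X q" "fin X p = fin X q"
      have X: "good X" "F \<subseteq> X" using pq walk_start by auto
      have h: "hyp X" "flat X" using X good_hyp good_flat by auto
      have "\<not> X \<subseteq> F" using 3 h rank_mono[of X F] by (auto simp: hyp_def)
      then obtain e where e: "e \<in> X - F" "conn (F \<squnion> e)"
        using conn_cover[OF less.prems conn_hyp[OF h(1)] X(2) F(1)] by auto
      have eE: "e \<in> E - F" "F \<squnion> e \<subseteq> X" using e h flat_ground adj_least[OF h(2) X(2)] by auto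
      note ctx = less.prems 3 eE(1) e(2) X(1) eE(2) sc'
      obtain v where v: "reach F e X (fin X p) v" "hm X p v" using reach_walk[OF ctx pq(1)] by auto
      obtain v' where v': "reach F e X (fin X q) v'" "hm X q v'" using reach_walk[OF ctx pq(2)] by auto
      have "hm X v v'" using reach_unique[OF ctx v(1)] v'(1) pq(3) by simp
      then show "hm X p q" using v v' hm_sym hm_trans by blast
    qed
  qed
qed

end

section \<open>Transfer along the lattice isomorphism\<close>

text \<open>Every flat of positive rank contains one of rank one less, and its image is strictly
  smaller; so the ranks of the images grow at least as fast.\<close>

lemma lattice_iso_rank_le:
  assumes L: "matroid L" and N: "matroid N" and iso: "lattice_iso \<phi> (flats L) (flats N)"
  shows "F \<in> flats L \<Longrightarrow> rank L F \<le> rank N (\<phi> F)"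
proof (induction "rank L F" arbitrary: F)
  case (Suc k)
  interpret L: matroid L by fact
  interpret N: matroid N by fact
  obtain I where I: "I \<in> indep L" "I \<subseteq> F" "card I = rank L F" using L.rank_ex by blast
  then obtain x where x: "x \<in> I" using Suc by (metis card.empty equals0I nat.simps(3))
  let ?G = "closure L (I - {x})"
  have "I - {x} \<in> indep L" using L.indep_subset I by blast
  then have rG: "rank L ?G = k" using L.rank_cl L.rank_indep I Suc(2) x L.indep_finite[OF I(1)] by (simp add: card_Diff_singleton)
  have G: "?G \<in> flats L" "?G \<subseteq> F" using L.flat_cl L.cl_least[OF Suc.prems, of "I - {x}"] I by auto
  have b: "bij_betw \<phi> (flats L) (flats N)" and m: "\<phi> ?G \<subseteq> \<phi> F" using iso G Suc.prems by (auto simp: lattice_iso_def)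
  have "?G \<noteq> F" using rG Suc(2) by auto
  then have "\<phi> ?G \<noteq> \<phi> F" using b G Suc.prems by (metis bij_betw_def inj_on_eq_iff)
  moreover have fl: "\<phi> ?G \<in> flats N" "\<phi> F \<in> flats N" using b G Suc.prems by (auto dest: bij_betwE)
  ultimately have "rank N (\<phi> ?G) < rank N (\<phi> F)" using N.flat_rank_less[OF fl(1), of "\<phi> F"] m N.flat_ground[OF fl(2)] by auto
  moreover have "rank L ?G \<le> rank N (\<phi> ?G)" using Suc(1)[of ?G] rG G by auto
  ultimately show ?case using rG Suc(2) by auto
qed auto

lemma lattice_iso_inv:
  assumes "lattice_iso \<phi> A B" shows "lattice_iso (inv_into A \<phi>) B A"
proof -
  have b: "bij_betw \<phi> A B" using assms by (simp add: lattice_iso_def)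
  have "F \<subseteq> G \<longleftrightarrow> inv_into A \<phi> F \<subseteq> inv_into A \<phi> G" if "F \<in> B" "G \<in> B" for F G
    using assms that b bij_betw_inv_into_right[OF b] bij_betwE[OF bij_betw_inv_into[OF b]] unfolding lattice_iso_def by metis
  then show ?thesis using bij_betw_inv_into[OF b] by (simp add: lattice_iso_def)
qed

lemma lattice_iso_rank:
  assumes "matroid L" "matroid N" "lattice_iso \<phi> (flats L) (flats N)" "F \<in> flats L"
  shows "rank N (\<phi> F) = rank L F"
proof (rule antisym)
  have "bij_betw \<phi> (flats L) (flats N)" using assms by (simp add: lattice_iso_def)
  then have "\<phi> F \<in> flats N" "inv_into (flats L) \<phi> (\<phi> F) = F" using assms by (auto dest: bij_betwE simp: bij_betw_def)
  then show "rank N (\<phi> F) \<le> rank L F"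
    using lattice_iso_rank_le[OF assms(2,1) lattice_iso_inv[OF assms(3)], of "\<phi> F"] by simp
qed (rule lattice_iso_rank_le[OF assms])

text \<open>The ground sets are unrelated, so a separator of \<open>L\<close> is carried over as a
  pair of complementary flats. Their images have ranks adding up to the rank of \<open>M\<close> and
  cover its ground set; a circuit through a private element of each would be independent.\<close>

lemma connected_lattice_conn:
  assumes M: "connected_matroid M" and L: "matroid L" and iso: "lattice_iso \<phi> (flats L) (flats M)"
  shows "matroid.conn L (closure L {})"
proof -
  interpret L: matroid L by fact
  interpret M: matroid M using M by (simp add: connected_matroid_def)
  let ?O = "closure L {}"
  have b: "bij_betw \<phi> (flats L) (flats M)" and mono: "\<And>F G. F \<in> flats L \<Longrightarrow> G \<in> flats L \<Longrightarrow> F \<subseteq> G \<longleftrightarrow> \<phi> F \<subseteq> \<phi> G"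
    using iso by (auto simp: lattice_iso_def)
  have rk: "\<And>F. F \<in> flats L \<Longrightarrow> rank M (\<phi> F) = rank L F" using lattice_iso_rank[OF L M.matroid_axioms iso] .
  have fl: "\<And>F. F \<in> flats L \<Longrightarrow> \<phi> F \<in> flats M" using b bij_betwE by blast
  have surj: "\<exists>F\<in>flats L. \<phi> F = G" if "G \<in> flats M" for G using b that by (metis bij_betw_def imageE)
  have O: "?O \<in> flats L" "rank L ?O = 0" "?O \<subseteq> ground L" using L.flat_cl L.rank_cl L.rank_empty L.cl_ground by auto
  have least: "?O \<subseteq> F" if "F \<in> flats L" for F using L.cl_least that by auto
  have "A = {} \<or> A = ground L - ?O" if A: "L.sep ?O A" for A
  proof (rule ccontr)
    assume n: "\<not> ?thesis"
    have AE: "A \<subseteq> ground L - ?O" using A by (simp add: L.sep_def)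
    let ?FA = "A \<union> ?O" and ?FB = "ground L - A"
    have FB: "?FB \<in> flats L" using L.sep_closed O A by auto
    have "ground L - (ground L - ?O - A) = ?FA" using AE O by auto
    then have FA: "?FA \<in> flats L" using L.sep_closed[OF O(1) L.sep_compl[OF O(3) A]] by simp
    let ?A = "\<phi> ?FA" and ?B = "\<phi> ?FB"
    have AB: "?A \<in> flats M" "?B \<in> flats M" using fl FA FB by auto
    have sum: "rank M ?A + rank M ?B = rank M (ground M)"
    proof -
      have "ground M \<subseteq> \<phi> (ground L)"
      proof -
        obtain G where "G \<in> flats L" "\<phi> G = ground M" using surj M.flat_E by blast
        then show ?thesis using mono[of G "ground L"] L.flat_E L.flat_ground by auto
      qed
      then have "\<phi> (ground L) = ground M" using M.flat_ground fl L.flat_E by blast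
      then have "rank M (ground M) = rank L (ground L)" using rk[OF L.flat_E] by simp
      then show ?thesis using rk FA FB A O by (simp add: L.sep_def)
    qed
    \<comment> \<open>The closure of \<open>x\<close> corresponds to a flat of rank at most 1, which
      is generated by one element over the loops and therefore falls on one side of the
      separator.\<close>
    have cov: "x \<in> ?A \<or> x \<in> ?B" if x: "x \<in> ground M" for x
    proof -
      let ?G = "closure M {x}"
      obtain G where G: "G \<in> flats L" "\<phi> G = ?G" using surj M.flat_cl by blast
      have "rank L G \<le> 1" using rk[OF G(1)] G(2) M.rank_cl[of "{x}"] M.rank_card[of "{x}"] by auto
      then have "G \<subseteq> ?FA \<or> G \<subseteq> ?FB"
      proof (cases "G \<subseteq> ?O")
        case False
        then obtain y where y: "y \<in> G" "y \<notin> ?O" by auto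
        have yE: "y \<in> ground L" using y G L.flat_ground by auto
        have Gy: "G = closure L (insert y ?O)"
          using L.adj_eq[OF O(1) G(1) least[OF G(1)], of y] y \<open>rank L G \<le> 1\<close> O by auto
        show ?thesis
        proof (cases "y \<in> A")
          case True
          then show ?thesis using L.adj_least[OF FA, of ?O y] Gy by auto
        next
          case False
          then show ?thesis using L.adj_least[OF FB least[OF FB], of y] Gy yE by auto
        qed
      qed auto
      then have "?G \<subseteq> ?A \<or> ?G \<subseteq> ?B" using mono[OF G(1) FA] mono[OF G(1) FB] G(2) by auto
      then show ?thesis using M.cl_superset[of x "{x}"] x by auto
    qed
    have "\<not> ?A \<subseteq> ?B" "\<not> ?B \<subseteq> ?A" using mono[OF FA FB] mono[OF FB FA] n AE by blast+
    then obtain x y where xy: "x \<in> ?A" "x \<notin> ?B" "y \<in> ?B" "y \<notin> ?A" by auto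
    then have "x \<in> ground M" "y \<in> ground M" "x \<noteq> y" using AB M.flat_ground by auto
    then obtain C where C: "C \<in> circuits M" "x \<in> C" "y \<in> C" using M by (auto simp: connected_matroid_def)
    have CE: "C \<subseteq> ground M" "finite C" using C M.finite_ground finite_subset by (auto simp: circuits_def)
    have "C \<inter> ?A \<subset> C" "C - ?A \<subset> C" using C xy by auto
    then have "C \<inter> ?A \<in> indep M" "C - ?A \<in> indep M" using C by (auto simp: circuits_def)
    then have c: "rank M (C \<inter> ?A) = card (C \<inter> ?A)" "rank M (C - ?A) = card (C - ?A)" using M.rank_indep by auto
    have "rank M (C \<union> ?A) + rank M (C \<inter> ?A) \<le> rank M C + rank M ?A" by (rule M.rank_submod)
    moreover have "rank M (ground M) + rank M (C - ?A) \<le> rank M (C \<union> ?A) + rank M ?B"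
      by (rule M.rank_submod') (use cov CE in auto)
    moreover have "card C = card (C \<inter> ?A) + card (C - ?A)"
      using CE card_Un_disjoint[of "C \<inter> ?A" "C - ?A"] by (simp add: Int_Diff_Un Int_Diff_disjoint)
    ultimately have "card C \<le> rank M C" using c sum by linarith
    moreover obtain I where I: "I \<in> indep M" "I \<subseteq> C" "card I = rank M C" using M.rank_ex by blast
    ultimately have "I = C" using CE by (simp add: card_seteq)
    then show False using C I by (auto simp: circuits_def)
  qed
  then show ?thesis using O by (auto simp: L.conn_def)
qed

theorem theorem1p14:
  fixes M :: "'b set_system" and L :: "'a set_system" and \<Gamma> :: "'a set set"
  assumes "connected_matroid M"
    and "constellation_of_type L \<Gamma> M"
    and "\<Gamma> \<noteq> {}"
  shows "\<forall>p. closed_tutte_path L \<Gamma> p \<longrightarrow> decomposes_into_elementary L \<Gamma> {1..9} p"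
proof (intro allI impI)
  fix p assume p: "closed_tutte_path L \<Gamma> p"
  obtain \<phi> where L: "matroid L" "modular_cut L \<Gamma>" and iso: "lattice_iso \<phi> (flats L) (flats M)"
    using assms(2) by (auto simp: constellation_of_type_def tutte_constellation_def)
  interpret constellation L \<Gamma>
    using L assms(3) by (simp add: constellation_def constellation_axioms_def)
  have "conn (cl {})" by (rule connected_lattice_conn[OF assms(1) L(1) iso])
  then have sc: "sc (cl {})" by (rule simply_connected)
  obtain X ps where p_eq: "p = X # ps" using p by (cases p) (auto simp: closed_tutte_path_def tutte_path_def)
  then have w: "walk {} X ps" "fin X ps = X" using p tutte_path_walk by auto
  \<comment> \<open>Elements of \<open>cl {}\<close> are loops and belong to every flat, so each
    walk outside \<Gamma> is one above the least flat.\<close>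
  have low: "walk (cl {}) Y qs" if "walk {} Y qs" for Y qs
    using that by (induction qs arbitrary: Y) (auto intro: subsetD[OF cl_least[OF good_flat(1)]])
  have "hm X ps []" using scD[OF sc low[OF w(1)], of "[]"] low[of X "[]"] w walk_start by auto
  then show "decomposes_into_elementary L \<Gamma> {1..9} p" unfolding p_eq by (rule hm_decomposes)
qed

end
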